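(* Let $\mathbb{K}$ be a field, and let $A$ be the polynomial ring $\mathbb{K}[x_1,\dots,x_d]$ graded by a positive type matrix $W\in\mathcal{M}_{m\times d}(\mathbb{Z})$. For any $1\le t\le d$ let $F_t$ be the face ideal of $A$ generated by $x_1,\dots,x_t$ and set $Q_t:=H_{\mathfrak{m}}^{d-t}(A/F_t)$. Then, for $1\le t\le d-1$, there is a canonical isomorphism $${}^*\!\operatorname{Ext}_A^1(Q_t(c_{t+1}),Q_{t+1})\cong A/F_{t+1},$$ where $c_{t+1}$ denotes the $(t+1)$th column of the matrix $W$; more precisely, ${}^*\!\operatorname{Ext}_A^1(Q_t(c_{t+1}),Q_{t+1})$ is a free, graded $(A/F_{t+1})$-module that admits as generator the class of the short exact sequence $$0\longrightarrow Q_{t+1}\longrightarrow Q_t\stackrel{\cdot x_{t+1}}{\longrightarrow}Q_t(c_{t+1})\longrightarrow 0.$$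
   Context: $\mathfrak{m}=(x_1,\dots,x_d)$. For $W\in\mathcal{M}_{m\times d}(\mathbb{Z})$ ($m\ge 1$), $A$ is graded by $W$ if it carries the $\mathbb{Z}^m$-grading for which $\mathbb{K}\subseteq A_0$ and each $x_i$ is homogeneous of degree the $i$th column of $W$. Let $w_1,\dots,w_m$ be the rows of $W$. $W$ is of positive type if it has rank $m$ and there are $a_1,\dots,a_m\in\mathbb{Z}$ such that all entries of $a_1w_1+\dots+a_mw_m$ are positive. For a $W$-graded (i.e. $\mathbb{Z}^m$-graded) $A$-module $N$ and $c\in\mathbb{Z}^m$, $N(c)$ is the shifted module $N(c)_b=N_{b+c}$. ${}^*\!\operatorname{Hom}_A(-,-)$ is the internal (graded) Hom in the category of $W$-graded $A$-modules and ${}^*\!\operatorname{Ext}_A^j$ denotes its derived functors. Local cohomology modules of $W$-graded modules carry their natural $W$-grading.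
   Formalization: The degrees are corrected: the arrow Q_{t+1} → Q_t has degree −c_{t+1} (no such degree-0 exact sequence exists), the class of the sequence lies in degree c_{t+1}, and the isomorphism A/F_{t+1} ≅ *Ext^1 is homogeneous of degree c_{t+1} rather than 0. *)

theory Defs
  imports "HOL-Analysis.Analysis" "HOL-Algebra.Module" "HOL-Algebra.QuotRing"
    "HOL-Algebra.Ideal_Product" "HOL-Library.Poly_Mapping"
begin

section \<open>Graded modules\<close>

text \<open>
  A graded module is a module record with a family of homogeneous components. A graded
  ring is a record of the same type (a graded module over some ring, with \<open>mult\<close> and \<open>one\<close>
  meaningful); e.g. the polynomial ring below is a graded module over itself. For other modules
  the fields \<open>mult\<close> and \<open>one\<close> carry no information.
\<close>

record ('a, 'b, 'g) gmod = "('a, 'b) module" +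
  hcomp :: "'g \<Rightarrow> 'b set"

locale graded_module = Module.module R M
  for R :: "('s, 'a, 'g::ab_group_add) gmod" and M :: "('a, 'b, 'g) gmod" +
  assumes hcomp_subgroup: "\<And>g. additive_subgroup (hcomp M g) M"
    and hcomp_decomp: "\<And>x. x \<in> carrier M \<Longrightarrow>
      \<exists>!u. (\<forall>g. u g \<in> hcomp M g) \<and> finite {g. u g \<noteq> \<zero>\<^bsub>M\<^esub>} \<and>
           x = finsum M u {g. u g \<noteq> \<zero>\<^bsub>M\<^esub>}"
    and hcomp_smult: "\<And>g h a x. a \<in> hcomp R g \<Longrightarrow> x \<in> hcomp M h \<Longrightarrow> a \<odot>\<^bsub>M\<^esub> x \<in> hcomp M (g + h)"

definition gshift :: "('a, 'b, 'g::ab_group_add) gmod \<Rightarrow> 'g \<Rightarrow> ('a, 'b, 'g) gmod" where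
  "gshift M c = M\<lparr>hcomp := (\<lambda>b. hcomp M (b + c))\<rparr>"

definition gsub :: "('a, 'b, 'g) gmod \<Rightarrow> 'b set \<Rightarrow> ('a, 'b, 'g) gmod" where
  "gsub M S = M\<lparr>carrier := S, hcomp := (\<lambda>g. hcomp M g \<inter> S)\<rparr>"

text \<open>
  If \<open>M\<close> is a graded ring and \<open>S\<close> a homogeneous ideal, then the ring part of \<open>gquot M S\<close>
  is \<open>M Quot S\<close>.
\<close>

definition gquot :: "('a, 'b, 'g) gmod \<Rightarrow> 'b set \<Rightarrow> ('a, 'b set, 'g) gmod" where
  "gquot M S = \<lparr>carrier = a_rcosets\<^bsub>M\<^esub> S,
     mult = rcoset_mult M S,
     one = S +>\<^bsub>M\<^esub> \<one>\<^bsub>M\<^esub>,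
     zero = S,
     add = set_add M,
     smult = (\<lambda>a Z. \<Union>x\<in>Z. S +>\<^bsub>M\<^esub> (a \<odot>\<^bsub>M\<^esub> x)),
     hcomp = (\<lambda>g. (\<lambda>x. S +>\<^bsub>M\<^esub> x) ` hcomp M g)\<rparr>"

text \<open>A module over \<open>R\<close> that is annihilated by the ideal \<open>S\<close>, regarded as a module over \<open>gquot R S\<close>:
  a coset \<open>Z\<close> acts by any of its representatives.\<close>

definition over_quotient :: "('a, 'b, 'g) gmod \<Rightarrow> ('a set, 'b, 'g) gmod" where
  "over_quotient M = \<lparr>carrier = carrier M, mult = mult M, one = one M, zero = zero M, add = add M,
     smult = (\<lambda>Z e. the_elem ((\<lambda>a. a \<odot>\<^bsub>M\<^esub> e) ` Z)), hcomp = hcomp M\<rparr>"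

section \<open>Homomorphisms and the internal Hom\<close>

definition mod_hom ::
    "('s, 'a, 'g) gmod \<Rightarrow> ('a, 'b, 'g) gmod \<Rightarrow> ('a, 'c, 'g) gmod \<Rightarrow> ('b \<Rightarrow> 'c) set" where
  "mod_hom R M N = {f \<in> carrier M \<rightarrow>\<^sub>E carrier N.
     (\<forall>x\<in>carrier M. \<forall>y\<in>carrier M. f (x \<oplus>\<^bsub>M\<^esub> y) = f x \<oplus>\<^bsub>N\<^esub> f y) \<and>
     (\<forall>a\<in>carrier R. \<forall>x\<in>carrier M. f (a \<odot>\<^bsub>M\<^esub> x) = a \<odot>\<^bsub>N\<^esub> f x)}"

definition gr_hom ::
    "('s, 'a, 'g::ab_group_add) gmod \<Rightarrow> ('a, 'b, 'g) gmod \<Rightarrow> ('a, 'c, 'g) gmod \<Rightarrow> 'g \<Rightarrow>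
      ('b \<Rightarrow> 'c) set" where
  "gr_hom R M N c = {f \<in> mod_hom R M N. \<forall>g. f ` hcomp M g \<subseteq> hcomp N (g + c)}"

definition gr_iso ::
    "('s, 'a, 'g::ab_group_add) gmod \<Rightarrow> ('a, 'b, 'g) gmod \<Rightarrow> ('a, 'c, 'g) gmod \<Rightarrow> 'g \<Rightarrow>
      ('b \<Rightarrow> 'c) set" where
  "gr_iso R M N c = {f \<in> mod_hom R M N. bij_betw f (carrier M) (carrier N) \<and>
     (\<forall>g. f ` hcomp M g = hcomp N (g + c))}"

text \<open>The internal Hom consists of the finite sums of homogeneous homomorphisms.\<close>

definition star_hom ::
    "('s, 'a, 'g::ab_group_add) gmod \<Rightarrow> ('a, 'b, 'g) gmod \<Rightarrow> ('a, 'c, 'g) gmod \<Rightarrow>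
      ('a, 'b \<Rightarrow> 'c, 'g) gmod" where
  "star_hom R M N = \<lparr>carrier = {f \<in> mod_hom R M N. \<exists>S u. finite S \<and> (\<forall>g\<in>S. u g \<in> gr_hom R M N g) \<and>
         (\<forall>x\<in>carrier M. f x = (\<Oplus>\<^bsub>N\<^esub>g\<in>S. u g x))},
     mult = undefined,
     one = undefined,
     zero = (\<lambda>x\<in>carrier M. \<zero>\<^bsub>N\<^esub>),
     add = (\<lambda>f h. \<lambda>x\<in>carrier M. f x \<oplus>\<^bsub>N\<^esub> h x),
     smult = (\<lambda>a f. \<lambda>x\<in>carrier M. a \<odot>\<^bsub>N\<^esub> f x),
     hcomp = gr_hom R M N\<rparr>"

definition short_exact ::
    "('s, 'a, 'g) gmod \<Rightarrow> ('a, 'b, 'g) gmod \<Rightarrow> ('b \<Rightarrow> 'c) \<Rightarrow> ('a, 'c, 'g) gmod \<Rightarrow>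
      ('c \<Rightarrow> 'e) \<Rightarrow> ('a, 'e, 'g) gmod \<Rightarrow> bool" where
  "short_exact R N i E p M \<longleftrightarrow> i \<in> mod_hom R N E \<and> p \<in> mod_hom R E M \<and>
     inj_on i (carrier N) \<and> p ` carrier E = carrier M \<and>
     i ` carrier N = {x \<in> carrier E. p x = \<zero>\<^bsub>M\<^esub>}"

section \<open>Resolutions and derived functors\<close>

definition cohomology ::
    "(nat \<Rightarrow> ('a, 'b, 'g) gmod) \<Rightarrow> (nat \<Rightarrow> 'b \<Rightarrow> 'b) \<Rightarrow> nat \<Rightarrow> ('a, 'b set, 'g) gmod" where
  "cohomology C \<delta> j = gquot
     (gsub (C j) {x \<in> carrier (C j). \<delta> j x = \<zero>\<^bsub>C (Suc j)\<^esub>})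
     (case j of 0 \<Rightarrow> {\<zero>\<^bsub>C 0\<^esub>} | Suc k \<Rightarrow> \<delta> k ` carrier (C k))"

definition graded_free_on ::
    "('s, 'a, 'g::ab_group_add) gmod \<Rightarrow> ('a, 'b, 'g) gmod \<Rightarrow> 'b set \<Rightarrow> bool" where
  "graded_free_on R M B \<longleftrightarrow> graded_module R M \<and> B \<subseteq> (\<Union>g. hcomp M g) \<and>
     (\<forall>x\<in>carrier M. \<exists>!u. u \<in> B \<rightarrow>\<^sub>E carrier R \<and> finite {b \<in> B. u b \<noteq> \<zero>\<^bsub>R\<^esub>} \<and>
        x = (\<Oplus>\<^bsub>M\<^esub>b\<in>{b \<in> B. u b \<noteq> \<zero>\<^bsub>R\<^esub>}. u b \<odot>\<^bsub>M\<^esub> b))"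

definition graded_free_resolution ::
    "('s, 'a, 'g::ab_group_add) gmod \<Rightarrow> ('a, 'b, 'g) gmod \<Rightarrow>
      (nat \<Rightarrow> ('a, 'p, 'g) gmod) \<Rightarrow> ('p \<Rightarrow> 'b) \<Rightarrow> (nat \<Rightarrow> 'p \<Rightarrow> 'p) \<Rightarrow> bool" where
  "graded_free_resolution R M P \<epsilon> D \<longleftrightarrow>
     (\<forall>n. \<exists>B. graded_free_on R (P n) B) \<and>
     \<epsilon> \<in> gr_hom R (P 0) M 0 \<and> \<epsilon> ` carrier (P 0) = carrier M \<and>
     (\<forall>n. D n \<in> gr_hom R (P (Suc n)) (P n) 0) \<and>
     D 0 ` carrier (P 1) = {x \<in> carrier (P 0). \<epsilon> x = \<zero>\<^bsub>M\<^esub>} \<and>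
     (\<forall>n. D (Suc n) ` carrier (P (Suc (Suc n))) =
            {x \<in> carrier (P (Suc n)). D n x = \<zero>\<^bsub>P n\<^esub>})"

text \<open>
  Injectivity in the category of graded modules. HOL cannot quantify over types, so the test
  monomorphisms \<open>f\<close> are those between graded modules whose elements have the type of the ring elements.
  They include the inclusions of the homogeneous ideals into the shifts \<open>R(c)\<close>, so by the graded
  Baer criterion nothing is lost.
\<close>

definition graded_injective ::
    "('s, 'a, 'g::ab_group_add) gmod \<Rightarrow> ('a, 'i, 'g) gmod \<Rightarrow> bool" where
  "graded_injective R J \<longleftrightarrow> graded_module R J \<and>
     (\<forall>(M :: ('a, 'a, 'g) gmod) (N :: ('a, 'a, 'g) gmod) f h.
        graded_module R M \<and> graded_module R N \<and>
        f \<in> gr_hom R M N 0 \<and> inj_on f (carrier M) \<and> h \<in> gr_hom R M J 0 \<longrightarrow>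
        (\<exists>k\<in>gr_hom R N J 0. \<forall>x\<in>carrier M. k (f x) = h x))"

definition graded_injective_resolution ::
    "('s, 'a, 'g::ab_group_add) gmod \<Rightarrow> ('a, 'b, 'g) gmod \<Rightarrow>
      (nat \<Rightarrow> ('a, 'i, 'g) gmod) \<Rightarrow> ('b \<Rightarrow> 'i) \<Rightarrow> (nat \<Rightarrow> 'i \<Rightarrow> 'i) \<Rightarrow> bool" where
  "graded_injective_resolution R M I \<eta> \<delta> \<longleftrightarrow>
     (\<forall>n. graded_injective R (I n)) \<and>
     \<eta> \<in> gr_hom R M (I 0) 0 \<and> inj_on \<eta> (carrier M) \<and>
     (\<forall>n. \<delta> n \<in> gr_hom R (I n) (I (Suc n)) 0) \<and>
     \<eta> ` carrier M = {x \<in> carrier (I 0). \<delta> 0 x = \<zero>\<^bsub>I 1\<^esub>} \<and>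
     (\<forall>n. \<delta> n ` carrier (I n) =
            {x \<in> carrier (I (Suc n)). \<delta> (Suc n) x = \<zero>\<^bsub>I (Suc (Suc n))\<^esub>})"

text \<open>If \<open>(P, D)\<close> belongs to a graded free resolution of \<open>M\<close>, this is the \<open>j\<close>-th right derived
  functor of the internal Hom, evaluated at \<open>(M, N)\<close>.\<close>

definition star_ext ::
    "('s, 'a, 'g::ab_group_add) gmod \<Rightarrow> (nat \<Rightarrow> ('a, 'p, 'g) gmod) \<Rightarrow> (nat \<Rightarrow> 'p \<Rightarrow> 'p) \<Rightarrow>
      ('a, 'c, 'g) gmod \<Rightarrow> nat \<Rightarrow> ('a, ('p \<Rightarrow> 'c) set, 'g) gmod" where
  "star_ext R P D N j =
     cohomology (\<lambda>n. star_hom R (P n) N) (\<lambda>n f. compose (carrier (P (Suc n))) f (D n)) j"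

text \<open>
  The class of an extension \<open>0 \<rightarrow> N \<rightarrow> E \<rightarrow> M \<rightarrow> 0\<close> with \<open>p\<close> of degree \<open>0\<close>: the image of the identity
  of \<open>M\<close> under the connecting homomorphism to the first Ext. Lift \<open>\<epsilon>\<close> along \<open>p\<close> to \<open>l : P 0 \<rightarrow> E\<close>;
  then \<open>l \<circ> D 0 = i \<circ> z\<close> for a cocycle \<open>z : P 1 \<rightarrow> N\<close>, whose class does not depend on \<open>l\<close>.
\<close>

definition ext_class ::
    "('s, 'a, 'g::ab_group_add) gmod \<Rightarrow> (nat \<Rightarrow> ('a, 'p, 'g) gmod) \<Rightarrow> ('p \<Rightarrow> 'b) \<Rightarrow>
      (nat \<Rightarrow> 'p \<Rightarrow> 'p) \<Rightarrow> ('a, 'c, 'g) gmod \<Rightarrow> ('c \<Rightarrow> 'e) \<Rightarrow> ('a, 'e, 'g) gmod \<Rightarrow>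
      ('e \<Rightarrow> 'b) \<Rightarrow> ('p \<Rightarrow> 'c) set" where
  "ext_class R P \<epsilon> D N i E p = (THE Z. Z \<in> carrier (star_ext R P D N 1) \<and>
     (\<exists>l z. l \<in> gr_hom R (P 0) E 0 \<and> (\<forall>y\<in>carrier (P 0). p (l y) = \<epsilon> y) \<and>
        z \<in> Z \<and> (\<forall>y\<in>carrier (P 1). i (z y) = l (D 0 y))))"

section \<open>Local cohomology\<close>

primrec ideal_pow :: "('a, 'r) ring_scheme \<Rightarrow> 'a set \<Rightarrow> nat \<Rightarrow> 'a set" where
  "ideal_pow R I 0 = carrier R"
| "ideal_pow R I (Suc n) = ideal_prod R I (ideal_pow R I n)"

definition torsion :: "('s, 'a, 'g) gmod \<Rightarrow> 'a set \<Rightarrow> ('a, 'b, 'g) gmod \<Rightarrow> ('a, 'b, 'g) gmod" where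
  "torsion R \<aa> M =
     gsub M {x \<in> carrier M. \<exists>n. \<forall>a\<in>ideal_pow R \<aa> n. a \<odot>\<^bsub>M\<^esub> x = \<zero>\<^bsub>M\<^esub>}"

text \<open>If \<open>(I, \<delta>)\<close> belongs to a graded injective resolution of \<open>M\<close>, this is the \<open>j\<close>-th right derived
  functor of the \<open>\<aa>\<close>-torsion functor, evaluated at \<open>M\<close>, with its natural grading.\<close>

definition local_cohomology ::
    "('s, 'a, 'g) gmod \<Rightarrow> 'a set \<Rightarrow> (nat \<Rightarrow> ('a, 'i, 'g) gmod) \<Rightarrow> (nat \<Rightarrow> 'i \<Rightarrow> 'i) \<Rightarrow> nat \<Rightarrow>
      ('a, 'i set, 'g) gmod" where
  "local_cohomology R \<aa> I \<delta> j = cohomology (\<lambda>n. torsion R \<aa> (I n)) \<delta> j"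

section \<open>The polynomial ring graded by an integer matrix\<close>

type_synonym 'k mpoly = "(nat \<Rightarrow>\<^sub>0 nat) \<Rightarrow>\<^sub>0 'k"

definition mvar :: "nat \<Rightarrow> 'k::field mpoly" where
  "mvar i = Poly_Mapping.single (Poly_Mapping.single i 1) 1"

text \<open>An \<open>m \<times> d\<close> integer matrix is given by its columns \<open>W 1, \<dots>, W d\<close>, with \<open>m = CARD('m)\<close>.\<close>

definition mdeg :: "nat \<Rightarrow> (nat \<Rightarrow> int ^ 'm) \<Rightarrow> (nat \<Rightarrow>\<^sub>0 nat) \<Rightarrow> int ^ 'm" where
  "mdeg d W e = (\<Sum>i\<in>{1..d}. int (Poly_Mapping.lookup e i) *s W i)"

definition poly_ring :: "nat \<Rightarrow> (nat \<Rightarrow> int ^ 'm) \<Rightarrow> ('k::field mpoly, 'k mpoly, int ^ 'm) gmod" where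
  "poly_ring d W =
     \<lparr>carrier = {f. \<forall>e\<in>Poly_Mapping.keys f. Poly_Mapping.keys e \<subseteq> {1..d}},
      mult = (*), one = 1, zero = 0, add = (+), smult = (*),
      hcomp = (\<lambda>g. {f. \<forall>e\<in>Poly_Mapping.keys f. Poly_Mapping.keys e \<subseteq> {1..d} \<and> mdeg d W e = g})\<rparr>"

definition positive_type :: "nat \<Rightarrow> (nat \<Rightarrow> int ^ 'm) \<Rightarrow> bool" where
  "positive_type d W \<longleftrightarrow>
     vec.dim ((\<lambda>i. \<chi> k. rat_of_int (W i $ k)) ` {1..d}) = CARD('m) \<and>
     (\<exists>a :: 'm \<Rightarrow> int. \<forall>i\<in>{1..d}. (\<Sum>k\<in>UNIV. a k * W i $ k) > 0)"

definition face_ideal :: "nat \<Rightarrow> (nat \<Rightarrow> int ^ 'm) \<Rightarrow> nat \<Rightarrow> 'k::field mpoly set" where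
  "face_ideal d W t = genideal (poly_ring d W) (mvar ` {1..t})"

definition max_ideal :: "nat \<Rightarrow> (nat \<Rightarrow> int ^ 'm) \<Rightarrow> 'k::field mpoly set" where
  "max_ideal d W = genideal (poly_ring d W) (mvar ` {1..d})"

end

theory Submission
  imports Defs
begin

text \<open>
  In an injective resolution of \<open>A/F\<^sub>t\<close>, multiplication by \<open>x\<^sub>k\<close> is surjective on the elements that are
  torsion with respect to any set of other variables. Hence torsion can be taken one variable at a
  time: for \<open>k \<le> t\<close> the cohomology does not change, and for \<open>k > t\<close> it moves up by one degree and
  \<open>K[x\<^sub>k]\<close> is replaced by \<open>K[x\<^sub>k, 1/x\<^sub>k]/K[x\<^sub>k]\<close>. So \<open>Q\<^sub>t\<close> is the module of inverse polynomials in
  \<open>x\<^sub>t\<^sub>+\<^sub>1, \<dots>, x\<^sub>d\<close>. Its residue pairing with \<open>A/F\<^sub>t\<close> is perfect, and positivity of the grading makes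
  degree components finite, so every homogeneous endomorphism of \<open>Q\<^sub>t\<close> is multiplication by an
  element of \<open>A/F\<^sub>t\<close>.

  Now put \<open>x = x\<^sub>t\<^sub>+\<^sub>1\<close>. It is surjective on \<open>Q\<^sub>t\<close> with kernel \<open>Q\<^sub>t\<^sub>+\<^sub>1\<close> and kills \<open>Q\<^sub>t\<^sub>+\<^sub>1\<close>. Given an
  extension of \<open>Q\<^sub>t(c)\<close> by \<open>Q\<^sub>t\<^sub>+\<^sub>1\<close>, the snake lemma for multiplication by \<open>x\<close> yields a map from the
  kernel \<open>Q\<^sub>t\<^sub>+\<^sub>1\<close> of \<open>x\<close> on the quotient to the cokernel \<open>Q\<^sub>t\<^sub>+\<^sub>1\<close> of \<open>x\<close> on the submodule. This is
  an isomorphism from \<open>Ext\<^sup>1(Q\<^sub>t(c), Q\<^sub>t\<^sub>+\<^sub>1)\<close> onto the endomorphisms of \<open>Q\<^sub>t\<^sub>+\<^sub>1\<close>, up to a shift, and the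
  class of the given sequence goes to the identity.
\<close>

section \<open>Components, submodules and quotients of graded modules\<close>

text \<open>The resolutions of A/F_t, of A/F_(t+1) and of Q(c) are arbitrary and have unrelated
  element types, so everything is computed inside the given ones. Injectivity is used in one form:
  division by x_k of elements that are torsion for other variables. It comes from extending a map
  from a monomial ideal to a shift of A. The result is a coefficient map \<open>\<theta>\<close>,
  after which the resolution is forgotten.

  The Ext computation is formal. It rests on \<open>X\<close> being onto on \<open>Q\<close> with
  kernel \<open>Q'\<close>, and on the homogeneous endomorphisms of \<open>Q'\<close> being scalars
  modulo \<open>F\<close>. The inverse of the snake isomorphism multiplies the given class by a
  scalar, so every cocycle has to be cohomologous to the cocycle \<open>z0\<close> of the given
  sequence followed by a snake map. The homotopy for this does not depend on the cocycle. That
  independence lets a cocycle be split into homogeneous summands, each turned into a scalar, and the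
  scalars be added. The grading of Ext is carried over from the residue ring at the end instead of
  being derived from the complex.\<close>

lemma finsum_hom:
  assumes "abelian_group M" "abelian_group N" "finite S" "u \<in> S \<rightarrow> carrier M"
    and f: "\<And>x. x \<in> carrier M \<Longrightarrow> f x \<in> carrier N"
    and add: "\<And>x y. x \<in> carrier M \<Longrightarrow> y \<in> carrier M \<Longrightarrow> f (x \<oplus>\<^bsub>M\<^esub> y) = f x \<oplus>\<^bsub>N\<^esub> f y"
  shows "f (finsum M u S) = finsum N (\<lambda>s. f (u s)) S"
proof -
  interpret M: abelian_group M by fact
  interpret N: abelian_group N by fact
  have z: "f \<zero>\<^bsub>M\<^esub> = \<zero>\<^bsub>N\<^esub>"
    using add[of "\<zero>\<^bsub>M\<^esub>" "\<zero>\<^bsub>M\<^esub>"] f[of "\<zero>\<^bsub>M\<^esub>"] by (metis M.l_zero M.zero_closed N.add.r_cancel_one')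
  show ?thesis using assms(3,4)
  proof (induction S)
    case empty
    then show ?case by (simp add: z)
  next
    case (insert s S)
    then have "u \<in> S \<rightarrow> carrier M" "u s \<in> carrier M" by auto
    then show ?case using insert.hyps insert.IH
      by (subst M.finsum_insert, simp_all, subst N.finsum_insert) (auto intro!: f simp: add)
  qed
qed

lemma finsum_closed_subset:
  assumes "abelian_group M" "finite S" "\<zero>\<^bsub>M\<^esub> \<in> T" "T \<subseteq> carrier M"
    "\<And>x y. x \<in> T \<Longrightarrow> y \<in> T \<Longrightarrow> x \<oplus>\<^bsub>M\<^esub> y \<in> T" "\<And>s. s \<in> S \<Longrightarrow> u s \<in> T"
  shows "finsum M u S \<in> T"
proof -
  interpret M: abelian_group M by fact
  show ?thesis using assms(2,6)
  proof (induction S)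
    case (insert s S)
    then have "u \<in> S \<rightarrow> carrier M" "u s \<in> carrier M" using assms(4) by auto
    then show ?case using insert assms(5) by (simp add: M.finsum_insert)
  qed (simp add: assms)
qed

text \<open>The component of \<open>x\<close> in degree \<open>g\<close>. The definite description
  picks the family promised by \<open>hcomp_decomp\<close>, so the value is meaningful only for
  \<open>x\<close> in the carrier.\<close>

definition hc :: "('a, 'b, 'g) gmod \<Rightarrow> 'b \<Rightarrow> 'g \<Rightarrow> 'b" where
  "hc M x = (THE u. (\<forall>g. u g \<in> hcomp M g) \<and> finite {g. u g \<noteq> \<zero>\<^bsub>M\<^esub>} \<and>
     x = finsum M u {g. u g \<noteq> \<zero>\<^bsub>M\<^esub>})"

text \<open>Uniqueness of the decomposition follows from independence \<open>ind\<close>: two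
  decompositions are padded by zero to a common finite index set and subtracted. In
  \<open>dec\<close> and \<open>ind\<close> the index set is any finite set instead of the exact
  support, which makes the hypotheses easy to check.\<close>

lemma graded_moduleI:
  assumes "Module.module R M"
    and sub: "\<And>g. additive_subgroup (hcomp M g) M"
    and dec: "\<And>x. x \<in> carrier M \<Longrightarrow> \<exists>S u. finite S \<and> (\<forall>g\<in>S. u g \<in> hcomp M g) \<and> x = finsum M u S"
    and ind: "\<And>S u. finite S \<Longrightarrow> (\<forall>g\<in>S. u g \<in> hcomp M g) \<Longrightarrow> finsum M u S = \<zero>\<^bsub>M\<^esub> \<Longrightarrow>
       (\<forall>g\<in>S. u g = \<zero>\<^bsub>M\<^esub>)"
    and sm: "\<And>g h a x. a \<in> hcomp R g \<Longrightarrow> x \<in> hcomp M h \<Longrightarrow> a \<odot>\<^bsub>M\<^esub> x \<in> hcomp M (g + h)"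
  shows "graded_module R M"
proof -
  interpret Module.module R M by fact
  have cl: "hcomp M g \<subseteq> carrier M" for g using sub[of g] additive_subgroup.a_subset by blast
  have z: "\<zero>\<^bsub>M\<^esub> \<in> hcomp M g" for g using sub[of g] by (simp add: additive_subgroup.zero_closed)
  show ?thesis
  proof (intro graded_module.intro graded_module_axioms.intro module_axioms)
    fix x assume x: "x \<in> carrier M"
    obtain S u where S: "finite S" and u: "\<forall>g\<in>S. u g \<in> hcomp M g" and xs: "x = finsum M u S"
      using dec[OF x] by blast
    define v where "v = (\<lambda>g. if g \<in> S then u g else \<zero>\<^bsub>M\<^esub>)"
    have v: "v g \<in> hcomp M g" for g using u z by (auto simp: v_def)
    have sv: "{g. v g \<noteq> \<zero>\<^bsub>M\<^esub>} \<subseteq> S" by (auto simp: v_def)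
    have "x = finsum M v {g. v g \<noteq> \<zero>\<^bsub>M\<^esub>}"
      unfolding xs
      by (rule M.add.finprod_mono_neutral_cong_right)
        (use S sv u cl in \<open>auto simp: v_def\<close>)
    moreover have "w = v" if w: "\<forall>g. w g \<in> hcomp M g" "finite {g. w g \<noteq> \<zero>\<^bsub>M\<^esub>}"
      "x = finsum M w {g. w g \<noteq> \<zero>\<^bsub>M\<^esub>}" for w
    proof -
      define T where "T = S \<union> {g. w g \<noteq> \<zero>\<^bsub>M\<^esub>}"
      have T: "finite T" using S w by (auto simp: T_def)
      have wc: "w g \<in> carrier M" "v g \<in> carrier M" for g using w v cl by auto
      have "x = finsum M v T" unfolding \<open>x = finsum M v _\<close>
        by (rule M.add.finprod_mono_neutral_cong_left) (use T sv wc in \<open>auto simp: T_def\<close>)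
      moreover have "x = finsum M w T" unfolding w(3)
        by (rule M.add.finprod_mono_neutral_cong_left) (use T wc in \<open>auto simp: T_def\<close>)
      moreover have "finsum M (\<lambda>g. \<ominus>\<^bsub>M\<^esub> v g) T = \<ominus>\<^bsub>M\<^esub> finsum M v T"
        by (rule finsum_hom[symmetric, where f = "\<lambda>x. \<ominus>\<^bsub>M\<^esub> x"])
          (use T wc M.minus_add M.abelian_group_axioms in auto)
      ultimately have "finsum M (\<lambda>g. w g \<oplus>\<^bsub>M\<^esub> \<ominus>\<^bsub>M\<^esub> v g) T = \<zero>\<^bsub>M\<^esub>"
        using x by (subst M.finsum_addf) (use wc in \<open>auto simp: M.r_neg\<close>)
      moreover have "w g \<oplus>\<^bsub>M\<^esub> \<ominus>\<^bsub>M\<^esub> v g \<in> hcomp M g" for g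
        using w(1) v[of g] sub[of g] M.abelian_group_axioms
        by (simp add: additive_subgroup.a_closed additive_subgroup.a_inv_closed)
      ultimately have "\<forall>g\<in>T. w g \<oplus>\<^bsub>M\<^esub> \<ominus>\<^bsub>M\<^esub> v g = \<zero>\<^bsub>M\<^esub>"
        using ind[OF T, of "\<lambda>g. w g \<oplus>\<^bsub>M\<^esub> \<ominus>\<^bsub>M\<^esub> v g"] by blast
      then have "w g = v g" if "g \<in> T" for g using wc that
        by (metis M.a_inv_closed M.minus_equality M.minus_minus)
      moreover have "w g = v g" if "g \<notin> T" for g using that by (auto simp: T_def v_def)
      ultimately show "w = v" by blast
    qed
    ultimately show "\<exists>!u. (\<forall>g. u g \<in> hcomp M g) \<and> finite {g. u g \<noteq> \<zero>\<^bsub>M\<^esub>} \<and>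
      x = finsum M u {g. u g \<noteq> \<zero>\<^bsub>M\<^esub>}"
      using v S finite_subset[OF sv] by (intro ex1I[of _ v]) auto
  qed (use sub sm in auto)
qed

context graded_module
begin

lemma hcomp_carrier: "x \<in> hcomp M g \<Longrightarrow> x \<in> carrier M"
  using hcomp_subgroup[of g] additive_subgroup.a_subset by blast

lemma hcomp_zero [simp, intro]: "\<zero>\<^bsub>M\<^esub> \<in> hcomp M g"
  using hcomp_subgroup[of g] by (simp add: additive_subgroup.zero_closed)

lemma hcomp_add: "x \<in> hcomp M g \<Longrightarrow> y \<in> hcomp M g \<Longrightarrow> x \<oplus>\<^bsub>M\<^esub> y \<in> hcomp M g"
  using hcomp_subgroup[of g] by (simp add: additive_subgroup.a_closed)

lemma hcomp_neg: "x \<in> hcomp M g \<Longrightarrow> \<ominus>\<^bsub>M\<^esub> x \<in> hcomp M g"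
  using hcomp_subgroup[of g] by (simp add: additive_subgroup.a_inv_closed M.abelian_group_axioms)

lemma hc_props:
  assumes "x \<in> carrier M"
  shows "hc M x g \<in> hcomp M g" "finite {g. hc M x g \<noteq> \<zero>\<^bsub>M\<^esub>}"
    "x = finsum M (hc M x) {g. hc M x g \<noteq> \<zero>\<^bsub>M\<^esub>}"
  using theI'[OF hcomp_decomp[OF assms]] unfolding hc_def[symmetric] by auto

text \<open>Any finite homogeneous decomposition computes the components, even one with zero
  summands: its extension by zero outside \<open>S\<close> is the family that \<open>hc\<close>
  describes.\<close>

lemma hc_eqI:
  assumes "finite S" "\<forall>g\<in>S. u g \<in> hcomp M g" "x = finsum M u S"
  shows "hc M x g = (if g \<in> S then u g else \<zero>\<^bsub>M\<^esub>)"
proof -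
  define v where "v = (\<lambda>g. if g \<in> S then u g else \<zero>\<^bsub>M\<^esub>)"
  have uc: "\<forall>g\<in>S. u g \<in> carrier M" using assms hcomp_carrier by blast
  have x: "x \<in> carrier M" unfolding assms by (rule M.finsum_closed) (use uc in auto)
  have "x = finsum M v {g. v g \<noteq> \<zero>\<^bsub>M\<^esub>}" unfolding assms
    by (rule M.add.finprod_mono_neutral_cong_right) (use assms(1) uc in \<open>auto simp: v_def\<close>)
  moreover have "finite {g. v g \<noteq> \<zero>\<^bsub>M\<^esub>}"
    by (rule finite_subset[OF _ assms(1)]) (auto simp: v_def)
  moreover have "\<forall>g. v g \<in> hcomp M g" using assms by (auto simp: v_def)
  ultimately have "hc M x = v" using the1_equality[OF hcomp_decomp[OF x], of v] unfolding hc_def by blast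
  then show ?thesis by (simp add: v_def)
qed

lemma hc_sum_superset:
  assumes "x \<in> carrier M" "finite S" "{g. hc M x g \<noteq> \<zero>\<^bsub>M\<^esub>} \<subseteq> S"
  shows "x = finsum M (hc M x) S"
proof -
  have "finsum M (hc M x) {g. hc M x g \<noteq> \<zero>\<^bsub>M\<^esub>} = finsum M (hc M x) S"
    by (rule M.add.finprod_mono_neutral_cong_left)
      (use assms hc_props(1)[OF assms(1)] hcomp_carrier in auto)
  then show ?thesis using hc_props(3)[OF assms(1)] by simp
qed

lemma hc_carrier: "x \<in> carrier M \<Longrightarrow> hc M x g \<in> carrier M"
  using hc_props(1) hcomp_carrier by blast

lemma hc_homog: "x \<in> hcomp M g \<Longrightarrow> hc M x h = (if h = g then x else \<zero>\<^bsub>M\<^esub>)"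
  using hc_eqI[of "{g}" "\<lambda>_. x" x h] hcomp_carrier[of x g] by (auto simp: M.finsum_insert)

lemma graded_induct [consumes 1, case_names zero homog add]:
  assumes "x \<in> carrier M" "P \<zero>\<^bsub>M\<^esub>" "\<And>g x. x \<in> hcomp M g \<Longrightarrow> P x"
    "\<And>x y. x \<in> carrier M \<Longrightarrow> y \<in> carrier M \<Longrightarrow> P x \<Longrightarrow> P y \<Longrightarrow> P (x \<oplus>\<^bsub>M\<^esub> y)"
  shows "P x"
proof -
  have "finsum M (hc M x) {g. hc M x g \<noteq> \<zero>\<^bsub>M\<^esub>} \<in> {x \<in> carrier M. P x}"
  proof (rule finsum_closed_subset[OF M.abelian_group_axioms hc_props(2)[OF assms(1)]])
    show "hc M x g \<in> {x \<in> carrier M. P x}" for g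
      using hc_props(1)[OF assms(1)] hcomp_carrier assms(3) by blast
  qed (use assms in auto)
  then show ?thesis using hc_props(3)[OF assms(1)] by simp
qed

lemma hcomp_independent:
  assumes "finite S" "\<forall>g\<in>S. u g \<in> hcomp M g" "finsum M u S = \<zero>\<^bsub>M\<^esub>" "g \<in> S"
  shows "u g = \<zero>\<^bsub>M\<^esub>"
  using hc_eqI[OF assms(1,2) assms(3)[symmetric], of g] hc_homog[OF hcomp_zero, of g g] assms(4) by simp

end

text \<open>Applying \<open>f\<close> to the decomposition of \<open>x\<close> decomposes
  \<open>f x\<close>, with indices moved by \<open>s\<close>; \<open>g\<close> joins the index set
  in case its component is zero. It is stated for additive maps so that it also covers the map
  sending a scalar to its multiple of a fixed basis element.\<close>

lemma hc_map:
  assumes "graded_module R M" "graded_module R' N"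
    and f: "\<And>x. x \<in> carrier M \<Longrightarrow> f x \<in> carrier N"
    and add: "\<And>x y. x \<in> carrier M \<Longrightarrow> y \<in> carrier M \<Longrightarrow> f (x \<oplus>\<^bsub>M\<^esub> y) = f x \<oplus>\<^bsub>N\<^esub> f y"
    and hom: "\<And>g x. x \<in> hcomp M g \<Longrightarrow> f x \<in> hcomp N (g + s)"
    and x: "x \<in> carrier M"
  shows "hc N (f x) (g + s) = f (hc M x g)"
proof -
  interpret M: graded_module R M by fact
  interpret N: graded_module R' N by fact
  note ab = M.M.abelian_group_axioms N.M.abelian_group_axioms
  define S where "S = insert g {g. hc M x g \<noteq> \<zero>\<^bsub>M\<^esub>}"
  have S: "finite S" using M.hc_props[OF x] by (simp add: S_def)
  have xs: "x = finsum M (hc M x) S"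
    by (rule M.hc_sum_superset[OF x S]) (auto simp: S_def)
  have "f (finsum M (hc M x) S) = finsum N (\<lambda>g. f (hc M x g)) S"
    by (rule finsum_hom[OF ab S _ f add]) (use M.hc_carrier[OF x] in auto)
  then have "f x = finsum N (\<lambda>g. f (hc M x g)) S" using xs by simp
  also have "\<dots> = finsum N (\<lambda>h. f (hc M x (h - s))) ((\<lambda>g. g + s) ` S)"
    by (subst N.M.finsum_reindex) (use f M.hc_carrier[OF x] in auto)
  finally have "f x = finsum N (\<lambda>h. f (hc M x (h - s))) ((\<lambda>g. g + s) ` S)" .
  from N.hc_eqI[OF _ _ this, of "g + s"] show ?thesis
    using S hom[OF M.hc_props(1)[OF x]] by (auto simp: S_def)
qed

lemma hc_zero: "graded_module R M \<Longrightarrow> hc M \<zero>\<^bsub>M\<^esub> g = \<zero>\<^bsub>M\<^esub>"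
  using graded_module.hc_homog[OF _ graded_module.hcomp_zero, of R M R g g] by auto

lemma hc_add:
  assumes "graded_module R M" "x \<in> carrier M" "y \<in> carrier M"
  shows "hc M (x \<oplus>\<^bsub>M\<^esub> y) g = hc M x g \<oplus>\<^bsub>M\<^esub> hc M y g"
proof -
  interpret M: graded_module R M by fact
  define S where "S = insert g ({g. hc M x g \<noteq> \<zero>\<^bsub>M\<^esub>} \<union> {g. hc M y g \<noteq> \<zero>\<^bsub>M\<^esub>})"
  have S: "finite S" using M.hc_props[OF assms(2)]  M.hc_props[OF assms(3)] by (simp add: S_def)
  have xs: "x = finsum M (hc M x) S"
    by (rule M.hc_sum_superset[OF assms(2) S]) (auto simp: S_def)
  have ys: "y = finsum M (hc M y) S"
    by (rule M.hc_sum_superset[OF assms(3) S]) (auto simp: S_def)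
  have "x \<oplus>\<^bsub>M\<^esub> y = finsum M (\<lambda>g. hc M x g \<oplus>\<^bsub>M\<^esub> hc M y g) S"
    by (subst M.M.finsum_addf)
     (use M.hc_carrier assms xs ys in auto)
  from M.hc_eqI[OF S _ this, of g] show ?thesis
    using M.hcomp_add M.hc_props(1) assms by (simp add: S_def)
qed

lemma hc_smult:
  assumes "graded_module R M" "a \<in> hcomp R k" "a \<in> carrier R" "x \<in> carrier M"
  shows "hc M (a \<odot>\<^bsub>M\<^esub> x) (g + k) = a \<odot>\<^bsub>M\<^esub> hc M x g"
proof -
  interpret M: graded_module R M by fact
  show ?thesis
    by (rule hc_map[OF assms(1,1)])
     (use assms M.smult_r_distr M.hcomp_smult[OF assms(2)] in \<open>auto simp: add.commute\<close>)
qed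

text \<open>A plain submodule; homogeneity is added where it matters, as closure under
  \<open>hc\<close>. Negatives are multiples by -1, hence no clause for them.\<close>

definition gsubmodule :: "('s, 'a, 'g) gmod \<Rightarrow> ('a, 'b, 'g) gmod \<Rightarrow> 'b set \<Rightarrow> bool" where
  "gsubmodule R M S \<longleftrightarrow> S \<subseteq> carrier M \<and> \<zero>\<^bsub>M\<^esub> \<in> S \<and> (\<forall>x\<in>S. \<forall>y\<in>S. x \<oplus>\<^bsub>M\<^esub> y \<in> S) \<and>
     (\<forall>a\<in>carrier R. \<forall>x\<in>S. a \<odot>\<^bsub>M\<^esub> x \<in> S)"

lemma gsubmodule_neg:
  assumes "Module.module R M" "gsubmodule R M S" "x \<in> S"
  shows "\<ominus>\<^bsub>M\<^esub> x \<in> S"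
proof -
  interpret Module.module R M by fact
  have "x \<in> carrier M" "\<ominus>\<^bsub>R\<^esub> \<one>\<^bsub>R\<^esub> \<in> carrier R" using assms(2,3) by (auto simp: gsubmodule_def)
  then have "\<ominus>\<^bsub>M\<^esub> x = (\<ominus>\<^bsub>R\<^esub> \<one>\<^bsub>R\<^esub>) \<odot>\<^bsub>M\<^esub> x" by (simp add: smult_l_minus)
  then show ?thesis using assms(2,3) by (auto simp: gsubmodule_def)
qed

lemma gsubmodule_diff:
  assumes "Module.module R M" "gsubmodule R M S" "x \<in> S" "y \<in> S"
  shows "x \<ominus>\<^bsub>M\<^esub> y \<in> S"
  using gsubmodule_neg[OF assms(1,2,4)] assms by (auto simp: gsubmodule_def a_minus_def)

lemma gsubmodule_additive_subgroup:
  assumes "Module.module R M" "gsubmodule R M S"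
  shows "additive_subgroup S M"
proof -
  interpret Module.module R M by fact
  show ?thesis
    using assms(2) gsubmodule_neg[OF assms]
    by (auto intro!: additive_subgroupI subgroup.intro simp: gsubmodule_def a_inv_def)
qed

lemma module_gsub:
  assumes "Module.module R M" "gsubmodule R M S"
  shows "Module.module R (gsub M S)"
proof -
  interpret Module.module R M by fact
  have c: "\<And>x. x \<in> S \<Longrightarrow> x \<in> carrier M" using assms(2) by (auto simp: gsubmodule_def)
  show ?thesis
    using assms(2) gsubmodule_neg[OF assms] c
    by (intro moduleI abelian_groupI R.cring_axioms)
     (auto simp: gsub_def gsubmodule_def smult_l_distr smult_r_distr smult_assoc1 M.a_ac M.r_neg
        intro!: bexI[of _ "\<ominus>\<^bsub>M\<^esub> x" for x])
qed

lemma gsub_simps [simp]: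
  "carrier (gsub M S) = S" "zero (gsub M S) = zero M" "add (gsub M S) = add M"
  "smult (gsub M S) = smult M" "hcomp (gsub M S) g = hcomp M g \<inter> S"
  by (auto simp: gsub_def)

lemma finsum_gsub:
  assumes "Module.module R M" "gsubmodule R M S" "finite A" "\<And>g. g \<in> A \<Longrightarrow> u g \<in> S"
  shows "finsum (gsub M S) u A = finsum M u A"
proof -
  interpret M: Module.module R M by fact
  interpret S: Module.module R "gsub M S" using module_gsub[OF assms(1,2)] .
  show ?thesis
    using finsum_hom[OF S.M.abelian_group_axioms M.M.abelian_group_axioms assms(3), of u "\<lambda>x. x"] assms
    by (auto simp: gsubmodule_def)
qed

lemma additive_subgroup_of_module:
  assumes "Module.module R M" "T \<subseteq> carrier M" "\<zero>\<^bsub>M\<^esub> \<in> T" "\<And>x y. x \<in> T \<Longrightarrow> y \<in> T \<Longrightarrow> x \<oplus>\<^bsub>M\<^esub> y \<in> T"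
    "\<And>x. x \<in> T \<Longrightarrow> \<ominus>\<^bsub>M\<^esub> x \<in> T"
  shows "additive_subgroup T M"
proof -
  interpret Module.module R M by fact
  show ?thesis
    using assms(2-) by (auto intro!: additive_subgroupI subgroup.intro simp: a_inv_def)
qed

lemma minus_gsub:
  assumes "Module.module R M" "gsubmodule R M S" "x \<in> S"
  shows "\<ominus>\<^bsub>gsub M S\<^esub> x = \<ominus>\<^bsub>M\<^esub> x"
proof -
  interpret M: Module.module R M by fact
  interpret S: Module.module R "gsub M S" using module_gsub[OF assms(1,2)] .
  show ?thesis
    using gsubmodule_neg[OF assms] assms
    by (intro S.M.minus_equality) (auto simp: gsubmodule_def M.M.l_neg)
qed

lemma graded_module_gsub:
  assumes "graded_module R M" "gsubmodule R M S" "\<And>x g. x \<in> S \<Longrightarrow> hc M x g \<in> S"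
    and R: "\<And>g. hcomp R g \<subseteq> carrier R"
  shows "graded_module R (gsub M S)"
proof -
  interpret M: graded_module R M by fact
  have mod: "Module.module R M" using M.module_axioms .
  have c: "\<And>x. x \<in> S \<Longrightarrow> x \<in> carrier M" using assms(2) by (auto simp: gsubmodule_def)
  interpret S: Module.module R "gsub M S" using module_gsub[OF mod assms(2)] .
  show ?thesis
  proof (rule graded_moduleI[OF S.module_axioms])
    fix g
    show "additive_subgroup (hcomp (gsub M S) g) (gsub M S)"
      by (rule additive_subgroup_of_module[OF S.module_axioms])
        (use M.hcomp_add M.hcomp_neg gsubmodule_neg[OF mod assms(2)] assms(2) in
         \<open>auto simp: gsubmodule_def minus_gsub[OF mod assms(2)]\<close>)
  next
    fix x assume "x \<in> carrier (gsub M S)"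
    then have x: "x \<in> S" "x \<in> carrier M" using c by auto
    let ?T = "{g. hc M x g \<noteq> \<zero>\<^bsub>M\<^esub>}"
    have "finsum (gsub M S) (hc M x) ?T = x"
      using M.hc_props[OF x(2)] assms(3)[OF x(1)] by (subst finsum_gsub[OF mod assms(2)]) auto
    then show "\<exists>T u. finite T \<and> (\<forall>g\<in>T. u g \<in> hcomp (gsub M S) g) \<and> x = finsum (gsub M S) u T"
      using M.hc_props[OF x(2)] assms(3)[OF x(1)] by (intro exI[of _ ?T] exI[of _ "hc M x"]) auto
  next
    fix T u assume T: "finite T" "\<forall>g\<in>T. u g \<in> hcomp (gsub M S) g" "finsum (gsub M S) u T = \<zero>\<^bsub>gsub M S\<^esub>"
    then have "finsum M u T = \<zero>\<^bsub>M\<^esub>" by (subst finsum_gsub[OF mod assms(2), symmetric]) auto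
    then show "\<forall>g\<in>T. u g = \<zero>\<^bsub>gsub M S\<^esub>" using M.hcomp_independent[OF T(1), of u] T(2) by auto
  next
    fix g h a x assume "a \<in> hcomp R g" "x \<in> hcomp (gsub M S) h"
    then show "a \<odot>\<^bsub>gsub M S\<^esub> x \<in> hcomp (gsub M S) (g + h)"
      using M.hcomp_smult[of a g x h] R[of g] assms(2) by (auto simp: gsubmodule_def)
  qed
qed

lemma gquot_simps [simp]:
  "carrier (gquot M S) = a_rcosets\<^bsub>M\<^esub> S" "zero (gquot M S) = S" "add (gquot M S) = set_add M"
  "mult (gquot M S) = rcoset_mult M S" "one (gquot M S) = S +>\<^bsub>M\<^esub> \<one>\<^bsub>M\<^esub>"
  "hcomp (gquot M S) g = (\<lambda>x. S +>\<^bsub>M\<^esub> x) ` hcomp M g"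
  by (auto simp: gquot_def)

text \<open>Every element of \<open>Y\<close> has a preimage, so each module axiom of
  \<open>Y\<close> is the image of one of \<open>M\<close>. Nothing is presupposed about the
  operations of the record \<open>Y\<close>, so the lemma fits quotients and, through the graded
  version, Ext.\<close>

lemma module_transport:
  assumes "Module.module R M" and surj: "\<pi> ` carrier M = carrier Y"
    and add: "\<And>x y. x \<in> carrier M \<Longrightarrow> y \<in> carrier M \<Longrightarrow> \<pi> (x \<oplus>\<^bsub>M\<^esub> y) = \<pi> x \<oplus>\<^bsub>Y\<^esub> \<pi> y"
    and smult: "\<And>a x. a \<in> carrier R \<Longrightarrow> x \<in> carrier M \<Longrightarrow> \<pi> (a \<odot>\<^bsub>M\<^esub> x) = a \<odot>\<^bsub>Y\<^esub> \<pi> x"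
    and zero: "\<pi> \<zero>\<^bsub>M\<^esub> = \<zero>\<^bsub>Y\<^esub>"
  shows "Module.module R Y"
proof -
  interpret Module.module R M by fact
  have c: "\<pi> x \<in> carrier Y" if "x \<in> carrier M" for x using surj that by auto
  have ex: "\<exists>z\<in>carrier M. y = \<pi> z" if "y \<in> carrier Y" for y using surj that by auto
  show ?thesis
  proof (intro moduleI abelian_groupI R.cring_axioms)
    fix x assume "x \<in> carrier Y"
    then obtain x' where x': "x' \<in> carrier M" "x = \<pi> x'" using ex by blast
    then have "\<pi> (\<ominus>\<^bsub>M\<^esub> x') \<in> carrier Y" "\<pi> (\<ominus>\<^bsub>M\<^esub> x') \<oplus>\<^bsub>Y\<^esub> x = \<zero>\<^bsub>Y\<^esub>"
      using c zero by (simp_all add: M.l_neg flip: add)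
    then show "\<exists>y\<in>carrier Y. y \<oplus>\<^bsub>Y\<^esub> x = \<zero>\<^bsub>Y\<^esub>" by blast
  next
    fix x y assume "x \<in> carrier Y" "y \<in> carrier Y"
    then obtain x' y' where "x' \<in> carrier M" "x = \<pi> x'" "y' \<in> carrier M" "y = \<pi> y'" using ex by blast
    then show "x \<oplus>\<^bsub>Y\<^esub> y \<in> carrier Y" "x \<oplus>\<^bsub>Y\<^esub> y = y \<oplus>\<^bsub>Y\<^esub> x"
      by (metis M.a_closed add c) (metis M.a_comm add \<open>x = \<pi> x'\<close> \<open>y = \<pi> y'\<close> \<open>x' \<in> _\<close> \<open>y' \<in> _\<close>)
    fix z assume "z \<in> carrier Y"
    then obtain z' where "z' \<in> carrier M" "z = \<pi> z'" using ex by blast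
    then show "x \<oplus>\<^bsub>Y\<^esub> y \<oplus>\<^bsub>Y\<^esub> z = x \<oplus>\<^bsub>Y\<^esub> (y \<oplus>\<^bsub>Y\<^esub> z)"
      using \<open>x = \<pi> x'\<close> \<open>y = \<pi> y'\<close> \<open>x' \<in> _\<close> \<open>y' \<in> _\<close>
      by (metis M.a_assoc M.a_closed add)
  next
    fix a x y assume "a \<in> carrier R" "x \<in> carrier Y" "y \<in> carrier Y"
    then obtain x' y' where "x' \<in> carrier M" "x = \<pi> x'" "y' \<in> carrier M" "y = \<pi> y'" using ex by blast
    then show "a \<odot>\<^bsub>Y\<^esub> (x \<oplus>\<^bsub>Y\<^esub> y) = a \<odot>\<^bsub>Y\<^esub> x \<oplus>\<^bsub>Y\<^esub> a \<odot>\<^bsub>Y\<^esub> y"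
      using \<open>a \<in> carrier R\<close> by (metis smult add smult_r_distr M.a_closed smult_closed)
  next
    fix a b x assume "a \<in> carrier R" "b \<in> carrier R" "x \<in> carrier Y"
    then obtain x' where "x' \<in> carrier M" "x = \<pi> x'" using ex by blast
    then show "(a \<oplus>\<^bsub>R\<^esub> b) \<odot>\<^bsub>Y\<^esub> x = a \<odot>\<^bsub>Y\<^esub> x \<oplus>\<^bsub>Y\<^esub> b \<odot>\<^bsub>Y\<^esub> x"
      "(a \<otimes>\<^bsub>R\<^esub> b) \<odot>\<^bsub>Y\<^esub> x = a \<odot>\<^bsub>Y\<^esub> (b \<odot>\<^bsub>Y\<^esub> x)"
      using \<open>a \<in> carrier R\<close> \<open>b \<in> carrier R\<close>
        smult[of a x'] smult[of b x'] smult[of a "b \<odot>\<^bsub>M\<^esub> x'"] smult[of "a \<oplus>\<^bsub>R\<^esub> b" x'] smult[of "a \<otimes>\<^bsub>R\<^esub> b" x']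
        add[of "a \<odot>\<^bsub>M\<^esub> x'" "b \<odot>\<^bsub>M\<^esub> x'"]
      by (simp_all add: smult_l_distr smult_assoc1)
  next
    fix x assume "x \<in> carrier Y"
    then obtain x' where "x' \<in> carrier M" "x = \<pi> x'" using ex by blast
    then show "\<zero>\<^bsub>Y\<^esub> \<oplus>\<^bsub>Y\<^esub> x = x" "\<one>\<^bsub>R\<^esub> \<odot>\<^bsub>Y\<^esub> x = x"
      using add[of "\<zero>\<^bsub>M\<^esub>" x'] zero smult[of "\<one>\<^bsub>R\<^esub>" x'] by simp_all
  next
    fix a x assume "a \<in> carrier R" "x \<in> carrier Y"
    then show "a \<odot>\<^bsub>Y\<^esub> x \<in> carrier Y" using ex[of x] smult c by (metis smult_closed)
  qed (use c[OF M.zero_closed] zero in simp_all)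
qed

locale gquotient = Module.module R M for R :: "('s, 'a, 'g::ab_group_add) gmod" and M :: "('a, 'b, 'g) gmod" +
  fixes S
  assumes gsub: "gsubmodule R M S"
begin

sublocale abelian_subgroup S M
  using gsubmodule_additive_subgroup[OF module_axioms gsub] M.abelian_group_axioms
  by (rule abelian_subgroupI3)

lemma coset_carrier: "x \<in> carrier M \<Longrightarrow> S +>\<^bsub>M\<^esub> x \<in> carrier (gquot M S)"
  by (auto simp: A_RCOSETS_def')

lemma coset_ex: "X \<in> carrier (gquot M S) \<Longrightarrow> \<exists>x\<in>carrier M. X = S +>\<^bsub>M\<^esub> x"
  by (auto simp: A_RCOSETS_def')

lemma coset_add: "x \<in> carrier M \<Longrightarrow> y \<in> carrier M \<Longrightarrow>
    (S +>\<^bsub>M\<^esub> x) \<oplus>\<^bsub>gquot M S\<^esub> (S +>\<^bsub>M\<^esub> y) = S +>\<^bsub>M\<^esub> (x \<oplus>\<^bsub>M\<^esub> y)"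
  by (simp add: a_rcos_sum)

lemma coset_eq_iff: "x \<in> carrier M \<Longrightarrow> y \<in> carrier M \<Longrightarrow>
    S +>\<^bsub>M\<^esub> x = S +>\<^bsub>M\<^esub> y \<longleftrightarrow> x \<ominus>\<^bsub>M\<^esub> y \<in> S"
  using a_rcos_module[of y x] a_rcos_self[of x] a_repr_independence'[of x y]
  unfolding a_minus_def by metis

lemma mem_coset_iff: "x \<in> carrier M \<Longrightarrow> y \<in> carrier M \<Longrightarrow>
    y \<in> S +>\<^bsub>M\<^esub> x \<longleftrightarrow> y \<ominus>\<^bsub>M\<^esub> x \<in> S"
  by (simp add: a_rcos_module a_minus_def)

lemma coset_zero: "S +>\<^bsub>M\<^esub> \<zero>\<^bsub>M\<^esub> = S"
  using a_rcos_const by auto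

lemma coset_eq_zero_iff: "x \<in> carrier M \<Longrightarrow> S +>\<^bsub>M\<^esub> x = S \<longleftrightarrow> x \<in> S"
  using coset_eq_iff[of x "\<zero>\<^bsub>M\<^esub>"] M.add.inv_one by (simp add: coset_zero a_minus_def a_inv_def)

text \<open>The union that defines the action on \<open>gquot\<close> runs over all representatives.
  It collapses because \<open>a\<close> times a difference of two representatives lies in
  \<open>S\<close>, so its members are one and the same coset.\<close>

lemma coset_smult: 
  assumes "a \<in> carrier R" "x \<in> carrier M"
  shows "a \<odot>\<^bsub>gquot M S\<^esub> (S +>\<^bsub>M\<^esub> x) = S +>\<^bsub>M\<^esub> (a \<odot>\<^bsub>M\<^esub> x)"
proof -
  have "S +>\<^bsub>M\<^esub> (a \<odot>\<^bsub>M\<^esub> z) = S +>\<^bsub>M\<^esub> (a \<odot>\<^bsub>M\<^esub> x)" if "z \<in> S +>\<^bsub>M\<^esub> x" for z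
  proof -
    have z: "z \<in> carrier M" using that assms a_elemrcos_carrier by blast
    then have "z \<ominus>\<^bsub>M\<^esub> x \<in> S" using that assms mem_coset_iff by auto
    then have "a \<odot>\<^bsub>M\<^esub> (z \<ominus>\<^bsub>M\<^esub> x) \<in> S" using gsub assms by (auto simp: gsubmodule_def)
    then show ?thesis using assms z
      by (subst coset_eq_iff) (simp_all add: a_minus_def smult_r_distr smult_r_minus)
  qed
  note * = this
  have "x \<in> S +>\<^bsub>M\<^esub> x" using assms a_rcos_self by auto
  from UN_constant_eq[OF this ballI[OF *]] have "(\<Union>z\<in>S +>\<^bsub>M\<^esub> x. S +>\<^bsub>M\<^esub> (a \<odot>\<^bsub>M\<^esub> z)) = S +>\<^bsub>M\<^esub> (a \<odot>\<^bsub>M\<^esub> x)" .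
  then show ?thesis by (simp only: gquot_def module.simps)
qed

lemma module_gquot: "Module.module R (gquot M S)"
proof (rule module_transport[OF module_axioms, of "\<lambda>x. S +>\<^bsub>M\<^esub> x"])
  show "(\<lambda>x. S +>\<^bsub>M\<^esub> x) ` carrier M = carrier (gquot M S)"
    using coset_carrier coset_ex by blast
qed (simp_all only: coset_add coset_smult coset_zero gquot_simps(2))

end

lemma graded_module_gquot:
  assumes "graded_module R M" "gsubmodule R M S" "\<And>x g. x \<in> S \<Longrightarrow> hc M x g \<in> S"
    and R: "\<And>g. hcomp R g \<subseteq> carrier R"
  shows "graded_module R (gquot M S)"
proof -
  interpret M: graded_module R M by fact
  interpret q: gquotient R M S using assms(2) by unfold_locales
  interpret Q: Module.module R "gquot M S" by (rule q.module_gquot)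
  have fs: "finsum (gquot M S) (\<lambda>g. S +>\<^bsub>M\<^esub> u g) T = S +>\<^bsub>M\<^esub> finsum M u T"
    if "finite T" "u \<in> T \<rightarrow> carrier M" for u T
    using finsum_hom[OF M.M.abelian_group_axioms Q.M.abelian_group_axioms that, of "\<lambda>x. S +>\<^bsub>M\<^esub> x"]
      q.coset_carrier q.coset_add by simp
  show ?thesis
  proof (rule graded_moduleI[OF Q.module_axioms])
    fix g
    have inv: "\<ominus>\<^bsub>gquot M S\<^esub> (S +>\<^bsub>M\<^esub> x) = S +>\<^bsub>M\<^esub> (\<ominus>\<^bsub>M\<^esub> x)" if "x \<in> carrier M" for x
      using that by (intro Q.M.minus_equality q.coset_carrier)
        (simp_all only: q.coset_add M.M.a_inv_closed M.M.l_neg q.coset_zero gquot_simps(2))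
    show "additive_subgroup (hcomp (gquot M S) g) (gquot M S)"
      apply (rule additive_subgroup_of_module[OF Q.module_axioms])
      subgoal using M.hcomp_carrier q.coset_carrier by (auto simp del: gquot_simps(1))
      subgoal using q.coset_zero M.hcomp_zero[of g] by (metis gquot_simps(2,6) image_eqI)
      subgoal using M.hcomp_carrier q.coset_add M.hcomp_add by (auto simp del: gquot_simps(3))
      subgoal using M.hcomp_carrier inv M.hcomp_neg by (auto)
      done
  next
    fix X assume "X \<in> carrier (gquot M S)"
    then obtain x where x: "x \<in> carrier M" "X = S +>\<^bsub>M\<^esub> x" using q.coset_ex by blast
    let ?T = "{g. hc M x g \<noteq> \<zero>\<^bsub>M\<^esub>}"
    have "finsum (gquot M S) (\<lambda>g. S +>\<^bsub>M\<^esub> hc M x g) ?T = X"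
      using M.hc_props[OF x(1)] M.hc_carrier[OF x(1)] x(2) by (subst fs) auto
    then show "\<exists>T u. finite T \<and> (\<forall>g\<in>T. u g \<in> hcomp (gquot M S) g) \<and> X = finsum (gquot M S) u T"
      using M.hc_props[OF x(1)] by (intro exI[of _ ?T] exI[of _ "\<lambda>g. S +>\<^bsub>M\<^esub> hc M x g"]) auto
  next
    fix T u assume T: "finite T" "\<forall>g\<in>T. u g \<in> hcomp (gquot M S) g" "finsum (gquot M S) u T = \<zero>\<^bsub>gquot M S\<^esub>"
    then have "\<forall>g\<in>T. \<exists>x. x \<in> hcomp M g \<and> u g = S +>\<^bsub>M\<^esub> x" by auto
    \<comment> \<open>A vanishing sum of cosets lifts to homogeneous representatives
      \<open>v g\<close> with sum in \<open>S\<close>; closure of \<open>S\<close> under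
      \<open>hc\<close> then puts each \<open>v g\<close> into \<open>S\<close>.\<close>
    then obtain v where v: "\<forall>g\<in>T. v g \<in> hcomp M g \<and> u g = S +>\<^bsub>M\<^esub> v g" by metis
    have vc: "v \<in> T \<rightarrow> carrier M" using v M.hcomp_carrier by auto
    have "finsum (gquot M S) u T = finsum (gquot M S) (\<lambda>g. S +>\<^bsub>M\<^esub> v g) T"
      by (rule Q.M.finsum_cong') (use v vc q.coset_carrier in \<open>auto simp del: gquot_simps(1)\<close>)
    then have "S +>\<^bsub>M\<^esub> finsum M v T = S" using T(3) fs[OF T(1) vc] by simp
    then have "finsum M v T \<in> S" using q.coset_eq_zero_iff vc by auto
    then have "hc M (finsum M v T) g \<in> S" for g using assms(3) by blast
    then have "v g \<in> S" if "g \<in> T" for g using M.hc_eqI[OF T(1), of v] v that by metis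
    then show "\<forall>g\<in>T. u g = \<zero>\<^bsub>gquot M S\<^esub>" using v q.coset_eq_zero_iff M.hcomp_carrier by auto
  next
    fix g h a X assume "a \<in> hcomp R g" "X \<in> hcomp (gquot M S) h"
    then show "a \<odot>\<^bsub>gquot M S\<^esub> X \<in> hcomp (gquot M S) (g + h)"
      using M.hcomp_smult[of a g _ h] R[of g] q.coset_smult M.hcomp_carrier by auto
  qed
qed

text \<open>Degrees may move by \<open>c\<close> along the bijection. This grades the shifts and, in
  the end, Ext, where independence of the components would be awkward to check on classes of
  cocycles.\<close>

lemma graded_module_transport:
  assumes "graded_module R M" and bij: "bij_betw \<pi> (carrier M) (carrier Y)"
    and add: "\<And>x y. x \<in> carrier M \<Longrightarrow> y \<in> carrier M \<Longrightarrow> \<pi> (x \<oplus>\<^bsub>M\<^esub> y) = \<pi> x \<oplus>\<^bsub>Y\<^esub> \<pi> y"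
    and smult: "\<And>a x. a \<in> carrier R \<Longrightarrow> x \<in> carrier M \<Longrightarrow> \<pi> (a \<odot>\<^bsub>M\<^esub> x) = a \<odot>\<^bsub>Y\<^esub> \<pi> x"
    and zero: "\<pi> \<zero>\<^bsub>M\<^esub> = \<zero>\<^bsub>Y\<^esub>"
    and hom: "\<And>g. \<pi> ` hcomp M g = hcomp Y (g + c)"
    and R: "\<And>g. hcomp R g \<subseteq> carrier R"
  shows "graded_module R Y"
proof -
  interpret M: graded_module R M by fact
  have surj: "\<pi> ` carrier M = carrier Y" and inj: "inj_on \<pi> (carrier M)" using bij by (auto simp: bij_betw_def)
  interpret Y: Module.module R Y
    by (rule module_transport[OF M.module_axioms surj add smult zero])
  have hom': "hcomp Y g = \<pi> ` hcomp M (g - c)" for g using hom[of "g - c"] by simp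
  have piy: "\<pi> x \<in> carrier Y" if "x \<in> carrier M" for x using surj that by blast
  have fs: "finsum Y (\<lambda>g. \<pi> (u g)) T = \<pi> (finsum M u T)"
    if "finite T" "u \<in> T \<rightarrow> carrier M" for u and T :: "'c set"
    using finsum_hom[OF M.M.abelian_group_axioms Y.M.abelian_group_axioms that piy add] by simp
  show ?thesis
  proof (rule graded_moduleI[OF Y.module_axioms])
    fix g
    have inv: "\<ominus>\<^bsub>Y\<^esub> (\<pi> x) = \<pi> (\<ominus>\<^bsub>M\<^esub> x)" if "x \<in> carrier M" for x
      using that by (intro Y.M.minus_equality piy) (auto simp: add[symmetric] M.M.l_neg zero)
    show "additive_subgroup (hcomp Y g) Y"
      apply (rule additive_subgroup_of_module[OF Y.module_axioms])
      subgoal using M.hcomp_carrier piy by (auto simp: hom')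
      subgoal using zero M.hcomp_zero[of "g - c"] by (metis hom' image_eqI)
      subgoal using M.hcomp_carrier add[symmetric] M.hcomp_add by (auto simp: hom')
      subgoal using M.hcomp_carrier inv M.hcomp_neg by (auto simp: hom')
      done
  next
    fix y assume "y \<in> carrier Y"
    then obtain x where x: "x \<in> carrier M" "y = \<pi> x" using surj by blast
    let ?T = "{g. hc M x g \<noteq> \<zero>\<^bsub>M\<^esub>}"
    have "finsum Y (\<lambda>g. \<pi> (hc M x (g - c))) ((\<lambda>g. g + c) ` ?T) = finsum Y (\<lambda>g. \<pi> (hc M x g)) ?T"
      by (subst Y.M.finsum_reindex) (use piy M.hc_carrier[OF x(1)] in auto)
    also have "\<dots> = y"
      using M.hc_props[OF x(1)] M.hc_carrier[OF x(1)] x(2) by (subst fs) auto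
    finally show "\<exists>T u. finite T \<and> (\<forall>g\<in>T. u g \<in> hcomp Y g) \<and> y = finsum Y u T"
      using M.hc_props[OF x(1)] hom'
      by (intro exI[of _ "(\<lambda>g. g + c) ` ?T"] exI[of _ "\<lambda>g. \<pi> (hc M x (g - c))"]) auto
  next
    fix T u assume T: "finite T" "\<forall>g\<in>T. u g \<in> hcomp Y g" "finsum Y u T = \<zero>\<^bsub>Y\<^esub>"
    then have "\<forall>g\<in>T. \<exists>x. x \<in> hcomp M (g - c) \<and> u g = \<pi> x" using hom' by auto
    then obtain v where v: "\<forall>g\<in>T. v g \<in> hcomp M (g - c) \<and> u g = \<pi> (v g)" by metis
    have vc: "v \<in> T \<rightarrow> carrier M" using v M.hcomp_carrier by auto
    have "finsum Y u T = finsum Y (\<lambda>g. \<pi> (v g)) T"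
      by (rule Y.M.finsum_cong') (use v vc piy in auto)
    then have "\<pi> (finsum M v T) = \<pi> \<zero>\<^bsub>M\<^esub>" using T(3) fs[OF T(1) vc] zero by simp
    then have "finsum M v T = \<zero>\<^bsub>M\<^esub>" using inj vc by (auto simp: inj_on_def)
    moreover have "finsum M v T = finsum M (\<lambda>g. v (g + c)) ((\<lambda>g. g - c) ` T)"
      by (subst M.M.finsum_reindex) (use vc in \<open>auto simp: inj_on_def\<close>)
    ultimately have "finsum M (\<lambda>g. v (g + c)) ((\<lambda>g. g - c) ` T) = \<zero>\<^bsub>M\<^esub>" by simp
    from M.hcomp_independent[OF _ _ this] have "v g = \<zero>\<^bsub>M\<^esub>" if "g \<in> T" for g
      using T(1) v that by force
    then show "\<forall>g\<in>T. u g = \<zero>\<^bsub>Y\<^esub>" using v zero by auto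
  next
    fix g h a y assume a: "a \<in> hcomp R g" and "y \<in> hcomp Y h"
    then obtain x where x: "x \<in> hcomp M (h - c)" "y = \<pi> x" using hom' by auto
    then have "a \<odot>\<^bsub>Y\<^esub> y = \<pi> (a \<odot>\<^bsub>M\<^esub> x)" using smult[of a x] a R[of g] M.hcomp_carrier by auto
    then show "a \<odot>\<^bsub>Y\<^esub> y \<in> hcomp Y (g + h)"
      using M.hcomp_smult[OF a x(1)] hom'[of "g + h"] by (simp add: add_diff_eq)
  qed
qed

section \<open>The polynomial ring and its monomial ideals\<close>

declare One_nat_def [simp del]

lemma sum_closed_set:
  assumes "0 \<in> T" "\<And>x y. x \<in> T \<Longrightarrow> y \<in> T \<Longrightarrow> x + y \<in> T" "\<And>s. s \<in> S \<Longrightarrow> u s \<in> T"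
  shows "sum u S \<in> (T :: 'a::comm_monoid_add set)"
  using assms(3) by (induction S rule: infinite_finite_induct) (auto intro: assms)

lemma poly_mapping_sum_single:
  "f = (\<Sum>e\<in>Poly_Mapping.keys f. Poly_Mapping.single e (Poly_Mapping.lookup f e))"
proof (rule poly_mapping_eqI)
  fix k
  have "Poly_Mapping.lookup (\<Sum>e\<in>Poly_Mapping.keys f. Poly_Mapping.single e (Poly_Mapping.lookup f e)) k =
    (\<Sum>e\<in>Poly_Mapping.keys f. if e = k then Poly_Mapping.lookup f e else 0)"
    by (simp add: lookup_sum lookup_single when_def)
  also have "\<dots> = Poly_Mapping.lookup f k"
    by (simp add: in_keys_iff)
  finally show "Poly_Mapping.lookup f k = Poly_Mapping.lookup
     (\<Sum>e\<in>Poly_Mapping.keys f. Poly_Mapping.single e (Poly_Mapping.lookup f e)) k" by simp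
qed

definition polys :: "nat \<Rightarrow> 'k::field mpoly set" where
  "polys d = {f. \<forall>e\<in>Poly_Mapping.keys f. Poly_Mapping.keys e \<subseteq> {1..d}}"

lemma poly_ring_simps [simp]:
  "carrier (poly_ring d W) = polys d"
  "mult (poly_ring d W) = (*)" "one (poly_ring d W) = 1" "zero (poly_ring d W) = 0"
  "add (poly_ring d W) = (+)" "smult (poly_ring d W) = (*)"
  "hcomp (poly_ring d W) g = {f \<in> polys d. \<forall>e\<in>Poly_Mapping.keys f. mdeg d W e = g}"
  by (auto simp: poly_ring_def polys_def)

lemma polysI: "(\<And>e. e \<in> Poly_Mapping.keys f \<Longrightarrow> Poly_Mapping.keys e \<subseteq> {1..d}) \<Longrightarrow> f \<in> polys d"
  by (simp add: polys_def)

lemma polysD: "f \<in> polys d \<Longrightarrow> e \<in> Poly_Mapping.keys f \<Longrightarrow> Poly_Mapping.keys e \<subseteq> {1..d}"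
  by (auto simp: polys_def)

lemma zero_polys [simp, intro]: "0 \<in> polys d" and one_polys [simp, intro]: "1 \<in> polys d"
  and uminus_polys: "f \<in> polys d \<Longrightarrow> - f \<in> polys d"
  by (auto simp: polys_def in_keys_iff lookup_one when_def)

lemma single_polys: "Poly_Mapping.keys e \<subseteq> {1..d} \<Longrightarrow> Poly_Mapping.single e c \<in> polys d"
  by (auto simp: polys_def)

lemma keys_add_nat: "Poly_Mapping.keys (a + b) = Poly_Mapping.keys a \<union> Poly_Mapping.keys (b :: nat \<Rightarrow>\<^sub>0 nat)"
  by (auto simp: in_keys_iff lookup_add)

lemma poly_mult_keysE:
  assumes "e \<in> Poly_Mapping.keys (f * g)"
  obtains a b where "a \<in> Poly_Mapping.keys f" "b \<in> Poly_Mapping.keys g" "e = a + b"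
  using assms keys_mult[of f g] by auto

lemma poly_add_keysE:
  assumes "e \<in> Poly_Mapping.keys (f + g)"
  shows "e \<in> Poly_Mapping.keys f \<or> e \<in> Poly_Mapping.keys g"
  using assms Poly_Mapping.keys_add[of f g] by auto

lemma polys_mult: "f \<in> polys d \<Longrightarrow> g \<in> polys d \<Longrightarrow> f * g \<in> polys d"
  by (intro polysI, elim poly_mult_keysE) (simp add: keys_add_nat polysD)

lemma polys_add: "f \<in> polys d \<Longrightarrow> g \<in> polys d \<Longrightarrow> f + g \<in> polys d"
  by (intro polysI, drule poly_add_keysE) (auto dest: polysD)

lemma cring_poly_ring: "cring (poly_ring d W :: ('k::field mpoly, 'k mpoly, int ^ 'm) gmod)"
proof (rule cringI)
  show "abelian_group (poly_ring d W :: ('k::field mpoly, 'k mpoly, int ^ 'm) gmod)"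
  proof (rule abelian_groupI)
    fix f :: "'k mpoly" assume "f \<in> carrier (poly_ring d W :: ('k::field mpoly, 'k mpoly, int ^ 'm) gmod)"
    then show "\<exists>y\<in>carrier (poly_ring d W :: ('k::field mpoly, 'k mpoly, int ^ 'm) gmod).
        y \<oplus>\<^bsub>poly_ring d W\<^esub> f = \<zero>\<^bsub>poly_ring d W\<^esub>"
      by (intro bexI[of _ "- f"]) (auto simp: uminus_polys)
  qed (use polys_add in \<open>auto simp: add_ac\<close>)
  show "comm_monoid (poly_ring d W :: ('k::field mpoly, 'k mpoly, int ^ 'm) gmod)"
    by (rule comm_monoidI) (use polys_mult in \<open>auto simp: mult_ac\<close>)
qed (auto simp: algebra_simps)

lemma module_poly_ring: "Module.module (poly_ring d W) (poly_ring d W :: ('k::field mpoly, 'k mpoly, int ^ 'm) gmod)"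
  using cring_poly_ring[of d W]
  by (intro moduleI ring.is_abelian_group cring.axioms) (use polys_mult in \<open>auto simp: algebra_simps\<close>)

lemma finsum_poly_ring:
  assumes "finite S" "\<And>s. s \<in> S \<Longrightarrow> u s \<in> polys d"
  shows "finsum (poly_ring d W) u S = sum u S"
proof -
  interpret cring "poly_ring d W" by (rule cring_poly_ring)
  show ?thesis using assms
  proof (induction S)
    case (insert s S)
    then show ?case by (subst finsum_insert) (auto simp: Pi_def)
  qed (use finsum_empty in simp)
qed

definition pfilter :: "('e \<Rightarrow> bool) \<Rightarrow> ('e \<Rightarrow>\<^sub>0 'k::zero) \<Rightarrow> ('e \<Rightarrow>\<^sub>0 'k)" where
  "pfilter P f = Abs_poly_mapping (\<lambda>e. if P e then Poly_Mapping.lookup f e else 0)"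

lemma lookup_pfilter: "Poly_Mapping.lookup (pfilter P f) e = (if P e then Poly_Mapping.lookup f e else 0)"
proof -
  have "finite {e. (if P e then Poly_Mapping.lookup f e else 0) \<noteq> 0}"
    by (rule finite_subset[OF _ finite_keys[of f]]) (auto simp: in_keys_iff split: if_splits)
  then show ?thesis unfolding pfilter_def by simp
qed

lemma keys_pfilter: "Poly_Mapping.keys (pfilter P f) = {e \<in> Poly_Mapping.keys f. P e}"
  by (auto simp: in_keys_iff lookup_pfilter split: if_splits)

lemma pfilter_polys: "f \<in> polys d \<Longrightarrow> pfilter P f \<in> polys d"
  by (auto simp: polys_def keys_pfilter)

lemma mdeg_add: "mdeg d W (a + b) = mdeg d W a + mdeg d W b"
  by (simp add: mdeg_def lookup_add vec.scale_left_distrib sum.distrib)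

lemma graded_module_poly_ring:
  "graded_module (poly_ring d W) (poly_ring d W :: ('k::field mpoly, 'k mpoly, int ^ 'm) gmod)"
  (is "graded_module ?A ?A")
proof (rule graded_moduleI[OF module_poly_ring])
  interpret cring ?A by (rule cring_poly_ring)
  have minus: "\<ominus>\<^bsub>?A\<^esub> f = - f" if "f \<in> carrier ?A" for f
    by (rule minus_equality) (use that in \<open>auto simp: uminus_polys\<close>)
  fix g
  show "additive_subgroup (hcomp ?A g) ?A"
  proof (rule additive_subgroup_of_module[OF module_poly_ring])
    fix f assume "f \<in> hcomp ?A g" 
    then show "\<ominus>\<^bsub>?A\<^esub> f \<in> hcomp ?A g" by (subst minus) (auto simp: in_keys_iff uminus_polys)
  qed (auto simp: polys_add dest!: poly_add_keysE)
next
  fix f assume f: "f \<in> carrier ?A"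
  let ?S = "mdeg d W ` Poly_Mapping.keys f"
  have "Poly_Mapping.lookup (\<Sum>g\<in>?S. pfilter (\<lambda>e. mdeg d W e = g) f) e = Poly_Mapping.lookup f e" for e
    by (simp add: lookup_sum lookup_pfilter) (metis image_eqI in_keys_iff)
  then have "finsum ?A (\<lambda>g. pfilter (\<lambda>e. mdeg d W e = g) f) ?S = f"
    using f by (subst finsum_poly_ring) (auto simp: pfilter_polys intro!: poly_mapping_eqI)
  then show "\<exists>S u. finite S \<and> (\<forall>g\<in>S. u g \<in> hcomp ?A g) \<and> f = finsum ?A u S"
    using f by (intro exI[of _ ?S] exI[of _ "\<lambda>g. pfilter (\<lambda>e. mdeg d W e = g) f"]) (auto simp: keys_pfilter pfilter_polys)
next
  fix S u assume S: "finite S" "\<forall>g\<in>S. u g \<in> hcomp ?A g" "finsum ?A u S = \<zero>\<^bsub>?A\<^esub>"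
  then have 0: "sum u S = 0" by (subst (asm) finsum_poly_ring) auto
  have "u g = 0" if g: "g \<in> S" for g
  proof (rule poly_mapping_eqI)
    fix e
    have *: "Poly_Mapping.lookup (u h) e = (if h = g then Poly_Mapping.lookup (u g) e else 0)"
      if "mdeg d W e = g" "h \<in> S" for h
      using S(2) that by (cases "h = g"; force simp: in_keys_iff)
    have "(\<Sum>h\<in>S. Poly_Mapping.lookup (u h) e) = 0" using 0 by (simp flip: lookup_sum)
    then have "Poly_Mapping.lookup (u g) e = 0" if "mdeg d W e = g"
      using sum.cong[OF refl *[OF that], of S] S(1) g by simp
    moreover have "Poly_Mapping.lookup (u g) e = 0" if "mdeg d W e \<noteq> g"
    proof -
      have "e \<notin> Poly_Mapping.keys (u g)" using S(2) g that by auto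
      then show ?thesis by (simp add: in_keys_iff)
    qed
    ultimately show "Poly_Mapping.lookup (u g) e = Poly_Mapping.lookup 0 e" by auto
  qed
  then show "\<forall>g\<in>S. u g = \<zero>\<^bsub>?A\<^esub>" by simp
next
  fix g h a x assume "a \<in> hcomp ?A g" "x \<in> hcomp ?A h"
  then show "a \<odot>\<^bsub>?A\<^esub> x \<in> hcomp ?A (g + h)"
    by (auto elim!: poly_mult_keysE simp: mdeg_add polys_mult)
qed

lemma hcomp_poly_ring_carrier: "hcomp (poly_ring d W) g \<subseteq> carrier (poly_ring d W)"
  by auto

lemma hc_poly_ring:
  assumes "f \<in> polys d"
  shows "hc (poly_ring d W) f g = pfilter (\<lambda>e. mdeg d W e = g) f"
proof -
  let ?A = "poly_ring d W"
  let ?S = "insert g (mdeg d W ` Poly_Mapping.keys f)"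
  have "Poly_Mapping.lookup (\<Sum>g\<in>?S. pfilter (\<lambda>e. mdeg d W e = g) f) e = Poly_Mapping.lookup f e" for e
    by (simp add: lookup_sum lookup_pfilter del: sum.insert_if sum.insert) (metis image_eqI in_keys_iff insertCI)
  then have "finsum ?A (\<lambda>g. pfilter (\<lambda>e. mdeg d W e = g) f) ?S = f"
    using assms by (subst finsum_poly_ring) (auto simp: pfilter_polys intro!: poly_mapping_eqI simp del: sum.insert_if sum.insert)
  then show ?thesis
    using graded_module.hc_eqI[OF graded_module_poly_ring, of ?S "\<lambda>g. pfilter (\<lambda>e. mdeg d W e = g) f" d W f g] assms
    by (auto simp: keys_pfilter pfilter_polys)
qed

text \<open>One encoding for the face ideals, the maximal ideal, bounds for its powers and the test
  ideals for injectivity. Such a set is homogeneous for every \<open>W\<close>, because taking a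
  component only selects monomials.\<close>

definition mon_ideal :: "nat \<Rightarrow> ((nat \<Rightarrow>\<^sub>0 nat) \<Rightarrow> bool) \<Rightarrow> 'k::field mpoly set" where
  "mon_ideal d U = {f \<in> polys d. \<forall>e\<in>Poly_Mapping.keys f. U e}"

lemma mon_ideal_gsubmodule:
  assumes "\<And>a e. U e \<Longrightarrow> U (a + e)"
  shows "gsubmodule (poly_ring d W) (poly_ring d W) (mon_ideal d U)"
  unfolding gsubmodule_def mon_ideal_def
  using polys_mult polys_add assms
  by (auto elim!: poly_mult_keysE dest!: poly_add_keysE)

lemma mon_ideal_ideal:
  assumes "\<And>a e. U e \<Longrightarrow> U (a + e)"
  shows "ideal (mon_ideal d U) (poly_ring d W :: ('a::field mpoly, 'a mpoly, int ^ 'b) gmod)"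
proof -
  interpret cring "poly_ring d W" by (rule cring_poly_ring)
  have s: "gsubmodule (poly_ring d W) (poly_ring d W) (mon_ideal d U)"
    by (rule mon_ideal_gsubmodule) (rule assms)
  show ?thesis
  proof (rule idealI[OF ring_axioms])
    show "subgroup (mon_ideal d U) (add_monoid (poly_ring d W))"
      using gsubmodule_additive_subgroup[OF module_poly_ring s] by (rule additive_subgroup.a_subgroup)
    fix a x :: "'a mpoly" assume "a \<in> mon_ideal d U" "x \<in> carrier (poly_ring d W :: ('a mpoly, 'a mpoly, int ^ 'b) gmod)"
    then have "x * a \<in> mon_ideal d U" using s by (auto simp: gsubmodule_def)
    then show "x \<otimes>\<^bsub>poly_ring d W\<^esub> a \<in> mon_ideal d U" "a \<otimes>\<^bsub>poly_ring d W\<^esub> x \<in> mon_ideal d U"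
      by (simp_all add: mult.commute)
  qed
qed

lemma mon_ideal_hc: "f \<in> mon_ideal d U \<Longrightarrow> hc (poly_ring d W) f g \<in> mon_ideal d U"
  by (auto simp: mon_ideal_def hc_poly_ring keys_pfilter pfilter_polys)

lemma mvar_power: "mvar i ^ n = Poly_Mapping.single (Poly_Mapping.single i n) (1 :: 'k::field)"
  by (induction n) (auto simp: mvar_def mult_single One_nat_def simp flip: single_add)

lemma keys_mvar_power: "Poly_Mapping.keys (mvar i ^ n :: 'k::field mpoly) = {Poly_Mapping.single i n}"
  by (simp add: mvar_power)

lemma mvar_power_polys: "i \<in> {1..d} \<Longrightarrow> mvar i ^ n \<in> polys d"
  by (intro polysI) (auto simp: keys_mvar_power split: if_splits)

lemma mvar_polys: "i \<in> {1..d} \<Longrightarrow> mvar i \<in> polys d"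
  using mvar_power_polys[of i d 1] by simp

lemma mdeg_single: "i \<in> {1..d} \<Longrightarrow> mdeg d W (Poly_Mapping.single i n) = int n *s W i"
proof -
  assume i: "i \<in> {1..d}"
  have "mdeg d W (Poly_Mapping.single i n) = (\<Sum>j\<in>{1..d}. if j = i then int n *s W j else 0)"
    unfolding mdeg_def by (intro sum.cong) (auto simp: lookup_single when_def)
  then show ?thesis using i by simp
qed

lemma mvar_power_hcomp: "i \<in> {1..d} \<Longrightarrow> mvar i ^ n \<in> hcomp (poly_ring d W) (int n *s W i)"
  using mvar_power_polys[of i d n] by (auto simp: keys_mvar_power mdeg_single)

lemma single_split:
  assumes "n \<le> Poly_Mapping.lookup e i"
  shows "Poly_Mapping.single e c = mvar i ^ n * Poly_Mapping.single (e - Poly_Mapping.single i n) (c :: 'k::field)"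
proof -
  have "Poly_Mapping.single i n + (e - Poly_Mapping.single i n) = e"
    using assms by (intro poly_mapping_eqI) (auto simp: lookup_add lookup_minus lookup_single when_def)
  then show ?thesis by (simp add: mvar_power mult_single)
qed

lemma keys_minus_nat: "Poly_Mapping.keys (a - b) \<subseteq> Poly_Mapping.keys (a :: nat \<Rightarrow>\<^sub>0 nat)"
  by (auto simp: in_keys_iff lookup_minus)

lemma genideal_mvar_mon:
  assumes f: "f \<in> polys d" "\<forall>e\<in>Poly_Mapping.keys f. \<exists>i\<in>{1..t}. i \<in> Poly_Mapping.keys e" and "t \<le> d"
  shows "f \<in> genideal (poly_ring d W) (mvar ` {1..t})"
proof -
  let ?A = "poly_ring d W" and ?I = "genideal (poly_ring d W) (mvar ` {1..t})"
  interpret cring ?A by (rule cring_poly_ring)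
  have vars: "mvar ` {1..t} \<subseteq> carrier ?A" using mvar_polys[of _ d] assms(3) by force
  interpret I: ideal ?I ?A by (rule genideal_ideal[OF vars])
  have "(\<Sum>e\<in>Poly_Mapping.keys f. Poly_Mapping.single e (Poly_Mapping.lookup f e)) \<in> ?I"
  proof (rule sum_closed_set)
    fix e assume e: "e \<in> Poly_Mapping.keys f"
    then obtain i where i: "i \<in> {1..t}" "i \<in> Poly_Mapping.keys e" using f by auto
    have "Poly_Mapping.keys e \<subseteq> {1..d}" using f e polysD by blast
    then have "Poly_Mapping.single (e - Poly_Mapping.single i 1) (Poly_Mapping.lookup f e) \<in> carrier ?A"
      using keys_minus_nat[of e "Poly_Mapping.single i 1"] by (auto intro!: single_polys)
    moreover have "mvar i \<in> ?I" using genideal_self[OF vars] i(1) by auto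
    ultimately show "Poly_Mapping.single e (Poly_Mapping.lookup f e) \<in> ?I"
      using I.I_r_closed[of "mvar i" "Poly_Mapping.single (e - Poly_Mapping.single i 1) (Poly_Mapping.lookup f e)"]
        single_split[of 1 e i "Poly_Mapping.lookup f e"] i(2) by (simp add: in_keys_iff)
  qed (use I.zero_closed I.a_closed in auto)
  then show ?thesis using poly_mapping_sum_single[of f] by simp
qed

lemma genideal_mvar:
  assumes "t \<le> d"
  shows "genideal (poly_ring d W) (mvar ` {1..t}) = mon_ideal d (\<lambda>e. \<exists>i\<in>{1..t}. i \<in> Poly_Mapping.keys e)"
proof -
  interpret cring "poly_ring d W" by (rule cring_poly_ring)
  have "mvar ` {1..t} \<subseteq> mon_ideal d (\<lambda>e. \<exists>i\<in>{1..t}. i \<in> Poly_Mapping.keys e)"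
    using assms by (auto simp: mon_ideal_def mvar_def intro!: single_polys)
  then have "genideal (poly_ring d W) (mvar ` {1..t}) \<subseteq> mon_ideal d (\<lambda>e. \<exists>i\<in>{1..t}. i \<in> Poly_Mapping.keys e)"
    by (intro genideal_minimal mon_ideal_ideal) (auto simp: keys_add_nat)
  then show ?thesis using genideal_mvar_mon[OF _ _ assms] by (auto simp: mon_ideal_def)
qed

lemma face_ideal_eq:
  "t \<le> d \<Longrightarrow> face_ideal d W t = mon_ideal d (\<lambda>e. \<exists>i\<in>{1..t}. i \<in> Poly_Mapping.keys e)"
  by (simp add: face_ideal_def genideal_mvar)

lemma max_ideal_eq:
  "max_ideal d W = mon_ideal d (\<lambda>e. e \<noteq> 0)"
proof -
  have "(\<exists>i\<in>{1..d}. i \<in> Poly_Mapping.keys e) \<longleftrightarrow> e \<noteq> 0" if "Poly_Mapping.keys e \<subseteq> {1..d}" for e :: "nat \<Rightarrow>\<^sub>0 nat"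
    using that keys_eq_empty[of e] by blast
  then show ?thesis by (auto simp: max_ideal_def genideal_mvar mon_ideal_def dest: polysD)
qed

text \<open>Each term of \<open>f\<close> is a constant times a monomial, and the polynomials that
  kill \<open>x\<close> are closed under sums and constant multiples, so monomials with coefficient
  1 decide.\<close>

lemma smult_zero_from_monomials:
  assumes M: "Module.module (poly_ring d W) M" and x: "x \<in> carrier M" and f: "f \<in> polys d"
    and "\<And>e. e \<in> Poly_Mapping.keys f \<Longrightarrow> Poly_Mapping.single e (1 :: 'k::field) \<odot>\<^bsub>M\<^esub> x = \<zero>\<^bsub>M\<^esub>"
  shows "f \<odot>\<^bsub>M\<^esub> x = \<zero>\<^bsub>M\<^esub>"
proof -
  interpret Module.module "poly_ring d W" M by fact
  let ?T = "{g \<in> polys d. g \<odot>\<^bsub>M\<^esub> x = \<zero>\<^bsub>M\<^esub>}"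
  have "(\<Sum>e\<in>Poly_Mapping.keys f. Poly_Mapping.single e (Poly_Mapping.lookup f e)) \<in> ?T"
  proof (rule sum_closed_set)
    fix e assume e: "e \<in> Poly_Mapping.keys f"
    have c: "Poly_Mapping.single 0 (Poly_Mapping.lookup f e) \<in> carrier (poly_ring d W)" by (auto intro: single_polys)
    have e1: "Poly_Mapping.keys e \<subseteq> {1..d}" using f e by (rule polysD)
    then have "Poly_Mapping.single e (1 :: 'k) \<in> carrier (poly_ring d W)" by (auto intro: single_polys)
    from smult_assoc1[OF c this x]
    show "Poly_Mapping.single e (Poly_Mapping.lookup f e) \<in> ?T" using e1 assms(4)[OF e] c
      by (auto simp: mult_single intro: single_polys)
  next
    fix g h assume "g \<in> ?T" "h \<in> ?T"
    then show "g + h \<in> ?T" using smult_l_distr[of g h x] x polys_add[of g d h] by auto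
  qed (use smult_l_null[OF x] in auto)
  then show ?thesis using poly_mapping_sum_single[of f] by simp
qed

section \<open>Powers of the maximal ideal and torsion\<close>

definition tdeg :: "(nat \<Rightarrow>\<^sub>0 nat) \<Rightarrow> nat" where
  "tdeg e = (\<Sum>i\<in>Poly_Mapping.keys e. Poly_Mapping.lookup e i)"

lemma tdeg_superset: "finite S \<Longrightarrow> Poly_Mapping.keys e \<subseteq> S \<Longrightarrow> tdeg e = (\<Sum>i\<in>S. Poly_Mapping.lookup e i)"
  unfolding tdeg_def by (rule sum.mono_neutral_left) (auto simp: in_keys_iff)

lemma tdeg_add: "tdeg (a + b) = tdeg a + tdeg b"
  using tdeg_superset[of "Poly_Mapping.keys a \<union> Poly_Mapping.keys b" a]
    tdeg_superset[of "Poly_Mapping.keys a \<union> Poly_Mapping.keys b" b]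
    tdeg_superset[of "Poly_Mapping.keys a \<union> Poly_Mapping.keys b" "a + b"]
  by (simp add: keys_add_nat lookup_add sum.distrib)

lemma ideal_pow_max_subset:
  "ideal_pow (poly_ring d W) (max_ideal d W) n \<subseteq> (mon_ideal d (\<lambda>e. n \<le> tdeg e) :: 'k::field mpoly set)"
proof (induction n)
  case 0
  then show ?case by (auto simp: mon_ideal_def)
next
  case (Suc n)
  have "f \<in> mon_ideal d (\<lambda>e. Suc n \<le> tdeg e)"
    if "f \<in> ideal_prod (poly_ring d W) (max_ideal d W) (ideal_pow (poly_ring d W) (max_ideal d W) n)" for f :: "'k mpoly"
    using that
  proof (induction f rule: ideal_prod.induct)
    case (prod i j)
    have 1: "1 \<le> tdeg a" if "a \<noteq> 0" for a :: "nat \<Rightarrow>\<^sub>0 nat"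
    proof -
      obtain i where "i \<in> Poly_Mapping.keys a" using \<open>a \<noteq> 0\<close> keys_eq_empty[of a] by blast
      then show ?thesis unfolding tdeg_def
        using sum_mono2[of "Poly_Mapping.keys a" "{i}" "Poly_Mapping.lookup a"] by (auto simp: in_keys_iff)
    qed
    have i: "i \<in> mon_ideal d (\<lambda>e. e \<noteq> 0)" and j: "j \<in> mon_ideal d (\<lambda>e. n \<le> tdeg e)"
      using prod Suc max_ideal_eq by blast+
    have "Suc n \<le> tdeg e" if "e \<in> Poly_Mapping.keys (i * j)" for e
      using that 1 i j unfolding mon_ideal_def
      by (elim poly_mult_keysE) (fastforce simp: tdeg_add)
    then show ?case using i j polys_mult[of i d j] by (auto simp: mon_ideal_def)
  next
    case (sum s1 s2)
    then show ?case using polys_add[of s1 d s2] by (auto simp: mon_ideal_def dest: poly_add_keysE)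
  qed
  then show ?case by auto
qed

lemma single_nat_neq_0: "Poly_Mapping.single i (1 :: nat) \<noteq> 0"
  by (metis lookup_single_eq lookup_zero zero_neq_one)

lemma mvar_power_ideal_pow:
  "i \<in> {1..d} \<Longrightarrow> mvar i ^ n \<in> ideal_pow (poly_ring d W) (max_ideal d W) n"
proof (induction n)
  case (Suc n)
  have "mvar i \<in> max_ideal d W" using Suc mvar_polys[of i d] single_nat_neq_0[of i]
    by (auto simp: max_ideal_eq mon_ideal_def mvar_def)
  then show ?case using ideal_prod.prod[of "mvar i" _ "mvar i ^ n" _ "poly_ring d W"] Suc by auto
qed auto

text \<open>Pigeonhole: when the total degree of a monomial exceeds the sum of the exponents
  \<open>n i\<close>, some variable occurs at least \<open>n i\<close> times. This trades powers of
  the ideal for one condition per variable, and these can be imposed successively.\<close>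

lemma torsion_max_iff:
  assumes M: "Module.module (poly_ring d W) M" and x: "x \<in> carrier M"
  shows "(\<exists>n. \<forall>a\<in>ideal_pow (poly_ring d W) (max_ideal d W) n. a \<odot>\<^bsub>M\<^esub> x = \<zero>\<^bsub>M\<^esub>) \<longleftrightarrow>
    (\<forall>i\<in>{1..d}. \<exists>n. (mvar i :: 'k::field mpoly) ^ n \<odot>\<^bsub>M\<^esub> x = \<zero>\<^bsub>M\<^esub>)"
proof
  assume "\<exists>n. \<forall>a\<in>ideal_pow (poly_ring d W) (max_ideal d W) n. a \<odot>\<^bsub>M\<^esub> x = \<zero>\<^bsub>M\<^esub>"
  then show "\<forall>i\<in>{1..d}. \<exists>n. (mvar i :: 'k mpoly) ^ n \<odot>\<^bsub>M\<^esub> x = \<zero>\<^bsub>M\<^esub>"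
    using mvar_power_ideal_pow[of _ d] by blast
next
  interpret Module.module "poly_ring d W" M by fact
  assume "\<forall>i\<in>{1..d}. \<exists>n. (mvar i :: 'k mpoly) ^ n \<odot>\<^bsub>M\<^esub> x = \<zero>\<^bsub>M\<^esub>"
  then obtain n where n: "\<forall>i\<in>{1..d}. (mvar i :: 'k mpoly) ^ n i \<odot>\<^bsub>M\<^esub> x = \<zero>\<^bsub>M\<^esub>" by metis
  define N where "N = Suc (\<Sum>i\<in>{1..d}. n i)"
  have "f \<odot>\<^bsub>M\<^esub> x = \<zero>\<^bsub>M\<^esub>" if f: "f \<in> mon_ideal d (\<lambda>e. N \<le> tdeg e)" for f
  proof (rule smult_zero_from_monomials[OF M x])
    show "f \<in> polys d" using f by (auto simp: mon_ideal_def)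
    fix e assume e: "e \<in> Poly_Mapping.keys f"
    then have k: "Poly_Mapping.keys e \<subseteq> {1..d}" and "N \<le> tdeg e" using f by (auto simp: mon_ideal_def dest: polysD)
    then have "(\<Sum>i\<in>{1..d}. n i) < (\<Sum>i\<in>{1..d}. Poly_Mapping.lookup e i)"
      using tdeg_superset[of "{1..d}" e] by (simp add: N_def)
    then have "\<not> (\<forall>i\<in>{1..d}. Poly_Mapping.lookup e i \<le> n i)"
      using sum_mono[of "{1..d}" "Poly_Mapping.lookup e" n] by force
    then obtain i where i: "i \<in> {1..d}" "n i \<le> Poly_Mapping.lookup e i" by (auto simp: not_le)
    let ?r = "Poly_Mapping.single (e - Poly_Mapping.single i (n i)) (1 :: 'k)"
    have r: "?r \<in> carrier (poly_ring d W)"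
      using k keys_minus_nat[of e "Poly_Mapping.single i (n i)"] by (auto intro!: single_polys)
    have m: "mvar i ^ n i \<in> carrier (poly_ring d W)" using mvar_power_polys[OF i(1)] by simp
    have "Poly_Mapping.single e (1 :: 'k) = ?r * mvar i ^ n i"
      using single_split[OF i(2), of "1 :: 'k"] by (simp add: mult.commute)
    then show "Poly_Mapping.single e (1 :: 'k) \<odot>\<^bsub>M\<^esub> x = \<zero>\<^bsub>M\<^esub>"
      using smult_assoc1[OF r m x] n i(1) smult_r_null[OF r] by simp
  qed
  then show "\<exists>n. \<forall>a\<in>ideal_pow (poly_ring d W) (max_ideal d W) n. a \<odot>\<^bsub>M\<^esub> x = \<zero>\<^bsub>M\<^esub>"
    using ideal_pow_max_subset[of d W N] by blast
qed

section \<open>Homomorphisms and homogeneous components\<close>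

lemma mod_homD:
  assumes "f \<in> mod_hom R M N"
  shows "x \<in> carrier M \<Longrightarrow> f x \<in> carrier N"
    "x \<in> carrier M \<Longrightarrow> y \<in> carrier M \<Longrightarrow> f (x \<oplus>\<^bsub>M\<^esub> y) = f x \<oplus>\<^bsub>N\<^esub> f y"
    "a \<in> carrier R \<Longrightarrow> x \<in> carrier M \<Longrightarrow> f (a \<odot>\<^bsub>M\<^esub> x) = a \<odot>\<^bsub>N\<^esub> f x"
  using assms by (auto simp: mod_hom_def)

lemma mod_hom_zero:
  assumes "Module.module R M" "Module.module R N" "f \<in> mod_hom R M N"
  shows "f \<zero>\<^bsub>M\<^esub> = \<zero>\<^bsub>N\<^esub>"
proof -
  interpret M: Module.module R M by fact
  interpret N: Module.module R N by fact
  show ?thesis using mod_homD(2)[OF assms(3) M.M.zero_closed M.M.zero_closed] mod_homD(1)[OF assms(3) M.M.zero_closed]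
    by (metis M.M.l_zero M.M.zero_closed N.M.add.r_cancel_one')
qed

lemma mod_hom_diff:
  assumes "Module.module R M" "Module.module R N" "f \<in> mod_hom R M N" "x \<in> carrier M" "y \<in> carrier M"
  shows "f (x \<ominus>\<^bsub>M\<^esub> y) = f x \<ominus>\<^bsub>N\<^esub> f y"
proof -
  interpret M: Module.module R M by fact
  interpret N: Module.module R N by fact
  note D = mod_homD[OF assms(3)]
  have "f (\<ominus>\<^bsub>M\<^esub> y) \<oplus>\<^bsub>N\<^esub> f y = \<zero>\<^bsub>N\<^esub>"
    using D(2)[of "\<ominus>\<^bsub>M\<^esub> y" y] assms mod_hom_zero[OF assms(1-3)] by (simp add: M.M.l_neg)
  then have "f (\<ominus>\<^bsub>M\<^esub> y) = \<ominus>\<^bsub>N\<^esub> f y"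
    using D(1) assms by (metis M.M.a_inv_closed N.M.minus_equality)
  then show ?thesis using D(2)[of x "\<ominus>\<^bsub>M\<^esub> y"] assms by (simp add: a_minus_def)
qed

lemma gr_homD:
  assumes "f \<in> gr_hom R M N s"
  shows "f \<in> mod_hom R M N" "x \<in> hcomp M g \<Longrightarrow> f x \<in> hcomp N (g + s)"
  using assms by (auto simp: gr_hom_def)

lemma gr_hom_hc:
  assumes "graded_module R M" "graded_module R N" "f \<in> gr_hom R M N s" "x \<in> carrier M"
  shows "hc N (f x) (g + s) = f (hc M x g)"
  using mod_homD[OF gr_homD(1)[OF assms(3)]] gr_homD(2)[OF assms(3)]
  by (intro hc_map[OF assms(1,2) _ _ _ assms(4)]) auto

lemma (in Module.module) smult_diff:
  "a \<in> carrier R \<Longrightarrow> x \<in> carrier M \<Longrightarrow> y \<in> carrier M \<Longrightarrow>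
    a \<odot>\<^bsub>M\<^esub> (x \<ominus>\<^bsub>M\<^esub> y) = a \<odot>\<^bsub>M\<^esub> x \<ominus>\<^bsub>M\<^esub> a \<odot>\<^bsub>M\<^esub> y"
  by (simp add: a_minus_def smult_r_distr smult_r_minus)

lemma (in abelian_group) diff_add: "x \<in> carrier G \<Longrightarrow> y \<in> carrier G \<Longrightarrow> (x \<ominus> y) \<oplus> y = x"
  by (simp add: a_minus_def a_assoc l_neg)

lemma (in abelian_group) diff_zero: "x \<in> carrier G \<Longrightarrow> x \<ominus> \<zero> = x"
  by (simp add: a_minus_def a_inv_def)

lemma (in abelian_group) diff_eq_zero_iff: "x \<in> carrier G \<Longrightarrow> y \<in> carrier G \<Longrightarrow> x \<ominus> y = \<zero> \<longleftrightarrow> x = y"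
  by (metis a_minus_def diff_add l_zero r_neg)

lemma poly_module:
  assumes "Module.module (poly_ring d W) M"
  shows "f \<in> polys d \<Longrightarrow> x \<in> carrier M \<Longrightarrow> f \<odot>\<^bsub>M\<^esub> x \<in> carrier M"
    "f \<in> polys d \<Longrightarrow> g \<in> polys d \<Longrightarrow> x \<in> carrier M \<Longrightarrow> (f + g) \<odot>\<^bsub>M\<^esub> x = f \<odot>\<^bsub>M\<^esub> x \<oplus>\<^bsub>M\<^esub> g \<odot>\<^bsub>M\<^esub> x"
    "f \<in> polys d \<Longrightarrow> x \<in> carrier M \<Longrightarrow> y \<in> carrier M \<Longrightarrow> f \<odot>\<^bsub>M\<^esub> (x \<oplus>\<^bsub>M\<^esub> y) = f \<odot>\<^bsub>M\<^esub> x \<oplus>\<^bsub>M\<^esub> f \<odot>\<^bsub>M\<^esub> y"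
    "f \<in> polys d \<Longrightarrow> g \<in> polys d \<Longrightarrow> x \<in> carrier M \<Longrightarrow> (f * g) \<odot>\<^bsub>M\<^esub> x = f \<odot>\<^bsub>M\<^esub> (g \<odot>\<^bsub>M\<^esub> x)"
    "x \<in> carrier M \<Longrightarrow> 1 \<odot>\<^bsub>M\<^esub> x = x"
    "x \<in> carrier M \<Longrightarrow> 0 \<odot>\<^bsub>M\<^esub> x = \<zero>\<^bsub>M\<^esub>"
    "f \<in> polys d \<Longrightarrow> f \<odot>\<^bsub>M\<^esub> \<zero>\<^bsub>M\<^esub> = \<zero>\<^bsub>M\<^esub>"
    "f \<in> polys d \<Longrightarrow> x \<in> carrier M \<Longrightarrow> y \<in> carrier M \<Longrightarrow> f \<odot>\<^bsub>M\<^esub> (x \<ominus>\<^bsub>M\<^esub> y) = f \<odot>\<^bsub>M\<^esub> x \<ominus>\<^bsub>M\<^esub> f \<odot>\<^bsub>M\<^esub> y"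
proof -
  interpret Module.module "poly_ring d W" M by fact
  show "f \<in> polys d \<Longrightarrow> x \<in> carrier M \<Longrightarrow> f \<odot>\<^bsub>M\<^esub> x \<in> carrier M"
    "f \<in> polys d \<Longrightarrow> g \<in> polys d \<Longrightarrow> x \<in> carrier M \<Longrightarrow> (f + g) \<odot>\<^bsub>M\<^esub> x = f \<odot>\<^bsub>M\<^esub> x \<oplus>\<^bsub>M\<^esub> g \<odot>\<^bsub>M\<^esub> x"
    "f \<in> polys d \<Longrightarrow> x \<in> carrier M \<Longrightarrow> y \<in> carrier M \<Longrightarrow> f \<odot>\<^bsub>M\<^esub> (x \<oplus>\<^bsub>M\<^esub> y) = f \<odot>\<^bsub>M\<^esub> x \<oplus>\<^bsub>M\<^esub> f \<odot>\<^bsub>M\<^esub> y"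
    "f \<in> polys d \<Longrightarrow> g \<in> polys d \<Longrightarrow> x \<in> carrier M \<Longrightarrow> (f * g) \<odot>\<^bsub>M\<^esub> x = f \<odot>\<^bsub>M\<^esub> (g \<odot>\<^bsub>M\<^esub> x)"
    "x \<in> carrier M \<Longrightarrow> 1 \<odot>\<^bsub>M\<^esub> x = x"
    "x \<in> carrier M \<Longrightarrow> 0 \<odot>\<^bsub>M\<^esub> x = \<zero>\<^bsub>M\<^esub>"
    "f \<in> polys d \<Longrightarrow> f \<odot>\<^bsub>M\<^esub> \<zero>\<^bsub>M\<^esub> = \<zero>\<^bsub>M\<^esub>"
    "f \<in> polys d \<Longrightarrow> x \<in> carrier M \<Longrightarrow> y \<in> carrier M \<Longrightarrow> f \<odot>\<^bsub>M\<^esub> (x \<ominus>\<^bsub>M\<^esub> y) = f \<odot>\<^bsub>M\<^esub> x \<ominus>\<^bsub>M\<^esub> f \<odot>\<^bsub>M\<^esub> y"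
    using smult_closed[of f x] smult_l_distr[of f g x] smult_r_distr[of f x y] smult_assoc1[of f g x] smult_one[of x]
      smult_l_null[of x] smult_r_null[of f] smult_diff[of f x y] by simp_all
qed

section \<open>Iterated torsion of a divisible complex\<close>

text \<open>The Laurent monomials with exponent in \<open>Lam T U\<close> form a basis of the local cohomology of
  \<open>K[x\<^sub>i | i \<in> T \<union> U]\<close> with support in \<open>(x\<^sub>i | i \<in> T)\<close>. An element is encoded by its coefficient
  function, with \<open>act\<close> cutting off the products that leave \<open>Lam T U\<close>.\<close>

definition Lam :: "nat set \<Rightarrow> nat set \<Rightarrow> (nat \<Rightarrow> int) set" where
  "Lam T U = {a. (\<forall>i\<in>T. a i < 0) \<and> (\<forall>i\<in>U. 0 \<le> a i) \<and> (\<forall>i. i \<notin> T \<union> U \<longrightarrow> a i = 0)}"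

definition xsub :: "(nat \<Rightarrow> int) \<Rightarrow> (nat \<Rightarrow>\<^sub>0 nat) \<Rightarrow> nat \<Rightarrow> int" where
  "xsub a b = (\<lambda>i. a i - int (Poly_Mapping.lookup b i))"

definition fns :: "(nat \<Rightarrow> int) set \<Rightarrow> ((nat \<Rightarrow> int) \<Rightarrow> 'k::field) set" where
  "fns L = {\<phi>. finite {a. \<phi> a \<noteq> 0} \<and> (\<forall>a. \<phi> a \<noteq> 0 \<longrightarrow> a \<in> L)}"

definition act :: "(nat \<Rightarrow> int) set \<Rightarrow> 'k::field mpoly \<Rightarrow> ((nat \<Rightarrow> int) \<Rightarrow> 'k) \<Rightarrow> ((nat \<Rightarrow> int) \<Rightarrow> 'k)" where
  "act L f \<phi> = (\<lambda>a. if a \<in> L then \<Sum>b\<in>Poly_Mapping.keys f. Poly_Mapping.lookup f b * \<phi> (xsub a b) else 0)"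

definition zdeg :: "nat \<Rightarrow> (nat \<Rightarrow> int ^ 'm) \<Rightarrow> (nat \<Rightarrow> int) \<Rightarrow> int ^ 'm" where
  "zdeg d W a = (\<Sum>i\<in>{1..d}. a i *s W i)"

lemma fns_outside: "\<phi> \<in> fns L \<Longrightarrow> a \<notin> L \<Longrightarrow> \<phi> a = 0"
  by (auto simp: fns_def)

lemma act_superset:
  "finite S \<Longrightarrow> Poly_Mapping.keys f \<subseteq> S \<Longrightarrow>
    act L f \<phi> a = (if a \<in> L then \<Sum>b\<in>S. Poly_Mapping.lookup f b * \<phi> (xsub a b) else 0)"
  unfolding act_def by (auto intro!: sum.mono_neutral_left simp: in_keys_iff)

lemma act_add_left: "act L (f + g) \<phi> = (\<lambda>a. act L f \<phi> a + act L g \<phi> a)"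
proof
  fix a
  let ?S = "Poly_Mapping.keys f \<union> Poly_Mapping.keys g"
  have "Poly_Mapping.keys (f + g) \<subseteq> ?S" by (auto dest: poly_add_keysE)
  then show "act L (f + g) \<phi> a = act L f \<phi> a + act L g \<phi> a"
    using act_superset[of ?S f L \<phi> a] act_superset[of ?S g L \<phi> a] act_superset[of ?S "f + g" L \<phi> a]
    by (simp add: lookup_add distrib_right sum.distrib)
qed

lemma act_zero_left: "act L 0 \<phi> = (\<lambda>_. 0)"
  by (simp add: act_def fun_eq_iff)

lemma act_add_right: "act L f (\<lambda>a. \<phi> a + \<psi> a) = (\<lambda>a. act L f \<phi> a + act L f \<psi> a)"
  by (auto simp: act_def distrib_left sum.distrib)

lemma act_single: "act L (Poly_Mapping.single b c) \<phi> a = (if a \<in> L then c * \<phi> (xsub a b) else 0)"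
  by (auto simp: act_def)

lemma act_mvar_power: "act L (mvar k ^ n) \<phi> a = (if a \<in> L then \<phi> (a(k := a k - int n)) else 0)"
proof -
  have "xsub a (Poly_Mapping.single k n) = a(k := a k - int n)"
    by (auto simp: xsub_def lookup_single when_def)
  then show ?thesis by (simp add: mvar_power act_single)
qed

text \<open>Subtracting exponents can leave \<open>Lam T U\<close> only through a coordinate outside
  \<open>T\<close> that becomes negative, and it stays negative under further subtraction. Hence
  cutting off after each factor or once at the end gives the same product.\<close>

lemma xsub_Lam: "a \<in> Lam T U \<Longrightarrow> xsub a b \<notin> Lam T U \<Longrightarrow> xsub (xsub a b) b' \<notin> Lam T U"
  unfolding Lam_def xsub_def by force

lemma xsub_add: "xsub a (b + b') = xsub (xsub a b) b'"
  by (auto simp: xsub_def lookup_add)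

lemma act_sum_left: "act L (sum u S) \<phi> = (\<lambda>a. \<Sum>s\<in>S. act L (u s) \<phi> a)"
  by (induction S rule: infinite_finite_induct) (auto simp: act_zero_left act_add_left)

lemma act_sum_right: "act L f (\<lambda>a. \<Sum>s\<in>S. \<phi> s a) = (\<lambda>a. \<Sum>s\<in>S. act L f (\<phi> s) a)"
  by (induction S rule: infinite_finite_induct) (auto simp: act_add_right, auto simp: act_def)

text \<open>By bilinearity a pair of terms suffices, and for terms the cut-off between the two
  factors loses nothing by \<open>xsub_Lam\<close>.\<close>

lemma act_mult:
  assumes "\<phi> \<in> fns (Lam T U)"
  shows "act (Lam T U) (f * g) \<phi> = act (Lam T U) f (act (Lam T U) g \<phi>)"
proof -
  let ?L = "Lam T U"
  let ?f = "\<lambda>e. Poly_Mapping.single e (Poly_Mapping.lookup f e)" and ?g = "\<lambda>e. Poly_Mapping.single e (Poly_Mapping.lookup g e)"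
  have *: "act ?L (?f a * ?g b) \<phi> = act ?L (?f a) (act ?L (?g b) \<phi>)" for a b
    using xsub_Lam[of _ T U a b] fns_outside[OF assms]
    by (auto simp: mult_single act_single xsub_add fun_eq_iff mult.assoc)
  have f: "f = (\<Sum>e\<in>Poly_Mapping.keys f. ?f e)" and g: "g = (\<Sum>e\<in>Poly_Mapping.keys g. ?g e)"
    by (rule poly_mapping_sum_single)+
  have "f * g = (\<Sum>a\<in>Poly_Mapping.keys f. \<Sum>b\<in>Poly_Mapping.keys g. ?f a * ?g b)"
    by (subst f, subst g) (simp add: sum_product)
  then have "act ?L (f * g) \<phi> = (\<lambda>x. \<Sum>a\<in>Poly_Mapping.keys f. \<Sum>b\<in>Poly_Mapping.keys g. act ?L (?f a) (act ?L (?g b) \<phi>) x)"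
    by (simp add: act_sum_left *)
  moreover have "act ?L f (act ?L g \<phi>) = (\<lambda>x. \<Sum>a\<in>Poly_Mapping.keys f. \<Sum>b\<in>Poly_Mapping.keys g. act ?L (?f a) (act ?L (?g b) \<phi>) x)"
    by (subst f, subst g) (simp add: act_sum_left act_sum_right, rule ext, rule sum.swap)
  ultimately show ?thesis by simp
qed

lemma act_fns:
  assumes "\<phi> \<in> fns L"
  shows "act L f \<phi> \<in> fns L"
proof -
  have "{a. act L f \<phi> a \<noteq> 0} \<subseteq> (\<Union>b\<in>Poly_Mapping.keys f. (\<lambda>a i. a i + int (Poly_Mapping.lookup b i)) ` {a. \<phi> a \<noteq> 0})"
  proof
    fix a assume "a \<in> {a. act L f \<phi> a \<noteq> 0}"
    then have "(\<Sum>b\<in>Poly_Mapping.keys f. Poly_Mapping.lookup f b * \<phi> (xsub a b)) \<noteq> 0"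
      by (auto simp: act_def split: if_splits)
    then obtain b where b: "b \<in> Poly_Mapping.keys f" "\<phi> (xsub a b) \<noteq> 0"
      by (metis (no_types, lifting) mult_zero_right sum.neutral)
    moreover have "a = (\<lambda>i. xsub a b i + int (Poly_Mapping.lookup b i))" by (auto simp: xsub_def)
    ultimately show "a \<in> (\<Union>b\<in>Poly_Mapping.keys f. (\<lambda>a i. a i + int (Poly_Mapping.lookup b i)) ` {a. \<phi> a \<noteq> 0})"
      by blast
  qed
  moreover have "finite (\<Union>b\<in>Poly_Mapping.keys f. (\<lambda>a i. a i + int (Poly_Mapping.lookup b i)) ` {a. \<phi> a \<noteq> 0})"
    using assms by (auto simp: fns_def)
  ultimately show ?thesis by (auto simp: fns_def finite_subset act_def)
qed

lemma zdeg_shift: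
  assumes "k \<in> {1..d}"
  shows "zdeg d W (a(k := a k + n)) = zdeg d W a + n *s W k"
proof -
  have "zdeg d W (a(k := a k + n)) = (\<Sum>i\<in>{1..d}. a i *s W i + (if i = k then n *s W k else 0))"
    unfolding zdeg_def by (intro sum.cong) (auto simp: vec.scale_left_distrib)
  then show ?thesis using assms by (simp add: sum.distrib zdeg_def)
qed

text \<open>What is retained of an injective resolution. Injectivity survives as
  \<open>divisible\<close>; exactness enters later, through the case of no torsion condition. The
  exponents that kill \<open>e'\<close> may differ from those that kill \<open>e\<close>.\<close>

locale div_complex =
  fixes d :: nat and W :: "nat \<Rightarrow> int ^ 'm" and C :: "nat \<Rightarrow> ('k::field mpoly, 'i, int ^ 'm) gmod" and \<delta>
  assumes gm: "graded_module (poly_ring d W) (C j)"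
    and hom: "\<delta> j \<in> gr_hom (poly_ring d W) (C j) (C (Suc j)) 0"
    and dd: "x \<in> carrier (C j) \<Longrightarrow> \<delta> (Suc j) (\<delta> j x) = \<zero>\<^bsub>C (Suc (Suc j))\<^esub>"
    and divisible: "S \<subseteq> {1..d} \<Longrightarrow> k \<in> {1..d} \<Longrightarrow> k \<notin> S \<Longrightarrow> e \<in> carrier (C j) \<Longrightarrow>
       (\<forall>i\<in>S. \<exists>n. mvar i ^ n \<odot>\<^bsub>C j\<^esub> e = \<zero>\<^bsub>C j\<^esub>) \<Longrightarrow>
       \<exists>e'\<in>carrier (C j). (\<forall>i\<in>S. \<exists>n. mvar i ^ n \<odot>\<^bsub>C j\<^esub> e' = \<zero>\<^bsub>C j\<^esub>) \<and> mvar k \<odot>\<^bsub>C j\<^esub> e' = e"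
begin

sublocale C: graded_module "poly_ring d W" "C j" for j by (rule gm)

lemmas cm = poly_module[OF C.module_axioms]

lemma pw: "i \<in> {1..d} \<Longrightarrow> (mvar i ^ n :: 'k mpoly) \<in> polys d"
  by (rule mvar_power_polys)

lemmas dl = mod_homD[OF gr_homD(1)[OF hom], simplified]
lemmas dl_zero = mod_hom_zero[OF C.module_axioms C.module_axioms gr_homD(1)[OF hom]]
lemmas dl_diff = mod_hom_diff[OF C.module_axioms C.module_axioms gr_homD(1)[OF hom]]

text \<open>\<open>G S\<close> is the subcomplex of the elements that are torsion with respect to \<open>x\<^sub>i\<close> for all \<open>i \<in> S\<close>;
  \<open>Zc S\<close> and \<open>B S\<close> are its cocycles and coboundaries.\<close>

definition G :: "nat set \<Rightarrow> nat \<Rightarrow> 'i set" where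
  "G S j = {e \<in> carrier (C j). \<forall>i\<in>S. \<exists>n. mvar i ^ n \<odot>\<^bsub>C j\<^esub> e = \<zero>\<^bsub>C j\<^esub>}"

definition Zc :: "nat set \<Rightarrow> nat \<Rightarrow> 'i set" where
  "Zc S j = {e \<in> G S j. \<delta> j e = \<zero>\<^bsub>C (Suc j)\<^esub>}"

definition B :: "nat set \<Rightarrow> nat \<Rightarrow> 'i set" where
  "B S j = (case j of 0 \<Rightarrow> {\<zero>\<^bsub>C 0\<^esub>} | Suc i \<Rightarrow> \<delta> i ` G S i)"

lemma G_carrier: "e \<in> G S j \<Longrightarrow> e \<in> carrier (C j)"
  by (simp add: G_def)

lemma power_add: "k \<in> {1..d} \<Longrightarrow> x \<in> carrier (C j) \<Longrightarrow>
    mvar k ^ (n + m) \<odot>\<^bsub>C j\<^esub> x = mvar k ^ n \<odot>\<^bsub>C j\<^esub> (mvar k ^ m \<odot>\<^bsub>C j\<^esub> x)"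
  by (simp add: Power.power_add cm(4) pw)

lemma power_kill: "k \<in> {1..d} \<Longrightarrow> x \<in> carrier (C j) \<Longrightarrow> mvar k ^ n \<odot>\<^bsub>C j\<^esub> x = \<zero>\<^bsub>C j\<^esub> \<Longrightarrow> n \<le> m \<Longrightarrow>
    mvar k ^ m \<odot>\<^bsub>C j\<^esub> x = \<zero>\<^bsub>C j\<^esub>"
  using power_add[of k x j "m - n" n] by (simp add: cm(7) pw)

lemma smult_commute: "f \<in> polys d \<Longrightarrow> g \<in> polys d \<Longrightarrow> x \<in> carrier (C j) \<Longrightarrow>
    f \<odot>\<^bsub>C j\<^esub> (g \<odot>\<^bsub>C j\<^esub> x) = g \<odot>\<^bsub>C j\<^esub> (f \<odot>\<^bsub>C j\<^esub> x)"
  by (metis cm(4) mult.commute)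

lemma G_gsubmodule:
  assumes "S \<subseteq> {1..d}"
  shows "gsubmodule (poly_ring d W) (C j) (G S j)"
  unfolding gsubmodule_def
proof (intro conjI ballI subsetI)
  fix x y assume x: "x \<in> G S j" and y: "y \<in> G S j"
  then have c: "x \<in> carrier (C j)" "y \<in> carrier (C j)" by (auto simp: G_def)
  have "\<exists>n. mvar i ^ n \<odot>\<^bsub>C j\<^esub> (x \<oplus>\<^bsub>C j\<^esub> y) = \<zero>\<^bsub>C j\<^esub>" if i: "i \<in> S" for i
  proof -
    obtain n where n: "mvar i ^ n \<odot>\<^bsub>C j\<^esub> x = \<zero>\<^bsub>C j\<^esub>" using x i by (auto simp: G_def)
    obtain m where "mvar i ^ m \<odot>\<^bsub>C j\<^esub> y = \<zero>\<^bsub>C j\<^esub>" using y i by (auto simp: G_def)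
    with n have "mvar i ^ (n + m) \<odot>\<^bsub>C j\<^esub> x = \<zero>\<^bsub>C j\<^esub>" "mvar i ^ (n + m) \<odot>\<^bsub>C j\<^esub> y = \<zero>\<^bsub>C j\<^esub>"
      using power_kill[OF subsetD[OF assms i] c(1), of n "n + m"] power_kill[OF subsetD[OF assms i] c(2), of m "n + m"]
      by simp_all
    then show ?thesis using cm(3)[of "mvar i ^ (n + m)" x j y] c pw[OF subsetD[OF assms i]] by (intro exI[of _ "n + m"]) simp
  qed
  then show "x \<oplus>\<^bsub>C j\<^esub> y \<in> G S j" using c by (auto simp: G_def)
next
  fix a :: "'k mpoly" and x assume a: "a \<in> carrier (poly_ring d W)" and x: "x \<in> G S j"
  have "\<exists>n. mvar i ^ n \<odot>\<^bsub>C j\<^esub> (a \<odot>\<^bsub>C j\<^esub> x) = \<zero>\<^bsub>C j\<^esub>" if i: "i \<in> S" for i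
  proof -
    obtain n where "mvar i ^ n \<odot>\<^bsub>C j\<^esub> x = \<zero>\<^bsub>C j\<^esub>" using x i by (auto simp: G_def)
    then show ?thesis using smult_commute[of "mvar i ^ n" a x j] pw[OF subsetD[OF assms i]] a x cm(7)
      by (intro exI[of _ n]) (auto simp: G_def)
  qed
  then show "a \<odot>\<^bsub>C j\<^esub> x \<in> G S j" using a x by (auto simp: G_def)
qed (use assms cm(7) pw in \<open>auto simp: G_def\<close>)

lemma G_closed:
  assumes "S \<subseteq> {1..d}"
  shows "\<zero>\<^bsub>C j\<^esub> \<in> G S j" "x \<in> G S j \<Longrightarrow> y \<in> G S j \<Longrightarrow> x \<oplus>\<^bsub>C j\<^esub> y \<in> G S j"
    "x \<in> G S j \<Longrightarrow> y \<in> G S j \<Longrightarrow> x \<ominus>\<^bsub>C j\<^esub> y \<in> G S j"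
    "f \<in> polys d \<Longrightarrow> x \<in> G S j \<Longrightarrow> f \<odot>\<^bsub>C j\<^esub> x \<in> G S j"
  using G_gsubmodule[OF assms, of j] gsubmodule_diff[OF C.module_axioms G_gsubmodule[OF assms, of j]]
  by (auto simp: gsubmodule_def)

lemma G_hc:
  assumes "S \<subseteq> {1..d}" "x \<in> G S j"
  shows "hc (C j) x g \<in> G S j"
proof -
  have x: "x \<in> carrier (C j)" using assms by (auto simp: G_def)
  have "\<exists>n. mvar i ^ n \<odot>\<^bsub>C j\<^esub> hc (C j) x g = \<zero>\<^bsub>C j\<^esub>" if i: "i \<in> S" for i
  proof -
    obtain n where n: "mvar i ^ n \<odot>\<^bsub>C j\<^esub> x = \<zero>\<^bsub>C j\<^esub>" using assms i by (auto simp: G_def)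
    have i: "i \<in> {1..d}" using i assms by auto
    have "mvar i ^ n \<odot>\<^bsub>C j\<^esub> hc (C j) x g = hc (C j) (mvar i ^ n \<odot>\<^bsub>C j\<^esub> x) (g + int n *s W i)"
      by (rule hc_smult[OF gm mvar_power_hcomp[OF i] _ x, symmetric]) (simp add: pw[OF i])
    then show ?thesis using n hc_zero[OF gm] by auto
  qed
  then show ?thesis using C.hc_carrier[OF x] by (auto simp: G_def)
qed

lemma dl_G: "S \<subseteq> {1..d} \<Longrightarrow> x \<in> G S j \<Longrightarrow> \<delta> j x \<in> G S (Suc j)"
proof -
  assume S: "S \<subseteq> {1..d}" and x: "x \<in> G S j"
  have "\<exists>n. mvar i ^ n \<odot>\<^bsub>C (Suc j)\<^esub> \<delta> j x = \<zero>\<^bsub>C (Suc j)\<^esub>" if i: "i \<in> S" for i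
  proof -
    obtain n where n: "mvar i ^ n \<odot>\<^bsub>C j\<^esub> x = \<zero>\<^bsub>C j\<^esub>" using x i by (auto simp: G_def)
    then show ?thesis using dl(3)[of "mvar i ^ n" x j] S x dl_zero pw[OF subsetD[OF S i], of n]
      by (intro exI[of _ n]) (auto simp: G_def)
  qed
  then show ?thesis using x dl(1) by (auto simp: G_def)
qed

lemma G_divisible:
  assumes "S \<subseteq> {1..d}" "k \<in> {1..d}" "k \<notin> S" "e \<in> G S j"
  shows "\<exists>e'\<in>G S j. mvar k ^ n \<odot>\<^bsub>C j\<^esub> e' = e"
proof (induction n)
  case 0
  then show ?case using assms(4) by (intro bexI[of _ e]) (auto simp: cm(5) G_def)
next
  case (Suc n)
  then obtain e' where e': "e' \<in> G S j" "mvar k ^ n \<odot>\<^bsub>C j\<^esub> e' = e" by blast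
  then obtain e'' where "e'' \<in> G S j" "mvar k \<odot>\<^bsub>C j\<^esub> e'' = e'"
    using divisible[OF assms(1-3), of e' j] by (auto simp: G_def)
  then show ?case using e' cm(4)[of "mvar k ^ n" "mvar k" e'' j] pw[OF assms(2)] pw[OF assms(2), of 1]
    by (intro bexI[of _ e'']) (auto simp: G_carrier mult.commute)
qed

lemma B_sub_Zc: "S \<subseteq> {1..d} \<Longrightarrow> B S j \<subseteq> Zc S j"
  using G_closed[of S] dl_G[of S] dl_zero dd by (cases j) (auto simp: B_def Zc_def G_carrier)

lemma Zc_closed:
  assumes "S \<subseteq> {1..d}"
  shows "\<zero>\<^bsub>C j\<^esub> \<in> Zc S j" "x \<in> Zc S j \<Longrightarrow> y \<in> Zc S j \<Longrightarrow> x \<oplus>\<^bsub>C j\<^esub> y \<in> Zc S j"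
    "x \<in> Zc S j \<Longrightarrow> y \<in> Zc S j \<Longrightarrow> x \<ominus>\<^bsub>C j\<^esub> y \<in> Zc S j"
    "f \<in> polys d \<Longrightarrow> x \<in> Zc S j \<Longrightarrow> f \<odot>\<^bsub>C j\<^esub> x \<in> Zc S j"
  using G_closed[OF assms] dl_zero dl dl_diff cm(7) by (auto simp: Zc_def G_carrier C.M.diff_zero)

section \<open>Adding one variable to the torsion condition\<close>

lemma G_insertI: "x \<in> G S j \<Longrightarrow> mvar k ^ n \<odot>\<^bsub>C j\<^esub> x = \<zero>\<^bsub>C j\<^esub> \<Longrightarrow> x \<in> G (insert k S) j"
  by (auto simp: G_def)

text \<open>If x_k^n u = \<open>\<delta>\<close> w, write w = x_k^n w' with w' torsion for
  \<open>S\<close>; then u minus the coboundary of w' is killed by x_k^n. So an element with a power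
  multiple that bounds is, modulo a coboundary, torsion for the new variable.\<close>

lemma divide_boundary:
  assumes S: "S \<subseteq> {1..d}" "k \<in> {1..d}" "k \<notin> S" and u: "u \<in> G S j" "mvar k ^ n \<odot>\<^bsub>C j\<^esub> u \<in> B S j"
  shows "\<exists>v\<in>B S j. u \<ominus>\<^bsub>C j\<^esub> v \<in> G (insert k S) j"
proof (cases j)
  case 0
  then show ?thesis using u G_insertI[of u S j k n]
    by (intro bexI[of _ "\<zero>\<^bsub>C j\<^esub>"]) (auto simp: B_def C.M.diff_zero G_carrier)
next
  case (Suc i)
  then obtain w where w: "w \<in> G S i" "mvar k ^ n \<odot>\<^bsub>C j\<^esub> u = \<delta> i w" using u by (auto simp: B_def)
  obtain w' where w': "w' \<in> G S i" "mvar k ^ n \<odot>\<^bsub>C i\<^esub> w' = w" using G_divisible[OF S w(1)] by blast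
  have p: "(mvar k :: 'k mpoly) ^ n \<in> polys d" by (rule pw[OF S(2)])
  have c: "\<delta> i w' \<in> carrier (C j)" "u \<in> carrier (C j)" using w' u dl(1) Suc by (auto simp: G_carrier)
  have "mvar k ^ n \<odot>\<^bsub>C j\<^esub> (u \<ominus>\<^bsub>C j\<^esub> \<delta> i w') = \<delta> i w \<ominus>\<^bsub>C j\<^esub> \<delta> i w"
    using cm(8)[OF p c(2,1)] w w' dl(3)[OF p, of w' i] Suc by (auto simp: G_carrier)
  also have "\<dots> = \<zero>\<^bsub>C j\<^esub>" using w(1) dl(1)[of w i] Suc by (simp add: a_minus_def C.M.r_neg G_carrier)
  finally have "u \<ominus>\<^bsub>C j\<^esub> \<delta> i w' \<in> G (insert k S) j"
    using u(1) dl_G[OF S(1) w'(1)] G_closed(3)[OF S(1)] Suc by (intro G_insertI) auto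
  then show ?thesis using w'(1) Suc by (auto simp: B_def)
qed

text \<open>A primitive \<open>u\<close> of \<open>z\<close> that is torsion only for
  \<open>S\<close> has to be corrected. As x_k^n z = 0, the element x_k^n u is a cocycle one degree
  lower; by \<open>tors\<close> some power multiple of \<open>u\<close> bounds, and
  \<open>divide_boundary\<close> supplies the correction.\<close>

lemma vanishing_insert:
  assumes S: "S \<subseteq> {1..d}" "k \<in> {1..d}" "k \<notin> S" and Z: "Zc (insert k S) j \<subseteq> B S j"
    and tors: "\<And>u n i. j = Suc i \<Longrightarrow> u \<in> G S i \<Longrightarrow> mvar k ^ n \<odot>\<^bsub>C i\<^esub> u \<in> Zc S i \<Longrightarrow>
      \<exists>m. mvar k ^ m \<odot>\<^bsub>C i\<^esub> u \<in> B S i"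
  shows "Zc (insert k S) j \<subseteq> B (insert k S) j"
proof
  fix z assume z: "z \<in> Zc (insert k S) j"
  show "z \<in> B (insert k S) j"
  proof (cases j)
    case 0
    then show ?thesis using z Z by (auto simp: B_def)
  next
    case (Suc i)
    then obtain u where u: "u \<in> G S i" "z = \<delta> i u" using z Z by (auto simp: B_def)
    obtain n where n: "mvar k ^ n \<odot>\<^bsub>C j\<^esub> z = \<zero>\<^bsub>C j\<^esub>" using z by (auto simp: Zc_def G_def)
    have p: "(mvar k :: 'k mpoly) ^ n \<in> polys d" by (rule pw[OF S(2)])
    have "mvar k ^ n \<odot>\<^bsub>C i\<^esub> u \<in> Zc S i"
      using u n dl(3)[OF p, of u i] Suc G_closed(4)[OF S(1) p] by (auto simp: Zc_def G_carrier)
    then obtain m where "mvar k ^ m \<odot>\<^bsub>C i\<^esub> u \<in> B S i" using tors[OF Suc u(1)] by blast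
    then obtain v where v: "v \<in> B S i" "u \<ominus>\<^bsub>C i\<^esub> v \<in> G (insert k S) i" using divide_boundary[OF S u(1)] by blast
    then have v': "v \<in> carrier (C i)" "\<delta> i v = \<zero>\<^bsub>C j\<^esub>" using subsetD[OF B_sub_Zc[OF S(1)] v(1)] Suc by (auto simp: Zc_def G_carrier)
    have "\<delta> i (u \<ominus>\<^bsub>C i\<^esub> v) = z"
      using dl_diff[of u i v] u v' dl(1)[of u i] Suc by (simp add: G_carrier C.M.diff_zero)
    then show ?thesis using v(2) Suc by (auto simp: B_def)
  qed
qed

text \<open>The cohomology of \<open>G S\<close> is concentrated in degree \<open>r\<close>, where \<open>\<theta>\<close> induces a graded isomorphism
  onto \<open>fns L\<close>.\<close>

definition rep :: "nat set \<Rightarrow> nat \<Rightarrow> (nat \<Rightarrow> int) set \<Rightarrow> ('i \<Rightarrow> (nat \<Rightarrow> int) \<Rightarrow> 'k) \<Rightarrow> bool" where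
  "rep S r L \<theta> \<longleftrightarrow>
    (\<forall>j. j \<noteq> r \<longrightarrow> Zc S j \<subseteq> B S j) \<and>
    (\<forall>z\<in>Zc S r. \<theta> z \<in> fns L) \<and>
    (\<forall>z\<in>Zc S r. \<forall>z'\<in>Zc S r. \<theta> (z \<oplus>\<^bsub>C r\<^esub> z') = (\<lambda>a. \<theta> z a + \<theta> z' a)) \<and>
    (\<forall>f\<in>polys d. \<forall>z\<in>Zc S r. \<theta> (f \<odot>\<^bsub>C r\<^esub> z) = act L f (\<theta> z)) \<and>
    (\<forall>\<phi>\<in>fns L. \<exists>z\<in>Zc S r. \<theta> z = \<phi>) \<and>
    (\<forall>z\<in>Zc S r. \<theta> z = (\<lambda>_. 0) \<longleftrightarrow> z \<in> B S r) \<and>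
    (\<forall>g. \<forall>z\<in>Zc S r. z \<in> hcomp (C r) g \<longrightarrow> (\<forall>a. \<theta> z a \<noteq> 0 \<longrightarrow> zdeg d W a = g))"

lemma repD:
  assumes "rep S r L \<theta>"
  shows "j \<noteq> r \<Longrightarrow> Zc S j \<subseteq> B S j"
    "z \<in> Zc S r \<Longrightarrow> \<theta> z \<in> fns L"
    "z \<in> Zc S r \<Longrightarrow> z' \<in> Zc S r \<Longrightarrow> \<theta> (z \<oplus>\<^bsub>C r\<^esub> z') = (\<lambda>a. \<theta> z a + \<theta> z' a)"
    "f \<in> polys d \<Longrightarrow> z \<in> Zc S r \<Longrightarrow> \<theta> (f \<odot>\<^bsub>C r\<^esub> z) = act L f (\<theta> z)"
    "\<phi> \<in> fns L \<Longrightarrow> \<exists>z\<in>Zc S r. \<theta> z = \<phi>"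
    "z \<in> Zc S r \<Longrightarrow> \<theta> z = (\<lambda>_. 0) \<longleftrightarrow> z \<in> B S r"
    "z \<in> Zc S r \<Longrightarrow> z \<in> hcomp (C r) g \<Longrightarrow> \<theta> z a \<noteq> 0 \<Longrightarrow> zdeg d W a = g"
  using assms unfolding rep_def by blast+

lemma rep_zero:
  assumes "S \<subseteq> {1..d}" "rep S r L \<theta>"
  shows "\<theta> \<zero>\<^bsub>C r\<^esub> = (\<lambda>_. 0)"
proof
  fix a
  have "\<theta> \<zero>\<^bsub>C r\<^esub> a = \<theta> \<zero>\<^bsub>C r\<^esub> a + \<theta> \<zero>\<^bsub>C r\<^esub> a"
    using fun_cong[OF repD(3)[OF assms(2) Zc_closed(1)[OF assms(1)] Zc_closed(1)[OF assms(1)]], of a] C.M.l_zero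
    by (metis C.M.zero_closed)
  then show "\<theta> \<zero>\<^bsub>C r\<^esub> a = 0" by (metis add_cancel_right_left)
qed

lemma rep_diff:
  assumes "S \<subseteq> {1..d}" "rep S r L \<theta>" "z \<in> Zc S r" "z' \<in> Zc S r"
  shows "\<theta> (z \<ominus>\<^bsub>C r\<^esub> z') = (\<lambda>a. \<theta> z a - \<theta> z' a)"
proof -
  have c: "z \<in> carrier (C r)" "z' \<in> carrier (C r)" using assms by (auto simp: Zc_def G_def)
  show ?thesis
    using repD(3)[OF assms(2) Zc_closed(3)[OF assms(1,3,4)] assms(4)] c by (simp add: C.M.diff_add fun_eq_iff)
qed

lemma Zc_mono: "Zc (insert k S) j \<subseteq> Zc S j" and G_mono: "G (insert k S) j \<subseteq> G S j"
  by (auto simp: Zc_def G_def)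

text \<open>The exponents in \<open>Lam T U\<close> vanish at \<open>k\<close>, so x_k acts as zero
  on the cohomology. Then every class has a representative that is torsion for x_k, and a torsion
  cocycle that bounds also bounds a torsion element; the same \<open>\<theta>\<close> serves both
  complexes.\<close>

lemma rep_step_nilpotent:
  assumes S: "S \<subseteq> {1..d}" "k \<in> {1..d}" "k \<notin> S" and k: "k \<notin> T \<union> U" and rep: "rep S r (Lam T U) \<theta>"
  shows "rep (insert k S) r (Lam T U) \<theta>"
proof -
  note r = repD[OF rep]
  have S': "insert k S \<subseteq> {1..d}" using S by auto
  have p: "(mvar k :: 'k mpoly) \<in> polys d" using pw[OF S(2), of 1] by simp
  have kill: "mvar k \<odot>\<^bsub>C r\<^esub> z \<in> B S r" if z: "z \<in> Zc S r" for z
  proof -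
    have "act (Lam T U) (mvar k ^ 1) (\<theta> z) = (\<lambda>_. 0)"
      unfolding act_mvar_power
      by (rule ext, rule if_splits(1)[THEN iffD2], intro conjI impI refl fns_outside[OF r(2)[OF z]])
        (use k in \<open>auto simp: Lam_def intro!: exI[of _ k]\<close>)
    then show ?thesis using r(4)[OF p z] r(6)[OF Zc_closed(4)[OF S(1) p z]] by simp
  qed
  have tors: "\<exists>m. mvar k ^ m \<odot>\<^bsub>C i\<^esub> u \<in> B S i" if "u \<in> G S i" "mvar k ^ n \<odot>\<^bsub>C i\<^esub> u \<in> Zc S i" for u n i
  proof (cases "i = r")
    case True
    then have "mvar k ^ (Suc n) \<odot>\<^bsub>C i\<^esub> u \<in> B S i"
      using kill[of "mvar k ^ n \<odot>\<^bsub>C i\<^esub> u"] that cm(4)[of "mvar k" "mvar k ^ n" u i] p pw[OF S(2)]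
      by (auto simp: G_carrier)
    then show ?thesis by blast
  qed (use r(1)[of i] that in auto)
  have van: "Zc (insert k S) j \<subseteq> B (insert k S) j" if "Zc (insert k S) j \<subseteq> B S j" for j
    by (rule vanishing_insert[OF S that]) (use tors in blast)
  have Bsub: "B (insert k S) j \<subseteq> B S j" for j
    using G_mono[of k S] by (cases j) (auto simp: B_def)
  \<comment> \<open>Injectivity on cohomology: the primitive \<open>u\<close> is changed into a
    torsion one. As degree \<open>r - 1\<close> carries no cohomology, x_k^n u itself
    bounds.\<close>
  have Z: "Zc (insert k S) r \<inter> B S r \<subseteq> B (insert k S) r"
  proof
    fix z assume z: "z \<in> Zc (insert k S) r \<inter> B S r"
    show "z \<in> B (insert k S) r"
    proof (cases r)
      case 0
      then show ?thesis using z by (auto simp: B_def)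
    next
      case (Suc i)
      then obtain u where u: "u \<in> G S i" "z = \<delta> i u" using z by (auto simp: B_def)
      obtain n where n: "mvar k ^ n \<odot>\<^bsub>C r\<^esub> z = \<zero>\<^bsub>C r\<^esub>" using z by (auto simp: Zc_def G_def)
      have p: "(mvar k :: 'k mpoly) ^ n \<in> polys d" by (rule pw[OF S(2)])
      have "mvar k ^ n \<odot>\<^bsub>C i\<^esub> u \<in> Zc S i"
        using u n dl(3)[OF p, of u i] Suc G_closed(4)[OF S(1) p] by (auto simp: Zc_def G_carrier)
      then have "mvar k ^ n \<odot>\<^bsub>C i\<^esub> u \<in> B S i" using r(1)[of i] Suc by auto
      then obtain v where v: "v \<in> B S i" "u \<ominus>\<^bsub>C i\<^esub> v \<in> G (insert k S) i" using divide_boundary[OF S u(1)] by blast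
      then have v': "v \<in> carrier (C i)" "\<delta> i v = \<zero>\<^bsub>C r\<^esub>" using subsetD[OF B_sub_Zc[OF S(1)] v(1)] Suc by (auto simp: Zc_def G_carrier)
      have "\<delta> i (u \<ominus>\<^bsub>C i\<^esub> v) = z"
        using dl_diff[of u i v] u v' dl(1)[of u i] Suc by (simp add: G_carrier C.M.diff_zero)
      then show ?thesis using v(2) Suc by (auto simp: B_def)
    qed
  qed
  \<comment> \<open>A representative is made torsion: x_k z bounds, so
    \<open>divide_boundary\<close> applies with exponent 1, and subtracting a coboundary leaves the
    value of \<open>\<theta>\<close> unchanged.\<close>
  have onto: "\<exists>z\<in>Zc (insert k S) r. \<theta> z = \<phi>" if \<phi>: "\<phi> \<in> fns (Lam T U)" for \<phi>
  proof -
    obtain z where z: "z \<in> Zc S r" "\<theta> z = \<phi>" using r(5)[OF \<phi>] by blast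
    have "mvar k ^ 1 \<odot>\<^bsub>C r\<^esub> z \<in> B S r" using kill[OF z(1)] by simp
    then obtain v where v: "v \<in> B S r" "z \<ominus>\<^bsub>C r\<^esub> v \<in> G (insert k S) r"
      using divide_boundary[OF S, of z r 1] z(1) unfolding Zc_def by blast
    have vz: "v \<in> Zc S r" using v B_sub_Zc[OF S(1)] by auto
    have "z \<ominus>\<^bsub>C r\<^esub> v \<in> Zc (insert k S) r" using Zc_closed(3)[OF S(1) z(1) vz] v(2) by (auto simp: Zc_def)
    moreover have "\<theta> (z \<ominus>\<^bsub>C r\<^esub> v) = \<phi>" using rep_diff[OF S(1) rep z(1) vz] r(6)[OF vz] v z by simp
    ultimately show ?thesis by blast
  qed
  show ?thesis
    unfolding rep_def
  proof (intro conjI allI ballI impI)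
    fix j assume "j \<noteq> r"
    then show "Zc (insert k S) j \<subseteq> B (insert k S) j" using van r(1)[of j] Zc_mono[of k S j] by blast
  next
    fix z assume z: "z \<in> Zc (insert k S) r"
    show "\<theta> z = (\<lambda>_. 0) \<longleftrightarrow> z \<in> B (insert k S) r"
      using r(6)[OF subsetD[OF Zc_mono z]] Z Bsub[of r] z by blast
  next
    fix g z a assume "z \<in> Zc (insert k S) r" "z \<in> hcomp (C r) g" "\<theta> z a \<noteq> 0"
    then show "zdeg d W a = g" using r(7)[OF subsetD[OF Zc_mono]] by blast
  qed (simp_all only: r(2-4) onto subsetD[OF Zc_mono])
qed

text \<open>If \<open>z = \<delta> u\<close> and \<open>x\<^sub>k\<^sup>n z = 0\<close>, then \<open>x\<^sub>k\<^sup>n u\<close> is a cocycle, and the class of \<open>z\<close> corresponds to that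
  of \<open>x\<^sub>k\<^sup>n u / x\<^sub>k\<^sup>n\<close> modulo nonnegative powers of \<open>x\<^sub>k\<close>.\<close>

definition lift_val :: "(nat \<Rightarrow> int) set \<Rightarrow> nat \<Rightarrow> nat \<Rightarrow> ((nat \<Rightarrow> int) \<Rightarrow> 'k) \<Rightarrow> (nat \<Rightarrow> int) \<Rightarrow> 'k" where
  "lift_val L k n \<phi> = (\<lambda>a. if a \<in> L then \<phi> (a(k := a k + int n)) else 0)"

definition lifts :: "nat set \<Rightarrow> nat \<Rightarrow> nat \<Rightarrow> 'i \<Rightarrow> 'i \<Rightarrow> nat \<Rightarrow> bool" where
  "lifts S k r z u n \<longleftrightarrow> u \<in> G S r \<and> \<delta> r u = z \<and> mvar k ^ n \<odot>\<^bsub>C (Suc r)\<^esub> z = \<zero>\<^bsub>C (Suc r)\<^esub>"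

text \<open>Here x_k acts injectively on the cohomology M. The torsion condition kills degree
  \<open>r\<close>, and M[1/x_k]/M appears in degree \<open>Suc r\<close>; its exponents at
  \<open>k\<close> are negative, hence \<open>k\<close> moves from \<open>U\<close> to
  \<open>T\<close>. The new coefficient map is given elementwise, so that no localized complex has
  to be formed.\<close>

lemma rep_step_regular:
  assumes S: "S \<subseteq> {1..d}" "k \<in> {1..d}" "k \<notin> S" and k: "k \<in> U" "k \<notin> T" and rep: "rep S r (Lam T U) \<theta>"
  shows "\<exists>\<theta>'. rep (insert k S) (Suc r) (Lam (insert k T) (U - {k})) \<theta>'"
proof -
  note r = repD[OF rep]
  let ?L = "Lam T U" and ?L' = "Lam (insert k T) (U - {k})"
  let ?X = "\<lambda>n. (mvar k :: 'k mpoly) ^ n"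
  let ?v = "\<lambda>n u. lift_val ?L' k n (\<theta> (?X n \<odot>\<^bsub>C r\<^esub> u))"
  have S': "insert k S \<subseteq> {1..d}" using S by auto
  have p: "?X n \<in> polys d" for n by (rule pw[OF S(2)])
  have neg: "a k < 0" if "a \<in> ?L'" for a using that by (auto simp: Lam_def)
  have shift_iff: "a(k := a k + int n) \<in> ?L \<longleftrightarrow> 0 \<le> a k + int n" if "a \<in> ?L'" for a n
    using that k unfolding Lam_def by (auto; metis)
  have lz: "?X n \<odot>\<^bsub>C r\<^esub> u \<in> Zc S r" if "lifts S k r z u n" for z u n
    using that dl(3)[OF p, of u r n] G_closed(4)[OF S(1) p, of u r n] by (auto simp: lifts_def Zc_def G_carrier)
  \<comment> \<open>Existence of \<open>u\<close> uses that the cohomology of \<open>G S\<close>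
    vanishes in degree \<open>Suc r\<close>; \<open>n\<close> comes from the torsion of
    \<open>z\<close>.\<close>
  have ex_lift: "\<exists>u n. lifts S k r z u n" if z: "z \<in> Zc (insert k S) (Suc r)" for z
  proof -
    have "z \<in> B S (Suc r)" using r(1)[of "Suc r"] subsetD[OF Zc_mono z] by auto
    then obtain u where "u \<in> G S r" "\<delta> r u = z" by (auto simp: B_def)
    moreover obtain n where "?X n \<odot>\<^bsub>C (Suc r)\<^esub> z = \<zero>\<^bsub>C (Suc r)\<^esub>" using z by (auto simp: Zc_def G_def)
    ultimately show ?thesis by (auto simp: lifts_def)
  qed
  have lmono: "lifts S k r z u (n + m)" if "lifts S k r z u n" for z u n m
    using that power_kill[OF S(2), of z "Suc r" n "n + m"] dl(1)[of u r] by (auto simp: lifts_def G_carrier)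
  \<comment> \<open>Raising \<open>n\<close> multiplies numerator and denominator of the fraction by
    the same power of x_k.\<close>
  have vmono: "?v (n + m) u = ?v n u" if l: "lifts S k r z u n" for z u n m
  proof
    fix a
    show "?v (n + m) u a = ?v n u a"
    proof (cases "a \<in> ?L'")
      case True
      have "?X (n + m) \<odot>\<^bsub>C r\<^esub> u = ?X m \<odot>\<^bsub>C r\<^esub> (?X n \<odot>\<^bsub>C r\<^esub> u)"
        using l power_add[OF S(2), of u r m n] by (auto simp: lifts_def G_carrier add.commute)
      then have "\<theta> (?X (n + m) \<odot>\<^bsub>C r\<^esub> u) = act ?L (?X m) (\<theta> (?X n \<odot>\<^bsub>C r\<^esub> u))"
        using r(4)[OF p lz[OF l]] by simp
      then show ?thesis
        using True fns_outside[OF r(2)[OF lz[OF l]], of "a(k := a k + int n)"]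
          shift_iff[OF True, of n] shift_iff[OF True, of "n + m"]
        by (auto simp: lift_val_def act_mvar_power)
    qed (simp add: lift_val_def)
  qed
  \<comment> \<open>Two lifts differ by a cocycle \<open>?w\<close>. Its contribution is x_k^n times
    its value, divided by x_k^n again; it has no negative exponent at \<open>k\<close> and is cut
    off.\<close>
  have vindep0: "?v n u = ?v n u'" if l: "lifts S k r z u n" "lifts S k r z u' n" for z u u' n
  proof -
    let ?w = "u \<ominus>\<^bsub>C r\<^esub> u'"
    have c: "u \<in> carrier (C r)" "u' \<in> carrier (C r)" "z \<in> carrier (C (Suc r))"
      using l dl(1)[of u r] by (auto simp: lifts_def G_carrier)
    have w: "?w \<in> Zc S r"
      using l G_closed(3)[OF S(1)] dl_diff[OF c(1,2)] c(3) by (auto simp: lifts_def Zc_def C.M.diff_eq_zero_iff)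
    have "?X n \<odot>\<^bsub>C r\<^esub> u = ?X n \<odot>\<^bsub>C r\<^esub> ?w \<oplus>\<^bsub>C r\<^esub> ?X n \<odot>\<^bsub>C r\<^esub> u'"
      using cm(3)[OF p, of ?w r u' n] c by (simp add: C.M.diff_add)
    then have "\<theta> (?X n \<odot>\<^bsub>C r\<^esub> u) = (\<lambda>a. act ?L (?X n) (\<theta> ?w) a + \<theta> (?X n \<odot>\<^bsub>C r\<^esub> u') a)"
      using r(3)[OF Zc_closed(4)[OF S(1) p w] lz[OF l(2)]] r(4)[OF p w] by simp
    moreover have "act ?L (?X n) (\<theta> ?w) (a(k := a k + int n)) = 0" if "a \<in> ?L'" for a
    proof -
      have "a \<notin> ?L" using neg[OF that] k by (force simp: Lam_def)
      then show ?thesis using fns_outside[OF r(2)[OF w]] by (simp add: act_mvar_power)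
    qed
    ultimately show ?thesis by (auto simp: lift_val_def fun_eq_iff)
  qed
  have vindep: "?v n u = ?v n' u'" if l: "lifts S k r z u n" "lifts S k r z u' n'" for z u u' n n'
    using vindep0[OF lmono[OF l(1), of n'], of u'] lmono[OF l(2), of n] vmono[OF l(1), of n'] vmono[OF l(2), of n]
    by (simp add: add.commute)
  define \<theta>' where "\<theta>' = (\<lambda>z. let p = (SOME p. lifts S k r z (fst p) (snd p)) in ?v (snd p) (fst p))"
  have th: "\<theta>' z = ?v n u" if "lifts S k r z u n" for z u n
  proof -
    have "lifts S k r z (fst (SOME p. lifts S k r z (fst p) (snd p))) (snd (SOME p. lifts S k r z (fst p) (snd p)))"
      by (rule someI[of "\<lambda>p. lifts S k r z (fst p) (snd p)" "(u, n)"]) (use that in simp)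
    from vindep[OF this that] show ?thesis by (simp add: \<theta>'_def Let_def)
  qed
  have Z: "Zc (insert k S) (Suc r) \<subseteq> Zc S (Suc r)" by (rule Zc_mono)
  have vfns: "lift_val ?L' k n \<phi> \<in> fns ?L'" if "\<phi> \<in> fns ?L" for \<phi> n
  proof -
    have "{a. lift_val ?L' k n \<phi> a \<noteq> 0} \<subseteq> (\<lambda>b. b(k := b k - int n)) ` {b. \<phi> b \<noteq> 0}"
      by (rule subsetI, rule_tac x = "x(k := x k + int n)" in image_eqI)
        (auto simp: lift_val_def split: if_splits)
    then show ?thesis using that by (auto simp: fns_def lift_val_def intro: finite_subset split: if_splits)
  qed
  have add: "\<theta>' (z \<oplus>\<^bsub>C (Suc r)\<^esub> z') = (\<lambda>a. \<theta>' z a + \<theta>' z' a)"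
    if z: "z \<in> Zc (insert k S) (Suc r)" "z' \<in> Zc (insert k S) (Suc r)" for z z'
  proof -
    obtain u n where l: "lifts S k r z u n" using ex_lift z by blast
    obtain u' n' where l': "lifts S k r z' u' n'" using ex_lift z by blast
    have L: "lifts S k r z u (n + n')" "lifts S k r z' u' (n + n')"
      using lmono[OF l, of n'] lmono[OF l', of n] by (simp_all add: add.commute)
    have c: "u \<in> carrier (C r)" "u' \<in> carrier (C r)" "z \<in> carrier (C (Suc r))" "z' \<in> carrier (C (Suc r))"
      using l l' dl(1)[of u r] dl(1)[of u' r] by (auto simp: lifts_def G_carrier)
    have "lifts S k r (z \<oplus>\<^bsub>C (Suc r)\<^esub> z') (u \<oplus>\<^bsub>C r\<^esub> u') (n + n')"
      using L G_closed(2)[OF S(1)] dl(2)[of u r u'] c cm(3)[OF p c(3,4)] by (auto simp: lifts_def)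
    from th[OF this] th[OF L(1)] th[OF L(2)] show ?thesis
      using cm(3)[OF p c(1,2), of "n + n'"] r(3)[OF lz[OF L(1)] lz[OF L(2)]] by (auto simp: lift_val_def)
  qed
  have smul: "\<theta>' (f \<odot>\<^bsub>C (Suc r)\<^esub> z) = act ?L' f (\<theta>' z)"
    if z: "z \<in> Zc (insert k S) (Suc r)" and f: "f \<in> polys d" for z f
  proof -
    obtain u n where l: "lifts S k r z u n" using ex_lift z by blast
    have c: "u \<in> carrier (C r)" "z \<in> carrier (C (Suc r))"
      using l dl(1)[of u r] by (auto simp: lifts_def G_carrier)
    have "lifts S k r (f \<odot>\<^bsub>C (Suc r)\<^esub> z) (f \<odot>\<^bsub>C r\<^esub> u) n"
      using l G_closed(4)[OF S(1) f] dl(3)[OF f c(1)] smult_commute[OF p f c(2)] cm(7)[OF f]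
      by (auto simp: lifts_def)
    from th[OF this] have "\<theta>' (f \<odot>\<^bsub>C (Suc r)\<^esub> z) = lift_val ?L' k n (act ?L f (\<theta> (?X n \<odot>\<^bsub>C r\<^esub> u)))"
      using smult_commute[OF p f c(1)] r(4)[OF f lz[OF l]] by simp
    also have "\<dots> = act ?L' f (?v n u)"
    proof
      fix a
      let ?\<phi> = "\<theta> (?X n \<odot>\<^bsub>C r\<^esub> u)"
      have \<phi>: "?\<phi> \<in> fns ?L" by (rule r(2)[OF lz[OF l]])
      show "lift_val ?L' k n (act ?L f ?\<phi>) a = act ?L' f (?v n u) a"
      proof (cases "a \<in> ?L'")
        case a: True
        \<comment> \<open>The two cut-offs agree. For \<open>a\<close> in \<open>?L'\<close> the
          exponents in \<open>insert k T\<close> stay negative under subtraction, so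
          \<open>?L'\<close> can only be left at a coordinate other than \<open>k\<close>, where the
          shift by \<open>n\<close> changes nothing.\<close>
        have 1: "lift_val ?L' k n ?\<phi> (xsub a b) = ?\<phi> (xsub (a(k := a k + int n)) b)" for b
        proof -
          have e: "(xsub a b)(k := xsub a b k + int n) = xsub (a(k := a k + int n)) b" by (auto simp: xsub_def)
          have "xsub (a(k := a k + int n)) b \<notin> ?L" if "xsub a b \<notin> ?L'"
          proof
            assume h: "xsub (a(k := a k + int n)) b \<in> ?L"
            have "xsub a b \<in> ?L'" unfolding Lam_def
            proof (intro CollectI conjI ballI allI impI)
              fix i assume "i \<in> insert k T"
              then have "a i < 0" using a by (auto simp: Lam_def)
              then show "xsub a b i < 0" by (auto simp: xsub_def)
            next
              fix i assume "i \<in> U - {k}"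
              then show "0 \<le> xsub a b i" using h by (auto simp: Lam_def xsub_def split: if_splits)
            next
              fix i assume "i \<notin> insert k T \<union> (U - {k})"
              then show "xsub a b i = 0" using h by (auto simp: Lam_def xsub_def split: if_splits)
            qed
            then show False using that by simp
          qed
          then show ?thesis using fns_outside[OF \<phi>] e by (auto simp: lift_val_def)
        qed
        have "act ?L f ?\<phi> (a(k := a k + int n)) =
          (\<Sum>b\<in>Poly_Mapping.keys f. Poly_Mapping.lookup f b * ?\<phi> (xsub (a(k := a k + int n)) b))"
        proof (cases "a(k := a k + int n) \<in> ?L")
          case False
          then have "a k + int n < 0" using shift_iff[OF a] by auto
          then have "xsub (a(k := a k + int n)) b \<notin> ?L" for b using k by (auto simp: Lam_def xsub_def intro!: bexI[of _ k])
          then show ?thesis using False fns_outside[OF \<phi>] by (simp add: act_def)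
        qed (simp add: act_def)
        then show ?thesis using a 1 by (simp add: lift_val_def[of _ _ _ "act ?L f ?\<phi>"] act_def[of ?L'])
      qed (simp add: lift_val_def act_def)
    qed
    finally show ?thesis using th[OF l] by simp
  qed
  have onto: "\<exists>z\<in>Zc (insert k S) (Suc r). \<theta>' z = \<phi>" if \<phi>: "\<phi> \<in> fns ?L'" for \<phi>
  proof -
    have fin: "finite ((\<lambda>a. nat (- a k)) ` {a. \<phi> a \<noteq> 0})" using \<phi> by (auto simp: fns_def)
    \<comment> \<open>Large enough for x_k^n times \<open>\<phi>\<close> to have no negative
      exponent at \<open>k\<close>; the inserted 0 covers the empty support.\<close>
    define n where "n = Max (insert 0 ((\<lambda>a. nat (- a k)) ` {a. \<phi> a \<noteq> 0}))"
    have n: "0 \<le> a k + int n" if "\<phi> a \<noteq> 0" for a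
    proof -
      have "nat (- a k) \<le> n" unfolding n_def using fin that by (intro Max_ge) auto
      then show ?thesis by linarith
    qed
    define \<psi> where "\<psi> = (\<lambda>b. \<phi> (b(k := b k - int n)))"
    have "b \<in> ?L" if "\<psi> b \<noteq> 0" for b
      using n[of "b(k := b k - int n)"] that \<phi> shift_iff[of "b(k := b k - int n)" n] by (auto simp: \<psi>_def fns_def)
    moreover have "{b. \<psi> b \<noteq> 0} \<subseteq> (\<lambda>a. a(k := a k + int n)) ` {a. \<phi> a \<noteq> 0}"
      by (rule subsetI, rule_tac x = "x(k := x k - int n)" in image_eqI) (auto simp: \<psi>_def)
    ultimately have "\<psi> \<in> fns ?L" using \<phi> by (auto simp: fns_def intro: finite_subset)
    then obtain v where v: "v \<in> Zc S r" "\<theta> v = \<psi>" using r(5) by blast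
    \<comment> \<open>Dividing the cocycle \<open>v\<close> by x_k^n inside the complex gives
      \<open>u\<close>; the value of its coboundary is the fraction \<open>\<psi>\<close> / x_k^n,
      which is \<open>\<phi>\<close>.\<close>
    then obtain u where u: "u \<in> G S r" "?X n \<odot>\<^bsub>C r\<^esub> u = v" using G_divisible[OF S, of v r n] by (auto simp: Zc_def)
    have kill: "?X n \<odot>\<^bsub>C (Suc r)\<^esub> \<delta> r u = \<zero>\<^bsub>C (Suc r)\<^esub>"
      using dl(3)[OF p, of u r n] u v(1) by (simp add: Zc_def G_carrier)
    then have l: "lifts S k r (\<delta> r u) u n" using u by (simp add: lifts_def)
    have "\<delta> r u \<in> Zc (insert k S) (Suc r)"
      using G_insertI[OF dl_G[OF S(1) u(1)] kill] dd u(1) by (simp add: Zc_def G_carrier)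
    moreover have "lift_val ?L' k n \<psi> a = \<phi> a" for a
      using fns_outside[OF \<phi>, of a] by (simp add: lift_val_def \<psi>_def)
    then have "\<theta>' (\<delta> r u) = \<phi>" using th[OF l] u(2) v(2) by auto
    ultimately show ?thesis by blast
  qed
  have ker: "\<theta>' z = (\<lambda>_. 0) \<longleftrightarrow> z \<in> B (insert k S) (Suc r)" if z: "z \<in> Zc (insert k S) (Suc r)" for z
  proof
    assume "z \<in> B (insert k S) (Suc r)"
    then obtain u where u: "u \<in> G (insert k S) r" "z = \<delta> r u" by (auto simp: B_def)
    then obtain n where n: "?X n \<odot>\<^bsub>C r\<^esub> u = \<zero>\<^bsub>C r\<^esub>" by (auto simp: G_def)
    then have "?X n \<odot>\<^bsub>C (Suc r)\<^esub> z = \<zero>\<^bsub>C (Suc r)\<^esub>"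
      using dl(3)[OF p, of u r n] u dl_zero by (simp add: G_carrier)
    then have "lifts S k r z u n" using u G_mono by (auto simp: lifts_def)
    then show "\<theta>' z = (\<lambda>_. 0)" using th n rep_zero[OF S(1) rep] by (auto simp: lift_val_def)
  next
    assume 0: "\<theta>' z = (\<lambda>_. 0)"
    obtain u n where l: "lifts S k r z u n" using ex_lift z by blast
    let ?\<phi> = "\<theta> (?X n \<odot>\<^bsub>C r\<^esub> u)"
    have \<phi>: "?\<phi> \<in> fns ?L" by (rule r(2)[OF lz[OF l]])
    have \<phi>0: "?\<phi> (a(k := a k + int n)) = 0" if "a \<in> ?L'" for a
      using fun_cong[OF 0, of a] th[OF l] that by (simp add: lift_val_def)
    \<comment> \<open>The quotient of \<open>?\<phi>\<close> by x_k^n. It exists because vanishing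
      of \<open>\<theta>' z\<close> says that the terms of \<open>?\<phi>\<close> with exponent
      below \<open>n\<close> at \<open>k\<close> are zero. A cocycle with value \<open>m\<close>
      then corrects \<open>u\<close>.\<close>
    define m where "m = (\<lambda>b. if b \<in> ?L then ?\<phi> (b(k := b k + int n)) else 0)"
    have "{b. m b \<noteq> 0} \<subseteq> (\<lambda>a. a(k := a k - int n)) ` {a. ?\<phi> a \<noteq> 0}"
      by (rule subsetI, rule_tac x = "x(k := x k + int n)" in image_eqI) (auto simp: m_def split: if_splits)
    then have m: "m \<in> fns ?L" using \<phi> by (auto simp: fns_def m_def intro: finite_subset split: if_splits)
    have am: "act ?L (?X n) m = ?\<phi>"
    proof
      fix a
      show "act ?L (?X n) m a = ?\<phi> a"
      proof (cases "a \<in> ?L")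
        case True
        show ?thesis
        proof (cases "a(k := a k - int n) \<in> ?L")
          case False
          have "a(k := a k - int n) \<in> ?L'"
          proof -
            have "a k - int n < 0" using False True k by (auto simp: Lam_def split: if_splits)
            then show ?thesis using True k by (auto simp: Lam_def)
          qed
          from \<phi>0[OF this] show ?thesis using True False by (simp add: act_mvar_power m_def)
        qed (use True in \<open>simp add: act_mvar_power m_def\<close>)
      qed (use fns_outside[OF \<phi>] in \<open>simp add: act_mvar_power\<close>)
    qed
    obtain v where v: "v \<in> Zc S r" "\<theta> v = m" using r(5)[OF m] by blast
    have c: "u \<in> carrier (C r)" "v \<in> carrier (C r)" "u \<in> G S r" "v \<in> G S r"
      using l v by (auto simp: lifts_def Zc_def G_carrier)
    let ?w = "u \<ominus>\<^bsub>C r\<^esub> v"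
    have Xw: "?X n \<odot>\<^bsub>C r\<^esub> ?w = ?X n \<odot>\<^bsub>C r\<^esub> u \<ominus>\<^bsub>C r\<^esub> ?X n \<odot>\<^bsub>C r\<^esub> v" by (rule cm(8)[OF p c(1,2)])
    have "\<theta> (?X n \<odot>\<^bsub>C r\<^esub> ?w) = (\<lambda>_. 0)"
      unfolding Xw using rep_diff[OF S(1) rep lz[OF l] Zc_closed(4)[OF S(1) p v(1)]] r(4)[OF p v(1)] v(2) am by simp
    then have "?X n \<odot>\<^bsub>C r\<^esub> ?w \<in> B S r"
      using r(6) Zc_closed(3)[OF S(1) lz[OF l] Zc_closed(4)[OF S(1) p v(1)]] Xw by simp
    then obtain b where b: "b \<in> B S r" "?w \<ominus>\<^bsub>C r\<^esub> b \<in> G (insert k S) r"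
      using divide_boundary[OF S G_closed(3)[OF S(1) c(3,4)]] by blast
    have b': "b \<in> carrier (C r)" "\<delta> r b = \<zero>\<^bsub>C (Suc r)\<^esub>" using subsetD[OF B_sub_Zc[OF S(1)] b(1)] by (auto simp: Zc_def G_carrier)
    have z': "\<delta> r u = z" "z \<in> carrier (C (Suc r))" "\<delta> r v = \<zero>\<^bsub>C (Suc r)\<^esub>"
      using l dl(1)[OF c(1)] v by (auto simp: lifts_def Zc_def)
    have "\<delta> r (?w \<ominus>\<^bsub>C r\<^esub> b) = z"
      using dl_diff[of ?w r b] dl_diff[of u r v] c b' z' by (simp add: C.M.diff_zero)
    then show "z \<in> B (insert k S) (Suc r)" using b(2) by (auto simp: B_def)
  qed
  have hom: "zdeg d W a = g" if z: "z \<in> Zc (insert k S) (Suc r)" "z \<in> hcomp (C (Suc r)) g" "\<theta>' z a \<noteq> 0" for z g a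
  proof -
    obtain u n where l: "lifts S k r z u n" using ex_lift z by blast
    have c: "u \<in> carrier (C r)" "u \<in> G S r" using l by (auto simp: lifts_def G_carrier)
    \<comment> \<open>The component in degree \<open>g\<close> is again a lift of \<open>z\<close>,
      and for a homogeneous lift the degree of the value is known.\<close>
    let ?u = "hc (C r) u g"
    have "\<delta> r ?u = z"
      using gr_hom_hc[OF gm gm hom c(1), of g] C.hc_homog[OF z(2), of g] l by (simp add: lifts_def)
    then have l': "lifts S k r z ?u n" using l G_hc[OF S(1) c(2)] by (auto simp: lifts_def)
    have "?X n \<odot>\<^bsub>C r\<^esub> ?u \<in> hcomp (C r) (int n *s W k + g)"
      by (rule C.hcomp_smult[OF mvar_power_hcomp[OF S(2)] C.hc_props(1)[OF c(1)]])
    moreover have "\<theta> (?X n \<odot>\<^bsub>C r\<^esub> ?u) (a(k := a k + int n)) \<noteq> 0"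
      using z(3) th[OF l'] by (auto simp: lift_val_def split: if_splits)
    ultimately have "zdeg d W (a(k := a k + int n)) = int n *s W k + g" using r(7)[OF lz[OF l']] by blast
    then show ?thesis using zdeg_shift[OF S(2), of W a "int n"] by simp
  qed
  have tors: "\<exists>m. ?X m \<odot>\<^bsub>C i\<^esub> u \<in> B S i" if "j \<noteq> Suc r" "j = Suc i" "?X n \<odot>\<^bsub>C i\<^esub> u \<in> Zc S i" for u n i j
    using r(1)[of i] that by auto
  have van: "Zc (insert k S) j \<subseteq> B (insert k S) j" if j: "j \<noteq> Suc r" for j
  proof (rule vanishing_insert[OF S])
    show "Zc (insert k S) j \<subseteq> B S j"
    proof (cases "j = r")
      case True
      show ?thesis
      proof
        fix z assume z: "z \<in> Zc (insert k S) j"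
        then obtain n where "?X n \<odot>\<^bsub>C r\<^esub> z = \<zero>\<^bsub>C r\<^esub>" using True by (auto simp: Zc_def G_def)
        moreover have zz: "z \<in> Zc S r" using z True Zc_mono by auto
        ultimately have 0: "act ?L (?X n) (\<theta> z) = (\<lambda>_. 0)" using r(4)[OF p zz, of n] rep_zero[OF S(1) rep] by simp
        \<comment> \<open>Multiplication by x_k^n is injective on \<open>fns ?L\<close>: as
          \<open>k\<close> is in \<open>U\<close>, raising the exponent at \<open>k\<close> does not
          leave \<open>?L\<close>.\<close>
        have "\<theta> z b = 0" for b
        proof (cases "b \<in> ?L")
          case True
          then have "b(k := b k + int n) \<in> ?L" using k by (auto simp: Lam_def)
          then show ?thesis using fun_cong[OF 0, of "b(k := b k + int n)"] by (simp add: act_mvar_power)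
        qed (use fns_outside[OF r(2)[OF zz]] in blast)
        then show "z \<in> B S j" using r(6)[OF zz] True by auto
      qed
    qed (use r(1) Zc_mono in blast)
  qed (use tors[OF j] in blast)
  have "rep (insert k S) (Suc r) ?L' \<theta>'"
    unfolding rep_def
  proof (intro conjI allI ballI impI)
    fix z assume z: "z \<in> Zc (insert k S) (Suc r)"
    obtain u n where "lifts S k r z u n" using ex_lift z by blast
    then show "\<theta>' z \<in> fns ?L'" using th vfns r(2)[OF lz] by metis
  qed (use van add smul onto ker hom in blast)+
  then show ?thesis by blast
qed

end

section \<open>Graded injective modules and the local cohomology of face rings\<close>

lemma gshift_simps [simp]:
  "carrier (gshift M c) = carrier M" "zero (gshift M c) = zero M" "add (gshift M c) = add M"
  "smult (gshift M c) = smult M" "hcomp (gshift M c) g = hcomp M (g + c)"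
  by (simp_all add: gshift_def)

lemma graded_module_gshift:
  assumes "graded_module R M" "\<And>g. hcomp R g \<subseteq> carrier R"
  shows "graded_module R (gshift M c)"
  by (rule graded_module_transport[OF assms(1), of "\<lambda>x. x" _ "- c"])
    (use assms(2) in \<open>auto simp: bij_betw_def\<close>)

lemma mon_kill:
  assumes M: "Module.module (poly_ring d W) M" and x: "x \<in> carrier M" and S: "S \<subseteq> {1..d}"
    and kill: "\<And>i. i \<in> S \<Longrightarrow> (mvar i :: 'k::field mpoly) ^ n i \<odot>\<^bsub>M\<^esub> x = \<zero>\<^bsub>M\<^esub>"
    and f: "f \<in> mon_ideal d (\<lambda>e. \<exists>i\<in>S. n i \<le> Poly_Mapping.lookup e i)"
  shows "f \<odot>\<^bsub>M\<^esub> x = \<zero>\<^bsub>M\<^esub>"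
proof (rule smult_zero_from_monomials[OF M x])
  show "f \<in> polys d" using f by (simp add: mon_ideal_def)
  fix e assume "e \<in> Poly_Mapping.keys f"
  then have k: "Poly_Mapping.keys e \<subseteq> {1..d}" and "\<exists>i\<in>S. n i \<le> Poly_Mapping.lookup e i"
    using f by (auto simp: mon_ideal_def dest: polysD)
  then obtain i where i: "i \<in> S" "n i \<le> Poly_Mapping.lookup e i" by blast
  let ?r = "Poly_Mapping.single (e - Poly_Mapping.single i (n i)) (1 :: 'k)"
  have r: "?r \<in> polys d"
    using k keys_minus_nat[of e "Poly_Mapping.single i (n i)"] by (auto intro!: single_polys)
  have m: "(mvar i :: 'k mpoly) ^ n i \<in> polys d" using mvar_power_polys[of i d] S i(1) by blast
  have "Poly_Mapping.single e (1 :: 'k) = ?r * mvar i ^ n i"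
    using single_split[OF i(2), of "1 :: 'k"] by (simp add: mult.commute)
  then show "Poly_Mapping.single e (1 :: 'k) \<odot>\<^bsub>M\<^esub> x = \<zero>\<^bsub>M\<^esub>"
    using poly_module(4)[OF M r m x] kill[OF i(1)] poly_module(7)[OF M r] by simp
qed

text \<open>Drops the monomials without \<open>x\<^sub>k\<close> and divides the others by \<open>x\<^sub>k\<close>.\<close>

definition shift_down :: "nat \<Rightarrow> 'k::field mpoly \<Rightarrow> 'k mpoly" where
  "shift_down k = Poly_Mapping.map_key (\<lambda>m. m + Poly_Mapping.single k 1)"

lemma inj_shift: "inj (\<lambda>m. m + Poly_Mapping.single k (1 :: nat))"
  by (simp add: inj_on_def)

lemma lookup_shift_down:
  "Poly_Mapping.lookup (shift_down k f) m = Poly_Mapping.lookup f (m + Poly_Mapping.single k 1)"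
  unfolding shift_down_def by (simp add: map_key.rep_eq[OF inj_shift])

lemma keys_shift_down: "m \<in> Poly_Mapping.keys (shift_down k f) \<longleftrightarrow> m + Poly_Mapping.single k 1 \<in> Poly_Mapping.keys f"
  by (simp add: in_keys_iff lookup_shift_down)

lemma shift_down_add: "shift_down k (f + g) = shift_down k f + shift_down k g"
  by (rule poly_mapping_eqI) (simp add: lookup_shift_down lookup_add)

lemma shift_down_single: "shift_down k (Poly_Mapping.single (m + Poly_Mapping.single k 1) c) = Poly_Mapping.single m c"
  by (rule poly_mapping_eqI) (auto simp: lookup_shift_down lookup_single when_def)

lemma shift_down_sum: "shift_down k (sum u S) = (\<Sum>s\<in>S. shift_down k (u s))"
  by (rule poly_mapping_eqI) (simp add: lookup_shift_down lookup_sum)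

lemma shift_down_mvar_mult: "shift_down k (mvar k * f) = f"
proof -
  have "mvar k * f = (\<Sum>e\<in>Poly_Mapping.keys f. mvar k * Poly_Mapping.single e (Poly_Mapping.lookup f e))"
    using poly_mapping_sum_single[of f] by (metis sum_distrib_left)
  also have "\<dots> = (\<Sum>e\<in>Poly_Mapping.keys f. Poly_Mapping.single (e + Poly_Mapping.single k 1) (Poly_Mapping.lookup f e))"
    by (simp add: mvar_def mult_single add.commute)
  finally show ?thesis using poly_mapping_sum_single[of f] by (simp add: shift_down_sum shift_down_single)
qed

lemma shift_down_polys: "f \<in> polys d \<Longrightarrow> shift_down k f \<in> polys d"
proof (rule polysI)
  fix e assume f: "f \<in> polys d" and "e \<in> Poly_Mapping.keys (shift_down k f)"
  then have "e + Poly_Mapping.single k 1 \<in> Poly_Mapping.keys f" by (simp add: keys_shift_down)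
  then show "Poly_Mapping.keys e \<subseteq> {1..d}" using polysD[OF f, of "e + Poly_Mapping.single k 1"] by (simp add: keys_add_nat)
qed

lemma shift_down_split: "f = mvar k * shift_down k f + pfilter (\<lambda>e. Poly_Mapping.lookup e k = 0) f"
proof (rule poly_mapping_eqI)
  fix e
  have ne: "m + Poly_Mapping.single k 1 \<noteq> e" if "Poly_Mapping.lookup e k = 0" for m :: "nat \<Rightarrow>\<^sub>0 nat"
    using that by (auto simp: lookup_add)
  have "mvar k * shift_down k f = (\<Sum>m\<in>Poly_Mapping.keys (shift_down k f).
      Poly_Mapping.single (m + Poly_Mapping.single k 1) (Poly_Mapping.lookup (shift_down k f) m))"
    by (subst poly_mapping_sum_single[of "shift_down k f"]) (simp add: sum_distrib_left mvar_def mult_single add.commute)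
  then have "Poly_Mapping.lookup (mvar k * shift_down k f) e = 0" if "Poly_Mapping.lookup e k = 0"
    using ne[OF that] by (simp add: lookup_sum lookup_single)
  moreover have "Poly_Mapping.lookup (mvar k * shift_down k f) e = Poly_Mapping.lookup f e" if "Poly_Mapping.lookup e k \<noteq> 0"
  proof -
    have "e = (e - Poly_Mapping.single k 1) + Poly_Mapping.single k 1"
      using that by (intro poly_mapping_eqI) (auto simp: lookup_add lookup_minus lookup_single when_def)
    then obtain m where m: "e = m + Poly_Mapping.single k 1" by blast
    then show ?thesis using shift_down_mvar_mult[of k "shift_down k f"] lookup_shift_down by metis
  qed
  ultimately show "Poly_Mapping.lookup f e =
      Poly_Mapping.lookup (mvar k * shift_down k f + pfilter (\<lambda>e. Poly_Mapping.lookup e k = 0) f) e"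
    by (simp add: lookup_add lookup_pfilter)
qed

text \<open>A Baer argument: the map from the test ideal that sends x_k to \<open>e\<close> and the
  given powers of the other variables to 0 extends to the shifted ring, and the value of the
  extension at 1 is the quotient sought. The exponents \<open>n i\<close> are kept, so that
  quotients of several components can be added without new estimates.\<close>

lemma injective_divisible_homogeneous:
  fixes W :: "nat \<Rightarrow> int ^ 'm" and J :: "('k::field mpoly, 'i, int ^ 'm) gmod"
  assumes inj: "graded_injective (poly_ring d W) J" and S: "S \<subseteq> {1..d}" "k \<in> {1..d}" "k \<notin> S"
    and e: "e \<in> hcomp J g" and kill: "\<And>i. i \<in> S \<Longrightarrow> mvar i ^ n i \<odot>\<^bsub>J\<^esub> e = \<zero>\<^bsub>J\<^esub>"
  shows "\<exists>e'\<in>carrier J. (\<forall>i\<in>S. mvar i ^ n i \<odot>\<^bsub>J\<^esub> e' = \<zero>\<^bsub>J\<^esub>) \<and> mvar k \<odot>\<^bsub>J\<^esub> e' = e"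
proof -
  let ?A = "poly_ring d W :: ('k mpoly, 'k mpoly, int ^ 'm) gmod"
  have gJ: "graded_module ?A J" using inj by (simp add: graded_injective_def)
  interpret J: graded_module ?A J by fact
  note jm = poly_module[OF J.module_axioms]
  have ec: "e \<in> carrier J" using e by (rule J.hcomp_carrier)
  let ?V = "\<lambda>m. \<exists>i\<in>S. n i \<le> Poly_Mapping.lookup m i"
  let ?U = "\<lambda>m. 1 \<le> Poly_Mapping.lookup m k \<or> ?V m"
  \<comment> \<open>The test ideal is generated by \<open>x\<^sub>k\<close> and the \<open>x\<^sub>i\<^sup>n\<close>, \<open>i \<in> S\<close>, which are to act as \<open>e\<close> and \<open>0\<close>.\<close>
  define Jd :: "'k mpoly set" where "Jd = mon_ideal d ?U"
  \<comment> \<open>In the shift by this degree x_k has degree \<open>g\<close>, the degree of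
    \<open>e\<close>; this makes \<open>h\<close> a map of degree 0, as
    \<open>graded_injective\<close> demands.\<close>
  let ?s = "W k - g"
  define M where "M = gshift (gsub ?A Jd) ?s"
  define N where "N = gshift ?A ?s"
  have Jsub: "gsubmodule ?A ?A Jd" unfolding Jd_def by (rule mon_ideal_gsubmodule) (auto simp: lookup_add intro: trans_le_add2)
  have Jp: "f \<in> polys d" if "f \<in> Jd" for f using that by (simp add: Jd_def mon_ideal_def)
  have gA: "graded_module ?A ?A" by (rule graded_module_poly_ring)
  have gM: "graded_module ?A M" unfolding M_def
    by (intro graded_module_gshift graded_module_gsub[OF gA Jsub] hcomp_poly_ring_carrier)
      (simp add: Jd_def mon_ideal_hc)
  have gN: "graded_module ?A N" unfolding N_def
    by (intro graded_module_gshift gA hcomp_poly_ring_carrier)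
  have Vkill: "f \<odot>\<^bsub>J\<^esub> e = \<zero>\<^bsub>J\<^esub>" if "f \<in> mon_ideal d ?V" for f
    by (rule mon_kill[OF J.module_axioms ec S(1) kill that])
  define h where "h = (\<lambda>f\<in>Jd. shift_down k f \<odot>\<^bsub>J\<^esub> e)"
  \<comment> \<open>\<open>shift_down\<close> is not linear over the ring: it drops the part
    \<open>?r\<close> of \<open>f\<close> without x_k. Inside \<open>Jd\<close> this part lies in
    the ideal of the powers of the other variables. Its multiples stay in that ideal after division
    by x_k, because \<open>k\<close> is not in \<open>S\<close>, and the ideal kills
    \<open>e\<close>.\<close>
  have hlin: "shift_down k (a * f) \<odot>\<^bsub>J\<^esub> e = a \<odot>\<^bsub>J\<^esub> (shift_down k f \<odot>\<^bsub>J\<^esub> e)" if a: "a \<in> polys d" and f: "f \<in> Jd" for a f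
  proof -
    let ?r = "pfilter (\<lambda>e. Poly_Mapping.lookup e k = 0) f"
    have r: "?r \<in> mon_ideal d ?V" using f by (auto simp: Jd_def mon_ideal_def keys_pfilter pfilter_polys)
    have "gsubmodule ?A ?A (mon_ideal d ?V)"
      by (rule mon_ideal_gsubmodule) (auto simp: lookup_add intro: trans_le_add2)
    then have ar: "a * ?r \<in> mon_ideal d ?V" using a r by (auto simp: gsubmodule_def)
    have V: "?V m" if "m + Poly_Mapping.single k 1 \<in> Poly_Mapping.keys (a * ?r)" for m
    proof -
      have "?V (m + Poly_Mapping.single k 1)" using ar that by (auto simp: mon_ideal_def)
      then show ?thesis using S(3) by (auto simp: lookup_add lookup_single when_def split: if_splits)
    qed
    have sr: "shift_down k (a * ?r) \<in> mon_ideal d ?V"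
      using ar V by (auto simp: mon_ideal_def keys_shift_down shift_down_polys)
    have "a * f = mvar k * (a * shift_down k f) + a * ?r"
      using shift_down_split[of f k] by (metis distrib_left mult.left_commute)
    then have "shift_down k (a * f) = a * shift_down k f + shift_down k (a * ?r)"
      by (simp add: shift_down_add shift_down_mvar_mult)
    moreover have "shift_down k (a * ?r) \<odot>\<^bsub>J\<^esub> e = \<zero>\<^bsub>J\<^esub>" by (rule Vkill[OF sr])
    ultimately show ?thesis
      using jm(2)[of "a * shift_down k f" "shift_down k (a * ?r)" e] jm(4)[OF a, of "shift_down k f" e]
        shift_down_polys[OF Jp[OF f], of k] sr polys_mult[OF a] ec a jm(1)
      by (simp add: mon_ideal_def)
  qed
  have hhom: "shift_down k f \<odot>\<^bsub>J\<^esub> e \<in> hcomp J b" if f: "f \<in> Jd" "f \<in> hcomp ?A (b + ?s)" for f b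
  proof -
    have "mdeg d W m = b + ?s - W k" if "m \<in> Poly_Mapping.keys (shift_down k f)" for m
    proof -
      have "mdeg d W (m + Poly_Mapping.single k 1) = b + ?s" using that f by (auto simp: keys_shift_down)
      then show ?thesis using S(2) by (simp add: mdeg_add mdeg_single eq_diff_eq)
    qed
    then have "shift_down k f \<in> hcomp ?A (b + ?s - W k)" using shift_down_polys[OF Jp[OF f(1)]] by auto
    from J.hcomp_smult[OF this e] show ?thesis by (simp add: algebra_simps)
  qed
  have "h \<in> gr_hom ?A M J 0"
    unfolding gr_hom_def mod_hom_def
  proof (intro CollectI conjI allI ballI)
    show "h \<in> carrier M \<rightarrow>\<^sub>E carrier J" using jm(1)[OF shift_down_polys[OF Jp] ec] by (auto simp: h_def M_def)
    fix x y assume "x \<in> carrier M" "y \<in> carrier M"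
    then have xy: "x \<in> Jd" "y \<in> Jd" "x + y \<in> Jd" using Jsub by (auto simp: M_def gsubmodule_def)
    then show "h (x \<oplus>\<^bsub>M\<^esub> y) = h x \<oplus>\<^bsub>J\<^esub> h y"
      using jm(2)[OF shift_down_polys[OF Jp[OF xy(1)], of k] shift_down_polys[OF Jp[OF xy(2)], of k] ec]
      by (simp add: h_def M_def shift_down_add)
  next
    fix a x assume "a \<in> carrier ?A" "x \<in> carrier M"
    then have "a \<in> polys d" "x \<in> Jd" "a * x \<in> Jd" using Jsub by (auto simp: M_def gsubmodule_def)
    then show "h (a \<odot>\<^bsub>M\<^esub> x) = a \<odot>\<^bsub>J\<^esub> h x" using hlin by (simp add: h_def M_def)
  next
    fix b show "h ` hcomp M b \<subseteq> hcomp J (b + 0)" using hhom by (auto simp: M_def h_def)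
  qed
  moreover have "(\<lambda>f\<in>Jd. f) \<in> gr_hom ?A M N 0"
    using Jsub Jp by (auto simp: gr_hom_def mod_hom_def M_def N_def gsubmodule_def)
  moreover have "inj_on (\<lambda>f\<in>Jd. f) (carrier M)" by (auto simp: M_def inj_on_def)
  ultimately obtain E where E: "E \<in> gr_hom ?A N J 0" "\<forall>f\<in>carrier M. E ((\<lambda>f\<in>Jd. f) f) = h f"
    using inj gM gN unfolding graded_injective_def by blast
  have Eh: "E f = shift_down k f \<odot>\<^bsub>J\<^esub> e" if "f \<in> Jd" for f using E(2) that by (auto simp: M_def h_def)
  note Em = mod_homD[OF gr_homD(1)[OF E(1)]]
  have E1: "f \<odot>\<^bsub>J\<^esub> E 1 = E f" if "f \<in> polys d" for f using Em(3)[of f 1] that by (simp add: N_def)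
  have xk: "(mvar k :: 'k mpoly) \<in> Jd" using S(2) mvar_polys[OF S(2)] by (auto simp: Jd_def mon_ideal_def mvar_def)
  have xi: "(mvar i :: 'k mpoly) ^ n i \<in> Jd" if "i \<in> S" for i
  proof -
    have "?V (Poly_Mapping.single i (n i))" using that by (intro bexI[of _ i]) auto
    then show ?thesis
      using mvar_power_polys[OF subsetD[OF S(1) that]] by (simp add: Jd_def mon_ideal_def keys_mvar_power)
  qed
  have sk: "shift_down k (mvar k) = (1 :: 'k mpoly)" using shift_down_mvar_mult[of k "1 :: 'k mpoly"] by simp
  have si: "shift_down k (mvar i ^ n i) = (0 :: 'k mpoly)" if "i \<in> S" for i
  proof (rule poly_mapping_eqI)
    fix m
    have "Poly_Mapping.single i (n i) \<noteq> m + Poly_Mapping.single k 1"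
    proof
      assume "Poly_Mapping.single i (n i) = m + Poly_Mapping.single k 1"
      then have "Poly_Mapping.lookup (Poly_Mapping.single i (n i)) k = Poly_Mapping.lookup (m + Poly_Mapping.single k 1) k" by simp
      then show False using S(3) that by (auto simp: lookup_add lookup_single when_def split: if_splits)
    qed
    then show "Poly_Mapping.lookup (shift_down k (mvar i ^ n i)) m = Poly_Mapping.lookup (0 :: 'k mpoly) m"
      by (simp add: lookup_shift_down mvar_power lookup_single when_def)
  qed
  show ?thesis
  proof (intro bexI conjI ballI)
    show "E 1 \<in> carrier J" using Em(1)[of 1] by (simp add: N_def)
    show "mvar k \<odot>\<^bsub>J\<^esub> E 1 = e" using E1[OF Jp[OF xk]] Eh[OF xk] sk jm(5)[OF ec] by simp
    show "mvar i ^ n i \<odot>\<^bsub>J\<^esub> E 1 = \<zero>\<^bsub>J\<^esub>" if "i \<in> S" for i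
      using E1[OF Jp[OF xi[OF that]]] Eh[OF xi[OF that]] si[OF that] jm(6)[OF ec] by simp
  qed
qed

text \<open>Powers of variables are homogeneous scalars, so those that kill \<open>e\<close> kill
  its components; each component is divided and the quotients are added.\<close>

lemma injective_divisible:
  fixes W :: "nat \<Rightarrow> int ^ 'm" and J :: "('k::field mpoly, 'i, int ^ 'm) gmod"
  assumes inj: "graded_injective (poly_ring d W) J" and S: "S \<subseteq> {1..d}" "k \<in> {1..d}" "k \<notin> S"
    and e: "e \<in> carrier J" and kill: "\<forall>i\<in>S. \<exists>n. mvar i ^ n \<odot>\<^bsub>J\<^esub> e = \<zero>\<^bsub>J\<^esub>"
  shows "\<exists>e'\<in>carrier J. (\<forall>i\<in>S. \<exists>n. mvar i ^ n \<odot>\<^bsub>J\<^esub> e' = \<zero>\<^bsub>J\<^esub>) \<and> mvar k \<odot>\<^bsub>J\<^esub> e' = e"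
proof -
  let ?A = "poly_ring d W :: ('k mpoly, 'k mpoly, int ^ 'm) gmod"
  have gJ: "graded_module ?A J" using inj by (simp add: graded_injective_def)
  interpret J: graded_module ?A J by fact
  note jm = poly_module[OF J.module_axioms]
  have p: "(mvar i :: 'k mpoly) ^ m \<in> polys d" if "i \<in> {1..d}" for i m using mvar_power_polys[OF that] .
  have pk: "(mvar k :: 'k mpoly) \<in> polys d" using p[OF S(2), of 1] by simp
  obtain n where n: "\<forall>i\<in>S. mvar i ^ n i \<odot>\<^bsub>J\<^esub> e = \<zero>\<^bsub>J\<^esub>" using kill by metis
  let ?T = "{e \<in> carrier J. \<exists>e'\<in>carrier J. (\<forall>i\<in>S. mvar i ^ n i \<odot>\<^bsub>J\<^esub> e' = \<zero>\<^bsub>J\<^esub>) \<and> mvar k \<odot>\<^bsub>J\<^esub> e' = e}"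
  have "finsum J (hc J e) {g. hc J e g \<noteq> \<zero>\<^bsub>J\<^esub>} \<in> ?T"
  proof (rule finsum_closed_subset[OF J.M.abelian_group_axioms J.hc_props(2)[OF e]])
    show "\<zero>\<^bsub>J\<^esub> \<in> ?T"
      using jm(7)[OF pk] jm(7)[OF p] S(1) by (intro CollectI conjI bexI[of _ "\<zero>\<^bsub>J\<^esub>"]) auto
    fix x y assume "x \<in> ?T" "y \<in> ?T"
    then obtain x' y' where x': "x' \<in> carrier J" "\<forall>i\<in>S. mvar i ^ n i \<odot>\<^bsub>J\<^esub> x' = \<zero>\<^bsub>J\<^esub>" "mvar k \<odot>\<^bsub>J\<^esub> x' = x"
      and y': "y' \<in> carrier J" "\<forall>i\<in>S. mvar i ^ n i \<odot>\<^bsub>J\<^esub> y' = \<zero>\<^bsub>J\<^esub>" "mvar k \<odot>\<^bsub>J\<^esub> y' = y"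
      and c: "x \<in> carrier J" "y \<in> carrier J" by auto
    then show "x \<oplus>\<^bsub>J\<^esub> y \<in> ?T"
      using jm(3)[OF p x'(1) y'(1)] jm(3)[OF pk x'(1) y'(1)] S(1)
      by (intro CollectI conjI bexI[of _ "x' \<oplus>\<^bsub>J\<^esub> y'"]) auto
  next
    fix g
    have "mvar i ^ n i \<odot>\<^bsub>J\<^esub> hc J e g = \<zero>\<^bsub>J\<^esub>" if "i \<in> S" for i
    proof -
      have i: "i \<in> {1..d}" using that S(1) by auto
      have "mvar i ^ n i \<odot>\<^bsub>J\<^esub> hc J e g = hc J (mvar i ^ n i \<odot>\<^bsub>J\<^esub> e) (g + int (n i) *s W i)"
        by (rule hc_smult[OF gJ mvar_power_hcomp[OF i] _ e, symmetric]) (simp add: p[OF i])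
      then show ?thesis using n that hc_zero[OF gJ] by auto
    qed
    from injective_divisible_homogeneous[OF inj S J.hc_props(1)[OF e] this]
    show "hc J e g \<in> ?T" using J.hc_carrier[OF e] by auto
  qed auto
  then show ?thesis using J.hc_props(3)[OF e] by auto
qed

lemma resolution_div_complex:
  assumes "graded_injective_resolution (poly_ring d W) M I \<eta> \<delta>"
  shows "div_complex d W I \<delta>"
proof (rule div_complex.intro)
  fix j
  show "graded_module (poly_ring d W) (I j)" using assms by (auto simp: graded_injective_resolution_def graded_injective_def)
  show h: "\<delta> j \<in> gr_hom (poly_ring d W) (I j) (I (Suc j)) 0" using assms by (auto simp: graded_injective_resolution_def)
  show "\<delta> (Suc j) (\<delta> j x) = \<zero>\<^bsub>I (Suc (Suc j))\<^esub>" if "x \<in> carrier (I j)" for x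
    using assms that unfolding graded_injective_resolution_def by blast
  fix S k e
  assume S: "S \<subseteq> {1..d}" "k \<in> {1..d}" "k \<notin> S" "e \<in> carrier (I j)" "\<forall>i\<in>S. \<exists>n. mvar i ^ n \<odot>\<^bsub>I j\<^esub> e = \<zero>\<^bsub>I j\<^esub>"
  have inj: "graded_injective (poly_ring d W) (I j)" using assms by (auto simp: graded_injective_resolution_def)
  show "\<exists>e'\<in>carrier (I j). (\<forall>i\<in>S. \<exists>n. mvar i ^ n \<odot>\<^bsub>I j\<^esub> e' = \<zero>\<^bsub>I j\<^esub>) \<and> mvar k \<odot>\<^bsub>I j\<^esub> e' = e"
    by (rule injective_divisible[OF inj S])
qed

section \<open>Polynomials as coefficient functions\<close>

definition xs :: "(nat \<Rightarrow>\<^sub>0 nat) \<Rightarrow> nat \<Rightarrow> int" where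
  "xs b = (\<lambda>i. int (Poly_Mapping.lookup b i))"

lemma inj_xs: "inj xs"
  by (rule injI) (auto simp: xs_def fun_eq_iff intro: poly_mapping_eqI)

lemma xs_Lam_iff: "xs b \<in> Lam {} U \<longleftrightarrow> Poly_Mapping.keys b \<subseteq> U"
  by (auto simp: xs_def Lam_def in_keys_iff subset_iff)

lemma Lam_xs:
  assumes "a \<in> Lam {} U" "finite U"
  obtains b where "a = xs b" "Poly_Mapping.keys b \<subseteq> U"
proof -
  have "finite {i. nat (a i) \<noteq> 0}"
    by (rule finite_subset[OF _ assms(2)]) (use assms(1) in \<open>auto simp: Lam_def\<close>)
  then have l: "Poly_Mapping.lookup (Abs_poly_mapping (\<lambda>i. nat (a i))) = (\<lambda>i. nat (a i))" by simp
  have nn: "0 \<le> a i" for i using assms(1) by (cases "i \<in> U") (auto simp: Lam_def)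
  have a: "a = xs (Abs_poly_mapping (\<lambda>i. nat (a i)))"
    unfolding xs_def l using nn by auto
  then have "Poly_Mapping.keys (Abs_poly_mapping (\<lambda>i. nat (a i))) \<subseteq> U" using assms(1) xs_Lam_iff by metis
  with a show ?thesis using that by blast
qed

lemma zdeg_xs: "zdeg d W (xs b) = mdeg d W b"
  by (simp add: zdeg_def mdeg_def xs_def)

text \<open>The coefficient function of the polynomial 1. Acting on it turns a polynomial into its
  coefficient function, with the monomials outside \<open>U\<close> deleted; compatibility with
  products then comes from \<open>act_mult\<close>.\<close>

definition delta_zero :: "(nat \<Rightarrow> int) \<Rightarrow> 'k::field" where
  "delta_zero = (\<lambda>a. if a = (\<lambda>_. 0) then 1 else 0)"

lemma delta_zero_fns: "delta_zero \<in> fns (Lam {} U)"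
  by (auto simp: fns_def delta_zero_def Lam_def)

lemma act_delta_zero:
  fixes f :: "'k::field mpoly"
  shows "act (Lam {} U) f delta_zero (xs b) = (if Poly_Mapping.keys b \<subseteq> U then Poly_Mapping.lookup f b else 0)"
proof -
  have "delta_zero (xsub (xs b) b') = (if b' = b then 1 else (0 :: 'k))" for b'
  proof -
    have "xsub (xs b) b' = (\<lambda>_. 0) \<longleftrightarrow> b' = b"
      by (auto simp: xsub_def xs_def fun_eq_iff intro: poly_mapping_eqI)
    then show ?thesis by (simp add: delta_zero_def)
  qed
  then have "(\<Sum>b'\<in>Poly_Mapping.keys f. Poly_Mapping.lookup f b' * delta_zero (xsub (xs b) b')) =
    (\<Sum>b'\<in>Poly_Mapping.keys f. if b' = b then Poly_Mapping.lookup f b' else 0)"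
    by (intro sum.cong) auto
  also have "\<dots> = Poly_Mapping.lookup f b" by (simp add: in_keys_iff)
  finally show ?thesis by (simp add: act_def xs_Lam_iff)
qed

lemma act_delta_zero_eq:
  assumes "finite U" "\<phi> \<in> fns (Lam {} U)"
  shows "act (Lam {} U) f delta_zero = \<phi> \<longleftrightarrow> (\<forall>b. Poly_Mapping.keys b \<subseteq> U \<longrightarrow> Poly_Mapping.lookup f b = \<phi> (xs b))"
proof
  assume "act (Lam {} U) f delta_zero = \<phi>"
  then show "\<forall>b. Poly_Mapping.keys b \<subseteq> U \<longrightarrow> Poly_Mapping.lookup f b = \<phi> (xs b)" using act_delta_zero[of U f] by metis
next
  assume h: "\<forall>b. Poly_Mapping.keys b \<subseteq> U \<longrightarrow> Poly_Mapping.lookup f b = \<phi> (xs b)"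
  show "act (Lam {} U) f delta_zero = \<phi>"
  proof
    fix a
    show "act (Lam {} U) f delta_zero a = \<phi> a"
    proof (cases "a \<in> Lam {} U")
      case True
      then obtain b where "a = xs b" "Poly_Mapping.keys b \<subseteq> U" using assms(1) by (rule Lam_xs)
      then show ?thesis using h by (simp add: act_delta_zero)
    qed (use fns_outside[OF assms(2)] in \<open>simp add: act_def\<close>)
  qed
qed

text \<open>The monomial form of \<open>face_ideal\<close>, free of any reference to the
  grading.\<close>

definition fmon :: "nat \<Rightarrow> nat \<Rightarrow> 'k::field mpoly set" where
  "fmon d t = mon_ideal d (\<lambda>e. \<exists>i\<in>{1..t}. i \<in> Poly_Mapping.keys e)"

lemma fmon_gsubmodule: "gsubmodule (poly_ring d W) (poly_ring d W) (fmon d t)"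
  unfolding fmon_def by (rule mon_ideal_gsubmodule) (auto simp: keys_add_nat)

text \<open>This identifies A/F_t with the polynomials in x_(t+1), ..., x_d: a coset is determined
  by the coefficients at monomials in these variables.\<close>

lemma fmon_iff: "t \<le> d \<Longrightarrow> f \<in> polys d \<Longrightarrow>
    f \<in> fmon d t \<longleftrightarrow> (\<forall>b. Poly_Mapping.keys b \<subseteq> {t+1..d} \<longrightarrow> Poly_Mapping.lookup f b = 0)"
proof
  assume f: "f \<in> fmon d t"
  show "\<forall>b. Poly_Mapping.keys b \<subseteq> {t+1..d} \<longrightarrow> Poly_Mapping.lookup f b = 0"
  proof (intro allI impI, rule ccontr)
    fix b assume b: "Poly_Mapping.keys b \<subseteq> {t+1..d}" "Poly_Mapping.lookup f b \<noteq> 0"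
    then have "b \<in> Poly_Mapping.keys f" by (simp add: in_keys_iff)
    then obtain i where "i \<in> {1..t}" "i \<in> Poly_Mapping.keys b" using f by (auto simp: fmon_def mon_ideal_def)
    then show False using b by auto
  qed
next
  assume t: "t \<le> d" "f \<in> polys d" and h: "\<forall>b. Poly_Mapping.keys b \<subseteq> {t+1..d} \<longrightarrow> Poly_Mapping.lookup f b = 0"
  have "\<exists>i\<in>{1..t}. i \<in> Poly_Mapping.keys e" if e: "e \<in> Poly_Mapping.keys f" for e
  proof (rule ccontr)
    assume n: "\<not> (\<exists>i\<in>{1..t}. i \<in> Poly_Mapping.keys e)"
    have "Poly_Mapping.keys e \<subseteq> {t+1..d}"
    proof
      fix i assume i: "i \<in> Poly_Mapping.keys e"
      then have "i \<in> {1..d}" using polysD[OF t(2) e] by auto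
      moreover have "i \<notin> {1..t}" using n i by blast
      ultimately show "i \<in> {t+1..d}" by auto
    qed
    then show False using h e by (auto simp: in_keys_iff)
  qed
  then show "f \<in> fmon d t" using t(2) by (simp add: fmon_def mon_ideal_def)
qed

lemma poly_of_fns:
  assumes "\<phi> \<in> fns (Lam {} U)" "U \<subseteq> {1..d}"
  shows "\<exists>f\<in>polys d. \<forall>b. Poly_Mapping.lookup f b = \<phi> (xs b)"
proof -
  have "finite (xs -` {a. \<phi> a \<noteq> 0})" using assms by (intro finite_vimageI inj_xs) (auto simp: fns_def)
  then have l: "Poly_Mapping.lookup (Abs_poly_mapping (\<lambda>b. \<phi> (xs b))) = (\<lambda>b. \<phi> (xs b))" by (simp add: vimage_def)
  have "Abs_poly_mapping (\<lambda>b. \<phi> (xs b)) \<in> polys d"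
  proof (rule polysI)
    fix e assume "e \<in> Poly_Mapping.keys (Abs_poly_mapping (\<lambda>b. \<phi> (xs b)))"
    then have "\<phi> (xs e) \<noteq> 0" by (simp add: in_keys_iff l)
    then have "xs e \<in> Lam {} U" using fns_outside[OF assms(1)] by blast
    then show "Poly_Mapping.keys e \<subseteq> {1..d}" using assms(2) by (auto simp: xs_Lam_iff)
  qed
  then show ?thesis using l by metis
qed

lemma graded_module_fmon_quot: "graded_module (poly_ring d W) (gquot (poly_ring d W) (fmon d t))"
  by (rule graded_module_gquot[OF graded_module_poly_ring fmon_gsubmodule _ hcomp_poly_ring_carrier])
    (simp add: fmon_def mon_ideal_hc)

text \<open>Without torsion condition the complex is the resolution itself, so its cohomology is
  A/F_t in degree 0. The map \<open>\<theta>\<close> reads off the coefficients of a representative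
  at the monomials in x_(t+1), ..., x_d.\<close>

lemma resolution_rep0:
  fixes W :: "nat \<Rightarrow> int ^ 'm" and I :: "nat \<Rightarrow> ('k::field mpoly, 'i, int ^ 'm) gmod"
  assumes res: "graded_injective_resolution (poly_ring d W) (gquot (poly_ring d W) (fmon d t)) I \<eta> \<delta>" and t: "t \<le> d"
  shows "\<exists>\<theta>. div_complex.rep d W I \<delta> {} 0 (Lam {} {t+1..d}) \<theta>"
proof -
  let ?A = "poly_ring d W :: ('k mpoly, 'k mpoly, int ^ 'm) gmod" and ?F = "fmon d t :: 'k mpoly set"
  let ?M = "gquot ?A ?F" and ?L = "Lam {} {t+1..d}"
  interpret div_complex d W I \<delta> using resolution_div_complex[OF res] .
  interpret q: gquotient ?A ?A ?F
    using module_poly_ring fmon_gsubmodule by (intro gquotient.intro gquotient_axioms.intro)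
  have ab: "abelian_group ?A" using cring_poly_ring by (blast intro: ring.is_abelian_group cring.axioms)
  have gM: "graded_module ?A ?M" by (rule graded_module_fmon_quot)
  have \<eta>: "\<eta> \<in> gr_hom ?A ?M (I 0) 0" "inj_on \<eta> (carrier ?M)"
    "\<eta> ` carrier ?M = {x \<in> carrier (I 0). \<delta> 0 x = \<zero>\<^bsub>I 1\<^esub>}"
    and ex: "\<And>n. \<delta> n ` carrier (I n) = {x \<in> carrier (I (Suc n)). \<delta> (Suc n) x = \<zero>\<^bsub>I (Suc (Suc n))\<^esub>}"
    using res by (auto simp: graded_injective_resolution_def)
  note e = mod_homD[OF gr_homD(1)[OF \<eta>(1)]]
  let ?c = "\<lambda>f. ?F +>\<^bsub>?A\<^esub> f"
  have Z0: "Zc {} 0 = \<eta> ` carrier ?M" using \<eta>(3) by (auto simp: Zc_def G_def One_nat_def)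
  have cc: "?c f \<in> carrier ?M" if "f \<in> polys d" for f using q.coset_carrier[of f] that by simp
  have rp: "\<exists>f\<in>polys d. z = \<eta> (?c f)" if "z \<in> Zc {} 0" for z
    using that q.coset_ex unfolding Z0 by force
  define \<theta> where "\<theta> = (\<lambda>z. act ?L (SOME f. f \<in> polys d \<and> \<eta> (?c f) = z) delta_zero)"
  have zero_iff: "act ?L f delta_zero = (\<lambda>_. 0) \<longleftrightarrow> f \<in> ?F" if "f \<in> polys d" for f
    using act_delta_zero_eq[of "{t+1..d}" "\<lambda>_. 0 :: 'k" f] fmon_iff[OF t that] by (simp add: fns_def)
  have act_eq: "act ?L f' delta_zero = act ?L f delta_zero" if f: "f' \<in> polys d" "f \<in> polys d" "f' \<ominus>\<^bsub>?A\<^esub> f \<in> ?F" for f f'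
  proof -
    have "(f' \<ominus>\<^bsub>?A\<^esub> f) + f = f'" using abelian_group.diff_add[OF ab, of f' f] f by simp
    moreover have "f' \<ominus>\<^bsub>?A\<^esub> f \<in> polys d" using abelian_group.minus_closed[OF ab, of f' f] f by simp
    then have "act ?L (f' \<ominus>\<^bsub>?A\<^esub> f) delta_zero = (\<lambda>_. 0)" using zero_iff f(3) by blast
    ultimately show ?thesis using act_add_left[of ?L "f' \<ominus>\<^bsub>?A\<^esub> f" f delta_zero] by simp
  qed
  have th: "\<theta> (\<eta> (?c f)) = act ?L f delta_zero" if f: "f \<in> polys d" for f
  proof -
    let ?f = "SOME f'. f' \<in> polys d \<and> \<eta> (?c f') = \<eta> (?c f)"
    have f': "?f \<in> polys d \<and> \<eta> (?c ?f) = \<eta> (?c f)"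
      by (rule someI[of "\<lambda>f'. f' \<in> polys d \<and> \<eta> (?c f') = \<eta> (?c f)" f]) (use f in simp)
    then have "?c ?f = ?c f" using \<eta>(2) cc f unfolding inj_on_def by blast
    then have "?f \<ominus>\<^bsub>?A\<^esub> f \<in> ?F" using q.coset_eq_iff[of ?f f] f' f by simp
    then have "act ?L ?f delta_zero = act ?L f delta_zero" using act_eq f' f by blast
    then show ?thesis by (simp add: \<theta>_def)
  qed
  have "rep {} 0 ?L \<theta>"
    unfolding rep_def
  proof (intro conjI allI ballI impI)
    fix j :: nat assume "j \<noteq> 0"
    then obtain i where "j = Suc i" by (cases j) auto
    then show "Zc {} j \<subseteq> B {} j" using ex[of i] by (auto simp: Zc_def B_def G_def)
  next
    fix z assume "z \<in> Zc {} 0"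
    then obtain f where f: "f \<in> polys d" "z = \<eta> (?c f)" using rp by blast
    then show "\<theta> z \<in> fns ?L" using th act_fns[OF delta_zero_fns] by auto
    have "z \<in> B {} 0 \<longleftrightarrow> \<eta> (?c f) = \<eta> (\<zero>\<^bsub>?M\<^esub>)"
      using f(2) mod_hom_zero[OF graded_module.axioms(1)[OF gM] C.module_axioms gr_homD(1)[OF \<eta>(1)]] by (simp add: B_def)
    also have "\<dots> \<longleftrightarrow> ?c f = ?F"
      using inj_on_eq_iff[OF \<eta>(2) cc[OF f(1)], of ?F] q.coset_carrier[of "\<zero>\<^bsub>?A\<^esub>"] q.coset_zero by simp
    also have "\<dots> \<longleftrightarrow> f \<in> ?F" using q.coset_eq_zero_iff[of f] f(1) by simp
    finally show "\<theta> z = (\<lambda>_. 0) \<longleftrightarrow> z \<in> B {} 0" using zero_iff[OF f(1)] th[OF f(1)] f(2) by simp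
    fix z' assume "z' \<in> Zc {} 0"
    then obtain f' where f': "f' \<in> polys d" "z' = \<eta> (?c f')" using rp by blast
    have "z \<oplus>\<^bsub>I 0\<^esub> z' = \<eta> (?c (f + f'))" using e(2)[OF cc[OF f(1)] cc[OF f'(1)]] f f' q.coset_add[of f f'] by simp
    then show "\<theta> (z \<oplus>\<^bsub>I 0\<^esub> z') = (\<lambda>a. \<theta> z a + \<theta> z' a)"
      using th[OF polys_add[OF f(1) f'(1)]] th[OF f(1)] th[OF f'(1)] f f' by (simp add: act_add_left)
  next
    fix h :: "'k mpoly" and z assume h: "h \<in> polys d" and "z \<in> Zc {} 0"
    then obtain f where f: "f \<in> polys d" "z = \<eta> (?c f)" using rp by blast
    have "h \<odot>\<^bsub>I 0\<^esub> z = \<eta> (?c (h * f))" using e(3)[OF _ cc[OF f(1)], of h] h f q.coset_smult[of h f] by simp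
    then show "\<theta> (h \<odot>\<^bsub>I 0\<^esub> z) = act ?L h (\<theta> z)"
      using th[OF polys_mult[OF h f(1)]] th[OF f(1)] f by (simp add: act_mult[OF delta_zero_fns])
  next
    fix \<phi> :: "(nat \<Rightarrow> int) \<Rightarrow> 'k" assume \<phi>: "\<phi> \<in> fns ?L"
    have "{t+1..d} \<subseteq> {1..d}" by auto
    then obtain f where f: "f \<in> polys d" "\<forall>b. Poly_Mapping.lookup f b = \<phi> (xs b)" using poly_of_fns[OF \<phi>] by blast
    then have "act ?L f delta_zero = \<phi>" using act_delta_zero_eq[OF _ \<phi>] by auto
    then show "\<exists>z\<in>Zc {} 0. \<theta> z = \<phi>" using th[OF f(1)] cc[OF f(1)] unfolding Z0 by blast
  next
    fix g z a assume z: "z \<in> Zc {} 0" "z \<in> hcomp (I 0) g" "\<theta> z a \<noteq> 0"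
    then obtain X where X: "X \<in> carrier ?M" "z = \<eta> X" using Z0 by blast
    \<comment> \<open>The preimage is replaced by its component in degree \<open>g\<close>, which
      has a homogeneous polynomial as representative.\<close>
    have "\<eta> (hc ?M X g) = z"
      using gr_hom_hc[OF gM gm \<eta>(1) X(1), of g] C.hc_homog[OF z(2), of g] X(2) by simp
    moreover have "hc ?M X g \<in> hcomp ?M g" using graded_module.hc_props(1)[OF gM X(1)] .
    ultimately obtain f where f: "f \<in> hcomp ?A g" "z = \<eta> (?c f)" by auto
    then have nz: "act ?L f delta_zero a \<noteq> 0" using z(3) th[of f] by simp
    then have "a \<in> ?L" by (auto simp: act_def split: if_splits)
    then obtain b where b: "a = xs b" "Poly_Mapping.keys b \<subseteq> {t+1..d}" by (rule Lam_xs) simp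
    then have "b \<in> Poly_Mapping.keys f" using nz by (simp add: act_delta_zero in_keys_iff)
    then show "zdeg d W a = g" using f(1) b(1) by (simp add: zdeg_xs)
  qed
  then show ?thesis by blast
qed

text \<open>The variables of index above \<open>t\<close> are added first, by one regular step each,
  which brings the cohomology from degree 0 to degree \<open>d - t\<close>. The variables of index
  up to \<open>t\<close> do not occur in the exponents, so their steps are nilpotent ones.\<close>

lemma resolution_rep:
  fixes W :: "nat \<Rightarrow> int ^ 'm" and I :: "nat \<Rightarrow> ('k::field mpoly, 'i, int ^ 'm) gmod"
  assumes res: "graded_injective_resolution (poly_ring d W) (gquot (poly_ring d W) (fmon d t)) I \<eta> \<delta>" and t: "t \<le> d"
  shows "\<exists>\<theta>. div_complex.rep d W I \<delta> {1..d} (d - t) (Lam {t+1..d} {}) \<theta>"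
proof -
  interpret div_complex d W I \<delta> using resolution_div_complex[OF res] .
  have reg: "\<exists>\<theta>. rep {t+1..t+m} m (Lam {t+1..t+m} {t+m+1..d}) \<theta>" if "t + m \<le> d" for m
    using that
  proof (induction m)
    case 0
    then show ?case using resolution_rep0[OF res t] by simp
  next
    case (Suc m)
    then obtain \<theta> where r: "rep {t+1..t+m} m (Lam {t+1..t+m} {t+m+1..d}) \<theta>" by auto
    have "insert (t+m+1) {t+1..t+m} = {t+1..t+Suc m}" "{t+m+1..d} - {t+m+1} = {t+Suc m+1..d}" by auto
    then show ?case
      using rep_step_regular[OF _ _ _ _ _ r, of "t+m+1"] Suc.prems by auto
  qed
  have nil: "\<exists>\<theta>. rep ({t+1..d} \<union> {1..m}) (d - t) (Lam {t+1..d} {}) \<theta>" if "m \<le> t" for m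
    using that
  proof (induction m)
    case 0
    then show ?case using reg[of "d - t"] t by auto
  next
    case (Suc m)
    then obtain \<theta> where r: "rep ({t+1..d} \<union> {1..m}) (d - t) (Lam {t+1..d} {}) \<theta>" by auto
    have "insert (Suc m) ({t+1..d} \<union> {1..m}) = {t+1..d} \<union> {1..Suc m}" by auto
    then show ?case
      using rep_step_nilpotent[OF _ _ _ _ r, of "Suc m"] Suc.prems t by auto
  qed
  have "{t+1..d} \<union> {1..t} = {1..d}" using t by auto
  then show ?thesis using nil[of t] by simp
qed

lemma hc_gsub:
  assumes "graded_module R M" "gsubmodule R M S" "\<And>x g. x \<in> S \<Longrightarrow> hc M x g \<in> S"
    and R: "\<And>g. hcomp R g \<subseteq> carrier R" and x: "x \<in> S"
  shows "hc (gsub M S) x g = hc M x g"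
proof -
  interpret M: graded_module R M by fact
  interpret S: graded_module R "gsub M S" by (rule graded_module_gsub[OF assms(1-4)])
  have xc: "x \<in> carrier M" using assms(2) x by (auto simp: gsubmodule_def)
  let ?T = "{g. hc M x g \<noteq> \<zero>\<^bsub>M\<^esub>}"
  have "x = finsum (gsub M S) (hc M x) ?T"
    using M.hc_props[OF xc] assms(3)[OF x] by (subst finsum_gsub[OF M.module_axioms assms(2)]) auto
  from S.hc_eqI[OF M.hc_props(2)[OF xc] _ this, of g] show ?thesis
    using M.hc_props(1)[OF xc] assms(3)[OF x] by auto
qed

text \<open>A graded module identified with the inverse polynomials in x_(t+1), ..., x_d. The locale
  hides the resolution behind the coordinates \<open>\<theta>\<close>, so that modules with
  different element types can be compared. The degree condition is required in one direction;
  bijectivity of \<open>\<theta>\<close> gives the other.\<close>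

locale inverse_system =
  fixes d :: nat and W :: "nat \<Rightarrow> int ^ 'm" and t :: nat and Q :: "('k::field mpoly, 'b, int ^ 'm) gmod"
    and \<theta> :: "'b \<Rightarrow> (nat \<Rightarrow> int) \<Rightarrow> 'k"
  assumes t: "t \<le> d" and gQ: "graded_module (poly_ring d W) Q"
    and bij: "bij_betw \<theta> (carrier Q) (fns (Lam {t+1..d} {}))"
    and theta_add: "x \<in> carrier Q \<Longrightarrow> y \<in> carrier Q \<Longrightarrow> \<theta> (x \<oplus>\<^bsub>Q\<^esub> y) = (\<lambda>a. \<theta> x a + \<theta> y a)"
    and theta_smul: "f \<in> polys d \<Longrightarrow> x \<in> carrier Q \<Longrightarrow> \<theta> (f \<odot>\<^bsub>Q\<^esub> x) = act (Lam {t+1..d} {}) f (\<theta> x)"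
    and theta_homog: "x \<in> hcomp Q g \<Longrightarrow> \<theta> x a \<noteq> 0 \<Longrightarrow> zdeg d W a = g"

section \<open>Local cohomology as a module of inverse polynomials\<close>

context div_complex
begin

lemma Zc_gsubmodule: "gsubmodule (poly_ring d W) (C j) (Zc {1..d} j)"
  using Zc_closed[of "{1..d}"] by (auto simp: gsubmodule_def Zc_def G_def)

lemma Zc_hc: "x \<in> Zc {1..d} j \<Longrightarrow> hc (C j) x g \<in> Zc {1..d} j"
  using G_hc[of "{1..d}" x j g] gr_hom_hc[OF gm gm hom, of x j g] hc_zero[OF gm]
  by (auto simp: Zc_def G_carrier)

lemma B_gsubmodule: "gsubmodule (poly_ring d W) (gsub (C j) (Zc {1..d} j)) (B {1..d} j)"
proof (cases j)
  case 0
  then show ?thesis using B_sub_Zc[of "{1..d}" j] cm(7) by (auto simp: gsubmodule_def B_def)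
next
  case (Suc i)
  have "\<delta> i u \<oplus>\<^bsub>C j\<^esub> \<delta> i v \<in> \<delta> i ` G {1..d} i" if "u \<in> G {1..d} i" "v \<in> G {1..d} i" for u v
    using dl(2)[of u i v] G_closed(2)[of "{1..d}" u i v] that Suc by (auto simp: G_carrier intro: rev_image_eqI)
  moreover have "f \<odot>\<^bsub>C j\<^esub> \<delta> i u \<in> \<delta> i ` G {1..d} i" if "f \<in> polys d" "u \<in> G {1..d} i" for u f
    using dl(3)[of f u i] G_closed(4)[of "{1..d}" f u i] that Suc by (auto simp: G_carrier intro: rev_image_eqI)
  moreover have "\<zero>\<^bsub>C j\<^esub> \<in> \<delta> i ` G {1..d} i"
    using dl_zero[of i] G_closed(1)[of "{1..d}" i] Suc by (auto intro: rev_image_eqI)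
  ultimately show ?thesis using B_sub_Zc[of "{1..d}" j] Suc by (auto simp: gsubmodule_def B_def)
qed

lemma B_hc: "x \<in> B {1..d} j \<Longrightarrow> hc (C j) x g \<in> B {1..d} j"
proof (cases j)
  case 0
  then show "x \<in> B {1..d} j \<Longrightarrow> hc (C j) x g \<in> B {1..d} j" using hc_zero[OF gm] by (auto simp: B_def)
next
  case (Suc i)
  assume "x \<in> B {1..d} j"
  then obtain u where u: "u \<in> G {1..d} i" "x = \<delta> i u" using Suc by (auto simp: B_def)
  then have "hc (C j) x g = \<delta> i (hc (C i) u g)"
    using gr_hom_hc[OF gm gm hom, of u i g] Suc by (simp add: G_carrier)
  then show ?thesis using G_hc[OF _ u(1), of g] Suc by (auto simp: B_def)
qed

lemma torsion_carrier: "carrier (torsion (poly_ring d W) (max_ideal d W) (C j)) = G {1..d} j"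
  unfolding torsion_def G_def gsub_simps
  by (intro Collect_cong conj_cong refl torsion_max_iff[OF C.module_axioms])

text \<open>By \<open>torsion_max_iff\<close> the torsion subcomplex for the maximal ideal is
  \<open>G {1..d}\<close>; restricting to it and then to its cocycles amounts to restricting to the
  cocycles at once.\<close>

lemma local_cohomology_eq:
  "local_cohomology (poly_ring d W) (max_ideal d W) C \<delta> j = gquot (gsub (C j) (Zc {1..d} j)) (B {1..d} j)"
proof -
  have z: "\<zero>\<^bsub>torsion (poly_ring d W) (max_ideal d W) (C i)\<^esub> = \<zero>\<^bsub>C i\<^esub>" for i by (simp add: torsion_def)
  have e: "{x \<in> carrier (torsion (poly_ring d W) (max_ideal d W) (C j)). \<delta> j x = \<zero>\<^bsub>torsion (poly_ring d W) (max_ideal d W) (C (Suc j))\<^esub>} = Zc {1..d} j"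
    unfolding z torsion_carrier Zc_def ..
  have g: "gsub (torsion (poly_ring d W) (max_ideal d W) (C j)) (Zc {1..d} j) = gsub (C j) (Zc {1..d} j)"
  proof -
    have "Zc {1..d} j \<subseteq> carrier (torsion (poly_ring d W) (max_ideal d W) (C j))" unfolding torsion_carrier Zc_def by auto
    then have "(\<lambda>g. hcomp (torsion (poly_ring d W) (max_ideal d W) (C j)) g \<inter> Zc {1..d} j) = (\<lambda>g. hcomp (C j) g \<inter> Zc {1..d} j)"
      by (auto simp: torsion_def)
    then show ?thesis unfolding gsub_def[of _ "Zc {1..d} j"] by (simp add: torsion_def gsub_def)
  qed
  show ?thesis
    unfolding local_cohomology_def cohomology_def e g
    by (cases j) (simp_all only: B_def nat.case z torsion_carrier)
qed

lemma local_cohomology_inverse_system: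
  assumes rep: "rep {1..d} (d - t) (Lam {t+1..d} {}) \<theta>" and t: "t \<le> d"
  shows "\<exists>\<theta>. inverse_system d W t (local_cohomology (poly_ring d W) (max_ideal d W) C \<delta> (d - t)) \<theta>"
proof -
  let ?A = "poly_ring d W :: ('k mpoly, 'k mpoly, int ^ 'm) gmod"
  let ?r = "d - t" and ?D = "{1..d}" and ?L = "Lam {t+1..d} {}"
  let ?N = "gsub (C ?r) (Zc ?D ?r)"
  let ?c = "\<lambda>z. B ?D ?r +>\<^bsub>?N\<^esub> z"
  let ?Q = "gquot ?N (B ?D ?r)"
  note r = repD[OF rep]
  note sub = Zc_gsubmodule[of ?r]
  have gN: "graded_module ?A ?N"
    by (rule graded_module_gsub[OF gm sub Zc_hc hcomp_poly_ring_carrier])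
  interpret N: graded_module ?A ?N by (rule gN)
  interpret q: gquotient ?A ?N "B ?D ?r"
    using N.module_axioms B_gsubmodule by (intro gquotient.intro gquotient_axioms.intro)
  have BZ: "B ?D ?r \<subseteq> Zc ?D ?r" by (rule B_sub_Zc) simp
  have gQ: "graded_module ?A ?Q"
  proof (rule graded_module_gquot[OF gN B_gsubmodule _ hcomp_poly_ring_carrier])
    fix x g assume x: "x \<in> B ?D ?r"
    show "hc ?N x g \<in> B ?D ?r"
      using hc_gsub[OF gm sub Zc_hc hcomp_poly_ring_carrier subsetD[OF BZ x], of g] B_hc[OF x, of g] by simp
  qed
  have ex: "\<exists>z\<in>Zc ?D ?r. X = ?c z" if "X \<in> carrier ?Q" for X using q.coset_ex[OF that] by simp
  have cc: "?c z \<in> carrier ?Q" if "z \<in> Zc ?D ?r" for z using q.coset_carrier[of z] that by simp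
  define \<Theta> where "\<Theta> = (\<lambda>X. \<theta> (SOME z. z \<in> Zc ?D ?r \<and> ?c z = X))"
  \<comment> \<open>A coset is determined by the value of \<open>\<theta>\<close>, since the
    cocycles with value zero are the coboundaries; so the representative chosen in
    \<open>\<Theta>\<close> does not matter.\<close>
  have ceq: "?c z' = ?c z \<longleftrightarrow> \<theta> z' = \<theta> z" if z: "z \<in> Zc ?D ?r" "z' \<in> Zc ?D ?r" for z z'
  proof -
    have m: "z' \<ominus>\<^bsub>?N\<^esub> z = z' \<ominus>\<^bsub>C ?r\<^esub> z" using minus_gsub[OF C.module_axioms sub z(1)] by (simp add: a_minus_def)
    have "?c z' = ?c z \<longleftrightarrow> z' \<ominus>\<^bsub>C ?r\<^esub> z \<in> B ?D ?r" using q.coset_eq_iff[of z' z] z m by simp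
    also have "\<dots> \<longleftrightarrow> \<theta> (z' \<ominus>\<^bsub>C ?r\<^esub> z) = (\<lambda>_. 0)" using r(6)[OF Zc_closed(3)[OF _ z(2,1)]] by simp
    also have "\<dots> \<longleftrightarrow> \<theta> z' = \<theta> z" using rep_diff[OF _ rep z(2,1)] by (simp add: fun_eq_iff)
    finally show ?thesis .
  qed
  have th: "\<Theta> (?c z) = \<theta> z" if z: "z \<in> Zc ?D ?r" for z
  proof -
    have "(SOME z'. z' \<in> Zc ?D ?r \<and> ?c z' = ?c z) \<in> Zc ?D ?r \<and> ?c (SOME z'. z' \<in> Zc ?D ?r \<and> ?c z' = ?c z) = ?c z"
      by (rule someI[of "\<lambda>z'. z' \<in> Zc ?D ?r \<and> ?c z' = ?c z" z]) (use z in simp)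
    then show ?thesis unfolding \<Theta>_def using ceq z by blast
  qed
  have "inverse_system d W t ?Q \<Theta>"
  proof (rule inverse_system.intro[OF t gQ])
    show "bij_betw \<Theta> (carrier ?Q) (fns ?L)"
      unfolding bij_betw_def
    proof
      show "inj_on \<Theta> (carrier ?Q)"
      proof (rule inj_onI)
        fix X Y assume XY: "X \<in> carrier ?Q" "Y \<in> carrier ?Q" "\<Theta> X = \<Theta> Y"
        obtain z z' where "z \<in> Zc ?D ?r" "X = ?c z" "z' \<in> Zc ?D ?r" "Y = ?c z'" using ex[OF XY(1)] ex[OF XY(2)] by blast
        then show "X = Y" using XY(3) th[of z] th[of z'] ceq[of z' z] by simp
      qed
      show "\<Theta> ` carrier ?Q = fns ?L"
      proof
        show "\<Theta> ` carrier ?Q \<subseteq> fns ?L" using ex th r(2) by force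
        show "fns ?L \<subseteq> \<Theta> ` carrier ?Q"
        proof
          fix \<phi> :: "(nat \<Rightarrow> int) \<Rightarrow> 'k" assume "\<phi> \<in> fns ?L"
          then obtain z where "z \<in> Zc ?D ?r" "\<theta> z = \<phi>" using r(5) by blast
          then show "\<phi> \<in> \<Theta> ` carrier ?Q" using th[of z] cc[of z] by (metis image_eqI)
        qed
      qed
    qed
  next
    fix X Y assume "X \<in> carrier ?Q" "Y \<in> carrier ?Q"
    then obtain z z' where z: "z \<in> Zc ?D ?r" "X = ?c z" "z' \<in> Zc ?D ?r" "Y = ?c z'" using ex by metis
    then have "X \<oplus>\<^bsub>?Q\<^esub> Y = ?c (z \<oplus>\<^bsub>C ?r\<^esub> z')" using q.coset_add[of z z'] by simp
    then show "\<Theta> (X \<oplus>\<^bsub>?Q\<^esub> Y) = (\<lambda>a. \<Theta> X a + \<Theta> Y a)"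
      using th[OF z(1)] th[OF z(3)] th[OF Zc_closed(2)[OF _ z(1,3)]] r(3)[OF z(1,3)] z(2,4) by simp
  next
    fix f :: "'k mpoly" and X assume f: "f \<in> polys d" and "X \<in> carrier ?Q"
    then obtain z where z: "z \<in> Zc ?D ?r" "X = ?c z" using ex by metis
    then have "f \<odot>\<^bsub>?Q\<^esub> X = ?c (f \<odot>\<^bsub>C ?r\<^esub> z)" using q.coset_smult[of f z] f by simp
    then show "\<Theta> (f \<odot>\<^bsub>?Q\<^esub> X) = act ?L f (\<Theta> X)"
      using th[OF z(1)] th[OF Zc_closed(4)[OF _ f z(1)]] r(4)[OF f z(1)] z(2) by simp
  next
    fix X g a assume X: "X \<in> hcomp ?Q g" "\<Theta> X a \<noteq> 0"
    then obtain z where z: "z \<in> Zc ?D ?r" "z \<in> hcomp (C ?r) g" "X = ?c z" by auto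
    then show "zdeg d W a = g" using r(7)[OF z(1,2)] X(2) th[OF z(1)] by simp
  qed
  then show ?thesis unfolding local_cohomology_eq by blast
qed

end

lemma resolution_inverse_system:
  fixes W :: "nat \<Rightarrow> int ^ 'm" and I :: "nat \<Rightarrow> ('k::field mpoly, 'i, int ^ 'm) gmod"
  assumes res: "graded_injective_resolution (poly_ring d W) (gquot (poly_ring d W) (fmon d t)) I \<eta> \<delta>" and t: "t \<le> d"
  shows "\<exists>\<theta>. inverse_system d W t (local_cohomology (poly_ring d W) (max_ideal d W) I \<delta> (d - t)) \<theta>"
  using div_complex.local_cohomology_inverse_system[OF resolution_div_complex[OF res] _ t] resolution_rep[OF res t] by blast

text \<open>Pairing degrees with \<open>a\<close> gives an integer weight in which every variable
  counts at least 1, so each exponent is bounded by the weight of \<open>g\<close>.\<close>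

lemma finite_mdeg:
  fixes W :: "nat \<Rightarrow> int ^ 'm"
  assumes "positive_type d W"
  shows "finite {b. Poly_Mapping.keys b \<subseteq> {1..d} \<and> mdeg d W b = g}"
proof -
  obtain a :: "'m \<Rightarrow> int" where a: "\<forall>i\<in>{1..d}. (\<Sum>k\<in>UNIV. a k * W i $ k) > 0"
    using assms by (auto simp: positive_type_def)
  let ?N = "nat (\<Sum>k\<in>UNIV. a k * g $ k)"
  let ?S = "{b. Poly_Mapping.keys b \<subseteq> {1..d} \<and> mdeg d W b = g}"
  have bound: "Poly_Mapping.lookup b i \<le> ?N" if b: "b \<in> ?S" and i: "i \<in> {1..d}" for b i
  proof -
    have "(\<Sum>k\<in>UNIV. a k * g $ k) = (\<Sum>k\<in>UNIV. a k * (\<Sum>i\<in>{1..d}. int (Poly_Mapping.lookup b i) * W i $ k))"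
      using b by (auto simp: mdeg_def sum_component intro!: sum.cong)
    also have "\<dots> = (\<Sum>k\<in>UNIV. \<Sum>i\<in>{1..d}. int (Poly_Mapping.lookup b i) * (a k * W i $ k))"
      by (simp add: sum_distrib_left mult_ac)
    also have "\<dots> = (\<Sum>i\<in>{1..d}. \<Sum>k\<in>UNIV. int (Poly_Mapping.lookup b i) * (a k * W i $ k))"
      by (rule sum.swap)
    also have "\<dots> = (\<Sum>i\<in>{1..d}. int (Poly_Mapping.lookup b i) * (\<Sum>k\<in>UNIV. a k * W i $ k))"
      by (simp add: sum_distrib_left)
    finally have e: "(\<Sum>k\<in>UNIV. a k * g $ k) = \<dots>" .
    have "int (Poly_Mapping.lookup b i) \<le> int (Poly_Mapping.lookup b i) * (\<Sum>k\<in>UNIV. a k * W i $ k)"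
      using a i mult_left_mono[of 1 "\<Sum>k\<in>UNIV. a k * W i $ k" "int (Poly_Mapping.lookup b i)"] by fastforce
    also have "\<dots> \<le> (\<Sum>i\<in>{1..d}. int (Poly_Mapping.lookup b i) * (\<Sum>k\<in>UNIV. a k * W i $ k))"
      using a i by (intro member_le_sum) (auto intro!: mult_nonneg_nonneg intro: less_imp_le)
    finally show ?thesis using e by linarith
  qed
  have "inj_on (\<lambda>b. restrict (Poly_Mapping.lookup b) {1..d}) ?S"
  proof (rule inj_onI)
    fix b b' assume b: "b \<in> ?S" "b' \<in> ?S" and e: "restrict (Poly_Mapping.lookup b) {1..d} = restrict (Poly_Mapping.lookup b') {1..d}"
    show "b = b'"
    proof (rule poly_mapping_eqI)
      fix i
      have "i \<notin> Poly_Mapping.keys b" "i \<notin> Poly_Mapping.keys b'" if "i \<notin> {1..d}" using b that by auto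
      then show "Poly_Mapping.lookup b i = Poly_Mapping.lookup b' i"
        using fun_cong[OF e, of i] by (cases "i \<in> {1..d}") (simp_all add: in_keys_iff)
    qed
  qed
  moreover have "(\<lambda>b. restrict (Poly_Mapping.lookup b) {1..d}) ` ?S \<subseteq> {1..d} \<rightarrow>\<^sub>E {..?N}"
    using bound by (auto simp: PiE_iff)
  then have "finite ((\<lambda>b. restrict (Poly_Mapping.lookup b) {1..d}) ` ?S)"
    by (rule finite_subset) (simp add: finite_PiE)
  ultimately show ?thesis by (rule finite_imageD[rotated])
qed

section \<open>The residue pairing on inverse polynomials\<close>

context inverse_system
begin

sublocale Q: graded_module "poly_ring d W" Q by (rule gQ)

lemmas qm = poly_module[OF Q.module_axioms]

abbreviation "L \<equiv> Lam {t+1..d} {}"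

lemma theta_fns: "q \<in> carrier Q \<Longrightarrow> \<theta> q \<in> fns L"
  using bij by (auto simp: bij_betw_def)

lemma theta_ex: "\<phi> \<in> fns L \<Longrightarrow> \<exists>q\<in>carrier Q. \<theta> q = \<phi>"
  using bij unfolding bij_betw_def by (metis imageE)

lemma theta_inj: "q \<in> carrier Q \<Longrightarrow> q' \<in> carrier Q \<Longrightarrow> \<theta> q = \<theta> q' \<longleftrightarrow> q = q'"
  using bij unfolding bij_betw_def by (metis inj_on_eq_iff)

lemma theta_zero: "\<theta> \<zero>\<^bsub>Q\<^esub> = (\<lambda>_. 0)"
proof
  fix a
  have "\<theta> \<zero>\<^bsub>Q\<^esub> a = \<theta> \<zero>\<^bsub>Q\<^esub> a + \<theta> \<zero>\<^bsub>Q\<^esub> a"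
    using fun_cong[OF theta_add[OF Q.M.zero_closed Q.M.zero_closed], of a] Q.M.l_zero[OF Q.M.zero_closed] by simp
  then show "\<theta> \<zero>\<^bsub>Q\<^esub> a = 0" by (metis add_cancel_right_left)
qed

lemma theta_zero_iff: "q \<in> carrier Q \<Longrightarrow> \<theta> q = (\<lambda>_. 0) \<longleftrightarrow> q = \<zero>\<^bsub>Q\<^esub>"
  using theta_inj[of q "\<zero>\<^bsub>Q\<^esub>"] theta_zero by simp

lemma theta_hc: "q \<in> carrier Q \<Longrightarrow> \<theta> (hc Q q g) = (\<lambda>a. if zdeg d W a = g then \<theta> q a else 0)"
proof (induction q rule: Q.graded_induct)
  case zero
  then show ?case by (simp add: hc_zero[OF gQ] theta_zero fun_eq_iff)
next
  case (homog h x)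
  then show ?case using theta_homog[of x h] by (auto simp: Q.hc_homog[OF homog(1)] theta_zero fun_eq_iff)
next
  case (add x y)
  then show ?case
    using theta_add[OF Q.hc_carrier[OF add(1)] Q.hc_carrier[OF add(2)]] theta_add[OF add(1,2)]
    by (auto simp: hc_add[OF gQ add(1,2)])
qed

text \<open>By \<open>theta_hc\<close> an element whose coefficients all sit in degree
  \<open>g\<close> has the same coordinates as its component there.\<close>

lemma hcomp_iff: "q \<in> carrier Q \<Longrightarrow> q \<in> hcomp Q g \<longleftrightarrow> (\<forall>a. \<theta> q a \<noteq> 0 \<longrightarrow> zdeg d W a = g)"
proof
  assume q: "q \<in> carrier Q" and "\<forall>a. \<theta> q a \<noteq> 0 \<longrightarrow> zdeg d W a = g"
  then have "\<theta> (hc Q q g) = \<theta> q" by (auto simp: theta_hc fun_eq_iff)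
  then have "hc Q q g = q" using theta_inj Q.hc_carrier q by blast
  then show "q \<in> hcomp Q g" using Q.hc_props(1)[OF q, of g] by simp
qed (use theta_homog in blast)

text \<open>The coefficient at the exponent \<open>soc\<close> of \<open>1 / (x\<^sub>t\<^sub>+\<^sub>1 \<cdots> x\<^sub>d)\<close>, the generator of the socle, is the residue.\<close>

definition soc :: "nat \<Rightarrow> int" where
  "soc = (\<lambda>i. if i \<in> {t+1..d} then - 1 else 0)"

lemma soc_L: "soc \<in> L"
  by (auto simp: soc_def Lam_def)

lemma xsub_soc_L: "Poly_Mapping.keys b \<subseteq> {t+1..d} \<Longrightarrow> xsub soc b \<in> L"
  by (auto simp: soc_def Lam_def xsub_def in_keys_iff subset_iff)

lemma xsub_soc_inj: "xsub soc b = xsub soc b' \<longleftrightarrow> b = b'"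
  by (auto simp: xsub_def fun_eq_iff intro: poly_mapping_eqI)

text \<open>Reflection at \<open>soc\<close> matches the exponents of inverse monomials with those
  of the monomials in x_(t+1), ..., x_d; these form dual bases for the residue pairing.\<close>

lemma L_ex: 
  assumes "a \<in> L"
  obtains b where "a = xsub soc b" "Poly_Mapping.keys b \<subseteq> {t+1..d}"
proof -
  have "(\<lambda>i. soc i - a i) \<in> Lam {} {t+1..d}" using assms by (auto simp: Lam_def soc_def)
  then obtain b where b: "(\<lambda>i. soc i - a i) = xs b" "Poly_Mapping.keys b \<subseteq> {t+1..d}" by (rule Lam_xs) simp
  then have "a = xsub soc b" by (auto simp: xsub_def xs_def fun_eq_iff algebra_simps)
  then show ?thesis using b that by blast
qed

lemma zdeg_xsub: "zdeg d W (xsub a b) = zdeg d W a - mdeg d W b"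
  by (simp add: zdeg_def mdeg_def xsub_def vec.scale_left_diff_distrib sum_subtractf)

definition pt :: "(nat \<Rightarrow> int) \<Rightarrow> (nat \<Rightarrow> int) \<Rightarrow> 'k" where
  "pt a = (\<lambda>x. if x = a then 1 else 0)"

lemma pt_fns: "a \<in> L \<Longrightarrow> pt a \<in> fns L"
  by (auto simp: pt_def fns_def)

text \<open>Only the term of \<open>f\<close> at \<open>b\<close> carries the exponent
  \<open>xsub soc b\<close> to \<open>soc\<close>, so the residue reads off one coefficient.\<close>

lemma act_pt_soc: "act L f (\<lambda>x. if x = xsub soc b then c else 0) soc = Poly_Mapping.lookup f b * c"
proof -
  have "(\<Sum>b'\<in>Poly_Mapping.keys f. Poly_Mapping.lookup f b' * (if xsub soc b' = xsub soc b then c else 0)) =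
    (\<Sum>b'\<in>Poly_Mapping.keys f. if b' = b then Poly_Mapping.lookup f b' * c else 0)"
    by (intro sum.cong) (auto simp: xsub_soc_inj)
  also have "\<dots> = Poly_Mapping.lookup f b * c" by (simp add: in_keys_iff)
  finally show ?thesis by (simp add: act_def soc_L)
qed

text \<open>Testing on the inverse monomial dual to \<open>b\<close> isolates the coefficient of
  \<open>f\<close> at \<open>b\<close>. Conversely, multiplying by a monomial with a variable of
  index at most \<open>t\<close> leads out of \<open>L\<close>.\<close>

lemma annihilator:
  assumes f: "f \<in> polys d"
  shows "(\<forall>q\<in>carrier Q. f \<odot>\<^bsub>Q\<^esub> q = \<zero>\<^bsub>Q\<^esub>) \<longleftrightarrow> f \<in> fmon d t"
proof
  assume h: "\<forall>q\<in>carrier Q. f \<odot>\<^bsub>Q\<^esub> q = \<zero>\<^bsub>Q\<^esub>"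
  have "Poly_Mapping.lookup f b = 0" if b: "Poly_Mapping.keys b \<subseteq> {t+1..d}" for b
  proof -
    obtain q where q: "q \<in> carrier Q" "\<theta> q = pt (xsub soc b)" using theta_ex[OF pt_fns[OF xsub_soc_L[OF b]]] by blast
    have "\<theta> (f \<odot>\<^bsub>Q\<^esub> q) soc = 0" using h q(1) theta_zero by simp
    then have "act L f (pt (xsub soc b)) soc = 0" unfolding theta_smul[OF f q(1)] q(2) .
    then show ?thesis using act_pt_soc[of f b 1] by (simp add: pt_def)
  qed
  then show "f \<in> fmon d t" using fmon_iff[OF t f] by blast
next
  assume h: "f \<in> fmon d t"
  show "\<forall>q\<in>carrier Q. f \<odot>\<^bsub>Q\<^esub> q = \<zero>\<^bsub>Q\<^esub>"
  proof
    fix q assume q: "q \<in> carrier Q"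
    have "\<theta> q (xsub a b) = 0" if a: "a \<in> L" and b: "b \<in> Poly_Mapping.keys f" for a b
    proof -
      obtain i where i: "i \<in> {1..t}" "i \<in> Poly_Mapping.keys b" using h b by (auto simp: fmon_def mon_ideal_def)
      then have "xsub a b i \<noteq> 0" "i \<notin> {t+1..d}" using a by (auto simp: Lam_def xsub_def in_keys_iff)
      then have "xsub a b \<notin> L" by (auto simp: Lam_def)
      then show ?thesis using fns_outside[OF theta_fns[OF q]] by blast
    qed
    then have "act L f (\<theta> q) = (\<lambda>_. 0)" by (auto simp: act_def fun_eq_iff)
    then show "f \<odot>\<^bsub>Q\<^esub> q = \<zero>\<^bsub>Q\<^esub>" using theta_smul[OF f q] theta_zero_iff[OF qm(1)[OF f q]] by simp
  qed
qed

text \<open>An element is determined by the residues of its multiples by monomials, so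
  \<open>\<phi>\<close> is determined by the functional taking \<open>q\<close> to the residue of
  \<open>\<phi> q\<close>. Such a functional is in general the pairing with a formal power series;
  homogeneity of \<open>\<phi>\<close> confines the series to degree \<open>g\<close>, where there
  are finitely many monomials.\<close>

lemma endomorphism:
  assumes pos: "positive_type d W" and \<phi>: "\<phi> \<in> gr_hom (poly_ring d W) Q Q g"
  shows "\<exists>f\<in>hcomp (poly_ring d W) g. \<forall>q\<in>carrier Q. \<phi> q = f \<odot>\<^bsub>Q\<^esub> q"
proof -
  note h = mod_homD[OF gr_homD(1)[OF \<phi>], simplified]
  have "\<forall>b. \<exists>q. Poly_Mapping.keys b \<subseteq> {t+1..d} \<longrightarrow> q \<in> carrier Q \<and> \<theta> q = pt (xsub soc b)"
    using theta_ex[OF pt_fns[OF xsub_soc_L]] by blast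
  then obtain e where e: "\<And>b. Poly_Mapping.keys b \<subseteq> {t+1..d} \<Longrightarrow> e b \<in> carrier Q \<and> \<theta> (e b) = pt (xsub soc b)"
    by metis
  \<comment> \<open>The coefficient of \<open>f\<close> at \<open>b\<close> is the residue of \<open>\<phi>\<close> at the monomial dual to \<open>b\<close>.\<close>
  define l where "l = (\<lambda>b. if Poly_Mapping.keys b \<subseteq> {t+1..d} then \<theta> (\<phi> (e b)) soc else 0)"
  \<comment> \<open>The inverse monomial dual to \<open>b\<close> has degree
    \<open>zdeg d W soc - mdeg d W b\<close>. Its image has degree larger by \<open>g\<close>, which
    must equal \<open>zdeg d W soc\<close> if the residue is nonzero.\<close>
  have deg: "mdeg d W b = g" if "l b \<noteq> 0" for b
  proof -
    have b: "Poly_Mapping.keys b \<subseteq> {t+1..d}" "\<theta> (\<phi> (e b)) soc \<noteq> 0" using that by (auto simp: l_def split: if_splits)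
    have "e b \<in> hcomp Q (zdeg d W soc - mdeg d W b)"
      using e[OF b(1)] by (subst hcomp_iff) (auto simp: pt_def zdeg_xsub split: if_splits)
    then have "\<phi> (e b) \<in> hcomp Q (zdeg d W soc - mdeg d W b + g)" by (rule gr_homD(2)[OF \<phi>])
    from theta_homog[OF this b(2)] show ?thesis by (simp add: algebra_simps)
  qed
  have keys: "Poly_Mapping.keys b \<subseteq> {1..d}" if "l b \<noteq> 0" for b using that by (auto simp: l_def split: if_splits)
  have "finite {b. l b \<noteq> 0}"
    by (rule finite_subset[OF _ finite_mdeg[OF pos, of g]]) (use deg keys in auto)
  then have lk: "Poly_Mapping.lookup (Abs_poly_mapping l) = l" by simp
  define f where "f = Abs_poly_mapping l"
  have fl: "l e \<noteq> 0" if "e \<in> Poly_Mapping.keys f" for e using that by (simp add: f_def in_keys_iff lk)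
  have fp: "f \<in> polys d" by (rule polysI) (use fl keys in blast)
  then have f: "f \<in> hcomp (poly_ring d W) g" using fl deg by auto
  \<comment> \<open>Equality of residues by induction on a finite set containing the support; the
    term split off at \<open>a\<close> is a constant multiple of a dual inverse monomial.\<close>
  have main: "\<forall>q\<in>carrier Q. {a. \<theta> q a \<noteq> 0} \<subseteq> F \<longrightarrow> \<theta> (\<phi> q) soc = \<theta> (f \<odot>\<^bsub>Q\<^esub> q) soc" if "finite F" for F
    using that
  proof (induction F)
    case empty
    show ?case
    proof (intro ballI impI)
      fix q assume q: "q \<in> carrier Q" "{a. \<theta> q a \<noteq> 0} \<subseteq> {}"
      then have "q = \<zero>\<^bsub>Q\<^esub>" using theta_zero_iff[OF q(1)] by auto
      then show "\<theta> (\<phi> q) soc = \<theta> (f \<odot>\<^bsub>Q\<^esub> q) soc"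
        using mod_hom_zero[OF Q.module_axioms Q.module_axioms gr_homD(1)[OF \<phi>]] qm(7)[OF fp] by simp
    qed
  next
    case (insert a F)
    show ?case
    proof (intro ballI impI)
      fix q assume q: "q \<in> carrier Q" "{a. \<theta> q a \<noteq> 0} \<subseteq> insert a F"
      show "\<theta> (\<phi> q) soc = \<theta> (f \<odot>\<^bsub>Q\<^esub> q) soc"
      proof (cases "\<theta> q a = 0")
        case True
        then have "{a. \<theta> q a \<noteq> 0} \<subseteq> F" using q(2) by auto
        then show ?thesis using insert.IH q(1) by blast
      next
        case False
        then have "a \<in> L" using fns_outside[OF theta_fns[OF q(1)]] by blast
        then obtain b where b: "a = xsub soc b" "Poly_Mapping.keys b \<subseteq> {t+1..d}" by (rule L_ex)
        define c where "c = \<theta> q a"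
        let ?C = "Poly_Mapping.single 0 c :: 'k mpoly"
        have C: "?C \<in> polys d" by (rule single_polys) simp
        have ac: "act L ?C \<psi> = (\<lambda>x. if x \<in> L then c * \<psi> x else 0)" for \<psi>
          by (auto simp: act_single fun_eq_iff xsub_def)
        define q2 where "q2 = ?C \<odot>\<^bsub>Q\<^esub> e b"
        have q2: "q2 \<in> carrier Q" "\<theta> q2 = (\<lambda>x. if x = xsub soc b then c else 0)"
        proof -
          show "q2 \<in> carrier Q" using e[OF b(2)] qm(1)[OF C] by (simp add: q2_def)
          have "\<theta> q2 = (\<lambda>x. if x \<in> L then c * pt (xsub soc b) x else 0)"
            using e[OF b(2)] theta_smul[OF C, of "e b"] by (simp add: q2_def ac)
          also have "\<dots> = (\<lambda>x. if x = xsub soc b then c else 0)"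
            by (rule ext) (use \<open>a \<in> L\<close> b(1) in \<open>auto simp: pt_def\<close>)
          finally show "\<theta> q2 = (\<lambda>x. if x = xsub soc b then c else 0)" .
        qed
        have "(\<lambda>x. \<theta> q x - \<theta> q2 x) \<in> fns L"
        proof -
          have "{x. \<theta> q x - \<theta> q2 x \<noteq> 0} \<subseteq> {x. \<theta> q x \<noteq> 0} \<union> {x. \<theta> q2 x \<noteq> 0}" by auto
          then show ?thesis using theta_fns[OF q(1)] theta_fns[OF q2(1)]
            unfolding fns_def by (auto intro: finite_subset; metis diff_zero)
        qed
        then obtain q1 where q1: "q1 \<in> carrier Q" "\<theta> q1 = (\<lambda>x. \<theta> q x - \<theta> q2 x)" using theta_ex by blast
        have qe: "q = q1 \<oplus>\<^bsub>Q\<^esub> q2"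
          using theta_add[OF q1(1) q2(1)] q1(2) theta_inj[OF q(1) Q.M.a_closed[OF q1(1) q2(1)]] by simp
        have "\<theta> (\<phi> q1) soc = \<theta> (f \<odot>\<^bsub>Q\<^esub> q1) soc"
        proof -
          have "{a. \<theta> q1 a \<noteq> 0} \<subseteq> F" using q(2) q1(2) q2(2) b(1) by (auto simp: c_def split: if_splits)
          then show ?thesis using insert.IH q1(1) by blast
        qed
        moreover have "\<theta> (\<phi> q2) soc = \<theta> (f \<odot>\<^bsub>Q\<^esub> q2) soc"
        proof -
          have "\<theta> (\<phi> q2) soc = c * l b"
            using h(3)[OF C, of "e b"] theta_smul[OF C h(1)] e[OF b(2)] b(2) soc_L by (simp add: q2_def ac l_def)
          moreover have "\<theta> (f \<odot>\<^bsub>Q\<^esub> q2) soc = l b * c"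
            using theta_smul[OF fp q2(1)] q2(2) act_pt_soc[of f b c] by (simp add: f_def lk)
          ultimately show ?thesis by simp
        qed
        ultimately show ?thesis
          unfolding qe using h(2)[OF q1(1) q2(1)] qm(3)[OF fp q1(1) q2(1)] theta_add[OF h(1)[OF q1(1)] h(1)[OF q2(1)]]
            theta_add[OF qm(1)[OF fp q1(1)] qm(1)[OF fp q2(1)]] by simp
      qed
    qed
  qed
  have soc: "\<theta> (\<phi> q) soc = \<theta> (f \<odot>\<^bsub>Q\<^esub> q) soc" if "q \<in> carrier Q" for q
    using main[of "{a. \<theta> q a \<noteq> 0}"] theta_fns[OF that] that by (auto simp: fns_def)
  have "\<phi> q = f \<odot>\<^bsub>Q\<^esub> q" if q: "q \<in> carrier Q" for q
  proof -
    \<comment> \<open>The coefficient at \<open>xsub soc b\<close> is the residue after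
      multiplication by the monomial \<open>b\<close>, and this multiplication commutes with
      \<open>\<phi>\<close> and with \<open>f\<close>.\<close>
    have "\<theta> (\<phi> q) a = \<theta> (f \<odot>\<^bsub>Q\<^esub> q) a" for a
    proof (cases "a \<in> L")
      case True
      then obtain b where b: "a = xsub soc b" "Poly_Mapping.keys b \<subseteq> {t+1..d}" by (rule L_ex)
      let ?X = "Poly_Mapping.single b 1 :: 'k mpoly"
      have X: "?X \<in> polys d" using b(2) by (intro single_polys) auto
      have c: "\<theta> q' a = \<theta> (?X \<odot>\<^bsub>Q\<^esub> q') soc" if "q' \<in> carrier Q" for q'
        using theta_smul[OF X that] soc_L b(1) by (simp add: act_single)
      have "\<theta> (\<phi> q) a = \<theta> (f \<odot>\<^bsub>Q\<^esub> (?X \<odot>\<^bsub>Q\<^esub> q)) soc"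
        using c[OF h(1)[OF q]] h(3)[OF X q] soc[OF qm(1)[OF X q]] by simp
      also have "f \<odot>\<^bsub>Q\<^esub> (?X \<odot>\<^bsub>Q\<^esub> q) = ?X \<odot>\<^bsub>Q\<^esub> (f \<odot>\<^bsub>Q\<^esub> q)"
        using qm(4)[OF fp X q] qm(4)[OF X fp q] by (simp add: mult.commute)
      finally show ?thesis using c[OF qm(1)[OF fp q]] by simp
    qed (use fns_outside[OF theta_fns[OF h(1)[OF q]]] fns_outside[OF theta_fns[OF qm(1)[OF fp q]]] in simp)
    then show ?thesis using theta_inj[OF h(1)[OF q] qm(1)[OF fp q]] by auto
  qed
  then show ?thesis using f by blast
qed

text \<open>Lowering the exponent at \<open>k\<close> by one never leaves \<open>L\<close>, so an
  inverse polynomial can be divided by x_k term by term.\<close>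

lemma mvar_surj:
  assumes k: "k \<in> {t+1..d}" and q: "q \<in> carrier Q"
  shows "\<exists>q'\<in>carrier Q. mvar k \<odot>\<^bsub>Q\<^esub> q' = q"
proof -
  let ?\<psi> = "\<lambda>a. \<theta> q (a(k := a k + 1))"
  have kp: "(mvar k :: 'k mpoly) \<in> polys d" using mvar_polys[of k d] k by auto
  have "{a. ?\<psi> a \<noteq> 0} \<subseteq> (\<lambda>b. b(k := b k - 1)) ` {b. \<theta> q b \<noteq> 0}"
    by (rule subsetI, rule_tac x = "x(k := x k + 1)" in image_eqI) auto
  moreover have "a \<in> L" if "?\<psi> a \<noteq> 0" for a
  proof -
    have "a(k := a k + 1) \<in> L" using fns_outside[OF theta_fns[OF q]] that by blast
    then show ?thesis using k by (auto simp: Lam_def split: if_splits)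
  qed
  ultimately have "?\<psi> \<in> fns L" using theta_fns[OF q] by (auto simp: fns_def intro: finite_subset)
  then obtain q' where q': "q' \<in> carrier Q" "\<theta> q' = ?\<psi>" using theta_ex by blast
  have "act L (mvar k ^ 1) ?\<psi> = \<theta> q"
    unfolding act_mvar_power using fns_outside[OF theta_fns[OF q]] by auto
  then have "\<theta> (mvar k \<odot>\<^bsub>Q\<^esub> q') = \<theta> q" using theta_smul[OF kp q'(1)] q'(2) by simp
  then show ?thesis using theta_inj[OF qm(1)[OF kp q'(1)] q] q'(1) by blast
qed

text \<open>x_k annihilates an inverse monomial exactly when it raises the exponent at
  \<open>k\<close> to 0; the other monomials stay distinct, so nothing cancels.\<close>

lemma mvar_kernel:
  assumes k: "k \<in> {t+1..d}" and q: "q \<in> carrier Q"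
  shows "mvar k \<odot>\<^bsub>Q\<^esub> q = \<zero>\<^bsub>Q\<^esub> \<longleftrightarrow> (\<forall>a. \<theta> q a \<noteq> 0 \<longrightarrow> a k = - 1)"
proof -
  have kp: "(mvar k :: 'k mpoly) \<in> polys d" using mvar_polys[of k d] k by auto
  have "mvar k \<odot>\<^bsub>Q\<^esub> q = \<zero>\<^bsub>Q\<^esub> \<longleftrightarrow> act L (mvar k ^ 1) (\<theta> q) = (\<lambda>_. 0)"
    using theta_zero_iff[OF qm(1)[OF kp q]] theta_smul[OF kp q] by simp
  also have "\<dots> \<longleftrightarrow> (\<forall>a\<in>L. \<theta> q (a(k := a k - 1)) = 0)"
    unfolding act_mvar_power by (auto simp: fun_eq_iff)
  also have "\<dots> \<longleftrightarrow> (\<forall>a. \<theta> q a \<noteq> 0 \<longrightarrow> a k = - 1)"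
  proof
    assume h: "\<forall>a\<in>L. \<theta> q (a(k := a k - 1)) = 0"
    show "\<forall>a. \<theta> q a \<noteq> 0 \<longrightarrow> a k = - 1"
    proof (intro allI impI, rule ccontr)
      fix a assume a: "\<theta> q a \<noteq> 0" "a k \<noteq> - 1"
      then have "a \<in> L" using fns_outside[OF theta_fns[OF q]] by blast
      moreover from this have "a k < 0" using k by (auto simp: Lam_def)
      then have "a k + 1 < 0" using a(2) by linarith
      ultimately have "a(k := a k + 1) \<in> L" using k by (auto simp: Lam_def)
      from bspec[OF h this] show False using a(1) by simp
    qed
  next
    assume h: "\<forall>a. \<theta> q a \<noteq> 0 \<longrightarrow> a k = - 1"
    show "\<forall>a\<in>L. \<theta> q (a(k := a k - 1)) = 0"
    proof
      fix a assume a: "a \<in> L"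
      then have "a k < 0" using k by (auto simp: Lam_def)
      then show "\<theta> q (a(k := a k - 1)) = 0" using spec[OF h, of "a(k := a k - 1)"] by auto
    qed
  qed
  finally show ?thesis .
qed

end

text \<open>The embedding multiplies by the inverse of x_(t+1): the exponent at \<open>t + 1\<close>
  changes from 0 to -1. This accounts for the degree \<open>- W (t + 1)\<close>, and the image is
  the kernel found in \<open>mvar_kernel\<close>.\<close>

lemma connecting_map:
  fixes W :: "nat \<Rightarrow> int ^ 'm" and Q :: "('k::field mpoly, 'b, int ^ 'm) gmod"
    and Q' :: "('k mpoly, 'c, int ^ 'm) gmod"
  assumes "inverse_system d W t Q \<theta>" "inverse_system d W (t + 1) Q' \<theta>'"
  shows "\<exists>i\<in>gr_hom (poly_ring d W) Q' Q (- W (t + 1)). inj_on i (carrier Q') \<and>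
    i ` carrier Q' = {q \<in> carrier Q. mvar (t + 1) \<odot>\<^bsub>Q\<^esub> q = \<zero>\<^bsub>Q\<^esub>}"
proof -
  interpret S: inverse_system d W t Q \<theta> by fact
  interpret S': inverse_system d W "t + 1" Q' \<theta>' by fact
  let ?k = "t + 1"
  let ?L = "Lam {t+1..d} {}" and ?L' = "Lam {t+1+1..d} {}"
  have k: "?k \<in> {t+1..d}" using S'.t by auto
  have down: "a(?k := 0) \<in> ?L' \<longleftrightarrow> a \<in> ?L" if "a ?k = - 1" for a
  proof
    assume h: "a(?k := 0) \<in> ?L'"
    show "a \<in> ?L"
      unfolding Lam_def
    proof (intro CollectI conjI ballI allI impI)
      fix i assume "i \<in> {t+1..d}"
      then show "a i < 0" using h that by (cases "i = ?k") (auto simp: Lam_def)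
    next
      fix i assume "i \<notin> {t+1..d} \<union> {}"
      moreover from this have "i \<noteq> ?k" using k by auto
      ultimately show "a i = 0" using h by (auto simp: Lam_def split: if_splits)
    qed auto
  next
    assume "a \<in> ?L"
    then show "a(?k := 0) \<in> ?L'" using k by (auto simp: Lam_def)
  qed
  define emb where "emb = (\<lambda>\<phi> (a :: nat \<Rightarrow> int). if a ?k = - 1 then \<phi> (a(?k := 0)) else (0 :: 'k))"
  have ed: "emb \<phi> a = (if a ?k = - 1 then \<phi> (a(?k := 0)) else 0)" for \<phi> a by (simp add: emb_def)
  have emb_fns: "emb \<phi> \<in> fns ?L" if \<phi>: "\<phi> \<in> fns ?L'" for \<phi>
  proof -
    have "{a. emb \<phi> a \<noteq> 0} \<subseteq> (\<lambda>b. b(?k := - 1)) ` {b. \<phi> b \<noteq> 0}"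
      by (rule subsetI, rule_tac x = "x(?k := 0)" in image_eqI) (auto simp: emb_def split: if_splits)
    moreover have "a \<in> ?L" if "emb \<phi> a \<noteq> 0" for a
      using that down[of a] fns_outside[OF \<phi>, of "a(?k := 0)"] by (auto simp: emb_def split: if_splits)
    ultimately show ?thesis using \<phi> by (auto simp: fns_def intro: finite_subset)
  qed
  \<comment> \<open>A monomial containing x_(t+1) contributes 0 on both sides: on the left because
    the exponent leaves \<open>?L'\<close>, on the right because \<open>emb\<close> is then
    evaluated at an exponent below -1. Other monomials do not touch the coordinate
    \<open>t + 1\<close>.\<close>
  have emb_act: "emb (act ?L' f \<phi>) = act ?L f (emb \<phi>)" if \<phi>: "\<phi> \<in> fns ?L'" for f \<phi>
  proof
    fix a
    show "emb (act ?L' f \<phi>) a = act ?L f (emb \<phi>) a"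
    proof (cases "a \<in> ?L")
      case aL: True
      then have ak: "a ?k < 0" using k by (auto simp: Lam_def)
      show ?thesis
      proof (cases "a ?k = - 1")
        case True
        have "emb \<phi> (xsub a b) = \<phi> (xsub (a(?k := 0)) b)" for b
        proof (cases "Poly_Mapping.lookup b ?k = 0")
          case b0: True
          have "(xsub a b)(?k := 0) = xsub (a(?k := 0)) b" using b0 by (auto simp: xsub_def)
          then show ?thesis using True b0 by (simp add: emb_def xsub_def)
        next
          case False
          then have "xsub (a(?k := 0)) b \<notin> ?L'" by (auto simp: Lam_def xsub_def intro!: exI[of _ ?k])
          then show ?thesis using fns_outside[OF \<phi>] True False by (simp add: emb_def xsub_def)
        qed
        then show ?thesis using aL True down[of a] unfolding ed[of "act ?L' f \<phi>" a] by (simp add: act_def)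
      next
        case False
        then have "emb \<phi> (xsub a b) = 0" for b using ak by (simp add: emb_def xsub_def)
        then show ?thesis using False unfolding ed[of "act ?L' f \<phi>" a] by (simp add: act_def)
      qed
    next
      case False
      then show ?thesis using down[of a] by (auto simp: emb_def act_def)
    qed
  qed
  have "\<forall>q'. \<exists>q. q' \<in> carrier Q' \<longrightarrow> q \<in> carrier Q \<and> \<theta> q = emb (\<theta>' q')"
    using S.theta_ex emb_fns S'.theta_fns by blast
  then obtain j where j: "\<And>q'. q' \<in> carrier Q' \<Longrightarrow> j q' \<in> carrier Q \<and> \<theta> (j q') = emb (\<theta>' q')" by metis
  define i where "i = restrict j (carrier Q')"
  have ii: "i q' \<in> carrier Q" "\<theta> (i q') = emb (\<theta>' q')" if "q' \<in> carrier Q'" for q' using j[OF that] that by (auto simp: i_def)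
  have "i \<in> gr_hom (poly_ring d W) Q' Q (- W ?k)"
    unfolding gr_hom_def mod_hom_def
  proof (intro CollectI conjI allI ballI)
    show "i \<in> carrier Q' \<rightarrow>\<^sub>E carrier Q" using ii(1) by (auto simp: i_def)
    fix x y assume xy: "x \<in> carrier Q'" "y \<in> carrier Q'"
    then have "\<theta> (i (x \<oplus>\<^bsub>Q'\<^esub> y)) = \<theta> (i x \<oplus>\<^bsub>Q\<^esub> i y)"
      using ii(2)[OF S'.Q.M.a_closed[OF xy]] S'.theta_add[OF xy] S.theta_add[OF ii(1)[OF xy(1)] ii(1)[OF xy(2)]]
      by (auto simp: ii(2) emb_def fun_eq_iff)
    then show "i (x \<oplus>\<^bsub>Q'\<^esub> y) = i x \<oplus>\<^bsub>Q\<^esub> i y" using S.theta_inj ii(1) xy S.Q.M.a_closed S'.Q.M.a_closed by metis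
  next
    fix f :: "'k mpoly" and x assume "f \<in> carrier (poly_ring d W)" and x: "x \<in> carrier Q'"
    then have f: "f \<in> polys d" by simp
    have "\<theta> (i (f \<odot>\<^bsub>Q'\<^esub> x)) = \<theta> (f \<odot>\<^bsub>Q\<^esub> i x)"
      using ii(2)[OF S'.qm(1)[OF f x]] S'.theta_smul[OF f x] S.theta_smul[OF f ii(1)[OF x]] ii(2)[OF x]
        emb_act[OF S'.theta_fns[OF x]] by simp
    then show "i (f \<odot>\<^bsub>Q'\<^esub> x) = f \<odot>\<^bsub>Q\<^esub> i x" using S.theta_inj ii(1) x f S.qm(1) S'.qm(1) by metis
  next
    fix g
    show "i ` hcomp Q' g \<subseteq> hcomp Q (g + - W ?k)"
    proof
      fix y assume "y \<in> i ` hcomp Q' g"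
      then obtain x where x: "x \<in> hcomp Q' g" "y = i x" by auto
      then have xc: "x \<in> carrier Q'" by (rule_tac S'.Q.hcomp_carrier)
      have "zdeg d W a = g + - W ?k" if "\<theta> y a \<noteq> 0" for a
      proof -
        have a: "a ?k = - 1" "\<theta>' x (a(?k := 0)) \<noteq> 0" using that x(2) ii(2)[OF xc] by (auto simp: emb_def split: if_splits)
        have "a(?k := 0) = a(?k := a ?k + 1)" using a(1) by simp
        then have "zdeg d W a + 1 *s W ?k = g"
          using S'.theta_homog[OF x(1) a(2)] zdeg_shift[of ?k d W a 1] k by simp
        then show ?thesis by (simp add: algebra_simps)
      qed
      then show "y \<in> hcomp Q (g + - W ?k)" using S.hcomp_iff[OF ii(1)[OF xc]] x(2) by simp
    qed
  qed
  moreover have "inj_on i (carrier Q')"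
  proof (rule inj_onI)
    fix x y assume xy: "x \<in> carrier Q'" "y \<in> carrier Q'" "i x = i y"
    then have e: "emb (\<theta>' x) = emb (\<theta>' y)" using ii(2) by metis
    have "\<theta>' x a = \<theta>' y a" for a
    proof (cases "a ?k = 0")
      case True
      then show ?thesis using fun_cong[OF e, of "a(?k := - 1)"] by (simp add: emb_def) (metis fun_upd_triv)
    next
      case False
      then have "a \<notin> ?L'" by (auto simp: Lam_def intro!: exI[of _ ?k])
      then show ?thesis using fns_outside[OF S'.theta_fns] xy by simp
    qed
    then show "x = y" using S'.theta_inj[OF xy(1,2)] by auto
  qed
  moreover have "i ` carrier Q' = {q \<in> carrier Q. mvar ?k \<odot>\<^bsub>Q\<^esub> q = \<zero>\<^bsub>Q\<^esub>}"
  proof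
    show "i ` carrier Q' \<subseteq> {q \<in> carrier Q. mvar ?k \<odot>\<^bsub>Q\<^esub> q = \<zero>\<^bsub>Q\<^esub>}"
      using ii S.mvar_kernel[OF k] by (auto simp: emb_def split: if_splits)
    show "{q \<in> carrier Q. mvar ?k \<odot>\<^bsub>Q\<^esub> q = \<zero>\<^bsub>Q\<^esub>} \<subseteq> i ` carrier Q'"
    proof
      fix q assume "q \<in> {q \<in> carrier Q. mvar ?k \<odot>\<^bsub>Q\<^esub> q = \<zero>\<^bsub>Q\<^esub>}"
      then have q: "q \<in> carrier Q" "\<forall>a. \<theta> q a \<noteq> 0 \<longrightarrow> a ?k = - 1" using S.mvar_kernel[OF k] by auto
      define \<psi> where "\<psi> = (\<lambda>a. if a ?k = 0 then \<theta> q (a(?k := - 1)) else 0)"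
      have "{a. \<psi> a \<noteq> 0} \<subseteq> (\<lambda>b. b(?k := 0)) ` {b. \<theta> q b \<noteq> 0}"
        by (rule subsetI, rule_tac x = "x(?k := - 1)" in image_eqI) (auto simp: \<psi>_def split: if_splits)
      moreover have "a \<in> ?L'" if "\<psi> a \<noteq> 0" for a
      proof -
        have a: "a ?k = 0" "\<theta> q (a(?k := - 1)) \<noteq> 0" using that by (auto simp: \<psi>_def split: if_splits)
        then have "a(?k := - 1) \<in> ?L" using fns_outside[OF S.theta_fns[OF q(1)]] by blast
        then have "(a(?k := - 1))(?k := 0) \<in> ?L'" using down[of "a(?k := - 1)"] by simp
        then show ?thesis using a(1) by (metis fun_upd_triv fun_upd_upd)
      qed
      ultimately have "\<psi> \<in> fns ?L'" using S.theta_fns[OF q(1)] by (auto simp: fns_def intro: finite_subset)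
      then obtain q' where q': "q' \<in> carrier Q'" "\<theta>' q' = \<psi>" using S'.theta_ex by blast
      have "emb \<psi> a = \<theta> q a" for a
        using q(2) by (cases "a ?k = - 1") (auto simp: emb_def \<psi>_def, metis fun_upd_triv)
      then have "\<theta> (i q') = \<theta> q" using ii(2)[OF q'(1)] q'(2) by auto
      then show "q \<in> i ` carrier Q'" using S.theta_inj[OF ii(1)[OF q'(1)] q(1)] q'(1) by auto
    qed
  qed
  ultimately show ?thesis by blast
qed

section \<open>Free modules and the internal Hom\<close>

lemma gr_hom_gshift: "gr_hom R M (gshift N c) s = gr_hom R M N (s + c)"
  by (simp add: gr_hom_def mod_hom_def add.assoc)

lemma gr_homI:
  assumes "f \<in> extensional (carrier M)" "\<And>x. x \<in> carrier M \<Longrightarrow> f x \<in> carrier N"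
    "\<And>x y. x \<in> carrier M \<Longrightarrow> y \<in> carrier M \<Longrightarrow> f (x \<oplus>\<^bsub>M\<^esub> y) = f x \<oplus>\<^bsub>N\<^esub> f y"
    "\<And>a x. a \<in> carrier R \<Longrightarrow> x \<in> carrier M \<Longrightarrow> f (a \<odot>\<^bsub>M\<^esub> x) = a \<odot>\<^bsub>N\<^esub> f x"
    "\<And>g x. x \<in> hcomp M g \<Longrightarrow> f x \<in> hcomp N (g + s)"
  shows "f \<in> gr_hom R M N s"
  using assms by (auto simp: gr_hom_def mod_hom_def PiE_def)

lemma mod_homI:
  assumes "f \<in> extensional (carrier M)" "\<And>x. x \<in> carrier M \<Longrightarrow> f x \<in> carrier N"
    "\<And>x y. x \<in> carrier M \<Longrightarrow> y \<in> carrier M \<Longrightarrow> f (x \<oplus>\<^bsub>M\<^esub> y) = f x \<oplus>\<^bsub>N\<^esub> f y"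
    "\<And>a x. a \<in> carrier R \<Longrightarrow> x \<in> carrier M \<Longrightarrow> f (a \<odot>\<^bsub>M\<^esub> x) = a \<odot>\<^bsub>N\<^esub> f x"
  shows "f \<in> mod_hom R M N"
  using assms by (auto simp: mod_hom_def PiE_def)

lemma mod_hom_ext: "f \<in> mod_hom R M N \<Longrightarrow> f \<in> extensional (carrier M)"
  by (auto simp: mod_hom_def PiE_def)

lemma gr_hom_compose:
  assumes "graded_module R M" "graded_module R X" "f \<in> gr_hom R M X s" "h \<in> gr_hom R X N s'"
  shows "compose (carrier M) h f \<in> gr_hom R M N (s + s')"
proof -
  interpret M: graded_module R M by fact
  interpret X: graded_module R X by fact
  note f = mod_homD[OF gr_homD(1)[OF assms(3)]] gr_homD(2)[OF assms(3)]
  note h = mod_homD[OF gr_homD(1)[OF assms(4)]] gr_homD(2)[OF assms(4)]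
  show ?thesis
  proof (rule gr_homI)
    fix g x assume x: "x \<in> hcomp M g"
    then show "compose (carrier M) h f x \<in> hcomp N (g + (s + s'))"
      using h(4)[OF f(4)[OF x]] M.hcomp_carrier[OF x] by (simp add: compose_eq add.assoc)
  qed (use f h in \<open>auto simp: compose_eq\<close>)
qed

text \<open>The component of a preimage in degree \<open>g - s\<close> is again a preimage.\<close>

lemma gr_hom_preimage:
  assumes "graded_module R X" "graded_module R Y" "p \<in> gr_hom R X Y s" "y \<in> hcomp Y g" "y \<in> p ` carrier X"
  shows "\<exists>x\<in>hcomp X (g - s). p x = y"
proof -
  obtain x where x: "x \<in> carrier X" "y = p x" using assms(5) by blast
  have "p (hc X x (g - s)) = y"
    using gr_hom_hc[OF assms(1-3) x(1), of "g - s"] graded_module.hc_homog[OF assms(2,4), of g] x(2) by simp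
  then show ?thesis using graded_module.hc_props(1)[OF assms(1) x(1)] by blast
qed

text \<open>The record of a graded ring carries both a multiplication and a scalar multiplication;
  \<open>smult_mult\<close> ties them together.\<close>

locale graded_ring = graded_module R R for R :: "('a, 'a, 'g::ab_group_add) gmod" +
  assumes hcomp_sub: "hcomp R g \<subseteq> carrier R" and smult_mult: "smult R = mult R"
begin

lemma free_coeffs:
  assumes free: "graded_free_on R F B" and x: "x \<in> carrier F"
  obtains S u where "finite S" "S \<subseteq> B" "u \<in> S \<rightarrow> carrier R" "x = finsum F (\<lambda>b. u b \<odot>\<^bsub>F\<^esub> b) S"
proof -
  have "\<exists>!u. u \<in> B \<rightarrow>\<^sub>E carrier R \<and> finite {b \<in> B. u b \<noteq> \<zero>\<^bsub>R\<^esub>} \<and>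
      x = (\<Oplus>\<^bsub>F\<^esub>b\<in>{b \<in> B. u b \<noteq> \<zero>\<^bsub>R\<^esub>}. u b \<odot>\<^bsub>F\<^esub> b)"
    using free x unfolding graded_free_on_def by blast
  then obtain u where u: "u \<in> B \<rightarrow>\<^sub>E carrier R" "finite {b \<in> B. u b \<noteq> \<zero>\<^bsub>R\<^esub>}"
      "x = (\<Oplus>\<^bsub>F\<^esub>b\<in>{b \<in> B. u b \<noteq> \<zero>\<^bsub>R\<^esub>}. u b \<odot>\<^bsub>F\<^esub> b)" by blast
  let ?S = "{b \<in> B. u b \<noteq> \<zero>\<^bsub>R\<^esub>}"
  have "?S \<subseteq> B" by blast
  moreover have "u \<in> ?S \<rightarrow> carrier R" using PiE_mem[OF u(1)] by (intro Pi_I) blast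
  ultimately show ?thesis using that[of ?S u, OF u(2) _ _ u(3)] by blast
qed

lemma free_carrier: "graded_free_on R F B \<Longrightarrow> B \<subseteq> carrier F"
proof
  fix b assume free: "graded_free_on R F B" and "b \<in> B"
  then obtain g where "b \<in> hcomp F g" unfolding graded_free_on_def by blast
  moreover have "graded_module R F" using free by (simp add: graded_free_on_def)
  ultimately show "b \<in> carrier F" by (rule graded_module.hcomp_carrier[rotated])
qed

text \<open>Coordinates with respect to the basis are unique, hence additive and linear in the
  element, and homogeneous for a homogeneous element. So the linear extension of \<open>v\<close> is
  a homomorphism of the common degree \<open>s\<close>.\<close>

lemma free_lift:
  assumes free: "graded_free_on R F B" and gN: "graded_module R N"
    and v: "\<And>b. b \<in> B \<Longrightarrow> b \<in> hcomp F (dg b) \<and> v b \<in> hcomp N (dg b + s)"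
  shows "\<exists>l\<in>gr_hom R F N s. \<forall>b\<in>B. l b = v b"
proof -
  have gF: "graded_module R F" using free by (simp add: graded_free_on_def)
  interpret F: graded_module R F by fact
  interpret N: graded_module R N by fact
  have BF: "b \<in> carrier F" and vN: "v b \<in> carrier N" if "b \<in> B" for b
    using v[OF that] F.hcomp_carrier N.hcomp_carrier by auto
  define C where "C = (\<lambda>x u. u \<in> B \<rightarrow>\<^sub>E carrier R \<and> finite {b \<in> B. u b \<noteq> \<zero>\<^bsub>R\<^esub>} \<and>
      x = (\<Oplus>\<^bsub>F\<^esub>b\<in>{b \<in> B. u b \<noteq> \<zero>\<^bsub>R\<^esub>}. u b \<odot>\<^bsub>F\<^esub> b))"
  have uniq: "\<exists>!u. C x u" if "x \<in> carrier F" for x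
    using free that unfolding graded_free_on_def C_def by blast
  define co where "co = (\<lambda>x. THE u. C x u)"
  have Cco: "C x (co x)" if "x \<in> carrier F" for x
    unfolding co_def by (rule theI'[OF uniq[OF that]])
  define sp where "sp = (\<lambda>x. {b \<in> B. co x b \<noteq> \<zero>\<^bsub>R\<^esub>})"
  have co: "co x \<in> B \<rightarrow>\<^sub>E carrier R" "finite (sp x)" "x = (\<Oplus>\<^bsub>F\<^esub>b\<in>sp x. co x b \<odot>\<^bsub>F\<^esub> b)"
    if "x \<in> carrier F" for x
    using Cco[OF that] unfolding sp_def C_def by blast+
  have coR: "co x b \<in> carrier R" if "x \<in> carrier F" "b \<in> B" for x b using co(1)[OF that(1)] that(2) by blast
  have spB: "sp x \<subseteq> B" for x by (auto simp: sp_def)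
  have sup: "x = (\<Oplus>\<^bsub>F\<^esub>b\<in>S. co x b \<odot>\<^bsub>F\<^esub> b)" if x: "x \<in> carrier F" and S: "finite S" "sp x \<subseteq> S" "S \<subseteq> B" for x S
  proof -
    have "(\<Oplus>\<^bsub>F\<^esub>b\<in>sp x. co x b \<odot>\<^bsub>F\<^esub> b) = (\<Oplus>\<^bsub>F\<^esub>b\<in>S. co x b \<odot>\<^bsub>F\<^esub> b)"
      by (rule F.M.add.finprod_mono_neutral_cong_left) (use S coR[OF x] BF in \<open>auto simp: sp_def subset_iff\<close>)
    then show ?thesis using co(3)[OF x] by simp
  qed
  \<comment> \<open>Any finite expansion over the basis yields the coordinates, whether or not its
    coefficients are nonzero. Sums, multiples, components and basis elements are all treated by it
    below.\<close>
  have co_eq: "co x = restrict u B"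
    if S: "finite S" "S \<subseteq> B" and u: "\<And>b. b \<in> B \<Longrightarrow> u b \<in> carrier R" "\<And>b. b \<in> B \<Longrightarrow> b \<notin> S \<Longrightarrow> u b = \<zero>\<^bsub>R\<^esub>"
      and x: "x = (\<Oplus>\<^bsub>F\<^esub>b\<in>S. u b \<odot>\<^bsub>F\<^esub> b)" for x S u
  proof -
    let ?S = "{b \<in> B. restrict u B b \<noteq> \<zero>\<^bsub>R\<^esub>}"
    have xc: "x \<in> carrier F" unfolding x by (rule F.M.finsum_closed) (use S(2) u(1) BF in blast)
    have sub: "?S \<subseteq> S" using u(2) by auto
    have "(\<Oplus>\<^bsub>F\<^esub>b\<in>?S. restrict u B b \<odot>\<^bsub>F\<^esub> b) = (\<Oplus>\<^bsub>F\<^esub>b\<in>S. u b \<odot>\<^bsub>F\<^esub> b)"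
    proof (rule F.M.add.finprod_mono_neutral_cong_left[OF S(1) sub])
      fix b assume "b \<in> S - ?S"
      then have "b \<in> B" "u b = \<zero>\<^bsub>R\<^esub>" using S(2) by auto
      then show "u b \<odot>\<^bsub>F\<^esub> b = \<zero>\<^bsub>F\<^esub>" using BF by simp
    next
      fix b assume "b \<in> ?S"
      then show "restrict u B b \<odot>\<^bsub>F\<^esub> b = u b \<odot>\<^bsub>F\<^esub> b" by simp
    next
      show "(\<lambda>b. u b \<odot>\<^bsub>F\<^esub> b) \<in> S \<rightarrow> carrier F" using S(2) u(1) BF by blast
    qed
    then have "x = (\<Oplus>\<^bsub>F\<^esub>b\<in>?S. restrict u B b \<odot>\<^bsub>F\<^esub> b)" using x by simp
    moreover have "restrict u B \<in> B \<rightarrow>\<^sub>E carrier R" using u(1) by simp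
    ultimately have "C x (restrict u B)"
      unfolding C_def using finite_subset[OF sub S(1)] by blast
    then show ?thesis using the1_equality[OF uniq[OF xc]] unfolding co_def by blast
  qed
  define l where "l = (\<lambda>x\<in>carrier F. \<Oplus>\<^bsub>N\<^esub>b\<in>sp x. co x b \<odot>\<^bsub>N\<^esub> v b)"
  have lsup: "l x = (\<Oplus>\<^bsub>N\<^esub>b\<in>S. co x b \<odot>\<^bsub>N\<^esub> v b)" if x: "x \<in> carrier F" and S: "finite S" "sp x \<subseteq> S" "S \<subseteq> B" for x S
  proof -
    have "(\<Oplus>\<^bsub>N\<^esub>b\<in>sp x. co x b \<odot>\<^bsub>N\<^esub> v b) = (\<Oplus>\<^bsub>N\<^esub>b\<in>S. co x b \<odot>\<^bsub>N\<^esub> v b)"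
      by (rule N.M.add.finprod_mono_neutral_cong_left) (use S coR[OF x] vN in \<open>auto simp: sp_def subset_iff\<close>)
    then show ?thesis using x by (simp add: l_def)
  qed
  have lc: "l x \<in> carrier N" if x: "x \<in> carrier F" for x
    using x coR[OF x] vN spB[of x] by (auto simp: l_def intro!: N.M.finsum_closed)
  have "l \<in> gr_hom R F N s"
  proof (rule gr_homI)
    show "l \<in> extensional (carrier F)" by (simp add: l_def)
    show "l x \<in> carrier N" if "x \<in> carrier F" for x using lc[OF that] .
  next
    fix x y assume xy: "x \<in> carrier F" "y \<in> carrier F"
    let ?S = "sp x \<union> sp y"
    have S: "finite ?S" "?S \<subseteq> B" using co(2) xy spB by auto
    have "x \<oplus>\<^bsub>F\<^esub> y = (\<Oplus>\<^bsub>F\<^esub>b\<in>?S. co x b \<odot>\<^bsub>F\<^esub> b \<oplus>\<^bsub>F\<^esub> co y b \<odot>\<^bsub>F\<^esub> b)"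
      using sup[OF xy(1) S(1) _ S(2)] sup[OF xy(2) S(1) _ S(2)]
      by (subst F.M.finsum_addf) (use S coR xy BF in auto)
    also have "\<dots> = (\<Oplus>\<^bsub>F\<^esub>b\<in>?S. (co x b \<oplus>\<^bsub>R\<^esub> co y b) \<odot>\<^bsub>F\<^esub> b)"
      by (rule F.M.finsum_cong') (use S coR xy BF in \<open>auto simp: F.smult_l_distr\<close>)
    finally have "co (x \<oplus>\<^bsub>F\<^esub> y) = restrict (\<lambda>b. co x b \<oplus>\<^bsub>R\<^esub> co y b) B"
      by (rule co_eq[OF S, rotated 2]) (use coR xy in \<open>auto simp: sp_def\<close>)
    then have co': "co (x \<oplus>\<^bsub>F\<^esub> y) b = co x b \<oplus>\<^bsub>R\<^esub> co y b" if "b \<in> B" for b using that by simp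
    have "sp (x \<oplus>\<^bsub>F\<^esub> y) \<subseteq> ?S" using co' by (auto simp: sp_def)
    then have "l (x \<oplus>\<^bsub>F\<^esub> y) = (\<Oplus>\<^bsub>N\<^esub>b\<in>?S. co (x \<oplus>\<^bsub>F\<^esub> y) b \<odot>\<^bsub>N\<^esub> v b)"
      using lsup[OF F.M.a_closed[OF xy] S(1) _ S(2)] by simp
    also have "\<dots> = (\<Oplus>\<^bsub>N\<^esub>b\<in>?S. co x b \<odot>\<^bsub>N\<^esub> v b \<oplus>\<^bsub>N\<^esub> co y b \<odot>\<^bsub>N\<^esub> v b)"
      by (rule N.M.finsum_cong') (use S coR xy vN co' in \<open>auto simp: N.smult_l_distr subset_iff\<close>)
    also have "\<dots> = l x \<oplus>\<^bsub>N\<^esub> l y"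
      using lsup[OF xy(1) S(1) _ S(2)] lsup[OF xy(2) S(1) _ S(2)]
      by (subst N.M.finsum_addf) (use S coR xy vN in auto)
    finally show "l (x \<oplus>\<^bsub>F\<^esub> y) = l x \<oplus>\<^bsub>N\<^esub> l y" .
  next
    fix a x assume a: "a \<in> carrier R" and x: "x \<in> carrier F"
    have S: "finite (sp x)" "sp x \<subseteq> B" using co(2) x spB by auto
    have "a \<odot>\<^bsub>F\<^esub> x = (\<Oplus>\<^bsub>F\<^esub>b\<in>sp x. a \<odot>\<^bsub>F\<^esub> (co x b \<odot>\<^bsub>F\<^esub> b))"
      using co(3)[OF x] F.finsum_smult_ldistr[OF S(1) a, of "\<lambda>b. co x b \<odot>\<^bsub>F\<^esub> b"] S coR[OF x] BF by auto
    also have "\<dots> = (\<Oplus>\<^bsub>F\<^esub>b\<in>sp x. (a \<otimes>\<^bsub>R\<^esub> co x b) \<odot>\<^bsub>F\<^esub> b)"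
      by (rule F.M.finsum_cong') (use S coR x BF a in \<open>auto simp: F.smult_assoc1 subset_iff\<close>)
    finally have "co (a \<odot>\<^bsub>F\<^esub> x) = restrict (\<lambda>b. a \<otimes>\<^bsub>R\<^esub> co x b) B"
      by (rule co_eq[OF S, rotated 2]) (use coR x a in \<open>auto simp: sp_def\<close>)
    then have co': "co (a \<odot>\<^bsub>F\<^esub> x) b = a \<otimes>\<^bsub>R\<^esub> co x b" if "b \<in> B" for b using that by simp
    have "sp (a \<odot>\<^bsub>F\<^esub> x) \<subseteq> sp x" using co' a by (auto simp: sp_def)
    then have "l (a \<odot>\<^bsub>F\<^esub> x) = (\<Oplus>\<^bsub>N\<^esub>b\<in>sp x. co (a \<odot>\<^bsub>F\<^esub> x) b \<odot>\<^bsub>N\<^esub> v b)"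
      using lsup[OF F.smult_closed[OF a x] S(1) _ S(2)] by simp
    also have "\<dots> = (\<Oplus>\<^bsub>N\<^esub>b\<in>sp x. a \<odot>\<^bsub>N\<^esub> (co x b \<odot>\<^bsub>N\<^esub> v b))"
      by (rule N.M.finsum_cong') (use S coR x vN co' a in \<open>auto simp: N.smult_assoc1 subset_iff\<close>)
    also have "\<dots> = a \<odot>\<^bsub>N\<^esub> l x"
    proof -
      have "(\<lambda>b. co x b \<odot>\<^bsub>N\<^esub> v b) \<in> sp x \<rightarrow> carrier N"
        using S(2) N.smult_closed[OF coR[OF x] vN] by blast
      from N.finsum_smult_ldistr[OF S(1) a this] show ?thesis using x by (simp add: l_def)
    qed
    finally show "l (a \<odot>\<^bsub>F\<^esub> x) = a \<odot>\<^bsub>N\<^esub> l x" .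
  next
    fix g x assume x: "x \<in> hcomp F g"
    have xc: "x \<in> carrier F" using F.hcomp_carrier[OF x] .
    have S: "finite (sp x)" "sp x \<subseteq> B" using co(2) xc spB by auto
    \<comment> \<open>Taking the component in degree \<open>g\<close> of the expansion of
      \<open>x\<close> gives a second expansion; uniqueness then makes the coordinate at
      \<open>b\<close> homogeneous of degree \<open>g - dg b\<close>.\<close>
    have hb: "hc F (a \<odot>\<^bsub>F\<^esub> b) g = hc R a (g - dg b) \<odot>\<^bsub>F\<^esub> b" if a: "a \<in> carrier R" and b: "b \<in> B" for a b
      using hc_map[OF graded_module_axioms gF, of "\<lambda>a. a \<odot>\<^bsub>F\<^esub> b" "dg b" a "g - dg b"] a v[OF b] BF[OF b]
        F.smult_l_distr F.hcomp_smult by auto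
    have "x = hc F x g" using F.hc_homog[OF x, of g] by simp
    also have "\<dots> = hc F (\<Oplus>\<^bsub>F\<^esub>b\<in>sp x. co x b \<odot>\<^bsub>F\<^esub> b) g" using co(3)[OF xc] by simp
    also have "\<dots> = (\<Oplus>\<^bsub>F\<^esub>b\<in>sp x. hc F (co x b \<odot>\<^bsub>F\<^esub> b) g)"
      by (rule finsum_hom[OF F.M.abelian_group_axioms F.M.abelian_group_axioms S(1)])
        (use S coR xc BF F.hc_carrier hc_add[OF gF] in auto)
    also have "\<dots> = (\<Oplus>\<^bsub>F\<^esub>b\<in>sp x. hc R (co x b) (g - dg b) \<odot>\<^bsub>F\<^esub> b)"
      by (rule F.M.finsum_cong') (use S coR xc BF hb hc_carrier in \<open>auto simp: subset_iff\<close>)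
    finally have "co x = restrict (\<lambda>b. hc R (co x b) (g - dg b)) B"
      by (rule co_eq[OF S, rotated 2]) (use coR xc hc_carrier hc_zero[OF graded_module_axioms] in \<open>auto simp: sp_def\<close>)
    then have "co x b = hc R (co x b) (g - dg b)" if "b \<in> B" for b using that by (metis restrict_apply')
    then have "co x b \<in> hcomp R (g - dg b)" if "b \<in> B" for b using hc_props(1)[OF coR[OF xc that]] that by metis
    then have "co x b \<odot>\<^bsub>N\<^esub> v b \<in> hcomp N (g + s)" if "b \<in> B" for b
      using N.hcomp_smult[of "co x b" "g - dg b" "v b" "dg b + s"] v[OF that] that by (simp add: algebra_simps)
    then have "(\<Oplus>\<^bsub>N\<^esub>b\<in>sp x. co x b \<odot>\<^bsub>N\<^esub> v b) \<in> hcomp N (g + s)"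
      by (intro finsum_closed_subset[OF N.M.abelian_group_axioms S(1)]) (use N.hcomp_carrier N.hcomp_add S(2) in auto)
    then show "l x \<in> hcomp N (g + s)" using xc by (simp add: l_def)
  qed
  moreover have "l b = v b" if b: "b \<in> B" for b
  proof -
    have "b = (\<Oplus>\<^bsub>F\<^esub>b'\<in>{b}. (if b' = b then \<one>\<^bsub>R\<^esub> else \<zero>\<^bsub>R\<^esub>) \<odot>\<^bsub>F\<^esub> b')" using BF[OF b] by simp
    then have c: "co b = restrict (\<lambda>b'. if b' = b then \<one>\<^bsub>R\<^esub> else \<zero>\<^bsub>R\<^esub>) B"
      by (rule co_eq[rotated 4]) (use b in auto)
    then have "sp b \<subseteq> {b}" by (auto simp: sp_def)
    from lsup[OF BF[OF b] _ this] show ?thesis using b c vN[OF b] by simp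
  qed
  ultimately show ?thesis by blast
qed

text \<open>Graded projectivity: homogeneous preimages are chosen on a basis. The condition is that
  \<open>f\<close> lands in the image of \<open>p\<close>, since the lemma is applied to the
  embedding \<open>i\<close> and to a differential as well as to surjections.\<close>

lemma free_lift_hom:
  assumes free: "graded_free_on R F B" and gX: "graded_module R X" and gY: "graded_module R Y"
    and f: "f \<in> gr_hom R F Y s" and p: "p \<in> gr_hom R X Y s'" and im: "\<And>x. x \<in> carrier F \<Longrightarrow> f x \<in> p ` carrier X"
  shows "\<exists>l\<in>gr_hom R F X (s - s'). \<forall>x\<in>carrier F. p (l x) = f x"
proof -
  have gF: "graded_module R F" using free by (simp add: graded_free_on_def)
  interpret F: graded_module R F by fact
  interpret X: graded_module R X by fact
  interpret Y: graded_module R Y by fact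
  have BF: "B \<subseteq> carrier F" by (rule free_carrier[OF free])
  have "\<forall>b. \<exists>h. b \<in> B \<longrightarrow> b \<in> hcomp F h" using free by (auto simp: graded_free_on_def)
  then obtain dg where dg: "\<And>b. b \<in> B \<Longrightarrow> b \<in> hcomp F (dg b)" by metis
  have "\<forall>b. \<exists>v. b \<in> B \<longrightarrow> v \<in> hcomp X (dg b + (s - s')) \<and> p v = f b"
  proof
    fix b show "\<exists>v. b \<in> B \<longrightarrow> v \<in> hcomp X (dg b + (s - s')) \<and> p v = f b"
    proof (cases "b \<in> B")
      case True
      then obtain v where "v \<in> hcomp X (dg b + s - s')" "p v = f b"
        using gr_hom_preimage[OF gX gY p gr_homD(2)[OF f dg]] im BF by blast
      then show ?thesis by (auto simp: add_diff_eq)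
    qed blast
  qed
  then obtain v where v: "\<And>b. b \<in> B \<Longrightarrow> v b \<in> hcomp X (dg b + (s - s')) \<and> p (v b) = f b" by metis
  obtain l where l: "l \<in> gr_hom R F X (s - s')" "\<forall>b\<in>B. l b = v b"
    using free_lift[OF free gX, of dg v "s - s'"] dg v by blast
  note lm = mod_homD[OF gr_homD(1)[OF l(1)]] and poly_module = mod_homD[OF gr_homD(1)[OF p]] and fm = mod_homD[OF gr_homD(1)[OF f]]
  have "p (l x) = f x" if x: "x \<in> carrier F" for x
  proof -
    obtain S u where S: "finite S" "S \<subseteq> B" "u \<in> S \<rightarrow> carrier R" "x = finsum F (\<lambda>b. u b \<odot>\<^bsub>F\<^esub> b) S"
      using free_coeffs[OF free x] .
    have c: "(\<lambda>b. u b \<odot>\<^bsub>F\<^esub> b) \<in> S \<rightarrow> carrier F" using S BF by auto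
    have "p (l x) = finsum Y (\<lambda>b. p (l (u b \<odot>\<^bsub>F\<^esub> b))) S"
      unfolding S(4) by (rule finsum_hom[OF F.M.abelian_group_axioms Y.M.abelian_group_axioms S(1) c, of "\<lambda>x. p (l x)"])
        (use lm poly_module in auto)
    also have "\<dots> = finsum Y (\<lambda>b. f (u b \<odot>\<^bsub>F\<^esub> b)) S"
    proof (rule Y.M.finsum_cong')
      fix b assume b: "b \<in> S"
      then have ub: "u b \<in> carrier R" "b \<in> carrier F" "b \<in> B" using S BF by auto
      show "p (l (u b \<odot>\<^bsub>F\<^esub> b)) = f (u b \<odot>\<^bsub>F\<^esub> b)"
        using lm(3)[OF ub(1,2)] poly_module(3)[OF ub(1) lm(1)[OF ub(2)]] fm(3)[OF ub(1,2)] l(2) v[OF ub(3)] ub(3) by simp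
    qed (use c fm(1) in auto)
    also have "\<dots> = f x"
      unfolding S(4) by (rule finsum_hom[OF F.M.abelian_group_axioms Y.M.abelian_group_axioms S(1) c, symmetric])
        (use fm in auto)
    finally show ?thesis .
  qed
  then show ?thesis using l(1) by blast
qed

end

lemma star_hom_simps [simp]:
  "zero (star_hom R M N) = (\<lambda>x\<in>carrier M. \<zero>\<^bsub>N\<^esub>)"
  "add (star_hom R M N) = (\<lambda>f h. \<lambda>x\<in>carrier M. f x \<oplus>\<^bsub>N\<^esub> h x)"
  "smult (star_hom R M N) = (\<lambda>a f. \<lambda>x\<in>carrier M. a \<odot>\<^bsub>N\<^esub> f x)"
  "hcomp (star_hom R M N) = gr_hom R M N"
  by (simp_all add: star_hom_def)

lemma star_hom_carrier:
  "f \<in> carrier (star_hom R M N) \<longleftrightarrow> f \<in> mod_hom R M N \<and> (\<exists>S u. finite S \<and> (\<forall>g\<in>S. u g \<in> gr_hom R M N g) \<and>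
     (\<forall>x\<in>carrier M. f x = (\<Oplus>\<^bsub>N\<^esub>g\<in>S. u g x)))"
  by (simp add: star_hom_def)

lemma (in Module.module) smult_swap:
  "a \<in> carrier R \<Longrightarrow> b \<in> carrier R \<Longrightarrow> x \<in> carrier M \<Longrightarrow> a \<odot>\<^bsub>M\<^esub> (b \<odot>\<^bsub>M\<^esub> x) = b \<odot>\<^bsub>M\<^esub> (a \<odot>\<^bsub>M\<^esub> x)"
  by (metis smult_assoc1 R.m_comm)

lemma (in Module.module) smult_diff_left:
  "a \<in> carrier R \<Longrightarrow> b \<in> carrier R \<Longrightarrow> x \<in> carrier M \<Longrightarrow>
    (a \<ominus>\<^bsub>R\<^esub> b) \<odot>\<^bsub>M\<^esub> x = a \<odot>\<^bsub>M\<^esub> x \<ominus>\<^bsub>M\<^esub> b \<odot>\<^bsub>M\<^esub> x"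
  by (simp add: a_minus_def smult_l_distr smult_l_minus)

lemma mod_hom_pointwise_add:
  assumes "graded_module R M" "graded_module R N" "f \<in> mod_hom R M N" "h \<in> mod_hom R M N"
  shows "(\<lambda>x\<in>carrier M. f x \<oplus>\<^bsub>N\<^esub> h x) \<in> mod_hom R M N"
proof -
  interpret M: graded_module R M by fact
  interpret N: graded_module R N by fact
  note f = mod_homD[OF assms(3)] and h = mod_homD[OF assms(4)]
  show ?thesis
    by (rule mod_homI) (use f h in \<open>simp_all add: N.M.a_ac N.smult_r_distr\<close>)
qed

lemma mod_hom_pointwise_smult:
  assumes "graded_module R M" "graded_module R N" "f \<in> mod_hom R M N" "a \<in> carrier R"
  shows "(\<lambda>x\<in>carrier M. a \<odot>\<^bsub>N\<^esub> f x) \<in> mod_hom R M N"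
proof -
  interpret M: graded_module R M by fact
  interpret N: graded_module R N by fact
  note f = mod_homD[OF assms(3)]
  show ?thesis
    by (rule mod_homI) (use f assms(4) N.smult_swap[OF assms(4)] in \<open>simp_all add: N.smult_r_distr\<close>)
qed

lemma gr_hom_pointwise_add:
  assumes "graded_module R M" "graded_module R N" "f \<in> gr_hom R M N s" "h \<in> gr_hom R M N s"
  shows "(\<lambda>x\<in>carrier M. f x \<oplus>\<^bsub>N\<^esub> h x) \<in> gr_hom R M N s"
  using mod_hom_pointwise_add[OF assms(1,2) gr_homD(1)[OF assms(3)] gr_homD(1)[OF assms(4)]]
    gr_homD(2)[OF assms(3)] gr_homD(2)[OF assms(4)] graded_module.hcomp_carrier[OF assms(1)] graded_module.hcomp_add[OF assms(2)]
  unfolding gr_hom_def by auto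

lemma gr_hom_pointwise_smult:
  assumes "graded_module R M" "graded_module R N" "f \<in> gr_hom R M N s" "a \<in> hcomp R k" "a \<in> carrier R"
  shows "(\<lambda>x\<in>carrier M. a \<odot>\<^bsub>N\<^esub> f x) \<in> gr_hom R M N (s + k)"
proof -
  have "a \<odot>\<^bsub>N\<^esub> f x \<in> hcomp N (g + (s + k))" if "x \<in> hcomp M g" for x g
    using graded_module.hcomp_smult[OF assms(2,4) gr_homD(2)[OF assms(3) that]] by (simp add: ac_simps)
  then show ?thesis
    using mod_hom_pointwise_smult[OF assms(1,2) gr_homD(1)[OF assms(3)] assms(5)] graded_module.hcomp_carrier[OF assms(1)]
    unfolding gr_hom_def by auto
qed

lemma gr_hom_zero:
  assumes "graded_module R M" "graded_module R N"
  shows "(\<lambda>x\<in>carrier M. \<zero>\<^bsub>N\<^esub>) \<in> gr_hom R M N s"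
proof -
  interpret M: graded_module R M by fact
  interpret N: graded_module R N by fact
  show ?thesis by (rule gr_homI) (use M.hcomp_carrier in auto)
qed

lemma gr_hom_id:
  assumes "graded_module R M"
  shows "(\<lambda>x\<in>carrier M. x) \<in> gr_hom R M M 0"
proof -
  interpret M: graded_module R M by fact
  show ?thesis by (rule gr_homI) (use M.hcomp_carrier in auto)
qed

lemma gr_hom_diff:
  assumes "graded_module R M" "graded_module R N" "f \<in> gr_hom R M N s" "h \<in> gr_hom R M N s"
  shows "(\<lambda>x\<in>carrier M. f x \<ominus>\<^bsub>N\<^esub> h x) \<in> gr_hom R M N s"
proof -
  interpret M: graded_module R M by fact
  interpret N: graded_module R N by fact
  note f = mod_homD[OF gr_homD(1)[OF assms(3)]] gr_homD(2)[OF assms(3)]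
  note h = mod_homD[OF gr_homD(1)[OF assms(4)]] gr_homD(2)[OF assms(4)]
  have "(\<lambda>x\<in>carrier M. \<ominus>\<^bsub>N\<^esub> h x) \<in> gr_hom R M N s"
    by (rule gr_homI) (use h M.hcomp_carrier N.hcomp_neg in \<open>simp_all add: N.M.minus_add N.M.a_comm N.smult_r_minus\<close>)
  from gr_hom_pointwise_add[OF assms(1-3) this] show ?thesis
    by (simp add: a_minus_def cong: restrict_cong)
qed

context graded_ring
begin

lemma gr_hom_star:
  assumes "graded_module R N" "f \<in> gr_hom R M N g"
  shows "f \<in> carrier (star_hom R M N)"
proof -
  interpret N: graded_module R N by fact
  show ?thesis
    unfolding star_hom_carrier
    using assms(2) mod_homD(1)[OF gr_homD(1)[OF assms(2)]]
    by (intro conjI exI[of _ "{g}"] exI[of _ "\<lambda>_. f"]) (auto simp: gr_homD(1))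
qed

lemma star_hom_add_closed:
  assumes gM: "graded_module R M" and gN: "graded_module R N"
    and f: "f \<in> carrier (star_hom R M N)" and h: "h \<in> carrier (star_hom R M N)"
  shows "(\<lambda>x\<in>carrier M. f x \<oplus>\<^bsub>N\<^esub> h x) \<in> carrier (star_hom R M N)"
proof -
  interpret M: graded_module R M by fact
  interpret N: graded_module R N by fact
  obtain S u where S: "finite S" "\<forall>g\<in>S. u g \<in> gr_hom R M N g" "\<forall>x\<in>carrier M. f x = (\<Oplus>\<^bsub>N\<^esub>g\<in>S. u g x)"
    using f unfolding star_hom_carrier by blast
  obtain T v where T: "finite T" "\<forall>g\<in>T. v g \<in> gr_hom R M N g" "\<forall>x\<in>carrier M. h x = (\<Oplus>\<^bsub>N\<^esub>g\<in>T. v g x)"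
    using h unfolding star_hom_carrier by blast
  let ?z = "\<lambda>x\<in>carrier M. \<zero>\<^bsub>N\<^esub>"
  \<comment> \<open>Both families are extended by the zero map to the union of their index
    sets.\<close>
  define u' where "u' = (\<lambda>g. if g \<in> S then u g else ?z)"
  define v' where "v' = (\<lambda>g. if g \<in> T then v g else ?z)"
  have u': "u' g \<in> gr_hom R M N g" and v': "v' g \<in> gr_hom R M N g" for g
    using S(2) T(2) gr_hom_zero[OF gM gN] by (auto simp: u'_def v'_def)
  have uc: "u' g x \<in> carrier N" "v' g x \<in> carrier N" if "x \<in> carrier M" for g x
    using mod_homD(1)[OF gr_homD(1)[OF u'] that] mod_homD(1)[OF gr_homD(1)[OF v'] that] .
  have "f x \<oplus>\<^bsub>N\<^esub> h x = (\<Oplus>\<^bsub>N\<^esub>g\<in>S \<union> T. u' g x \<oplus>\<^bsub>N\<^esub> v' g x)" if x: "x \<in> carrier M" for x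
  proof -
    have "(\<Oplus>\<^bsub>N\<^esub>g\<in>S. u g x) = (\<Oplus>\<^bsub>N\<^esub>g\<in>S \<union> T. u' g x)"
      by (rule N.M.add.finprod_mono_neutral_cong_left) (use S(1) T(1) x uc[OF x] in \<open>auto simp: u'_def\<close>)
    moreover have "(\<Oplus>\<^bsub>N\<^esub>g\<in>T. v g x) = (\<Oplus>\<^bsub>N\<^esub>g\<in>S \<union> T. v' g x)"
      by (rule N.M.add.finprod_mono_neutral_cong_left) (use S(1) T(1) x uc[OF x] in \<open>auto simp: v'_def\<close>)
    ultimately show ?thesis
      using S(3) T(3) x uc[OF x] by (subst N.M.finsum_addf) auto
  qed
  moreover have "(\<lambda>x\<in>carrier M. u' g x \<oplus>\<^bsub>N\<^esub> v' g x) \<in> gr_hom R M N g" for g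
    by (rule gr_hom_pointwise_add[OF gM gN u' v'])
  ultimately show ?thesis
    unfolding star_hom_carrier
    using mod_hom_pointwise_add[OF gM gN] f h S(1) T(1)
    by (intro conjI exI[of _ "S \<union> T"] exI[of _ "\<lambda>g. \<lambda>x\<in>carrier M. u' g x \<oplus>\<^bsub>N\<^esub> v' g x"])
      (auto simp: star_hom_carrier)
qed

text \<open>A general scalar is handled by induction over its components; one of degree
  \<open>k\<close> moves the summand of degree \<open>g\<close> to degree
  \<open>g + k\<close>.\<close>

lemma star_hom_smult_closed:
  assumes gM: "graded_module R M" and gN: "graded_module R N"
    and f: "f \<in> carrier (star_hom R M N)" and a: "a \<in> carrier R"
  shows "(\<lambda>x\<in>carrier M. a \<odot>\<^bsub>N\<^esub> f x) \<in> carrier (star_hom R M N)"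
proof -
  interpret M: graded_module R M by fact
  interpret N: graded_module R N by fact
  obtain S u where S: "finite S" "\<forall>g\<in>S. u g \<in> gr_hom R M N g" "\<forall>x\<in>carrier M. f x = (\<Oplus>\<^bsub>N\<^esub>g\<in>S. u g x)"
    using f unfolding star_hom_carrier by blast
  have fm: "f \<in> mod_hom R M N" using f by (simp add: star_hom_carrier)
  note fc = mod_homD(1)[OF fm]
  show ?thesis using a
  proof (induction a rule: graded_induct)
    case zero
    have e: "(\<lambda>x\<in>carrier M. \<zero>\<^bsub>R\<^esub> \<odot>\<^bsub>N\<^esub> f x) = (\<lambda>x\<in>carrier M. \<zero>\<^bsub>N\<^esub>)" using fc by (auto intro!: restrict_ext)
    show ?case unfolding e by (rule gr_hom_star[OF gN gr_hom_zero[OF gM gN]])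
  next
    case (homog k a)
    then have a: "a \<in> carrier R" using hcomp_sub by blast
    have "a \<odot>\<^bsub>N\<^esub> f x = (\<Oplus>\<^bsub>N\<^esub>g\<in>(\<lambda>g. g + k) ` S. (\<lambda>x\<in>carrier M. a \<odot>\<^bsub>N\<^esub> u (g - k) x) x)" if x: "x \<in> carrier M" for x
    proof -
      have uc: "u g x \<in> carrier N" if "g \<in> S" for g using mod_homD(1)[OF gr_homD(1) x] S(2) that by blast
      then have uc': "(\<lambda>g. u g x) \<in> S \<rightarrow> carrier N" by blast
      have "a \<odot>\<^bsub>N\<^esub> f x = (\<Oplus>\<^bsub>N\<^esub>g\<in>S. a \<odot>\<^bsub>N\<^esub> u g x)"
        using S(3) x N.finsum_smult_ldistr[OF S(1) a uc'] by simp
      also have "\<dots> = (\<Oplus>\<^bsub>N\<^esub>g\<in>(\<lambda>g. g + k) ` S. a \<odot>\<^bsub>N\<^esub> u (g - k) x)"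
        by (subst N.M.finsum_reindex) (use uc a in auto)
      finally show ?thesis using x by simp
    qed
    moreover have "(\<lambda>x\<in>carrier M. a \<odot>\<^bsub>N\<^esub> u (g - k) x) \<in> gr_hom R M N g" if "g \<in> (\<lambda>g. g + k) ` S" for g
      using that gr_hom_pointwise_smult[OF gM gN _ homog a] S(2) by auto
    ultimately show ?case
      unfolding star_hom_carrier
      using mod_hom_pointwise_smult[OF gM gN fm a] S(1)
      by (intro conjI exI[of _ "(\<lambda>g. g + k) ` S"] exI[of _ "\<lambda>g. \<lambda>x\<in>carrier M. a \<odot>\<^bsub>N\<^esub> u (g - k) x"]) simp_all
  next
    case (add a b)
    have e: "(\<lambda>x\<in>carrier M. (a \<oplus>\<^bsub>R\<^esub> b) \<odot>\<^bsub>N\<^esub> f x) =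
      (\<lambda>x\<in>carrier M. (\<lambda>x\<in>carrier M. a \<odot>\<^bsub>N\<^esub> f x) x \<oplus>\<^bsub>N\<^esub> (\<lambda>x\<in>carrier M. b \<odot>\<^bsub>N\<^esub> f x) x)"
      using add(1,2) fc by (auto intro!: restrict_ext simp: N.smult_l_distr)
    show ?case unfolding e by (rule star_hom_add_closed[OF gM gN add(3,4)])
  qed
qed

lemma module_star_hom:
  assumes gM: "graded_module R M" and gN: "graded_module R N"
  shows "Module.module R (star_hom R M N)"
proof -
  interpret M: graded_module R M by fact
  interpret N: graded_module R N by fact
  have c: "f x \<in> carrier N" if "f \<in> carrier (star_hom R M N)" "x \<in> carrier M" for f x
    using that mod_homD(1)[of f R M N] by (simp add: star_hom_carrier)
  have ext: "f \<in> extensional (carrier M)" if "f \<in> carrier (star_hom R M N)" for f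
    using that mod_hom_ext by (auto simp: star_hom_carrier)
  show ?thesis
  proof (intro moduleI abelian_groupI R.cring_axioms)
    show "\<zero>\<^bsub>star_hom R M N\<^esub> \<in> carrier (star_hom R M N)"
      using gr_hom_star[OF gN gr_hom_zero[OF gM gN]] by simp
    fix f assume f: "f \<in> carrier (star_hom R M N)"
    show "\<zero>\<^bsub>star_hom R M N\<^esub> \<oplus>\<^bsub>star_hom R M N\<^esub> f = f"
      by (rule extensionalityI[of _ "carrier M"]) (use ext[OF f] c[OF f] in simp_all)
    show "\<one>\<^bsub>R\<^esub> \<odot>\<^bsub>star_hom R M N\<^esub> f = f"
      by (rule extensionalityI[of _ "carrier M"]) (use ext[OF f] c[OF f] in simp_all)
    have "(\<lambda>x\<in>carrier M. (\<ominus>\<^bsub>R\<^esub> \<one>\<^bsub>R\<^esub>) \<odot>\<^bsub>N\<^esub> f x) \<in> carrier (star_hom R M N)"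
      by (rule star_hom_smult_closed[OF gM gN f]) simp
    moreover have "(\<lambda>x\<in>carrier M. (\<ominus>\<^bsub>R\<^esub> \<one>\<^bsub>R\<^esub>) \<odot>\<^bsub>N\<^esub> f x) \<oplus>\<^bsub>star_hom R M N\<^esub> f = \<zero>\<^bsub>star_hom R M N\<^esub>"
      by (rule extensionalityI[of _ "carrier M"]) (use c[OF f] in \<open>simp_all add: N.smult_l_minus N.M.l_neg\<close>)
    ultimately show "\<exists>h\<in>carrier (star_hom R M N). h \<oplus>\<^bsub>star_hom R M N\<^esub> f = \<zero>\<^bsub>star_hom R M N\<^esub>" by blast
  qed (use star_hom_add_closed[OF gM gN] star_hom_smult_closed[OF gM gN] c in
      \<open>auto intro!: restrict_ext simp: N.M.a_ac N.smult_l_distr N.smult_r_distr N.smult_assoc1\<close>)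
qed

end

section \<open>Modules over a residue ring\<close>

lemma over_quotient_simps [simp]:
  "carrier (over_quotient M) = carrier M" "zero (over_quotient M) = zero M" "add (over_quotient M) = add M"
  "hcomp (over_quotient M) = hcomp M"
  by (simp_all add: over_quotient_def)

lemma finsum_over_quotient: "finsum (over_quotient M) f A = finsum M f A"
  by (simp add: finsum_def finprod_def over_quotient_def)

context graded_ring
begin

lemma ideal_gsubmodule:
  assumes "gsubmodule R R F"
  shows "ideal F R"
proof -
  interpret Module.module R R by (rule module_axioms)
  show ?thesis
  proof (rule idealI[OF R.ring_axioms])
    show "subgroup F (add_monoid R)"
      using gsubmodule_additive_subgroup[OF module_axioms assms] by (rule additive_subgroup.a_subgroup)
    fix a x assume "a \<in> F" "x \<in> carrier R"
    then have "x \<otimes>\<^bsub>R\<^esub> a \<in> F" "a \<in> carrier R" using assms by (auto simp: gsubmodule_def smult_mult)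
    then show "x \<otimes>\<^bsub>R\<^esub> a \<in> F" "a \<otimes>\<^bsub>R\<^esub> x \<in> F" using \<open>x \<in> carrier R\<close> R.m_comm by auto
  qed
qed

text \<open>The ring part of \<open>gquot R F\<close> agrees with the factor ring
  \<open>R Quot F\<close>, from which the axioms are taken.\<close>

lemma cring_gquot:
  assumes "gsubmodule R R F"
  shows "cring (gquot R F)"
proof -
  interpret I: ideal F R by (rule ideal_gsubmodule[OF assms])
  have q: "cring (R Quot F)" by (rule I.quotient_is_cring[OF R.cring_axioms])
  have ab: "abelian_group (R Quot F)" by (rule ring.is_abelian_group[OF cring.axioms(1)[OF q]])
  show ?thesis
  proof (rule cringI)
    show "abelian_group (gquot R F)"
      by (rule abelian_groupI) (use abelian_groupE[OF ab] in \<open>simp_all add: FactRing_def\<close>)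
    show "comm_monoid (gquot R F)"
      using q[THEN cring.axioms(2)] by (auto simp: FactRing_def comm_monoid_def comm_monoid_axioms_def monoid_def)
    fix x y z assume "x \<in> carrier (gquot R F)" "y \<in> carrier (gquot R F)" "z \<in> carrier (gquot R F)"
    then show "(x \<oplus>\<^bsub>gquot R F\<^esub> y) \<otimes>\<^bsub>gquot R F\<^esub> z = x \<otimes>\<^bsub>gquot R F\<^esub> z \<oplus>\<^bsub>gquot R F\<^esub> y \<otimes>\<^bsub>gquot R F\<^esub> z"
      using ring.ring_simprules(13)[OF q[THEN cring.axioms(1)], of x y z] by (simp add: FactRing_def)
  qed
qed

lemma gquotient_self: "gsubmodule R R F \<Longrightarrow> gquotient R R F"
  by (intro gquotient.intro gquotient_axioms.intro module_axioms)

text \<open>Representatives of a coset differ by elements of \<open>F\<close>, which kill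
  \<open>Y\<close>; the image formed in \<open>over_quotient\<close> is therefore a singleton and
  \<open>the_elem\<close> is meaningful.\<close>

lemma over_quotient_smult:
  assumes "gsubmodule R R F" "Module.module R Y" "\<And>f y. f \<in> F \<Longrightarrow> y \<in> carrier Y \<Longrightarrow> f \<odot>\<^bsub>Y\<^esub> y = \<zero>\<^bsub>Y\<^esub>"
    and a: "a \<in> carrier R" and y: "y \<in> carrier Y"
  shows "(F +>\<^bsub>R\<^esub> a) \<odot>\<^bsub>over_quotient Y\<^esub> y = a \<odot>\<^bsub>Y\<^esub> y"
proof -
  interpret Y: Module.module R Y by fact
  interpret q: gquotient R R F by (rule gquotient_self[OF assms(1)])
  have FR: "F \<subseteq> carrier R" using assms(1) by (simp add: gsubmodule_def)
  have "(\<lambda>a. a \<odot>\<^bsub>Y\<^esub> y) ` (F +>\<^bsub>R\<^esub> a) = {a \<odot>\<^bsub>Y\<^esub> y}"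
  proof
    show "(\<lambda>a. a \<odot>\<^bsub>Y\<^esub> y) ` (F +>\<^bsub>R\<^esub> a) \<subseteq> {a \<odot>\<^bsub>Y\<^esub> y}"
    proof
      fix w assume "w \<in> (\<lambda>a. a \<odot>\<^bsub>Y\<^esub> y) ` (F +>\<^bsub>R\<^esub> a)"
      then obtain f where f: "f \<in> F" "w = (f \<oplus>\<^bsub>R\<^esub> a) \<odot>\<^bsub>Y\<^esub> y" by (auto simp: a_r_coset_def')
      then have "w = f \<odot>\<^bsub>Y\<^esub> y \<oplus>\<^bsub>Y\<^esub> a \<odot>\<^bsub>Y\<^esub> y" using Y.smult_l_distr[of f a y] FR a y by auto
      then show "w \<in> {a \<odot>\<^bsub>Y\<^esub> y}" using assms(3)[OF f(1) y] a y by simp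
    qed
    show "{a \<odot>\<^bsub>Y\<^esub> y} \<subseteq> (\<lambda>a. a \<odot>\<^bsub>Y\<^esub> y) ` (F +>\<^bsub>R\<^esub> a)" using q.a_rcos_self[OF a] by blast
  qed
  then show ?thesis by (simp add: over_quotient_def)
qed

lemma graded_module_over_quotient:
  assumes F: "gsubmodule R R F" and gY: "graded_module R Y"
    and kill: "\<And>f y. f \<in> F \<Longrightarrow> y \<in> carrier Y \<Longrightarrow> f \<odot>\<^bsub>Y\<^esub> y = \<zero>\<^bsub>Y\<^esub>"
  shows "graded_module (gquot R F) (over_quotient Y)"
proof -
  interpret Y: graded_module R Y by fact
  interpret q: gquotient R R F by (rule gquotient_self[OF F])
  interpret I: ideal F R by (rule ideal_gsubmodule[OF F])
  have os: "(F +>\<^bsub>R\<^esub> a) \<odot>\<^bsub>over_quotient Y\<^esub> y = a \<odot>\<^bsub>Y\<^esub> y" if "a \<in> carrier R" "y \<in> carrier Y" for a y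
    by (rule over_quotient_smult[OF F Y.module_axioms _ that]) (rule kill)
  have ex: "\<exists>a\<in>carrier R. A = F +>\<^bsub>R\<^esub> a" if "A \<in> carrier (gquot R F)" for A using q.coset_ex[OF that] .
  have ab: "abelian_group (over_quotient Y)"
    by (rule abelian_groupI) (use abelian_groupE[OF Y.M.abelian_group_axioms] in \<open>simp_all\<close>)
  have mod: "Module.module (gquot R F) (over_quotient Y)"
  proof (intro moduleI cring_gquot[OF F] ab)
    fix A y assume "A \<in> carrier (gquot R F)" "y \<in> carrier (over_quotient Y)"
    then show "A \<odot>\<^bsub>over_quotient Y\<^esub> y \<in> carrier (over_quotient Y)" using ex[of A] os by auto
  next
    fix A B y assume "A \<in> carrier (gquot R F)" "B \<in> carrier (gquot R F)" "y \<in> carrier (over_quotient Y)"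
    then obtain a b where ab: "a \<in> carrier R" "A = F +>\<^bsub>R\<^esub> a" "b \<in> carrier R" "B = F +>\<^bsub>R\<^esub> b" and y: "y \<in> carrier Y"
      using ex[of A] ex[of B] by auto
    have "A \<oplus>\<^bsub>gquot R F\<^esub> B = F +>\<^bsub>R\<^esub> (a \<oplus>\<^bsub>R\<^esub> b)" using q.coset_add ab by simp
    then show "(A \<oplus>\<^bsub>gquot R F\<^esub> B) \<odot>\<^bsub>over_quotient Y\<^esub> y =
        A \<odot>\<^bsub>over_quotient Y\<^esub> y \<oplus>\<^bsub>over_quotient Y\<^esub> B \<odot>\<^bsub>over_quotient Y\<^esub> y"
      using os ab y Y.smult_l_distr by simp
    have "A \<otimes>\<^bsub>gquot R F\<^esub> B = F +>\<^bsub>R\<^esub> (a \<otimes>\<^bsub>R\<^esub> b)" using I.rcoset_mult_add ab by simp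
    then show "(A \<otimes>\<^bsub>gquot R F\<^esub> B) \<odot>\<^bsub>over_quotient Y\<^esub> y = A \<odot>\<^bsub>over_quotient Y\<^esub> (B \<odot>\<^bsub>over_quotient Y\<^esub> y)"
      using os ab y Y.smult_assoc1 by simp
  next
    fix A x y assume "A \<in> carrier (gquot R F)" "x \<in> carrier (over_quotient Y)" "y \<in> carrier (over_quotient Y)"
    then show "A \<odot>\<^bsub>over_quotient Y\<^esub> (x \<oplus>\<^bsub>over_quotient Y\<^esub> y) =
        A \<odot>\<^bsub>over_quotient Y\<^esub> x \<oplus>\<^bsub>over_quotient Y\<^esub> A \<odot>\<^bsub>over_quotient Y\<^esub> y"
      using ex[of A] os Y.smult_r_distr by auto
  next
    fix y assume "y \<in> carrier (over_quotient Y)"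
    then show "\<one>\<^bsub>gquot R F\<^esub> \<odot>\<^bsub>over_quotient Y\<^esub> y = y" using os by simp
  qed
  show ?thesis
  proof (rule graded_moduleI[OF mod])
    fix g
    have m: "\<ominus>\<^bsub>over_quotient Y\<^esub> y = \<ominus>\<^bsub>Y\<^esub> y" for y by (simp add: a_inv_def m_inv_def over_quotient_def)
    show "additive_subgroup (hcomp (over_quotient Y) g) (over_quotient Y)"
      by (rule additive_subgroup_of_module[OF mod]) (use Y.hcomp_carrier Y.hcomp_add Y.hcomp_neg m in auto)
  next
    fix x assume "x \<in> carrier (over_quotient Y)"
    then have x: "x \<in> carrier Y" by simp
    show "\<exists>S u. finite S \<and> (\<forall>g\<in>S. u g \<in> hcomp (over_quotient Y) g) \<and> x = finsum (over_quotient Y) u S"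
      using Y.hc_props[OF x] unfolding finsum_over_quotient over_quotient_simps by blast
  next
    fix S u assume "finite S" "\<forall>g\<in>S. u g \<in> hcomp (over_quotient Y) g" "finsum (over_quotient Y) u S = \<zero>\<^bsub>over_quotient Y\<^esub>"
    then show "\<forall>g\<in>S. u g = \<zero>\<^bsub>over_quotient Y\<^esub>"
      using Y.hcomp_independent[of S u] unfolding finsum_over_quotient over_quotient_simps by blast
  next
    fix g h A x assume "A \<in> hcomp (gquot R F) g" "x \<in> hcomp (over_quotient Y) h"
    then obtain a where a: "a \<in> hcomp R g" "A = F +>\<^bsub>R\<^esub> a" and x: "x \<in> hcomp Y h" by auto
    then show "A \<odot>\<^bsub>over_quotient Y\<^esub> x \<in> hcomp (over_quotient Y) (g + h)"
      using os[OF subsetD[OF hcomp_sub a(1)] Y.hcomp_carrier[OF x]] Y.hcomp_smult[OF a(1) x] by simp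
  qed
qed

lemma star_hom_compose:
  assumes gM: "graded_module R M" and gX: "graded_module R Y" and gN: "graded_module R N"
    and f: "f \<in> gr_hom R M Y 0" and h: "h \<in> carrier (star_hom R Y N)"
  shows "compose (carrier M) h f \<in> carrier (star_hom R M N)"
proof -
  interpret M: graded_module R M by fact
  obtain S u where S: "finite S" "\<forall>g\<in>S. u g \<in> gr_hom R Y N g" "\<forall>x\<in>carrier Y. h x = (\<Oplus>\<^bsub>N\<^esub>g\<in>S. u g x)"
    and H_hom: "h \<in> mod_hom R Y N"
    using h unfolding star_hom_carrier by blast
  note fm = mod_homD[OF gr_homD(1)[OF f]] and hD = mod_homD[OF H_hom]
  have "compose (carrier M) h f \<in> mod_hom R M N"
    by (rule mod_homI) (use fm hD in \<open>simp_all add: compose_eq\<close>)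
  moreover have "compose (carrier M) (u g) f \<in> gr_hom R M N g" if "g \<in> S" for g
    using gr_hom_compose[OF gM gX f, of "u g" N g] S(2) that by simp
  moreover have "compose (carrier M) h f x = (\<Oplus>\<^bsub>N\<^esub>g\<in>S. compose (carrier M) (u g) f x)" if "x \<in> carrier M" for x
    using S(3) fm(1)[OF that] that by (simp add: compose_eq)
  ultimately show ?thesis
    unfolding star_hom_carrier using S(1)
    by (intro conjI exI[of _ S] exI[of _ "\<lambda>g. compose (carrier M) (u g) f"]) simp_all
qed

end

section \<open>The extension module\<close>

text \<open>The formal core: \<open>X\<close> is onto on \<open>Q\<close>, \<open>i\<close> embeds
  \<open>Q'\<close> as its kernel, and homogeneous endomorphisms of \<open>Q'\<close> are scalars,
  with \<open>F\<close> as annihilator. The resolution is one of the shift of \<open>Q\<close> by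
  \<open>c\<close>; as a map to \<open>Q\<close> itself its augmentation has degree
  \<open>c\<close>.\<close>

locale self_dual_extension = graded_ring R for R :: "('a, 'a, 'g::ab_group_add) gmod" +
  fixes Q :: "('a, 'b, 'g) gmod" and Q' :: "('a, 'c, 'g) gmod" and c :: 'g and X :: 'a and F :: "'a set"
    and i :: "'c \<Rightarrow> 'b" and P :: "nat \<Rightarrow> ('a, 'p, 'g) gmod" and \<epsilon> D
  assumes gQ: "graded_module R Q" and gQ': "graded_module R Q'"
    and X: "X \<in> hcomp R c"
    and X_surj: "q \<in> carrier Q \<Longrightarrow> \<exists>q'\<in>carrier Q. X \<odot>\<^bsub>Q\<^esub> q' = q"
    and i_hom: "i \<in> gr_hom R Q' Q (- c)" and i_inj: "inj_on i (carrier Q')"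
    and i_im: "i ` carrier Q' = {q \<in> carrier Q. X \<odot>\<^bsub>Q\<^esub> q = \<zero>\<^bsub>Q\<^esub>}"
    and endo: "\<phi> \<in> gr_hom R Q' Q' g \<Longrightarrow> \<exists>f\<in>hcomp R g. \<forall>q\<in>carrier Q'. \<phi> q = f \<odot>\<^bsub>Q'\<^esub> q"
    and F_sub: "gsubmodule R R F" and F_hc: "f \<in> F \<Longrightarrow> hc R f g \<in> F"
    and ann: "f \<in> carrier R \<Longrightarrow> (\<forall>q\<in>carrier Q'. f \<odot>\<^bsub>Q'\<^esub> q = \<zero>\<^bsub>Q'\<^esub>) \<longleftrightarrow> f \<in> F"
    and res: "graded_free_resolution R (gshift Q c) P \<epsilon> D"
begin

lemma P_free: "\<exists>B. graded_free_on R (P n) B"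
  using res by (auto simp: graded_free_resolution_def)

lemma gP: "graded_module R (P n)"
  using P_free[of n] by (auto simp: graded_free_on_def)

sublocale Q: graded_module R Q by (rule gQ)
sublocale Q': graded_module R Q' by (rule gQ')
sublocale P: graded_module R "P n" for n by (rule gP)

lemma XR: "X \<in> carrier R" using X hcomp_sub by blast

lemma eps_hom: "\<epsilon> \<in> gr_hom R (P 0) Q c"
  using res by (simp add: graded_free_resolution_def gr_hom_gshift)

lemma eps_surj: "\<epsilon> ` carrier (P 0) = carrier Q"
  using res by (simp add: graded_free_resolution_def)

lemma D_hom: "D n \<in> gr_hom R (P (Suc n)) (P n) 0"
  using res by (simp add: graded_free_resolution_def)

lemma D0_im: "D 0 ` carrier (P (Suc 0)) = {x \<in> carrier (P 0). \<epsilon> x = \<zero>\<^bsub>Q\<^esub>}"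
  using res by (simp add: graded_free_resolution_def One_nat_def)

lemma D1_im: "D (Suc 0) ` carrier (P (Suc (Suc 0))) = {x \<in> carrier (P (Suc 0)). D 0 x = \<zero>\<^bsub>P 0\<^esub>}"
  using res by (simp add: graded_free_resolution_def)

lemmas em = mod_homD[OF gr_homD(1)[OF eps_hom]]
lemmas Dm = mod_homD[OF gr_homD(1)[OF D_hom]]
lemmas im = mod_homD[OF gr_homD(1)[OF i_hom]]
lemmas D_zero = mod_hom_zero[OF P.module_axioms P.module_axioms gr_homD(1)[OF D_hom]]
lemmas D_diff = mod_hom_diff[OF P.module_axioms P.module_axioms gr_homD(1)[OF D_hom]]
lemmas e_diff = mod_hom_diff[OF P.module_axioms Q.module_axioms gr_homD(1)[OF eps_hom]]
lemmas i_zero = mod_hom_zero[OF Q'.module_axioms Q.module_axioms gr_homD(1)[OF i_hom]]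

lemma i_eq: "q \<in> carrier Q' \<Longrightarrow> q' \<in> carrier Q' \<Longrightarrow> i q = i q' \<longleftrightarrow> q = q'"
  using i_inj by (auto simp: inj_on_def)

lemma X_i: "q \<in> carrier Q' \<Longrightarrow> X \<odot>\<^bsub>Q\<^esub> i q = \<zero>\<^bsub>Q\<^esub>"
  using i_im by blast

lemma X_kill: "q \<in> carrier Q' \<Longrightarrow> X \<odot>\<^bsub>Q'\<^esub> q = \<zero>\<^bsub>Q'\<^esub>"
  using im(3)[OF XR, of q] X_i[of q] i_zero i_eq[of "X \<odot>\<^bsub>Q'\<^esub> q" "\<zero>\<^bsub>Q'\<^esub>"] XR by auto

lemma F_carrier: "f \<in> F \<Longrightarrow> f \<in> carrier R"
  using F_sub by (auto simp: gsubmodule_def)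

lemma F_kill: "f \<in> F \<Longrightarrow> q \<in> carrier Q' \<Longrightarrow> f \<odot>\<^bsub>Q'\<^esub> q = \<zero>\<^bsub>Q'\<^esub>"
  using ann F_carrier by blast

definition lifting :: "('p \<Rightarrow> 'b) \<Rightarrow> ('p \<Rightarrow> 'c) \<Rightarrow> bool" where
  "lifting l z \<longleftrightarrow> l \<in> gr_hom R (P 0) Q 0 \<and> (\<forall>y\<in>carrier (P 0). X \<odot>\<^bsub>Q\<^esub> l y = \<epsilon> y) \<and>
    z \<in> mod_hom R (P (Suc 0)) Q' \<and> (\<forall>y\<in>carrier (P (Suc 0)). i (z y) = l (D 0 y))"

definition cocycle :: "('p \<Rightarrow> 'c) \<Rightarrow> bool" where
  "cocycle z \<longleftrightarrow> (\<forall>y\<in>carrier (P (Suc (Suc 0))). z (D (Suc 0) y) = \<zero>\<^bsub>Q'\<^esub>)"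

lemma X_hom: "(\<lambda>q\<in>carrier Q. X \<odot>\<^bsub>Q\<^esub> q) \<in> gr_hom R Q Q c"
proof -
  have e: "(\<lambda>q\<in>carrier Q. X \<odot>\<^bsub>Q\<^esub> (\<lambda>q\<in>carrier Q. q) q) = (\<lambda>q\<in>carrier Q. X \<odot>\<^bsub>Q\<^esub> q)" by (rule restrict_ext) simp
  show ?thesis using gr_hom_pointwise_smult[OF gQ gQ gr_hom_id[OF gQ] X XR] unfolding e by simp
qed

text \<open>\<open>P 0\<close> is free and \<open>X\<close> is onto, so \<open>\<epsilon>\<close>
  lifts to \<open>l\<close>. As \<open>\<epsilon>\<close> vanishes on the image of
  \<open>D 0\<close>, \<open>l\<close> maps that image into the kernel of \<open>X\<close>, which is
  the image of \<open>i\<close>; freeness of \<open>P 1\<close> then gives \<open>z\<close>.\<close>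

lemma lifting_ex: "\<exists>l z. lifting l z"
proof -
  obtain B0 where B0: "graded_free_on R (P 0) B0" using P_free by blast
  obtain B1 where B1: "graded_free_on R (P (Suc 0)) B1" using P_free by blast
  have "\<epsilon> y \<in> (\<lambda>q\<in>carrier Q. X \<odot>\<^bsub>Q\<^esub> q) ` carrier Q" if y: "y \<in> carrier (P 0)" for y
    using X_surj[OF em(1)[OF y]] by force
  from free_lift_hom[OF B0 gQ gQ eps_hom X_hom this]
  obtain l where l: "l \<in> gr_hom R (P 0) Q 0" "\<forall>y\<in>carrier (P 0). (\<lambda>q\<in>carrier Q. X \<odot>\<^bsub>Q\<^esub> q) (l y) = \<epsilon> y" by auto
  note lm = mod_homD[OF gr_homD(1)[OF l(1)]]
  have lX: "X \<odot>\<^bsub>Q\<^esub> l y = \<epsilon> y" if "y \<in> carrier (P 0)" for y using bspec[OF l(2) that] lm(1)[OF that] by simp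
  have lD: "compose (carrier (P (Suc 0))) l (D 0) \<in> gr_hom R (P (Suc 0)) Q (0 + 0)"
    by (rule gr_hom_compose[OF gP gP D_hom l(1)])
  have "compose (carrier (P (Suc 0))) l (D 0) y \<in> i ` carrier Q'" if y: "y \<in> carrier (P (Suc 0))" for y
  proof -
    have "\<epsilon> (D 0 y) = \<zero>\<^bsub>Q\<^esub>" using D0_im y by blast
    then show ?thesis using lX[OF Dm(1)[OF y]] lm(1)[OF Dm(1)[OF y]] y by (simp add: compose_eq i_im)
  qed
  from free_lift_hom[OF B1 gQ' gQ lD i_hom this]
  obtain z where z: "z \<in> gr_hom R (P (Suc 0)) Q' (0 + 0 - - c)"
    "\<forall>y\<in>carrier (P (Suc 0)). i (z y) = compose (carrier (P (Suc 0))) l (D 0) y" by blast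
  have "lifting l z"
    unfolding lifting_def using l(1) lX gr_homD(1)[OF z(1)] z(2) by (auto simp: compose_eq)
  then show ?thesis by blast
qed

text \<open>The composite of \<open>z\<close> with \<open>i\<close> has degree 0, and
  \<open>i\<close> is injective of degree \<open>- c\<close>; this forces degree \<open>c\<close> on
  \<open>z\<close>.\<close>

lemma lifting_degree:
  assumes "lifting l z"
  shows "z \<in> gr_hom R (P (Suc 0)) Q' c"
proof -
  have z: "z \<in> mod_hom R (P (Suc 0)) Q'" and l: "l \<in> gr_hom R (P 0) Q 0"
    and zl: "\<And>y. y \<in> carrier (P (Suc 0)) \<Longrightarrow> i (z y) = l (D 0 y)" using assms by (auto simp: lifting_def)
  have "z y \<in> hcomp Q' (g + c)" if y: "y \<in> hcomp (P (Suc 0)) g" for y g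
  proof -
    have yc: "y \<in> carrier (P (Suc 0))" using P.hcomp_carrier[OF y] .
    have v: "z y \<in> carrier Q'" using mod_homD(1)[OF z yc] .
    have "i (z y) \<in> hcomp Q g" using gr_homD(2)[OF l gr_homD(2)[OF D_hom y]] zl[OF yc] by simp
    then have "i (hc Q' (z y) (g + c)) = i (z y)"
      using gr_hom_hc[OF gQ' gQ i_hom v, of "g + c"] Q.hc_homog[of "i (z y)" g g] by simp
    then have "hc Q' (z y) (g + c) = z y" using i_eq[OF Q'.hc_carrier[OF v] v] by blast
    then show ?thesis using Q'.hc_props(1)[OF v, of "g + c"] by simp
  qed
  then show ?thesis using z by (auto simp: gr_hom_def)
qed

lemma lifting_cocycle: "lifting l z \<Longrightarrow> cocycle z"
  unfolding cocycle_def
proof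
  fix y assume h: "lifting l z" and y: "y \<in> carrier (P (Suc (Suc 0)))"
  have z: "z \<in> mod_hom R (P (Suc 0)) Q'" and l: "l \<in> gr_hom R (P 0) Q 0"
    and zl: "\<And>y. y \<in> carrier (P (Suc 0)) \<Longrightarrow> i (z y) = l (D 0 y)" using h by (auto simp: lifting_def)
  have d: "D (Suc 0) y \<in> carrier (P (Suc 0))" "D 0 (D (Suc 0) y) = \<zero>\<^bsub>P 0\<^esub>" using D1_im y by blast+
  have "i (z (D (Suc 0) y)) = i \<zero>\<^bsub>Q'\<^esub>"
    using zl[OF d(1)] d(2) mod_hom_zero[OF P.module_axioms Q.module_axioms gr_homD(1)[OF l]] i_zero by simp
  then show "z (D (Suc 0) y) = \<zero>\<^bsub>Q'\<^esub>" using i_eq[OF mod_homD(1)[OF z d(1)]] by simp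
qed

text \<open>Choose \<open>y\<close> over \<open>i q\<close>. Since \<open>X\<close> kills
  \<open>i q\<close>, the augmentation kills X y, hence X y = \<open>D 0 w\<close>; the snake map of
  a cocycle \<open>z\<close> sends \<open>q\<close> to \<open>z w\<close>. It is a relation because
  \<open>y\<close> and \<open>w\<close> are arbitrary choices.\<close>

definition chase :: "'c \<Rightarrow> 'p \<Rightarrow> 'p \<Rightarrow> bool" where
  "chase q y w \<longleftrightarrow> q \<in> carrier Q' \<and> y \<in> carrier (P 0) \<and> w \<in> carrier (P (Suc 0)) \<and>
     \<epsilon> y = i q \<and> D 0 w = X \<odot>\<^bsub>P 0\<^esub> y"

text \<open>All choices can be homogeneous: \<open>i\<close> and \<open>\<epsilon>\<close> put
  \<open>y\<close> in degree \<open>h - c - c\<close>, multiplication by \<open>X\<close> returns to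
  \<open>h - c\<close>, and \<open>D 0\<close> has degree 0.\<close>

lemma chase_homog:
  assumes "q \<in> hcomp Q' h"
  shows "\<exists>y w. chase q y w \<and> w \<in> hcomp (P (Suc 0)) (h - c)"
proof -
  have q: "q \<in> carrier Q'" using Q'.hcomp_carrier[OF assms] .
  have iq: "i q \<in> hcomp Q (h + - c)" by (rule gr_homD(2)[OF i_hom assms])
  have "i q \<in> \<epsilon> ` carrier (P 0)" using eps_surj im(1)[OF q] by simp
  from gr_hom_preimage[OF gP gQ eps_hom iq this]
  obtain y where y: "y \<in> hcomp (P 0) (h + - c - c)" "\<epsilon> y = i q" by blast
  have yc: "y \<in> carrier (P 0)" using P.hcomp_carrier[OF y(1)] .
  have Xy: "X \<odot>\<^bsub>P 0\<^esub> y \<in> hcomp (P 0) (h - c)" using P.hcomp_smult[OF X y(1)] by (simp add: algebra_simps)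
  have "\<epsilon> (X \<odot>\<^bsub>P 0\<^esub> y) = \<zero>\<^bsub>Q\<^esub>" using em(3)[OF XR yc] y(2) X_i[OF q] by simp
  then have "X \<odot>\<^bsub>P 0\<^esub> y \<in> D 0 ` carrier (P (Suc 0))" unfolding D0_im using P.smult_closed[OF XR yc] by simp
  from gr_hom_preimage[OF gP gP D_hom Xy this] show ?thesis
    using q yc y(2) P.hcomp_carrier by (fastforce simp: chase_def)
qed

lemma chase_ex: "q \<in> carrier Q' \<Longrightarrow> \<exists>y w. chase q y w"
proof -
  assume q: "q \<in> carrier Q'"
  have "i q \<in> \<epsilon> ` carrier (P 0)" using eps_surj im(1)[OF q] by simp
  then obtain y where y: "y \<in> carrier (P 0)" "\<epsilon> y = i q" by force
  have "\<epsilon> (X \<odot>\<^bsub>P 0\<^esub> y) = \<zero>\<^bsub>Q\<^esub>" using em(3)[OF XR y(1)] y(2) X_i[OF q] by simp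
  then have "X \<odot>\<^bsub>P 0\<^esub> y \<in> D 0 ` carrier (P (Suc 0))" unfolding D0_im using P.smult_closed[OF XR y(1)] by simp
  then show ?thesis using q y by (force simp: chase_def)
qed

lemma chase_add:
  assumes "chase q y w" "chase q' y' w'"
  shows "chase (q \<oplus>\<^bsub>Q'\<^esub> q') (y \<oplus>\<^bsub>P 0\<^esub> y') (w \<oplus>\<^bsub>P (Suc 0)\<^esub> w')"
  using assms em(2) im(2) Dm(2) P.smult_r_distr XR by (simp add: chase_def)

lemma chase_smult:
  assumes "chase q y w" "a \<in> carrier R"
  shows "chase (a \<odot>\<^bsub>Q'\<^esub> q) (a \<odot>\<^bsub>P 0\<^esub> y) (a \<odot>\<^bsub>P (Suc 0)\<^esub> w)"
  using assms em(3) im(3) Dm(3) P.smult_swap XR by (simp add: chase_def)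

text \<open>Two choices of \<open>y\<close> differ by some \<open>D 0 v\<close>, and then w - w' - X
  v lies in the image of the next differential, where the cocycle \<open>z\<close> vanishes. The
  remaining term z (X v) = X (z v) is zero because \<open>X\<close> kills \<open>Q'\<close>.\<close>

lemma chase_unique:
  assumes z: "z \<in> mod_hom R (P (Suc 0)) Q'" "cocycle z" and "chase q y w" "chase q y' w'"
  shows "z w = z w'"
proof -
  have c: "y \<in> carrier (P 0)" "y' \<in> carrier (P 0)" "w \<in> carrier (P (Suc 0))" "w' \<in> carrier (P (Suc 0))" "q \<in> carrier Q'"
    and e: "\<epsilon> y = i q" "\<epsilon> y' = i q" "D 0 w = X \<odot>\<^bsub>P 0\<^esub> y" "D 0 w' = X \<odot>\<^bsub>P 0\<^esub> y'"
    using assms(3,4) by (auto simp: chase_def)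
  have "\<epsilon> (y \<ominus>\<^bsub>P 0\<^esub> y') = \<zero>\<^bsub>Q\<^esub>" using e_diff[OF c(1,2)] e im(1)[OF c(5)] by (simp add: Q.M.diff_eq_zero_iff)
  then have "y \<ominus>\<^bsub>P 0\<^esub> y' \<in> D 0 ` carrier (P (Suc 0))" unfolding D0_im using c by simp
  then obtain v where v: "v \<in> carrier (P (Suc 0))" "D 0 v = y \<ominus>\<^bsub>P 0\<^esub> y'" by force
  let ?u = "w \<ominus>\<^bsub>P (Suc 0)\<^esub> w'"
  have Xv: "X \<odot>\<^bsub>P (Suc 0)\<^esub> v \<in> carrier (P (Suc 0))" using v XR by simp
  have u: "?u \<in> carrier (P (Suc 0))" using c by simp
  have "D 0 ?u = D 0 (X \<odot>\<^bsub>P (Suc 0)\<^esub> v)"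
    using D_diff[OF c(3,4)] e Dm(3)[OF XR v(1)] v(2) P.smult_diff[OF XR c(1,2)] by simp
  then have "D 0 (?u \<ominus>\<^bsub>P (Suc 0)\<^esub> X \<odot>\<^bsub>P (Suc 0)\<^esub> v) = \<zero>\<^bsub>P 0\<^esub>"
    using D_diff[of ?u 0 "X \<odot>\<^bsub>P (Suc 0)\<^esub> v"] c Xv Dm(1)[OF Xv] by (simp add: P.M.diff_eq_zero_iff)
  then have "?u \<ominus>\<^bsub>P (Suc 0)\<^esub> X \<odot>\<^bsub>P (Suc 0)\<^esub> v \<in> D (Suc 0) ` carrier (P (Suc (Suc 0)))"
    unfolding D1_im using c Xv by simp
  then obtain t where "t \<in> carrier (P (Suc (Suc 0)))" "D (Suc 0) t = ?u \<ominus>\<^bsub>P (Suc 0)\<^esub> X \<odot>\<^bsub>P (Suc 0)\<^esub> v" by force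
  then have k: "z (?u \<ominus>\<^bsub>P (Suc 0)\<^esub> X \<odot>\<^bsub>P (Suc 0)\<^esub> v) = \<zero>\<^bsub>Q'\<^esub>" using z(2) unfolding cocycle_def by metis
  note zd = mod_hom_diff[OF P.module_axioms Q'.module_axioms z(1)] and zm = mod_homD[OF z(1)]
  have "z ?u = z (X \<odot>\<^bsub>P (Suc 0)\<^esub> v)"
    using zd[OF u Xv] k Q'.M.diff_eq_zero_iff[OF zm(1)[OF u] zm(1)[OF Xv]] by simp
  also have "\<dots> = \<zero>\<^bsub>Q'\<^esub>" using zm(3)[OF XR v(1)] X_kill[OF zm(1)[OF v(1)]] by simp
  finally show ?thesis using zd[OF c(3,4)] Q'.M.diff_eq_zero_iff[OF zm(1)[OF c(3)] zm(1)[OF c(4)]] by simp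
qed

text \<open>The given sequence has the identity as its snake map: i (z w) = l (X y) = X (l y) =
  \<open>\<epsilon> y\<close> = i q, and \<open>i\<close> is injective.\<close>

lemma chase_lifting:
  assumes "lifting l z" "chase q y w"
  shows "z w = q"
proof -
  have l: "l \<in> gr_hom R (P 0) Q 0" "\<forall>y\<in>carrier (P 0). X \<odot>\<^bsub>Q\<^esub> l y = \<epsilon> y"
    and z: "z \<in> mod_hom R (P (Suc 0)) Q'" "\<forall>y\<in>carrier (P (Suc 0)). i (z y) = l (D 0 y)"
    using assms(1) by (auto simp: lifting_def)
  have c: "y \<in> carrier (P 0)" "w \<in> carrier (P (Suc 0))" "q \<in> carrier Q'" "\<epsilon> y = i q" "D 0 w = X \<odot>\<^bsub>P 0\<^esub> y"
    using assms(2) by (auto simp: chase_def)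
  have "i (z w) = i q" using z(2) c l(2) mod_homD(3)[OF gr_homD(1)[OF l(1)] XR c(1)] by simp
  then show ?thesis using i_eq mod_homD(1)[OF z(1) c(2)] c(3) by blast
qed

text \<open>The snake map for multiplication by \<open>X\<close> on the extension of \<open>Q(c)\<close> by \<open>Q'\<close> that belongs to the
  cocycle \<open>z\<close>; the relation \<open>chase\<close> is the diagram chase in the resolution.\<close>

definition pushed :: "('p \<Rightarrow> 'c) \<Rightarrow> 'c \<Rightarrow> 'c" where
  "pushed z = (\<lambda>q\<in>carrier Q'. z (SOME w. \<exists>y. chase q y w))"

lemma pushed_eq:
  assumes z: "z \<in> mod_hom R (P (Suc 0)) Q'" "cocycle z" and c: "chase q y w"
  shows "pushed z q = z w"
proof -
  have "\<exists>y. chase q y (SOME w. \<exists>y. chase q y w)" by (rule someI[of "\<lambda>w. \<exists>y. chase q y w" w]) (use c in blast)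
  then have "z (SOME w. \<exists>y. chase q y w) = z w" using chase_unique[OF z _ c] by blast
  then show ?thesis using c by (simp add: pushed_def chase_def)
qed

text \<open>Chases add and scale, and the value is independent of the choices, so
  \<open>pushed z\<close> is linear. A homogeneous chase lowers degrees by \<open>c\<close>, whence
  the degree \<open>g - c\<close>.\<close>

lemma pushed_hom:
  assumes z: "z \<in> gr_hom R (P (Suc 0)) Q' g" "cocycle z"
  shows "pushed z \<in> gr_hom R Q' Q' (g - c)"
proof -
  note zm = mod_homD[OF gr_homD(1)[OF z(1)]] and pe = pushed_eq[OF gr_homD(1)[OF z(1)] z(2)]
  show ?thesis
  proof (rule gr_homI)
    show "pushed z \<in> extensional (carrier Q')" by (simp add: pushed_def)
  next
    fix x assume "x \<in> carrier Q'"
    then obtain y w where ch: "chase x y w" using chase_ex by blast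
    then show "pushed z x \<in> carrier Q'" using pe[OF ch] zm(1)[of w] by (simp add: chase_def)
  next
    fix x x' assume "x \<in> carrier Q'" "x' \<in> carrier Q'"
    then obtain y w y' w' where ch: "chase x y w" "chase x' y' w'" using chase_ex by metis
    then show "pushed z (x \<oplus>\<^bsub>Q'\<^esub> x') = pushed z x \<oplus>\<^bsub>Q'\<^esub> pushed z x'"
      using pe[OF ch(1)] pe[OF ch(2)] pe[OF chase_add[OF ch]] zm(2)[of w w'] by (simp add: chase_def)
  next
    fix a x assume a: "a \<in> carrier R" and "x \<in> carrier Q'"
    then obtain y w where ch: "chase x y w" using chase_ex by blast
    then show "pushed z (a \<odot>\<^bsub>Q'\<^esub> x) = a \<odot>\<^bsub>Q'\<^esub> pushed z x"
      using pe[OF ch] pe[OF chase_smult[OF ch a]] zm(3)[OF a, of w] by (simp add: chase_def)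
  next
    fix h x assume "x \<in> hcomp Q' h"
    then obtain y w where ch: "chase x y w" and w: "w \<in> hcomp (P (Suc 0)) (h - c)" using chase_homog by blast
    show "pushed z x \<in> hcomp Q' (h + (g - c))"
      using pe[OF ch] gr_homD(2)[OF z(1) w] by (simp add: algebra_simps)
  qed
qed

text \<open>Lifting \<open>l\<close> through \<open>\<epsilon>\<close> gives \<open>m\<close> with \<open>\<epsilon> \<circ> m = l\<close>; then \<open>X m - id\<close> maps into the image of \<open>D 0\<close> and
  lifts to \<open>n\<close>. So every cocycle is cohomologous to \<open>pushed z \<circ> z0\<close>.\<close>

lemma homotopy:
  assumes "lifting l z0"
  shows "\<exists>n\<in>gr_hom R (P 0) (P (Suc 0)) 0. \<forall>z w. z \<in> mod_hom R (P (Suc 0)) Q' \<longrightarrow> cocycle z \<longrightarrow> w \<in> carrier (P (Suc 0)) \<longrightarrow>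
    pushed z (z0 w) = z w \<oplus>\<^bsub>Q'\<^esub> z (n (D 0 w))"
proof -
  obtain B0 where B0: "graded_free_on R (P 0) B0" using P_free by blast
  have l: "l \<in> gr_hom R (P 0) Q 0" "\<forall>y\<in>carrier (P 0). X \<odot>\<^bsub>Q\<^esub> l y = \<epsilon> y"
    and z0: "z0 \<in> mod_hom R (P (Suc 0)) Q'" "\<forall>y\<in>carrier (P (Suc 0)). i (z0 y) = l (D 0 y)"
    using assms by (auto simp: lifting_def)
  note lm = mod_homD[OF gr_homD(1)[OF l(1)]]
  have "l y \<in> \<epsilon> ` carrier (P 0)" if "y \<in> carrier (P 0)" for y using lm(1)[OF that] eps_surj by simp
  from free_lift_hom[OF B0 gP gQ l(1) eps_hom this]
  obtain m where m: "m \<in> gr_hom R (P 0) (P 0) (0 - c)" "\<forall>y\<in>carrier (P 0). \<epsilon> (m y) = l y" by blast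
  note mm = mod_homD[OF gr_homD(1)[OF m(1)]]
  define k where "k = (\<lambda>y\<in>carrier (P 0). (\<lambda>y\<in>carrier (P 0). X \<odot>\<^bsub>P 0\<^esub> m y) y \<ominus>\<^bsub>P 0\<^esub> (\<lambda>y\<in>carrier (P 0). y) y)"
  have "(\<lambda>y\<in>carrier (P 0). X \<odot>\<^bsub>P 0\<^esub> m y) \<in> gr_hom R (P 0) (P 0) (0 - c + c)"
    by (rule gr_hom_pointwise_smult[OF gP gP m(1) X XR])
  then have "(\<lambda>y\<in>carrier (P 0). X \<odot>\<^bsub>P 0\<^esub> m y) \<in> gr_hom R (P 0) (P 0) 0" by simp
  then have k: "k \<in> gr_hom R (P 0) (P 0) 0" unfolding k_def by (rule gr_hom_diff[OF gP gP _ gr_hom_id[OF gP]])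
  have ky: "k y = X \<odot>\<^bsub>P 0\<^esub> m y \<ominus>\<^bsub>P 0\<^esub> y" if "y \<in> carrier (P 0)" for y using that by (simp add: k_def)
  have "k y \<in> D 0 ` carrier (P (Suc 0))" if y: "y \<in> carrier (P 0)" for y
  proof -
    have Xm: "X \<odot>\<^bsub>P 0\<^esub> m y \<in> carrier (P 0)" using XR mm(1)[OF y] by simp
    have "\<epsilon> (k y) = \<zero>\<^bsub>Q\<^esub>"
      using ky[OF y] e_diff[OF Xm y] em(3)[OF XR mm(1)[OF y]] m(2) l(2) y em(1)[OF y] by (simp add: Q.M.diff_eq_zero_iff)
    then show ?thesis unfolding D0_im using mod_homD(1)[OF gr_homD(1)[OF k] y] by simp
  qed
  from free_lift_hom[OF B0 gP gP k D_hom this]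
  obtain n where n: "n \<in> gr_hom R (P 0) (P (Suc 0)) 0" "\<forall>y\<in>carrier (P 0). D 0 (n y) = k y" by auto
  note nm = mod_homD[OF gr_homD(1)[OF n(1)]]
  have "pushed z (z0 w) = z w \<oplus>\<^bsub>Q'\<^esub> z (n (D 0 w))"
    if z: "z \<in> mod_hom R (P (Suc 0)) Q'" "cocycle z" and w: "w \<in> carrier (P (Suc 0))" for z w
  proof -
    let ?d = "D 0 w"
    have d: "?d \<in> carrier (P 0)" using Dm(1)[OF w] .
    have Xm: "X \<odot>\<^bsub>P 0\<^esub> m ?d \<in> carrier (P 0)" using XR mm(1)[OF d] by simp
    have "D 0 (w \<oplus>\<^bsub>P (Suc 0)\<^esub> n ?d) = ?d \<oplus>\<^bsub>P 0\<^esub> (X \<odot>\<^bsub>P 0\<^esub> m ?d \<ominus>\<^bsub>P 0\<^esub> ?d)"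
      using Dm(2)[OF w nm(1)[OF d]] n(2) ky d by simp
    also have "\<dots> = X \<odot>\<^bsub>P 0\<^esub> m ?d"
      using P.M.diff_add[OF Xm d] P.M.a_comm[OF d P.M.minus_closed[OF Xm d]] by simp
    \<comment> \<open>Both conditions for a chase of \<open>z0 w\<close> hold:
      \<open>\<epsilon>\<close> sends \<open>m ?d\<close> to \<open>l ?d\<close>, which is
      \<open>i (z0 w)\<close>, and adding \<open>n ?d\<close> turns \<open>D 0 w\<close> into
      \<open>X\<close> times \<open>m ?d\<close>.\<close>
    finally have "chase (z0 w) (m ?d) (w \<oplus>\<^bsub>P (Suc 0)\<^esub> n ?d)"
      using mod_homD(1)[OF z0(1) w] mm(1)[OF d] w nm(1)[OF d] m(2) z0(2) d by (simp add: chase_def)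
    from pushed_eq[OF z this] show ?thesis using mod_homD(2)[OF z(1) w nm(1)[OF d]] by simp
  qed
  then show ?thesis using n(1) by blast
qed

section \<open>Ext in degree one as cocycles modulo coboundaries\<close>

abbreviation "H n \<equiv> star_hom R (P n) Q'"

definition Z1 :: "('p \<Rightarrow> 'c) set" where
  "Z1 = {f \<in> carrier (H (Suc 0)). cocycle f}"

definition B1 :: "('p \<Rightarrow> 'c) set" where
  "B1 = (\<lambda>h. compose (carrier (P (Suc 0))) h (D 0)) ` carrier (H 0)"

abbreviation "Ext \<equiv> star_ext R P D Q' 1"

lemma Ext_eq: "Ext = gquot (gsub (H (Suc 0)) Z1) B1"
proof -
  have "(compose (carrier (P (Suc (Suc 0)))) f (D (Suc 0)) = (\<lambda>x\<in>carrier (P (Suc (Suc 0))). \<zero>\<^bsub>Q'\<^esub>)) \<longleftrightarrow> cocycle f" for f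
  proof
    assume h: "compose (carrier (P (Suc (Suc 0)))) f (D (Suc 0)) = (\<lambda>x\<in>carrier (P (Suc (Suc 0))). \<zero>\<^bsub>Q'\<^esub>)"
    show "cocycle f" unfolding cocycle_def
    proof
      fix y assume "y \<in> carrier (P (Suc (Suc 0)))"
      then show "f (D (Suc 0) y) = \<zero>\<^bsub>Q'\<^esub>" using fun_cong[OF h, of y] by (simp add: compose_eq)
    qed
  next
    assume "cocycle f"
    then show "compose (carrier (P (Suc (Suc 0)))) f (D (Suc 0)) = (\<lambda>x\<in>carrier (P (Suc (Suc 0))). \<zero>\<^bsub>Q'\<^esub>)"
      by (auto simp: compose_def cocycle_def intro!: restrict_ext)
  qed
  then have "{f \<in> carrier (H (Suc 0)). compose (carrier (P (Suc (Suc 0)))) f (D (Suc 0)) = \<zero>\<^bsub>H (Suc (Suc 0))\<^esub>} = Z1"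
    unfolding Z1_def star_hom_simps by blast
  then show ?thesis
    unfolding star_ext_def cohomology_def B1_def One_nat_def by simp
qed

lemma H_hom: "f \<in> carrier (H n) \<Longrightarrow> f \<in> mod_hom R (P n) Q'"
  by (simp add: star_hom_carrier)

lemma Z1_sub: "gsubmodule R (H (Suc 0)) Z1"
proof -
  interpret H: Module.module R "H (Suc 0)" by (rule module_star_hom[OF gP gQ'])
  have d: "y \<in> carrier (P (Suc (Suc 0))) \<Longrightarrow> D (Suc 0) y \<in> carrier (P (Suc 0))" for y by (rule Dm(1))
  have "a \<odot>\<^bsub>H (Suc 0)\<^esub> f \<in> Z1" if "a \<in> carrier R" "f \<in> Z1" for a f
    using that H.smult_closed[of a f] d by (auto simp: Z1_def cocycle_def)
  moreover have "f \<oplus>\<^bsub>H (Suc 0)\<^esub> h \<in> Z1" if "f \<in> Z1" "h \<in> Z1" for f h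
    using that H.M.a_closed[of f h] d by (auto simp: Z1_def cocycle_def)
  moreover have "\<zero>\<^bsub>H (Suc 0)\<^esub> \<in> Z1"
    using H.M.zero_closed d by (auto simp: Z1_def cocycle_def)
  ultimately show ?thesis by (auto simp: gsubmodule_def Z1_def simp del: star_hom_simps)
qed

lemma B1_Z1: "B1 \<subseteq> Z1"
proof
  fix b assume "b \<in> B1"
  then obtain h where h: "h \<in> carrier (H 0)" "b = compose (carrier (P (Suc 0))) h (D 0)" by (auto simp: B1_def)
  have "b \<in> carrier (H (Suc 0))" unfolding h(2) by (rule star_hom_compose[OF gP gP gQ' D_hom h(1)])
  moreover have "cocycle b" unfolding cocycle_def
  proof
    fix y assume y: "y \<in> carrier (P (Suc (Suc 0)))"
    have d: "D (Suc 0) y \<in> carrier (P (Suc 0))" "D 0 (D (Suc 0) y) = \<zero>\<^bsub>P 0\<^esub>" using D1_im y by blast+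
    then show "b (D (Suc 0) y) = \<zero>\<^bsub>Q'\<^esub>"
      using mod_hom_zero[OF P.module_axioms Q'.module_axioms H_hom[OF h(1)]] by (simp add: h(2) compose_eq)
  qed
  ultimately show "b \<in> Z1" by (simp add: Z1_def)
qed

abbreviation "N1 \<equiv> gsub (H (Suc 0)) Z1"

lemma B1_sub: "gsubmodule R N1 B1"
proof -
  interpret H0: Module.module R "H 0" by (rule module_star_hom[OF gP gQ'])
  let ?c = "\<lambda>h. compose (carrier (P (Suc 0))) h (D 0)"
  have add: "?c h \<oplus>\<^bsub>H (Suc 0)\<^esub> ?c h' = ?c (h \<oplus>\<^bsub>H 0\<^esub> h')" for h h'
    using Dm(1) by (auto simp: compose_def intro!: restrict_ext)
  have smult: "a \<odot>\<^bsub>H (Suc 0)\<^esub> ?c h = ?c (a \<odot>\<^bsub>H 0\<^esub> h)" for a h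
    using Dm(1) by (auto simp: compose_def intro!: restrict_ext)
  have zero: "\<zero>\<^bsub>H (Suc 0)\<^esub> = ?c \<zero>\<^bsub>H 0\<^esub>"
    using Dm(1) by (auto simp: compose_def intro!: restrict_ext)
  have zB: "\<zero>\<^bsub>H (Suc 0)\<^esub> \<in> B1" unfolding B1_def zero using H0.M.zero_closed by (rule imageI)
  have aB: "x \<oplus>\<^bsub>H (Suc 0)\<^esub> y \<in> B1" if xy: "x \<in> B1" "y \<in> B1" for x y
  proof -
    obtain h h' where "h \<in> carrier (H 0)" "x = ?c h" "h' \<in> carrier (H 0)" "y = ?c h'" using xy unfolding B1_def by blast
    then show ?thesis using add H0.M.a_closed unfolding B1_def by (simp del: star_hom_simps)
  qed
  have sB: "a \<odot>\<^bsub>H (Suc 0)\<^esub> x \<in> B1" if a: "a \<in> carrier R" and x: "x \<in> B1" for a x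
  proof -
    obtain h where "h \<in> carrier (H 0)" "x = ?c h" using x unfolding B1_def by blast
    then show ?thesis using smult H0.smult_closed[OF a] unfolding B1_def by (simp del: star_hom_simps)
  qed
  show ?thesis unfolding gsubmodule_def gsub_simps using B1_Z1 zB aB sB by (intro conjI ballI)
qed

lemma module_N1: "Module.module R N1"
  by (rule module_gsub[OF module_star_hom[OF gP gQ'] Z1_sub])

sublocale E: gquotient R N1 B1
  by (intro gquotient.intro gquotient_axioms.intro module_N1 B1_sub)

abbreviation cls :: "('p \<Rightarrow> 'c) \<Rightarrow> ('p \<Rightarrow> 'c) set" where
  "cls z \<equiv> B1 +>\<^bsub>N1\<^esub> z"

lemma module_Ext: "Module.module R Ext"
  unfolding Ext_eq by (rule E.module_gquot)

lemma cls_Ext: "z \<in> Z1 \<Longrightarrow> cls z \<in> carrier Ext"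
  unfolding Ext_eq using E.coset_carrier[of z] by simp

lemma Ext_ex: "Z \<in> carrier Ext \<Longrightarrow> \<exists>z\<in>Z1. Z = cls z"
  unfolding Ext_eq using E.coset_ex[of Z] by simp

lemma Ext_zero: "\<zero>\<^bsub>Ext\<^esub> = B1"
  unfolding Ext_eq by simp

lemma cls_smult: "a \<in> carrier R \<Longrightarrow> z \<in> Z1 \<Longrightarrow> a \<odot>\<^bsub>Ext\<^esub> cls z = cls (\<lambda>y\<in>carrier (P (Suc 0)). a \<odot>\<^bsub>Q'\<^esub> z y)"
  unfolding Ext_eq using E.coset_smult[of a z] by simp

lemma Ext_hcomp: "hcomp Ext g = cls ` (gr_hom R (P (Suc 0)) Q' g \<inter> Z1)"
  unfolding Ext_eq by simp

lemma Z1_hom: "z \<in> Z1 \<Longrightarrow> z \<in> mod_hom R (P (Suc 0)) Q'"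
  by (simp add: Z1_def H_hom)

lemma Z1_smult: "a \<in> carrier R \<Longrightarrow> z \<in> Z1 \<Longrightarrow> (\<lambda>y\<in>carrier (P (Suc 0)). a \<odot>\<^bsub>Q'\<^esub> z y) \<in> Z1"
  using Z1_sub by (auto simp: gsubmodule_def)

text \<open>The difference is the coboundary of \<open>z\<close> composed with \<open>n\<close>.
  This composite is a finite sum of homogeneous maps because \<open>z\<close> is one and
  \<open>n\<close> has degree 0.\<close>

lemma cls_eqI:
  assumes n: "n \<in> gr_hom R (P 0) (P (Suc 0)) 0" and z: "z \<in> Z1" and z': "z' \<in> Z1"
    and e: "\<And>w. w \<in> carrier (P (Suc 0)) \<Longrightarrow> z' w = z w \<oplus>\<^bsub>Q'\<^esub> z (n (D 0 w))"
  shows "cls z' = cls z"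
proof -
  let ?b = "compose (carrier (P (Suc 0))) (compose (carrier (P 0)) z n) (D 0)"
  have "z \<in> carrier (H (Suc 0))" using z by (simp add: Z1_def)
  from star_hom_compose[OF gP gP gQ' n this]
  have b: "?b \<in> B1" by (auto simp: B1_def)
  have "z' = ?b \<oplus>\<^bsub>N1\<^esub> z"
  proof (rule extensionalityI)
    show "z' \<in> extensional (carrier (P (Suc 0)))" using mod_hom_ext[OF Z1_hom[OF z']] .
    show "?b \<oplus>\<^bsub>N1\<^esub> z \<in> extensional (carrier (P (Suc 0)))" by simp
    fix w assume w: "w \<in> carrier (P (Suc 0))"
    have "z (n (D 0 w)) \<in> carrier Q'" "z w \<in> carrier Q'"
      using mod_homD(1)[OF Z1_hom[OF z]] mod_homD(1)[OF gr_homD(1)[OF n] Dm(1)[OF w]] w by auto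
    then show "z' w = (?b \<oplus>\<^bsub>N1\<^esub> z) w" using e[OF w] w Dm(1)[OF w] Q'.M.a_comm by (simp add: compose_eq)
  qed
  then have "z' \<in> cls z" using b by (auto simp: a_r_coset_def')
  then show ?thesis using E.a_repr_independence'[of z' z] z by simp
qed

section \<open>The class of the given sequence as generator of Ext\<close>

context
  fixes l z0
  assumes lift: "lifting l z0"
begin

lemma z0_Z1: "z0 \<in> Z1"
  using gr_hom_star[OF gQ' lifting_degree[OF lift]] lifting_cocycle[OF lift] by (simp add: Z1_def)

lemma z0_hom: "z0 \<in> mod_hom R (P (Suc 0)) Q'"
  by (rule Z1_hom[OF z0_Z1])

text \<open>The snake map of \<open>z\<close> is an endomorphism of \<open>Q'\<close> of degree
  \<open>g - c\<close>, hence multiplication by a scalar of that degree; the homotopy formula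
  compares this multiple of \<open>z0\<close> with \<open>z\<close>.\<close>

lemma generate_homog:
  assumes z: "z \<in> gr_hom R (P (Suc 0)) Q' g" "cocycle z"
    and n: "\<And>w. w \<in> carrier (P (Suc 0)) \<Longrightarrow> pushed z (z0 w) = z w \<oplus>\<^bsub>Q'\<^esub> z (n (D 0 w))"
  shows "\<exists>a\<in>hcomp R (g - c). \<forall>w\<in>carrier (P (Suc 0)). a \<odot>\<^bsub>Q'\<^esub> z0 w = z w \<oplus>\<^bsub>Q'\<^esub> z (n (D 0 w))"
  using endo[OF pushed_hom[OF z]] n mod_homD(1)[OF z0_hom] by metis

text \<open>On a homogeneous element of the resolution the values of the summands \<open>u g\<close>
  lie in different degrees, so they vanish separately when their sum does.\<close>

lemma cocycle_components:
  assumes z: "z \<in> Z1" and S: "finite S" "\<forall>g\<in>S. u g \<in> gr_hom R (P (Suc 0)) Q' g"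
    "\<forall>x\<in>carrier (P (Suc 0)). z x = (\<Oplus>\<^bsub>Q'\<^esub>g\<in>S. u g x)" and g: "g \<in> S"
  shows "cocycle (u g)"
  unfolding cocycle_def
proof
  note ug = mod_homD[OF gr_homD(1)[OF bspec[OF S(2) g]]]
  fix y assume "y \<in> carrier (P (Suc (Suc 0)))"
  then show "u g (D (Suc 0) y) = \<zero>\<^bsub>Q'\<^esub>"
  proof (induction y rule: P.graded_induct)
    case zero
    show ?case using mod_hom_zero[OF P.module_axioms Q'.module_axioms gr_homD(1)[OF bspec[OF S(2) g]]] D_zero by simp
  next
    case (homog h y)
    have d: "D (Suc 0) y \<in> hcomp (P (Suc 0)) h" using gr_homD(2)[OF D_hom homog] by simp
    have dc: "D (Suc 0) y \<in> carrier (P (Suc 0))" using P.hcomp_carrier[OF d] .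
    have "(\<Oplus>\<^bsub>Q'\<^esub>g\<in>S. u g (D (Suc 0) y)) = \<zero>\<^bsub>Q'\<^esub>"
      using z S(3) dc P.hcomp_carrier[OF homog] by (auto simp: Z1_def cocycle_def)
    moreover have "u g (D (Suc 0) y) \<in> carrier Q'" if "g \<in> S" for g
      using mod_homD(1)[OF gr_homD(1)[OF bspec[OF S(2) that]] dc] .
    then have "(\<Oplus>\<^bsub>Q'\<^esub>g\<in>S. u g (D (Suc 0) y)) = (\<Oplus>\<^bsub>Q'\<^esub>g\<in>(\<lambda>g. h + g) ` S. u (g - h) (D (Suc 0) y))"
      by (subst Q'.M.finsum_reindex) auto
    ultimately have s: "(\<Oplus>\<^bsub>Q'\<^esub>g\<in>(\<lambda>g. h + g) ` S. u (g - h) (D (Suc 0) y)) = \<zero>\<^bsub>Q'\<^esub>" by simp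
    have "u g (D (Suc 0) y) \<in> hcomp Q' (h + g)" if "g \<in> S" for g
      using gr_homD(2)[OF bspec[OF S(2) that] d] .
    then have "\<forall>g\<in>(\<lambda>g. h + g) ` S. u (g - h) (D (Suc 0) y) \<in> hcomp Q' g" by simp
    from Q'.hcomp_independent[OF _ this s, of "h + g"] show ?case using S(1) g by simp
  next
    case (add x y)
    then show ?case using Dm(2)[OF add(1,2)] ug(2)[OF Dm(1)[OF add(1)] Dm(1)[OF add(2)]] by simp
  qed
qed

text \<open>\<open>endo\<close> speaks about homogeneous maps, so \<open>z\<close> is split into
  homogeneous cocycles, each with its own scalar. One map \<open>n\<close> serves all of them, and
  therefore the equations can be added.\<close>

lemma generate:
  assumes z: "z \<in> Z1"
    and n: "n \<in> gr_hom R (P 0) (P (Suc 0)) 0"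
    and nz: "\<And>z w. z \<in> mod_hom R (P (Suc 0)) Q' \<Longrightarrow> cocycle z \<Longrightarrow> w \<in> carrier (P (Suc 0)) \<Longrightarrow>
      pushed z (z0 w) = z w \<oplus>\<^bsub>Q'\<^esub> z (n (D 0 w))"
  shows "\<exists>a\<in>carrier R. \<forall>w\<in>carrier (P (Suc 0)). a \<odot>\<^bsub>Q'\<^esub> z0 w = z w \<oplus>\<^bsub>Q'\<^esub> z (n (D 0 w))"
proof -
  obtain S u where S: "finite S" "\<forall>g\<in>S. u g \<in> gr_hom R (P (Suc 0)) Q' g"
    "\<forall>x\<in>carrier (P (Suc 0)). z x = (\<Oplus>\<^bsub>Q'\<^esub>g\<in>S. u g x)"
    using z unfolding Z1_def star_hom_carrier by blast
  have "\<exists>a. g \<in> S \<longrightarrow> a \<in> carrier R \<and> (\<forall>w\<in>carrier (P (Suc 0)). a \<odot>\<^bsub>Q'\<^esub> z0 w = u g w \<oplus>\<^bsub>Q'\<^esub> u g (n (D 0 w)))" for g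
  proof (cases "g \<in> S")
    case True
    have c: "cocycle (u g)" by (rule cocycle_components[OF z S True])
    have ug: "u g \<in> gr_hom R (P (Suc 0)) Q' g" using S(2) True by blast
    from generate_homog[OF ug c nz[OF gr_homD(1)[OF ug] c]] show ?thesis using hcomp_sub by blast
  qed blast
  then obtain a where a: "\<And>g. g \<in> S \<Longrightarrow> a g \<in> carrier R"
    "\<And>g w. g \<in> S \<Longrightarrow> w \<in> carrier (P (Suc 0)) \<Longrightarrow> a g \<odot>\<^bsub>Q'\<^esub> z0 w = u g w \<oplus>\<^bsub>Q'\<^esub> u g (n (D 0 w))" by metis
  have "finsum R a S \<odot>\<^bsub>Q'\<^esub> z0 w = z w \<oplus>\<^bsub>Q'\<^esub> z (n (D 0 w))" if w: "w \<in> carrier (P (Suc 0))" for w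
  proof -
    have zw: "z0 w \<in> carrier Q'" using mod_homD(1)[OF z0_hom w] .
    have nw: "n (D 0 w) \<in> carrier (P (Suc 0))" using mod_homD(1)[OF gr_homD(1)[OF n] Dm(1)[OF w]] .
    have uc: "u g w \<in> carrier Q'" "u g (n (D 0 w)) \<in> carrier Q'" if "g \<in> S" for g
      by (rule mod_homD(1)[OF gr_homD(1)[OF bspec[OF S(2) that]] w],
          rule mod_homD(1)[OF gr_homD(1)[OF bspec[OF S(2) that]] nw])
    have "finsum R a S \<odot>\<^bsub>Q'\<^esub> z0 w = (\<Oplus>\<^bsub>Q'\<^esub>g\<in>S. a g \<odot>\<^bsub>Q'\<^esub> z0 w)"
      by (rule finsum_hom[OF R.abelian_group_axioms Q'.M.abelian_group_axioms S(1), of a "\<lambda>a. a \<odot>\<^bsub>Q'\<^esub> z0 w"])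
        (use a(1) zw Q'.smult_l_distr in auto)
    also have "\<dots> = (\<Oplus>\<^bsub>Q'\<^esub>g\<in>S. u g w \<oplus>\<^bsub>Q'\<^esub> u g (n (D 0 w)))"
      by (rule Q'.M.finsum_cong') (use a(2)[OF _ w] uc in auto)
    also have "\<dots> = z w \<oplus>\<^bsub>Q'\<^esub> z (n (D 0 w))"
      using S(3) w nw uc by (subst Q'.M.finsum_addf) auto
    finally show ?thesis .
  qed
  moreover have "finsum R a S \<in> carrier R" using a(1) by (intro R.finsum_closed) auto
  ultimately show ?thesis by blast
qed

text \<open>If a z0 is the coboundary of \<open>h\<close>, a chase of \<open>q\<close> gives a q = a
  (z0 w) = h (X y) = X (h y) = 0, so \<open>a\<close> annihilates \<open>Q'\<close>.\<close>

lemma coboundary_iff: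
  assumes a: "a \<in> carrier R"
  shows "(\<lambda>y\<in>carrier (P (Suc 0)). a \<odot>\<^bsub>Q'\<^esub> z0 y) \<in> B1 \<longleftrightarrow> a \<in> F"
proof
  assume "a \<in> F"
  then have "(\<lambda>y\<in>carrier (P (Suc 0)). a \<odot>\<^bsub>Q'\<^esub> z0 y) = \<zero>\<^bsub>N1\<^esub>"
    using F_kill mod_homD(1)[OF z0_hom] by (auto intro!: restrict_ext)
  then show "(\<lambda>y\<in>carrier (P (Suc 0)). a \<odot>\<^bsub>Q'\<^esub> z0 y) \<in> B1" using E.zero_closed by simp
next
  assume "(\<lambda>y\<in>carrier (P (Suc 0)). a \<odot>\<^bsub>Q'\<^esub> z0 y) \<in> B1"
  then obtain h where h: "h \<in> carrier (H 0)" "(\<lambda>y\<in>carrier (P (Suc 0)). a \<odot>\<^bsub>Q'\<^esub> z0 y) = compose (carrier (P (Suc 0))) h (D 0)"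
    by (auto simp: B1_def)
  note h' = mod_homD[OF H_hom[OF h(1)]]
  have "a \<odot>\<^bsub>Q'\<^esub> q = \<zero>\<^bsub>Q'\<^esub>" if q: "q \<in> carrier Q'" for q
  proof -
    obtain y w where ch: "chase q y w" using chase_ex[OF q] by blast
    then have c: "y \<in> carrier (P 0)" "w \<in> carrier (P (Suc 0))" "D 0 w = X \<odot>\<^bsub>P 0\<^esub> y" by (auto simp: chase_def)
    have "a \<odot>\<^bsub>Q'\<^esub> z0 w = h (D 0 w)" using fun_cong[OF h(2), of w] c(2) by (simp add: compose_eq)
    then show ?thesis using chase_lifting[OF lift ch] c(3) h'(3)[OF XR c(1)] X_kill[OF h'(1)[OF c(1)]] by simp
  qed
  then show "a \<in> F" using ann[OF a] by blast
qed

lemma F_kills_Ext: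
  assumes "f \<in> F" "Z \<in> carrier Ext"
  shows "f \<odot>\<^bsub>Ext\<^esub> Z = \<zero>\<^bsub>Ext\<^esub>"
proof -
  obtain z where z: "z \<in> Z1" "Z = cls z" using Ext_ex[OF assms(2)] by blast
  have "(\<lambda>y\<in>carrier (P (Suc 0)). f \<odot>\<^bsub>Q'\<^esub> z y) = \<zero>\<^bsub>N1\<^esub>"
    using F_kill[OF assms(1)] mod_homD(1)[OF Z1_hom[OF z(1)]] by (auto intro!: restrict_ext)
  then have "f \<odot>\<^bsub>Ext\<^esub> Z = cls \<zero>\<^bsub>N1\<^esub>" using cls_smult[OF F_carrier[OF assms(1)] z(1)] z(2) by simp
  then show ?thesis using E.coset_zero Ext_zero by simp
qed

abbreviation "\<xi> \<equiv> cls z0"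
text \<open>Multiplication of the class by residues. The isomorphism and the freeness in the theorem
  are two readings of its bijectivity.\<close>

definition "q_act = (\<lambda>A\<in>carrier (gquot R F). A \<odot>\<^bsub>over_quotient Ext\<^esub> \<xi>)"

lemma xi_carrier: "\<xi> \<in> carrier Ext"
  by (rule cls_Ext[OF z0_Z1])

lemma xi_hcomp: "\<xi> \<in> hcomp Ext c"
  unfolding Ext_hcomp using lifting_degree[OF lift] z0_Z1 by blast

lemma q_act_coset: "a \<in> carrier R \<Longrightarrow> q_act (F +>\<^bsub>R\<^esub> a) = a \<odot>\<^bsub>Ext\<^esub> \<xi>"
  using over_quotient_smult[OF F_sub module_Ext F_kills_Ext _ xi_carrier]
    gquotient.coset_carrier[OF gquotient_self[OF F_sub], of a] by (simp add: q_act_def)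

lemma Ext_generated:
  assumes "Z \<in> carrier Ext"
  shows "\<exists>a\<in>carrier R. Z = a \<odot>\<^bsub>Ext\<^esub> \<xi>"
proof -
  obtain n where n: "n \<in> gr_hom R (P 0) (P (Suc 0)) 0"
    "\<And>z w. z \<in> mod_hom R (P (Suc 0)) Q' \<Longrightarrow> cocycle z \<Longrightarrow> w \<in> carrier (P (Suc 0)) \<Longrightarrow>
      pushed z (z0 w) = z w \<oplus>\<^bsub>Q'\<^esub> z (n (D 0 w))"
    using homotopy[OF lift] by blast
  obtain z where z: "z \<in> Z1" "Z = cls z" using Ext_ex[OF assms] by blast
  obtain a where a: "a \<in> carrier R" "\<forall>w\<in>carrier (P (Suc 0)). a \<odot>\<^bsub>Q'\<^esub> z0 w = z w \<oplus>\<^bsub>Q'\<^esub> z (n (D 0 w))"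
    using generate[OF z(1) n] by blast
  have "cls (\<lambda>y\<in>carrier (P (Suc 0)). a \<odot>\<^bsub>Q'\<^esub> z0 y) = cls z"
    by (rule cls_eqI[OF n(1) z(1) Z1_smult[OF a(1) z0_Z1]]) (use a(2) in simp)
  then have "Z = a \<odot>\<^bsub>Ext\<^esub> \<xi>" unfolding cls_smult[OF a(1) z0_Z1] z(2) by (rule sym)
  then show ?thesis using a(1) by (intro bexI[of _ a])
qed

text \<open>The scalar must have the exact degree for \<open>q_act\<close> to match the homogeneous
  components. A homogeneous class contains a homogeneous cocycle, to which
  \<open>generate_homog\<close> applies directly.\<close>

lemma Ext_generated_homog:
  assumes "Z \<in> hcomp Ext (g + c)"
  shows "\<exists>a\<in>hcomp R g. Z = a \<odot>\<^bsub>Ext\<^esub> \<xi>"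
proof -
  obtain n where n: "n \<in> gr_hom R (P 0) (P (Suc 0)) 0"
    "\<And>z w. z \<in> mod_hom R (P (Suc 0)) Q' \<Longrightarrow> cocycle z \<Longrightarrow> w \<in> carrier (P (Suc 0)) \<Longrightarrow>
      pushed z (z0 w) = z w \<oplus>\<^bsub>Q'\<^esub> z (n (D 0 w))"
    using homotopy[OF lift] by blast
  obtain z where z: "z \<in> Z1" "Z = cls z" "z \<in> gr_hom R (P (Suc 0)) Q' (g + c)" using assms Ext_hcomp by auto
  have cz: "cocycle z" using z(1) by (simp add: Z1_def)
  obtain a where a: "a \<in> hcomp R (g + c - c)" "\<forall>w\<in>carrier (P (Suc 0)). a \<odot>\<^bsub>Q'\<^esub> z0 w = z w \<oplus>\<^bsub>Q'\<^esub> z (n (D 0 w))"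
    using generate_homog[OF z(3) cz n(2)[OF gr_homD(1)[OF z(3)] cz]] by blast
  have aR: "a \<in> carrier R" using a(1) hcomp_sub by blast
  have "cls (\<lambda>y\<in>carrier (P (Suc 0)). a \<odot>\<^bsub>Q'\<^esub> z0 y) = cls z"
    by (rule cls_eqI[OF n(1) z(1) Z1_smult[OF aR z0_Z1]]) (use a(2) in simp)
  then have "Z = a \<odot>\<^bsub>Ext\<^esub> \<xi>" unfolding cls_smult[OF aR z0_Z1] z(2) by (rule sym)
  moreover have "a \<in> hcomp R g" using a(1) by simp
  ultimately show ?thesis by (intro bexI[of _ a])
qed

lemma annihilator_xi:
  assumes a: "a \<in> carrier R"
  shows "a \<odot>\<^bsub>Ext\<^esub> \<xi> = \<zero>\<^bsub>Ext\<^esub> \<longleftrightarrow> a \<in> F"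
  unfolding cls_smult[OF a z0_Z1] Ext_zero coboundary_iff[OF a, symmetric]
  by (rule E.coset_eq_zero_iff) (simp add: Z1_smult[OF a z0_Z1])

text \<open>Ext is not yet known to be graded at this point, so the facts are listed separately;
  they are the hypotheses of \<open>graded_module_transport\<close>.\<close>

lemma q_act_props:
  "bij_betw q_act (carrier (gquot R F)) (carrier Ext)"
  "A \<in> carrier (gquot R F) \<Longrightarrow> B \<in> carrier (gquot R F) \<Longrightarrow> q_act (A \<oplus>\<^bsub>gquot R F\<^esub> B) = q_act A \<oplus>\<^bsub>Ext\<^esub> q_act B"
  "a \<in> carrier R \<Longrightarrow> A \<in> carrier (gquot R F) \<Longrightarrow> q_act (a \<odot>\<^bsub>gquot R F\<^esub> A) = a \<odot>\<^bsub>Ext\<^esub> q_act A"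
  "q_act \<zero>\<^bsub>gquot R F\<^esub> = \<zero>\<^bsub>Ext\<^esub>"
  "q_act ` hcomp (gquot R F) g = hcomp Ext (g + c)"
proof -
  interpret q: gquotient R R F by (rule gquotient_self[OF F_sub])
  interpret X: Module.module R Ext by (rule module_Ext)
  have ex: "\<exists>a\<in>carrier R. A = F +>\<^bsub>R\<^esub> a" if "A \<in> carrier (gquot R F)" for A using q.coset_ex[OF that] .
  show "bij_betw q_act (carrier (gquot R F)) (carrier Ext)"
    unfolding bij_betw_def
  proof
    show "inj_on q_act (carrier (gquot R F))"
    proof (rule inj_onI)
      fix A B assume AB: "A \<in> carrier (gquot R F)" "B \<in> carrier (gquot R F)" "q_act A = q_act B"
      obtain a where a: "a \<in> carrier R" "A = F +>\<^bsub>R\<^esub> a" using ex[OF AB(1)] by blast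
      obtain b where b: "b \<in> carrier R" "B = F +>\<^bsub>R\<^esub> b" using ex[OF AB(2)] by blast
      have "a \<odot>\<^bsub>Ext\<^esub> \<xi> = b \<odot>\<^bsub>Ext\<^esub> \<xi>" using AB(3) q_act_coset[OF a(1)] q_act_coset[OF b(1)] a(2) b(2) by simp
      then have "(a \<ominus>\<^bsub>R\<^esub> b) \<odot>\<^bsub>Ext\<^esub> \<xi> = \<zero>\<^bsub>Ext\<^esub>"
        using X.smult_diff_left[OF a(1) b(1) xi_carrier] X.smult_closed[OF b(1) xi_carrier] X.M.diff_eq_zero_iff by simp
      then have "a \<ominus>\<^bsub>R\<^esub> b \<in> F" using annihilator_xi R.minus_closed a(1) b(1) by blast
      then show "A = B" using q.coset_eq_iff a b by blast
    qed
    show "q_act ` carrier (gquot R F) = carrier Ext"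
    proof
      show "q_act ` carrier (gquot R F) \<subseteq> carrier Ext"
      proof (rule image_subsetI)
        fix A assume "A \<in> carrier (gquot R F)"
        then obtain a where a: "a \<in> carrier R" "A = F +>\<^bsub>R\<^esub> a" using ex by blast
        show "q_act A \<in> carrier Ext"
          unfolding a(2) q_act_coset[OF a(1)] by (rule X.smult_closed[OF a(1) xi_carrier])
      qed
      show "carrier Ext \<subseteq> q_act ` carrier (gquot R F)"
      proof
        fix Z assume "Z \<in> carrier Ext"
        then obtain a where a: "a \<in> carrier R" "Z = a \<odot>\<^bsub>Ext\<^esub> \<xi>" using Ext_generated by blast
        have "Z = q_act (F +>\<^bsub>R\<^esub> a)" unfolding q_act_coset[OF a(1)] by (rule a(2))
        then show "Z \<in> q_act ` carrier (gquot R F)" using q.coset_carrier[OF a(1)] by (rule image_eqI)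
      qed
    qed
  qed
  show "q_act (A \<oplus>\<^bsub>gquot R F\<^esub> B) = q_act A \<oplus>\<^bsub>Ext\<^esub> q_act B"
    if A: "A \<in> carrier (gquot R F)" and B: "B \<in> carrier (gquot R F)" for A B
  proof -
    obtain a where a: "a \<in> carrier R" "A = F +>\<^bsub>R\<^esub> a" using ex[OF A] by blast
    obtain b where b: "b \<in> carrier R" "B = F +>\<^bsub>R\<^esub> b" using ex[OF B] by blast
    show ?thesis
      unfolding a(2) b(2) q.coset_add[OF a(1) b(1)] q_act_coset[OF a(1)] q_act_coset[OF b(1)]
        q_act_coset[OF R.a_closed[OF a(1) b(1)]] by (rule X.smult_l_distr[OF a(1) b(1) xi_carrier])
  qed
  show "q_act (a \<odot>\<^bsub>gquot R F\<^esub> A) = a \<odot>\<^bsub>Ext\<^esub> q_act A" if a: "a \<in> carrier R" and A: "A \<in> carrier (gquot R F)" for a A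
  proof -
    obtain b where b: "b \<in> carrier R" "A = F +>\<^bsub>R\<^esub> b" using ex[OF A] by blast
    have ab: "a \<odot>\<^bsub>R\<^esub> b = a \<otimes>\<^bsub>R\<^esub> b" by (simp add: smult_mult)
    show ?thesis
      unfolding b(2) q.coset_smult[OF a b(1)] ab q_act_coset[OF b(1)] q_act_coset[OF R.m_closed[OF a b(1)]]
      by (rule X.smult_assoc1[OF a b(1) xi_carrier])
  qed
  show "q_act \<zero>\<^bsub>gquot R F\<^esub> = \<zero>\<^bsub>Ext\<^esub>"
    using q_act_coset[OF R.zero_closed] X.smult_l_null[OF xi_carrier] by (simp only: q.coset_zero gquot_simps)
  show "q_act ` hcomp (gquot R F) g = hcomp Ext (g + c)"
  proof
    show "q_act ` hcomp (gquot R F) g \<subseteq> hcomp Ext (g + c)"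
    proof
      fix Z assume "Z \<in> q_act ` hcomp (gquot R F) g"
      then obtain A where A: "A \<in> hcomp (gquot R F) g" "Z = q_act A" by blast
      then obtain a where a: "a \<in> hcomp R g" "A = F +>\<^bsub>R\<^esub> a" by auto
      have aR: "a \<in> carrier R" using a(1) hcomp_sub by blast
      have "Z = cls (\<lambda>y\<in>carrier (P (Suc 0)). a \<odot>\<^bsub>Q'\<^esub> z0 y)"
        unfolding A(2) a(2) q_act_coset[OF aR] by (rule cls_smult[OF aR z0_Z1])
      moreover have "(\<lambda>y\<in>carrier (P (Suc 0)). a \<odot>\<^bsub>Q'\<^esub> z0 y) \<in> gr_hom R (P (Suc 0)) Q' (c + g)"
        by (rule gr_hom_pointwise_smult[OF gP gQ' lifting_degree[OF lift] a(1) aR])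
      ultimately show "Z \<in> hcomp Ext (g + c)"
        unfolding Ext_hcomp using Z1_smult[OF aR z0_Z1] by (simp add: add.commute)
    qed
    show "hcomp Ext (g + c) \<subseteq> q_act ` hcomp (gquot R F) g"
    proof
      fix Z assume "Z \<in> hcomp Ext (g + c)"
      then obtain a where a: "a \<in> hcomp R g" "Z = a \<odot>\<^bsub>Ext\<^esub> \<xi>" using Ext_generated_homog by blast
      have "Z = q_act (F +>\<^bsub>R\<^esub> a)" unfolding q_act_coset[OF subsetD[OF hcomp_sub a(1)]] by (rule a(2))
      moreover have "F +>\<^bsub>R\<^esub> a \<in> hcomp (gquot R F) g" using a(1) by simp
      ultimately show "Z \<in> q_act ` hcomp (gquot R F) g" by (rule image_eqI)
    qed
  qed
qed

lemma graded_module_Ext: "graded_module R Ext"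
  by (rule graded_module_transport[OF graded_module_gquot[OF graded_module_axioms F_sub F_hc hcomp_sub]
        q_act_props(1-4) _ hcomp_sub, of c]) (simp_all only: q_act_props(5))

lemma q_act_iso: "q_act \<in> gr_iso R (gquot R F) Ext c"
proof -
  have "q_act \<in> mod_hom R (gquot R F) Ext"
  proof (rule mod_homI)
    show "q_act \<in> extensional (carrier (gquot R F))" by (simp only: q_act_def restrict_extensional)
  qed (use q_act_props(1-3) in \<open>auto simp: bij_betw_def simp del: gquot_simps\<close>)
  then show ?thesis unfolding gr_iso_def using q_act_props(1,5) by blast
qed

text \<open>A coefficient family on a one-element basis is its value there, and the sum it defines
  is \<open>q_act\<close> of that value; existence and uniqueness of coefficients are bijectivity of
  \<open>q_act\<close>.\<close>

lemma Ext_free: "graded_free_on (gquot R F) (over_quotient Ext) {\<xi>}"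
proof -
  have gm: "graded_module (gquot R F) (over_quotient Ext)"
    by (rule graded_module_over_quotient[OF F_sub graded_module_Ext F_kills_Ext])
  interpret O: graded_module "gquot R F" "over_quotient Ext" by (rule gm)
  have val: "(\<Oplus>\<^bsub>over_quotient Ext\<^esub>b\<in>{b \<in> {\<xi>}. u b \<noteq> \<zero>\<^bsub>gquot R F\<^esub>}. u b \<odot>\<^bsub>over_quotient Ext\<^esub> b) = q_act (u \<xi>)"
    if u: "u \<in> {\<xi>} \<rightarrow>\<^sub>E carrier (gquot R F)" for u
  proof -
    have A: "u \<xi> \<in> carrier (gquot R F)" using u by auto
    show ?thesis
    \<comment> \<open>The sum in \<open>graded_free_on\<close> ranges over nonzero coefficients, so
      it is empty when the coefficient is zero.\<close>
    proof (cases "u \<xi> = \<zero>\<^bsub>gquot R F\<^esub>")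
      case True
      then have e: "{b \<in> {\<xi>}. u b \<noteq> \<zero>\<^bsub>gquot R F\<^esub>} = {}" by auto
      show ?thesis unfolding e using True q_act_props(4) by (simp only: O.M.finsum_empty over_quotient_simps)
    next
      case False
      then have e: "{b \<in> {\<xi>}. u b \<noteq> \<zero>\<^bsub>gquot R F\<^esub>} = {\<xi>}" by auto
      have "u \<xi> \<odot>\<^bsub>over_quotient Ext\<^esub> \<xi> \<in> carrier (over_quotient Ext)"
        by (rule O.smult_closed[OF A]) (simp only: over_quotient_simps xi_carrier)
      then show ?thesis unfolding e using A by (simp add: O.M.finsum_insert q_act_def del: gquot_simps over_quotient_simps)
    qed
  qed
  show ?thesis
    unfolding graded_free_on_def
  proof (intro conjI gm ballI)
    show "{\<xi>} \<subseteq> (\<Union>g. hcomp (over_quotient Ext) g)" using xi_hcomp by auto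
    fix Z assume "Z \<in> carrier (over_quotient Ext)"
    then have Z: "Z \<in> carrier Ext" by simp
    then have "Z \<in> q_act ` carrier (gquot R F)" unfolding bij_betw_imp_surj_on[OF q_act_props(1)] .
    then obtain A where A: "A \<in> carrier (gquot R F)" "q_act A = Z" by blast
    let ?Pr = "\<lambda>u. u \<in> {\<xi>} \<rightarrow>\<^sub>E carrier (gquot R F) \<and> finite {b \<in> {\<xi>}. u b \<noteq> \<zero>\<^bsub>gquot R F\<^esub>} \<and>
      Z = (\<Oplus>\<^bsub>over_quotient Ext\<^esub>b\<in>{b \<in> {\<xi>}. u b \<noteq> \<zero>\<^bsub>gquot R F\<^esub>}. u b \<odot>\<^bsub>over_quotient Ext\<^esub> b)"
    show "\<exists>!u. ?Pr u"
    proof (rule ex1I)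
      have m: "(\<lambda>b\<in>{\<xi>}. A) \<in> {\<xi>} \<rightarrow>\<^sub>E carrier (gquot R F)" using A(1) by (simp del: gquot_simps)
      then show "?Pr (\<lambda>b\<in>{\<xi>}. A)" using val[OF m] A by (simp del: gquot_simps)
    next
      fix u assume u: "?Pr u"
      then have uP: "u \<in> {\<xi>} \<rightarrow>\<^sub>E carrier (gquot R F)" by (rule conjunct1)
      have "q_act (u \<xi>) = q_act A" using conjunct2[OF conjunct2[OF u]] unfolding val[OF uP] A(2) by (rule sym)
      moreover have "u \<xi> \<in> carrier (gquot R F)" using uP by auto
      ultimately have "u \<xi> = A" using inj_onD[OF bij_betw_imp_inj_on[OF q_act_props(1)] _ _ A(1)] by (simp only:)
      then show "u = (\<lambda>b\<in>{\<xi>}. A)" using u by (intro extensionalityI[of _ "{\<xi>}"]) (auto simp: PiE_def simp del: gquot_simps)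
    qed
  qed
qed

text \<open>The definite description needs uniqueness of the class. A second lifting has the
  identity as its snake map too, so the homotopy formula makes its cocycle cohomologous to
  \<open>z0\<close>.\<close>

lemma ext_class_eq: "ext_class R P \<epsilon> D Q' i Q (\<lambda>q\<in>carrier Q. X \<odot>\<^bsub>Q\<^esub> q) = \<xi>"
  unfolding ext_class_def
proof (rule the_equality)
  have l: "l \<in> gr_hom R (P 0) Q 0" "\<forall>y\<in>carrier (P 0). X \<odot>\<^bsub>Q\<^esub> l y = \<epsilon> y" "\<forall>y\<in>carrier (P (Suc 0)). i (z0 y) = l (D 0 y)"
    using lift by (auto simp: lifting_def)
  have "z0 \<in> \<xi>" using E.a_rcos_self[of z0] z0_Z1 by simp
  moreover have "\<forall>y\<in>carrier (P 0). (\<lambda>q\<in>carrier Q. X \<odot>\<^bsub>Q\<^esub> q) (l y) = \<epsilon> y"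
    using l(2) mod_homD(1)[OF gr_homD(1)[OF l(1)]] by simp
  ultimately show "\<xi> \<in> carrier Ext \<and> (\<exists>l z. l \<in> gr_hom R (P 0) Q 0 \<and>
      (\<forall>y\<in>carrier (P 0). (\<lambda>q\<in>carrier Q. X \<odot>\<^bsub>Q\<^esub> q) (l y) = \<epsilon> y) \<and> z \<in> \<xi> \<and> (\<forall>y\<in>carrier (P 1). i (z y) = l (D 0 y)))"
    using xi_carrier l(1,3) unfolding One_nat_def by blast
next
  fix Z assume "Z \<in> carrier Ext \<and> (\<exists>l z. l \<in> gr_hom R (P 0) Q 0 \<and>
      (\<forall>y\<in>carrier (P 0). (\<lambda>q\<in>carrier Q. X \<odot>\<^bsub>Q\<^esub> q) (l y) = \<epsilon> y) \<and> z \<in> Z \<and> (\<forall>y\<in>carrier (P 1). i (z y) = l (D 0 y)))"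
  then obtain l' z where Z: "Z \<in> carrier Ext" and l': "l' \<in> gr_hom R (P 0) Q 0"
    "\<forall>y\<in>carrier (P 0). (\<lambda>q\<in>carrier Q. X \<odot>\<^bsub>Q\<^esub> q) (l' y) = \<epsilon> y"
    and z: "z \<in> Z" "\<forall>y\<in>carrier (P (Suc 0)). i (z y) = l' (D 0 y)" unfolding One_nat_def by blast
  obtain z1 where z1: "z1 \<in> Z1" "Z = cls z1" using Ext_ex[OF Z] by blast
  have zZ1: "z \<in> Z1" using E.a_elemrcos_carrier[of z1 z] z1 z(1) by simp
  have Zz: "Z = cls z" using E.a_repr_independence'[of z z1] z1 z(1) by simp
  have lz: "lifting l' z"
    unfolding lifting_def using l' z(2) Z1_hom[OF zZ1] mod_homD(1)[OF gr_homD(1)[OF l'(1)]] by simp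
  obtain n where n: "n \<in> gr_hom R (P 0) (P (Suc 0)) 0"
    "\<And>z w. z \<in> mod_hom R (P (Suc 0)) Q' \<Longrightarrow> cocycle z \<Longrightarrow> w \<in> carrier (P (Suc 0)) \<Longrightarrow>
      pushed z (z0 w) = z w \<oplus>\<^bsub>Q'\<^esub> z (n (D 0 w))"
    using homotopy[OF lift] by blast
  have "cls z0 = cls z"
  proof (rule cls_eqI[OF n(1) zZ1 z0_Z1])
    fix w assume w: "w \<in> carrier (P (Suc 0))"
    obtain y v where ch: "chase (z0 w) y v" using chase_ex[OF mod_homD(1)[OF z0_hom w]] by blast
    have "pushed z (z0 w) = z0 w"
      using pushed_eq[OF Z1_hom[OF zZ1] lifting_cocycle[OF lz] ch] chase_lifting[OF lz ch] by simp
    then show "z0 w = z w \<oplus>\<^bsub>Q'\<^esub> z (n (D 0 w))" using n(2)[OF Z1_hom[OF zZ1] lifting_cocycle[OF lz] w] by simp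
  qed
  then show "Z = \<xi>" using Zz by simp
qed

end

theorem Ext_structure:
  fixes x defines "x \<equiv> (\<lambda>q\<in>carrier Q. X \<odot>\<^bsub>Q\<^esub> q)"
  defines "\<zeta> \<equiv> ext_class R P \<epsilon> D Q' i Q x"
  shows "\<zeta> \<in> hcomp Ext c" "\<forall>a\<in>F. \<forall>e\<in>carrier Ext. a \<odot>\<^bsub>Ext\<^esub> e = \<zero>\<^bsub>Ext\<^esub>"
    "graded_free_on (gquot R F) (over_quotient Ext) {\<zeta>}"
    "(\<lambda>r\<in>carrier (gquot R F). r \<odot>\<^bsub>over_quotient Ext\<^esub> \<zeta>) \<in> gr_iso R (gquot R F) Ext c"
proof -
  obtain l z0 where lift: "lifting l z0" using lifting_ex by blast
  have e: "\<zeta> = cls z0" unfolding \<zeta>_def x_def by (rule ext_class_eq[OF lift])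
  show "\<zeta> \<in> hcomp Ext c" unfolding e by (rule xi_hcomp[OF lift])
  show "\<forall>a\<in>F. \<forall>e\<in>carrier Ext. a \<odot>\<^bsub>Ext\<^esub> e = \<zero>\<^bsub>Ext\<^esub>"
    by (intro ballI F_kills_Ext[OF lift])
  show "graded_free_on (gquot R F) (over_quotient Ext) {\<zeta>}" unfolding e by (rule Ext_free[OF lift])
  show "(\<lambda>r\<in>carrier (gquot R F). r \<odot>\<^bsub>over_quotient Ext\<^esub> \<zeta>) \<in> gr_iso R (gquot R F) Ext c"
    unfolding e q_act_def[OF lift, symmetric] by (rule q_act_iso[OF lift])
qed

end

lemma graded_ring_poly_ring:
  "graded_ring (poly_ring d W :: ('k::field mpoly, 'k mpoly, int ^ 'm) gmod)"
  by (intro graded_ring.intro graded_ring_axioms.intro graded_module_poly_ring hcomp_poly_ring_carrier)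
    (simp add: poly_ring_def)

theorem theorem8p13:
  fixes d t :: nat and W :: "nat \<Rightarrow> int ^ 'm"
    and A :: "('k::field mpoly, 'k mpoly, int ^ 'm) gmod"
    and F :: "nat \<Rightarrow> 'k mpoly set"
    and I :: "nat \<Rightarrow> ('k mpoly, 'i, int ^ 'm) gmod" and \<eta> \<delta>
    and I' :: "nat \<Rightarrow> ('k mpoly, 'j, int ^ 'm) gmod" and \<eta>' \<delta>'
    and P :: "nat \<Rightarrow> ('k mpoly, 'p, int ^ 'm) gmod" and \<epsilon> D
    and Q Q' c x Ext
  defines "A \<equiv> poly_ring d W"
    and "F \<equiv> face_ideal d W"
    and "Q \<equiv> local_cohomology A (max_ideal d W) I \<delta> (d - t)"
    and "Q' \<equiv> local_cohomology A (max_ideal d W) I' \<delta>' (d - (t + 1))"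
    and "c \<equiv> W (t + 1)"
    and "x \<equiv> (\<lambda>q\<in>carrier Q. mvar (t + 1) \<odot>\<^bsub>Q\<^esub> q)"
    and "Ext \<equiv> star_ext A P D Q' 1"
  assumes "positive_type d W"
    and "1 \<le> t" and "t \<le> d - 1"
    and "graded_injective_resolution A (gquot A (F t)) I \<eta> \<delta>"
    and "graded_injective_resolution A (gquot A (F (t + 1))) I' \<eta>' \<delta>'"
    and "graded_free_resolution A (gshift Q c) P \<epsilon> D"
  shows "x \<in> gr_hom A Q (gshift Q c) 0 \<and>
    (\<exists>i\<in>gr_hom A Q' Q (- c). short_exact A Q' i Q x (gshift Q c)) \<and>
    (\<forall>i\<in>gr_hom A Q' Q (- c). short_exact A Q' i Q x (gshift Q c) \<longrightarrow>
      (let \<xi> = ext_class A P \<epsilon> D Q' i Q x in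
        \<xi> \<in> hcomp Ext c \<and>
        (\<forall>a\<in>F (t + 1). \<forall>e\<in>carrier Ext. a \<odot>\<^bsub>Ext\<^esub> e = \<zero>\<^bsub>Ext\<^esub>) \<and>
        graded_free_on (gquot A (F (t + 1))) (over_quotient Ext) {\<xi>} \<and>
        (\<lambda>r\<in>carrier (gquot A (F (t + 1))). r \<odot>\<^bsub>over_quotient Ext\<^esub> \<xi>)
          \<in> gr_iso A (gquot A (F (t + 1))) Ext c))"
proof -
  let ?A = "poly_ring d W :: ('k mpoly, 'k mpoly, int ^ 'm) gmod"
  \<comment> \<open>Subtraction is truncated, but \<open>1 \<le> t\<close> excludes
    \<open>d = 0\<close>, so \<open>t + 1 \<le> d\<close> follows.\<close>
  have td: "t \<le> d" "t + 1 \<le> d" and k: "t + 1 \<in> {1..d}" "t + 1 \<in> {t + 1..d}" using assms(9,10) by auto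
  have F: "F t = fmon d t" "F (t + 1) = fmon d (t + 1)"
    unfolding F_def fmon_def by (rule face_ideal_eq[OF td(1)], rule face_ideal_eq[OF td(2)])
  obtain \<theta> where "inverse_system d W t Q \<theta>"
    using resolution_inverse_system[OF assms(11)[unfolded A_def F(1)] td(1)] unfolding Q_def A_def by blast
  then interpret S: inverse_system d W t Q \<theta> .
  obtain \<theta>' where "inverse_system d W (t + 1) Q' \<theta>'"
    using resolution_inverse_system[OF assms(12)[unfolded A_def F(2)] td(2)] unfolding Q'_def A_def by blast
  then interpret S': inverse_system d W "t + 1" Q' \<theta>' .
  have X: "mvar (t + 1) \<in> hcomp ?A c" using mvar_power_hcomp[OF k(1), of 1 W] unfolding c_def by simp
  have XA: "mvar (t + 1) \<in> carrier ?A" by (rule subsetD[OF hcomp_poly_ring_carrier X])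
  note gQ = S.gQ and gQ' = S'.gQ
  have "(\<lambda>q\<in>carrier Q. mvar (t + 1) \<odot>\<^bsub>Q\<^esub> (\<lambda>q\<in>carrier Q. q) q) \<in> gr_hom ?A Q Q (0 + c)"
    by (rule gr_hom_pointwise_smult[OF gQ gQ gr_hom_id[OF gQ] X XA])
  moreover have "(\<lambda>q\<in>carrier Q. mvar (t + 1) \<odot>\<^bsub>Q\<^esub> (\<lambda>q\<in>carrier Q. q) q) = x"
    unfolding x_def by (rule restrict_ext) simp
  ultimately have x: "x \<in> gr_hom A Q (gshift Q c) 0" unfolding gr_hom_gshift A_def by simp
  have Xc: "mvar (t + 1) \<odot>\<^bsub>Q\<^esub> q \<in> carrier Q" if "q \<in> carrier Q" for q
    using Module.module.smult_closed[OF graded_module.axioms(1)[OF gQ] XA that] .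
  have surj: "x ` carrier Q = carrier (gshift Q c)"
  proof
    show "x ` carrier Q \<subseteq> carrier (gshift Q c)" using Xc by (auto simp: x_def)
    show "carrier (gshift Q c) \<subseteq> x ` carrier Q"
    proof
      fix q assume "q \<in> carrier (gshift Q c)"
      then have "q \<in> carrier Q" by simp
      from S.mvar_surj[OF k(2) this] obtain q' where "q' \<in> carrier Q" "mvar (t + 1) \<odot>\<^bsub>Q\<^esub> q' = q" by blast
      then show "q \<in> x ` carrier Q" unfolding x_def by force
    qed
  qed
  have ker: "{q \<in> carrier Q. x q = \<zero>\<^bsub>gshift Q c\<^esub>} = {q \<in> carrier Q. mvar (t + 1) \<odot>\<^bsub>Q\<^esub> q = \<zero>\<^bsub>Q\<^esub>}"
    by (auto simp: x_def)
  \<comment> \<open>For a map of degree \<open>- c\<close>, exactness reduces to the two conditions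
    on \<open>i\<close> in \<open>self_dual_extension\<close>.\<close>
  have exact: "short_exact A Q' i Q x (gshift Q c) \<longleftrightarrow> inj_on i (carrier Q') \<and>
      i ` carrier Q' = {q \<in> carrier Q. mvar (t + 1) \<odot>\<^bsub>Q\<^esub> q = \<zero>\<^bsub>Q\<^esub>}" if "i \<in> gr_hom A Q' Q (- c)" for i
    unfolding short_exact_def ker using gr_homD(1)[OF that] gr_homD(1)[OF x] surj by blast
  have ses: "\<exists>i\<in>gr_hom A Q' Q (- c). short_exact A Q' i Q x (gshift Q c)"
    using connecting_map[OF S.inverse_system_axioms S'.inverse_system_axioms] exact unfolding A_def c_def by blast
  have Ext: "ext_class A P \<epsilon> D Q' i Q x \<in> hcomp Ext c \<and>
        (\<forall>a\<in>F (t + 1). \<forall>e\<in>carrier Ext. a \<odot>\<^bsub>Ext\<^esub> e = \<zero>\<^bsub>Ext\<^esub>) \<and>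
        graded_free_on (gquot A (F (t + 1))) (over_quotient Ext) {ext_class A P \<epsilon> D Q' i Q x} \<and>
        (\<lambda>r\<in>carrier (gquot A (F (t + 1))). r \<odot>\<^bsub>over_quotient Ext\<^esub> ext_class A P \<epsilon> D Q' i Q x)
          \<in> gr_iso A (gquot A (F (t + 1))) Ext c"
    if i: "i \<in> gr_hom A Q' Q (- c)" and se: "short_exact A Q' i Q x (gshift Q c)" for i
  proof -
    note ex = iffD1[OF exact[OF i] se]
    \<comment> \<open>The embedding \<open>i\<close> is arbitrary here, not just the one from
      \<open>connecting_map\<close>: the statement is about every exact sequence with this
      \<open>x\<close>.\<close>
    interpret self_dual_extension ?A Q Q' c "mvar (t + 1)" "fmon d (t + 1)" i P \<epsilon> D
    proof (intro self_dual_extension.intro self_dual_extension_axioms.intro graded_ring_poly_ring gQ gQ' X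
        conjunct1[OF ex] conjunct2[OF ex] fmon_gsubmodule)
      show "i \<in> gr_hom ?A Q' Q (- c)" using i unfolding A_def .
      show "graded_free_resolution ?A (gshift Q c) P \<epsilon> D" using assms(13) unfolding A_def .
      show "\<exists>q'\<in>carrier Q. mvar (t + 1) \<odot>\<^bsub>Q\<^esub> q' = q" if "q \<in> carrier Q" for q
        by (rule S.mvar_surj[OF k(2) that])
      show "\<exists>f\<in>hcomp ?A g. \<forall>q\<in>carrier Q'. \<phi> q = f \<odot>\<^bsub>Q'\<^esub> q" if "\<phi> \<in> gr_hom ?A Q' Q' g" for \<phi> g
        by (rule S'.endomorphism[OF assms(8) that])
      show "hc ?A f g \<in> fmon d (t + 1)" if "f \<in> fmon d (t + 1)" for f g
        using that unfolding fmon_def by (rule mon_ideal_hc)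
      show "(\<forall>q\<in>carrier Q'. f \<odot>\<^bsub>Q'\<^esub> q = \<zero>\<^bsub>Q'\<^esub>) \<longleftrightarrow> f \<in> fmon d (t + 1)" if "f \<in> carrier ?A" for f
        by (rule S'.annihilator) (use that in simp)
    qed
    show ?thesis using Ext_structure unfolding A_def Ext_def x_def F(2) by blast
  qed
  show ?thesis unfolding Let_def using x ses Ext by blast
qed

end
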